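(* Let $R$ be a commutative ring with unit. Suppose that $\mathcal{A}$ is a smooth Poisson algebra over $R$ and that $I$ is a Poisson ideal of $\mathcal{A}$ which is generated (as an ideal) by a single element. If the quotient $\mathcal{B}:=\mathcal{A}/I$ is an integral domain, then the PBW theorem holds for the Poisson algebra $\mathcal{B}$, i.e., the PBW map $\mathrm{PBW}_{\mathcal{B}}:\operatorname{Sym}_{\mathcal{B}}(\Omega(\mathcal{B}))\to\operatorname{gr}(U(\mathcal{B}))$ is injective, hence is an isomorphism of graded $\mathcal{B}$-algebras.
   Context: All rings and associative algebras are unitary and morphisms preserve units; algebras are over $R$. A Poisson algebra over $R$ is an $R$-module $\mathcal{A}$ with a commutative (associative, unitary) $R$-algebra structure and an $R$-Lie algebra structure $\{\cdot,\cdot\}$ such that $\{a_1a_2,a_3\}=a_1\{a_2,a_3\}+a_2\{a_1,a_3\}$ for all $a_1,a_2,a_3\in\mathcal{A}$. A Poisson ideal $I$ of $\mathcal{A}$ is a submodule which is both an ideal and a Lie ideal; the quotient $\mathcal{A}/I$ carries the unique Poisson structure making the canonical surjection $\mathcal{A}\to\mathcal{A}/I$ a morphism of Poisson algebras (a linear map which is a morphism of algebras and of Lie algebras). $\Omega(\mathcal{A})$ denotes the $\mathcal{A}$-module of Kähler differentials of the commutative $R$-algebra $\mathcal{A}$, with universal derivation $\mathrm{d}$. The Poisson algebra $\mathcal{A}$ is smooth if $\Omega(\mathcal{A})$ is a projective $\mathcal{A}$-module. For an algebra $U$, $U_L$ denotes $U$ viewed as a Lie algebra with the commutator bracket. A Poisson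 enveloping algebra of a Poisson algebra $\mathcal{A}$ is a triple $(U,\alpha,\beta)$ with $U$ an algebra, $\alpha:\mathcal{A}\to U$ an algebra morphism and $\beta:\mathcal{A}\to U_L$ a Lie algebra morphism such that for all $a_1,a_2\in\mathcal{A}$: $\alpha(\{a_1,a_2\})=\alpha(a_1)\beta(a_2)-\beta(a_2)\alpha(a_1)$ and $\beta(a_1a_2)=\alpha(a_1)\beta(a_2)+\alpha(a_2)\beta(a_1)$, and which is universal: for any algebra $U'$, algebra morphism $\alpha':\mathcal{A}\to U'$ and Lie algebra morphism $\beta':\mathcal{A}\to U'_L$ satisfying the same two identities, there is a unique algebra morphism $\gamma:U\to U'$ with $\gamma\circ\alpha=\alpha'$ and $\gamma\circ\beta=\beta'$. It exists, is unique up to isomorphism, and is denoted $(U(\mathcal{A}),\alpha,\beta)$. $U(\mathcal{A})$ is an $\mathcal{A}$-module via $a\cdot u:=\alpha(a)u$. $U_k(\mathcal{A})$ ($k\in\mathbb{N}$) denotes the $\mathcal{A}$-submodule of $U(\mathcal{A})$ generated by all products of at most $k$ elements of $\beta(\mathcal{A})$; this is an algebra filtration of $U(\mathcal{A})$. Its associated graded algebra is $\operatorname{gr}(U(\mathcal{A}))=\bigoplus_{k}U_k(\mathcal{A})/U_{k-1}(\mathcal{A})$ (with $U_{-1}(\mathcal{A})=0$), which is a commutative graded $\mathcal{A}$-algebra; write $\operatorname{gr}_k:U_k(\mathcal{A})\to U_k(\mathcal{A})/U_{k-1}(\mathcal{A})$ for the canonical surjection. The PBW map is the (well-defined, surjective)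 morphism of graded $\mathcal{A}$-algebras $$\mathrm{PBW}_{\mathcal{A}}:\operatorname{Sym}_{\mathcal{A}}(\Omega(\mathcal{A}))\to\operatorname{gr}(U(\mathcal{A})),\qquad a\,\mathrm{d}a_1\,\mathrm{d}a_2\cdots\mathrm{d}a_k\mapsto\operatorname{gr}_k(\alpha(a)\beta(a_1)\beta(a_2)\cdots\beta(a_k)).$$ A Poisson algebra satisfies the PBW theorem (equivalently, the PBW theorem holds for it) if its PBW map is injective, hence an isomorphism of graded algebras. *)

theory Defs
  imports "HOL-Algebra.QuotRing" "HOL-Algebra.Module"
begin

section \<open>Modules and algebras\<close>

text \<open>Modules and algebras are HOL-Algebra structures with explicit carriers, stored in records of
  type \<open>module\<close>. For a structure that is only a module, the ring fields \<open>mult\<close> and \<open>one\<close> of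
  that record carry no meaning.\<close>

definition lin_hom ::
  "('k, 'c) ring_scheme \<Rightarrow> ('k, 'a, 'm) module_scheme \<Rightarrow> ('k, 'b, 'n) module_scheme \<Rightarrow> ('a \<Rightarrow> 'b) set"
  where "lin_hom K M N =
    {h. h \<in> carrier M \<rightarrow> carrier N \<and>
        (\<forall>x\<in>carrier M. \<forall>y\<in>carrier M. h (x \<oplus>\<^bsub>M\<^esub> y) = h x \<oplus>\<^bsub>N\<^esub> h y) \<and>
        (\<forall>k\<in>carrier K. \<forall>x\<in>carrier M. h (k \<odot>\<^bsub>M\<^esub> x) = k \<odot>\<^bsub>N\<^esub> h x)}"

definition alg_hom ::
  "('k, 'c) ring_scheme \<Rightarrow> ('k, 'a, 'm) module_scheme \<Rightarrow> ('k, 'b, 'n) module_scheme \<Rightarrow> ('a \<Rightarrow> 'b) set"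
  where "alg_hom K A B = ring_hom A B \<inter> lin_hom K A B"

text \<open>The library locale \<open>algebra\<close> is for commutative algebras.\<close>

locale assoc_algebra = module R U + U?: ring U for R (structure) and U (structure) +
  assumes smult_mult_left:
    "\<lbrakk>r \<in> carrier R; x \<in> carrier U; y \<in> carrier U\<rbrakk>
      \<Longrightarrow> (r \<odot>\<^bsub>U\<^esub> x) \<otimes>\<^bsub>U\<^esub> y = r \<odot>\<^bsub>U\<^esub> (x \<otimes>\<^bsub>U\<^esub> y)"
  and smult_mult_right:
    "\<lbrakk>r \<in> carrier R; x \<in> carrier U; y \<in> carrier U\<rbrakk>
      \<Longrightarrow> x \<otimes>\<^bsub>U\<^esub> (r \<odot>\<^bsub>U\<^esub> y) = r \<odot>\<^bsub>U\<^esub> (x \<otimes>\<^bsub>U\<^esub> y)"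

definition list_prod :: "('a, 'm) ring_scheme \<Rightarrow> 'a list \<Rightarrow> 'a"
  where "list_prod U xs = foldr (\<lambda>x y. x \<otimes>\<^bsub>U\<^esub> y) xs \<one>\<^bsub>U\<^esub>"

definition submodule_gen ::
  "('k, 'c) ring_scheme \<Rightarrow> ('k, 'a, 'm) module_scheme \<Rightarrow> 'a set \<Rightarrow> 'a set"
  where "submodule_gen K M S = \<Inter>{N. submodule N K M \<and> S \<subseteq> N}"

text \<open>The quotient by a submodule, or, when \<open>N\<close> is a two-sided ideal of an algebra, the
  quotient algebra.\<close>

definition quot_module :: "('k, 'a, 'm) module_scheme \<Rightarrow> 'a set \<Rightarrow> ('k, 'a set) module"
  where "quot_module M N =
    \<lparr>carrier = carrier (M Quot N), mult = mult (M Quot N), one = one (M Quot N),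
     zero = zero (M Quot N), add = add (M Quot N),
     smult = (\<lambda>k X. \<Union>x\<in>X. N +>\<^bsub>M\<^esub> (k \<odot>\<^bsub>M\<^esub> x))\<rparr>"

text \<open>Lifting property of \<open>P\<close> along surjections \<open>g: M \<rightarrow> N\<close>. A quantifier inside a formula
  cannot range over all types, so \<open>M\<close> and \<open>N\<close> have their carriers in fixed types. These are large
  enough: they contain \<open>N = P\<close> and the free module \<open>M\<close> on the set \<open>carrier P\<close>, and a
  splitting of the canonical surjection from \<open>M\<close> to \<open>P\<close> gives the lifting property for modules
  over every type.\<close>

definition projective_module :: "('k, 'c) ring_scheme \<Rightarrow> ('k, 'p) module \<Rightarrow> bool"
  where "projective_module K P \<longleftrightarrow>
    module K P \<and>
    (\<forall>(M :: ('k, 'p \<Rightarrow> 'k) module) (N :: ('k, 'p) module) g f.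
       module K M \<longrightarrow> module K N \<longrightarrow> g \<in> lin_hom K M N \<longrightarrow> g ` carrier M = carrier N \<longrightarrow>
       f \<in> lin_hom K P N \<longrightarrow>
       (\<exists>h \<in> lin_hom K P M. \<forall>x\<in>carrier P. g (h x) = f x))"

section \<open>Free modules, free algebras and symmetric algebras\<close>

definition free_module :: "('k, 'c) ring_scheme \<Rightarrow> 'x set \<Rightarrow> ('k, 'x \<Rightarrow> 'k) module"
  where "free_module K X =
    \<lparr>carrier = {f. (\<forall>x. f x \<in> carrier K) \<and> finite {x. f x \<noteq> \<zero>\<^bsub>K\<^esub>} \<and> {x. f x \<noteq> \<zero>\<^bsub>K\<^esub>} \<subseteq> X},
     mult = (\<lambda>_ _. undefined), one = undefined,
     zero = (\<lambda>_. \<zero>\<^bsub>K\<^esub>), add = (\<lambda>f g x. f x \<oplus>\<^bsub>K\<^esub> g x),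
     smult = (\<lambda>k f x. k \<otimes>\<^bsub>K\<^esub> f x)\<rparr>"

definition basis_elt :: "('k, 'c) ring_scheme \<Rightarrow> 'x \<Rightarrow> 'x \<Rightarrow> 'k"
  where "basis_elt K x = (\<lambda>y. if y = x then \<one>\<^bsub>K\<^esub> else \<zero>\<^bsub>K\<^esub>)"

text \<open>The free associative algebra on \<open>X\<close>: the free module on the words over \<open>X\<close>, with the
  multiplication extending concatenation of words.\<close>

definition free_algebra :: "('k, 'c) ring_scheme \<Rightarrow> 'x set \<Rightarrow> ('k, 'x list \<Rightarrow> 'k) module"
  where "free_algebra K X =
    (free_module K (lists X))
      \<lparr>mult := (\<lambda>f g w. \<Oplus>\<^bsub>K\<^esub>i\<in>{..length w}. f (take i w) \<otimes>\<^bsub>K\<^esub> g (drop i w)),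
       one := basis_elt K []\<rparr>"

text \<open>The symmetric algebra is the tensor algebra of \<open>M\<close> modulo the commutators of elements of
  \<open>M\<close>. The tensor algebra is itself the quotient of the free algebra on the set \<open>carrier M\<close> by
  the linearity relations; both quotients are taken at once.\<close>

definition sym_ideal ::
  "('k, 'c) ring_scheme \<Rightarrow> ('k, 'x) module \<Rightarrow> ('x list \<Rightarrow> 'k) set"
  where "sym_ideal K M =
    (let F = free_algebra K (carrier M); e = (\<lambda>x. basis_elt K [x]) in
     Idl\<^bsub>F\<^esub>
      ({e (x \<oplus>\<^bsub>M\<^esub> y) \<ominus>\<^bsub>F\<^esub> (e x \<oplus>\<^bsub>F\<^esub> e y) |x y. x \<in> carrier M \<and> y \<in> carrier M} \<union>
       {e (k \<odot>\<^bsub>M\<^esub> x) \<ominus>\<^bsub>F\<^esub> (k \<odot>\<^bsub>F\<^esub> e x) |k x. k \<in> carrier K \<and> x \<in> carrier M} \<union>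
       {(e x \<otimes>\<^bsub>F\<^esub> e y) \<ominus>\<^bsub>F\<^esub> (e y \<otimes>\<^bsub>F\<^esub> e x) |x y. x \<in> carrier M \<and> y \<in> carrier M}))"

definition sym_algebra ::
  "('k, 'c) ring_scheme \<Rightarrow> ('k, 'x) module \<Rightarrow> ('k, ('x list \<Rightarrow> 'k) set) module"
  where "sym_algebra K M = quot_module (free_algebra K (carrier M)) (sym_ideal K M)"

definition sym_incl ::
  "('k, 'c) ring_scheme \<Rightarrow> ('k, 'x) module \<Rightarrow> 'x \<Rightarrow> ('x list \<Rightarrow> 'k) set"
  where "sym_incl K M x = sym_ideal K M +>\<^bsub>free_algebra K (carrier M)\<^esub> basis_elt K [x]"

definition sym_degree ::
  "('k, 'c) ring_scheme \<Rightarrow> ('k, 'x) module \<Rightarrow> nat \<Rightarrow> ('x list \<Rightarrow> 'k) set set"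
  where "sym_degree K M n =
    {sym_ideal K M +>\<^bsub>free_algebra K (carrier M)\<^esub> f |f.
       f \<in> carrier (free_algebra K (carrier M)) \<and> (\<forall>w. f w \<noteq> \<zero>\<^bsub>K\<^esub> \<longrightarrow> length w = n)}"

definition graded_alg_hom ::
  "('k, 'c) ring_scheme \<Rightarrow> ('k, 'a) module \<Rightarrow> (nat \<Rightarrow> 'a set) \<Rightarrow>
   ('k, 'b) module \<Rightarrow> (nat \<Rightarrow> 'b set) \<Rightarrow> ('a \<Rightarrow> 'b) set"
  where "graded_alg_hom K S degS T degT = {h \<in> alg_hom K S T. \<forall>n. h ` degS n \<subseteq> degT n}"

definition graded_alg_iso ::
  "('k, 'c) ring_scheme \<Rightarrow> ('k, 'a) module \<Rightarrow> (nat \<Rightarrow> 'a set) \<Rightarrow>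
   ('k, 'b) module \<Rightarrow> (nat \<Rightarrow> 'b set) \<Rightarrow> ('a \<Rightarrow> 'b) set"
  where "graded_alg_iso K S degS T degT =
    {h \<in> alg_hom K S T. bij_betw h (carrier S) (carrier T) \<and> (\<forall>n. h ` degS n = degT n)}"

section \<open>Poisson algebras\<close>

record ('r, 'a) poisson = "('r, 'a) module" +
  bracket :: "['a, 'a] \<Rightarrow> 'a"

locale poisson_algebra = algebra R A
  for R :: "('r, 'c) ring_scheme" and A :: "('r, 'a) poisson" +
  assumes bracket_closed:
    "\<lbrakk>x \<in> carrier A; y \<in> carrier A\<rbrakk> \<Longrightarrow> bracket A x y \<in> carrier A"
  and bracket_add_left:
    "\<lbrakk>x \<in> carrier A; y \<in> carrier A; z \<in> carrier A\<rbrakk>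
      \<Longrightarrow> bracket A (x \<oplus>\<^bsub>A\<^esub> y) z = bracket A x z \<oplus>\<^bsub>A\<^esub> bracket A y z"
  and bracket_add_right:
    "\<lbrakk>x \<in> carrier A; y \<in> carrier A; z \<in> carrier A\<rbrakk>
      \<Longrightarrow> bracket A x (y \<oplus>\<^bsub>A\<^esub> z) = bracket A x y \<oplus>\<^bsub>A\<^esub> bracket A x z"
  and bracket_smult_left:
    "\<lbrakk>r \<in> carrier R; x \<in> carrier A; y \<in> carrier A\<rbrakk>
      \<Longrightarrow> bracket A (r \<odot>\<^bsub>A\<^esub> x) y = r \<odot>\<^bsub>A\<^esub> bracket A x y"
  and bracket_smult_right:
    "\<lbrakk>r \<in> carrier R; x \<in> carrier A; y \<in> carrier A\<rbrakk>
      \<Longrightarrow> bracket A x (r \<odot>\<^bsub>A\<^esub> y) = r \<odot>\<^bsub>A\<^esub> bracket A x y"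
  and bracket_alternating:
    "x \<in> carrier A \<Longrightarrow> bracket A x x = \<zero>\<^bsub>A\<^esub>"
  and bracket_jacobi:
    "\<lbrakk>x \<in> carrier A; y \<in> carrier A; z \<in> carrier A\<rbrakk>
      \<Longrightarrow> bracket A x (bracket A y z) \<oplus>\<^bsub>A\<^esub> bracket A y (bracket A z x)
            \<oplus>\<^bsub>A\<^esub> bracket A z (bracket A x y) = \<zero>\<^bsub>A\<^esub>"
  and bracket_leibniz:
    "\<lbrakk>x \<in> carrier A; y \<in> carrier A; z \<in> carrier A\<rbrakk>
      \<Longrightarrow> bracket A (x \<otimes>\<^bsub>A\<^esub> y) z = (x \<otimes>\<^bsub>A\<^esub> bracket A y z) \<oplus>\<^bsub>A\<^esub> (y \<otimes>\<^bsub>A\<^esub> bracket A x z)"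

definition poisson_ideal ::
  "('r, 'c) ring_scheme \<Rightarrow> ('r, 'a) poisson \<Rightarrow> 'a set \<Rightarrow> bool"
  where "poisson_ideal R A I \<longleftrightarrow>
    submodule I R A \<and> ideal I A \<and> (\<forall>a\<in>carrier A. \<forall>x\<in>I. bracket A a x \<in> I)"

definition poisson_quotient :: "('r, 'a) poisson \<Rightarrow> 'a set \<Rightarrow> ('r, 'a set) poisson"
  where "poisson_quotient A I =
    module.extend (quot_module A I)
      (poisson.fields (\<lambda>X Y. \<Union>x\<in>X. \<Union>y\<in>Y. I +>\<^bsub>A\<^esub> bracket A x y))"

section \<open>Kaehler differentials\<close>

text \<open>The free \<open>A\<close>-module on symbols \<open>e x\<close>, for \<open>x\<close> in \<open>A\<close>, modulo the relations making
  \<open>x \<mapsto> e x\<close> an \<open>R\<close>-linear derivation.\<close>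

definition kaehler_relations ::
  "('r, 'c) ring_scheme \<Rightarrow> ('r, 'a, 'm) module_scheme \<Rightarrow> ('a \<Rightarrow> 'a) set"
  where "kaehler_relations R A =
    (let F = free_module A (carrier A); e = basis_elt A in
     submodule_gen A F
      ({e (x \<oplus>\<^bsub>A\<^esub> y) \<ominus>\<^bsub>F\<^esub> (e x \<oplus>\<^bsub>F\<^esub> e y) |x y. x \<in> carrier A \<and> y \<in> carrier A} \<union>
       {e (r \<odot>\<^bsub>A\<^esub> x) \<ominus>\<^bsub>F\<^esub> ((r \<odot>\<^bsub>A\<^esub> \<one>\<^bsub>A\<^esub>) \<odot>\<^bsub>F\<^esub> e x) |r x. r \<in> carrier R \<and> x \<in> carrier A} \<union>
       {e (x \<otimes>\<^bsub>A\<^esub> y) \<ominus>\<^bsub>F\<^esub> ((x \<odot>\<^bsub>F\<^esub> e y) \<oplus>\<^bsub>F\<^esub> (y \<odot>\<^bsub>F\<^esub> e x)) |x y. x \<in> carrier A \<and> y \<in> carrier A}))"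

definition kaehler ::
  "('r, 'c) ring_scheme \<Rightarrow> ('r, 'a, 'm) module_scheme \<Rightarrow> ('a, ('a \<Rightarrow> 'a) set) module"
  where "kaehler R A = quot_module (free_module A (carrier A)) (kaehler_relations R A)"

definition kaehler_d ::
  "('r, 'c) ring_scheme \<Rightarrow> ('r, 'a, 'm) module_scheme \<Rightarrow> 'a \<Rightarrow> ('a \<Rightarrow> 'a) set"
  where "kaehler_d R A x = kaehler_relations R A +>\<^bsub>free_module A (carrier A)\<^esub> basis_elt A x"

definition smooth_poisson :: "('r, 'c) ring_scheme \<Rightarrow> ('r, 'a) poisson \<Rightarrow> bool"
  where "smooth_poisson R A \<longleftrightarrow> poisson_algebra R A \<and> projective_module A (kaehler R A)"

section \<open>Poisson enveloping algebras\<close>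

definition enveloping_pair ::
  "('r, 'c) ring_scheme \<Rightarrow> ('r, 'a) poisson \<Rightarrow> ('r, 'u) module \<Rightarrow> ('a \<Rightarrow> 'u) \<Rightarrow> ('a \<Rightarrow> 'u) \<Rightarrow> bool"
  where "enveloping_pair R A U \<alpha> \<beta> \<longleftrightarrow>
    assoc_algebra R U \<and> \<alpha> \<in> alg_hom R A U \<and> \<beta> \<in> lin_hom R A U \<and>
    (\<forall>x\<in>carrier A. \<forall>y\<in>carrier A.
       \<beta> (bracket A x y) = (\<beta> x \<otimes>\<^bsub>U\<^esub> \<beta> y) \<ominus>\<^bsub>U\<^esub> (\<beta> y \<otimes>\<^bsub>U\<^esub> \<beta> x) \<and>
       \<alpha> (bracket A x y) = (\<alpha> x \<otimes>\<^bsub>U\<^esub> \<beta> y) \<ominus>\<^bsub>U\<^esub> (\<beta> y \<otimes>\<^bsub>U\<^esub> \<alpha> x) \<and>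
       \<beta> (x \<otimes>\<^bsub>A\<^esub> y) = (\<alpha> x \<otimes>\<^bsub>U\<^esub> \<beta> y) \<oplus>\<^bsub>U\<^esub> (\<alpha> y \<otimes>\<^bsub>U\<^esub> \<beta> x))"

definition enveloping_morphism ::
  "('r, 'c) ring_scheme \<Rightarrow> ('r, 'a) poisson \<Rightarrow> ('r, 'u) module \<Rightarrow> ('a \<Rightarrow> 'u) \<Rightarrow> ('a \<Rightarrow> 'u) \<Rightarrow>
   ('r, 'v) module \<Rightarrow> ('a \<Rightarrow> 'v) \<Rightarrow> ('a \<Rightarrow> 'v) \<Rightarrow> ('u \<Rightarrow> 'v) \<Rightarrow> bool"
  where "enveloping_morphism R A U \<alpha> \<beta> U' \<alpha>' \<beta>' \<gamma> \<longleftrightarrow>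
    \<gamma> \<in> alg_hom R U U' \<and> (\<forall>x\<in>carrier A. \<gamma> (\<alpha> x) = \<alpha>' x \<and> \<gamma> (\<beta> x) = \<beta>' x)"

text \<open>The universal property quantifies over test algebras \<open>U'\<close> whose carrier lies in the type
  \<open>(('a + 'a) list \<Rightarrow> 'r) set\<close>. That type contains all quotients of the free algebra over \<open>R\<close> on
  two copies of \<open>A\<close> (generators for the values of \<open>\<alpha>'\<close> and of \<open>\<beta>'\<close>), and hence an enveloping
  algebra that is universal for test algebras over every type. The type \<open>'u\<close> of \<open>U\<close> itself is
  arbitrary.\<close>

definition poisson_enveloping_algebra ::
  "('r, 'c) ring_scheme \<Rightarrow> ('r, 'a) poisson \<Rightarrow> ('r, 'u) module \<Rightarrow> ('a \<Rightarrow> 'u) \<Rightarrow> ('a \<Rightarrow> 'u) \<Rightarrow> bool"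
  where "poisson_enveloping_algebra R A U \<alpha> \<beta> \<longleftrightarrow>
    enveloping_pair R A U \<alpha> \<beta> \<and>
    (\<forall>(U' :: ('r, (('a + 'a) list \<Rightarrow> 'r) set) module) \<alpha>' \<beta>'.
       enveloping_pair R A U' \<alpha>' \<beta>' \<longrightarrow>
       (\<exists>\<gamma>. enveloping_morphism R A U \<alpha> \<beta> U' \<alpha>' \<beta>' \<gamma> \<and>
          (\<forall>\<gamma>'. enveloping_morphism R A U \<alpha> \<beta> U' \<alpha>' \<beta>' \<gamma>' \<longrightarrow>
             (\<forall>u\<in>carrier U. \<gamma>' u = \<gamma> u))))"

section \<open>The filtration, its associated graded algebra and the PBW map\<close>

definition left_module :: "('r, 'u) module \<Rightarrow> ('a \<Rightarrow> 'u) \<Rightarrow> ('a, 'u) module"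
  where "left_module U \<alpha> =
    \<lparr>carrier = carrier U, mult = mult U, one = one U, zero = zero U, add = add U,
     smult = (\<lambda>a u. \<alpha> a \<otimes>\<^bsub>U\<^esub> u)\<rparr>"

definition env_filt ::
  "('r, 'a) poisson \<Rightarrow> ('r, 'u) module \<Rightarrow> ('a \<Rightarrow> 'u) \<Rightarrow> ('a \<Rightarrow> 'u) \<Rightarrow> nat \<Rightarrow> 'u set"
  where "env_filt A U \<alpha> \<beta> k =
    submodule_gen A (left_module U \<alpha>)
      {list_prod U (map \<beta> xs) |xs. set xs \<subseteq> carrier A \<and> length xs \<le> k}"

text \<open>The step of index \<open>k - 1\<close>, which is \<open>0\<close> for \<open>k = 0\<close>.\<close>

definition env_filt_pred ::
  "('r, 'a) poisson \<Rightarrow> ('r, 'u) module \<Rightarrow> ('a \<Rightarrow> 'u) \<Rightarrow> ('a \<Rightarrow> 'u) \<Rightarrow> nat \<Rightarrow> 'u set"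
  where "env_filt_pred A U \<alpha> \<beta> k =
    (case k of 0 \<Rightarrow> {\<zero>\<^bsub>U\<^esub>} | Suc j \<Rightarrow> env_filt A U \<alpha> \<beta> j)"

definition gr_piece ::
  "('r, 'a) poisson \<Rightarrow> ('r, 'u) module \<Rightarrow> ('a \<Rightarrow> 'u) \<Rightarrow> ('a \<Rightarrow> 'u) \<Rightarrow> nat \<Rightarrow> ('a, 'u set) module"
  where "gr_piece A U \<alpha> \<beta> k =
    quot_module ((left_module U \<alpha>)\<lparr>carrier := env_filt A U \<alpha> \<beta> k\<rparr>) (env_filt_pred A U \<alpha> \<beta> k)"

definition gr_class ::
  "('r, 'a) poisson \<Rightarrow> ('r, 'u) module \<Rightarrow> ('a \<Rightarrow> 'u) \<Rightarrow> ('a \<Rightarrow> 'u) \<Rightarrow> nat \<Rightarrow> 'u \<Rightarrow> 'u set"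
  where "gr_class A U \<alpha> \<beta> k u = env_filt_pred A U \<alpha> \<beta> k +>\<^bsub>U\<^esub> u"

definition gr_piece_mult ::
  "('r, 'a) poisson \<Rightarrow> ('r, 'u) module \<Rightarrow> ('a \<Rightarrow> 'u) \<Rightarrow> ('a \<Rightarrow> 'u) \<Rightarrow>
   nat \<Rightarrow> nat \<Rightarrow> 'u set \<Rightarrow> 'u set \<Rightarrow> 'u set"
  where "gr_piece_mult A U \<alpha> \<beta> i j X Y =
    (\<Union>x\<in>X. \<Union>y\<in>Y. gr_class A U \<alpha> \<beta> (i + j) (x \<otimes>\<^bsub>U\<^esub> y))"

text \<open>The element of the direct sum with the single component \<open>X\<close>, in degree \<open>k\<close>.\<close>

definition gr_in ::
  "('r, 'a) poisson \<Rightarrow> ('r, 'u) module \<Rightarrow> ('a \<Rightarrow> 'u) \<Rightarrow> ('a \<Rightarrow> 'u) \<Rightarrow>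
   nat \<Rightarrow> 'u set \<Rightarrow> nat \<Rightarrow> 'u set"
  where "gr_in A U \<alpha> \<beta> k X = (\<lambda>n. if n = k then X else \<zero>\<^bsub>gr_piece A U \<alpha> \<beta> n\<^esub>)"

definition gr_algebra ::
  "('r, 'a) poisson \<Rightarrow> ('r, 'u) module \<Rightarrow> ('a \<Rightarrow> 'u) \<Rightarrow> ('a \<Rightarrow> 'u) \<Rightarrow> ('a, nat \<Rightarrow> 'u set) module"
  where "gr_algebra A U \<alpha> \<beta> =
    (let G = gr_piece A U \<alpha> \<beta> in
     \<lparr>carrier = {s. (\<forall>n. s n \<in> carrier (G n)) \<and> finite {n. s n \<noteq> \<zero>\<^bsub>G n\<^esub>}},
      mult = (\<lambda>s t n. \<Oplus>\<^bsub>G n\<^esub>i\<in>{..n}. gr_piece_mult A U \<alpha> \<beta> i (n - i) (s i) (t (n - i))),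
      one = gr_in A U \<alpha> \<beta> 0 (gr_class A U \<alpha> \<beta> 0 \<one>\<^bsub>U\<^esub>),
      zero = (\<lambda>n. \<zero>\<^bsub>G n\<^esub>),
      add = (\<lambda>s t n. s n \<oplus>\<^bsub>G n\<^esub> t n),
      smult = (\<lambda>a s n. a \<odot>\<^bsub>G n\<^esub> s n)\<rparr>)"

definition gr_degree ::
  "('r, 'a) poisson \<Rightarrow> ('r, 'u) module \<Rightarrow> ('a \<Rightarrow> 'u) \<Rightarrow> ('a \<Rightarrow> 'u) \<Rightarrow> nat \<Rightarrow> (nat \<Rightarrow> 'u set) set"
  where "gr_degree A U \<alpha> \<beta> k =
    {s \<in> carrier (gr_algebra A U \<alpha> \<beta>). \<forall>n. n \<noteq> k \<longrightarrow> s n = \<zero>\<^bsub>gr_piece A U \<alpha> \<beta> n\<^esub>}"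

abbreviation sym_kaehler ::
  "('r, 'c) ring_scheme \<Rightarrow> ('r, 'a) poisson \<Rightarrow> ('a, (('a \<Rightarrow> 'a) set list \<Rightarrow> 'a) set) module"
  where "sym_kaehler R A \<equiv> sym_algebra A (kaehler R A)"

definition is_pbw_map ::
  "('r, 'c) ring_scheme \<Rightarrow> ('r, 'a) poisson \<Rightarrow> ('r, 'u) module \<Rightarrow> ('a \<Rightarrow> 'u) \<Rightarrow> ('a \<Rightarrow> 'u) \<Rightarrow>
   ((('a \<Rightarrow> 'a) set list \<Rightarrow> 'a) set \<Rightarrow> (nat \<Rightarrow> 'u set)) \<Rightarrow> bool"
  where "is_pbw_map R A U \<alpha> \<beta> \<phi> \<longleftrightarrow>
    \<phi> \<in> extensional (carrier (sym_kaehler R A)) \<and>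
    \<phi> \<in> graded_alg_hom A (sym_kaehler R A) (sym_degree A (kaehler R A))
          (gr_algebra A U \<alpha> \<beta>) (gr_degree A U \<alpha> \<beta>) \<and>
    (\<forall>a\<in>carrier A. \<forall>xs\<in>lists (carrier A).
       \<phi> (a \<odot>\<^bsub>sym_kaehler R A\<^esub>
             list_prod (sym_kaehler R A) (map (\<lambda>x. sym_incl A (kaehler R A) (kaehler_d R A x)) xs)) =
       gr_in A U \<alpha> \<beta> (length xs)
         (gr_class A U \<alpha> \<beta> (length xs) (\<alpha> a \<otimes>\<^bsub>U\<^esub> list_prod U (map \<beta> xs))))"

definition pbw_map ::
  "('r, 'c) ring_scheme \<Rightarrow> ('r, 'a) poisson \<Rightarrow> ('r, 'u) module \<Rightarrow> ('a \<Rightarrow> 'u) \<Rightarrow> ('a \<Rightarrow> 'u) \<Rightarrow>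
   (('a \<Rightarrow> 'a) set list \<Rightarrow> 'a) set \<Rightarrow> (nat \<Rightarrow> 'u set)"
  where "pbw_map R A U \<alpha> \<beta> = (THE \<phi>. is_pbw_map R A U \<alpha> \<beta> \<phi>)"

end

theory Submission
  imports Defs "HOL-Library.Multiset"
begin

text \<open>For a smooth \<open>A\<close> the module \<open>\<Omega>(A)\<close> is projective, and an Eilenberg swindle embeds the Lie--Rinehart
  algebra \<open>\<Omega>(A)\<close> in a free one, its semidirect product with a free module of infinite rank. A free
  Lie--Rinehart algebra \<open>L\<close> acts on the polynomial ring \<open>S\<close> over \<open>A\<close> in a basis of \<open>L\<close> by operators \<open>E v\<close>
  whose leading part is multiplication by \<open>v\<close>; this is the classical proof of PBW.

  Let \<open>I\<close> be generated by \<open>f0\<close> and \<open>w = df0\<close>. The elements of \<open>\<alpha>(I)\<close> and \<open>\<beta>(I)\<close> map \<open>S\<close> into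
  \<open>N = I S + E w S\<close>, which the operators of \<open>A\<close> preserve, so \<open>U(A / I)\<close> acts on \<open>S / N\<close>. As \<open>A / I\<close> is a
  domain, either \<open>w\<close> vanishes modulo \<open>I\<close> or its leading form is not a zero divisor modulo \<open>I\<close>; in both
  cases the leading forms of elements of \<open>N\<close> lie in \<open>I S + w S\<close>. The symmetric algebra of \<open>\<Omega>(A / I)\<close>
  receives \<open>S / (I S + w S)\<close>, so an element of \<open>U(A / I)\<close> that is of smaller filtration degree than
  expected has symbol \<open>0\<close>, as its action on \<open>1 \<in> S / N\<close> shows.\<close>

section \<open>Additive maps and additive spans\<close>

text \<open>Passing to the associated graded algebra need not commute with quotients: a combination
  of the relations imposed by \<open>\<alpha>(I)\<close> and \<open>\<beta>(I)\<close> may lose its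
  leading term and then have a symbol outside the ideal generated by the symbols of the relations.
  Controlling this is what the domain hypothesis is for. That one generator is enough to describe
  the relations comes from the Leibniz rule \<open>d (c f0) = c df0 + f0 dc\<close>. The form
  \<open>E w S\<close>, with \<open>E w\<close> applied last, is dictated by \<open>w\<close> being
  normal modulo \<open>I\<close>: \<open>E (u x)\<close> commutes with \<open>E w\<close> up to some
  \<open>E (u y)\<close> with \<open>y\<close> in \<open>I\<close>.

  Freeness supplies coordinates, hence monomials, degrees and exponents to argue with; the free
  summand added to \<open>\<Omega>(A)\<close> does no harm, since it is sent to \<open>0\<close> in
  \<open>\<Omega>(A / I)\<close>. The operators differentiate coefficients, so they are additive but
  not \<open>A\<close>-linear; this is why additive maps and additive spans, instead of linear ones,
  carry the extension arguments.\<close>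

definition add_map :: "('a, 'm) ring_scheme \<Rightarrow> ('b, 'n) ring_scheme \<Rightarrow> ('a \<Rightarrow> 'b) set"
  where "add_map M N =
    {h \<in> carrier M \<rightarrow> carrier N.
       \<forall>x\<in>carrier M. \<forall>y\<in>carrier M. h (x \<oplus>\<^bsub>M\<^esub> y) = h x \<oplus>\<^bsub>N\<^esub> h y}"

lemma add_mapI:
  assumes "\<And>x. x \<in> carrier M \<Longrightarrow> h x \<in> carrier N"
    and "\<And>x y. x \<in> carrier M \<Longrightarrow> y \<in> carrier M \<Longrightarrow> h (x \<oplus>\<^bsub>M\<^esub> y) = h x \<oplus>\<^bsub>N\<^esub> h y"
  shows "h \<in> add_map M N"
  using assms by (auto simp: add_map_def)

lemma add_map_closed: "h \<in> add_map M N \<Longrightarrow> x \<in> carrier M \<Longrightarrow> h x \<in> carrier N"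
  by (auto simp: add_map_def)

lemma add_map_add:
  "h \<in> add_map M N \<Longrightarrow> x \<in> carrier M \<Longrightarrow> y \<in> carrier M \<Longrightarrow> h (x \<oplus>\<^bsub>M\<^esub> y) = h x \<oplus>\<^bsub>N\<^esub> h y"
  by (auto simp: add_map_def)

lemma add_map_zero:
  assumes "h \<in> add_map M N" "abelian_group M" "abelian_group N"
  shows "h \<zero>\<^bsub>M\<^esub> = \<zero>\<^bsub>N\<^esub>"
proof -
  interpret M: abelian_group M by fact
  interpret N: abelian_group N by fact
  have "h \<zero>\<^bsub>M\<^esub> = h \<zero>\<^bsub>M\<^esub> \<oplus>\<^bsub>N\<^esub> h \<zero>\<^bsub>M\<^esub>"
    using add_map_add[OF assms(1), of "\<zero>\<^bsub>M\<^esub>" "\<zero>\<^bsub>M\<^esub>"] by simp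
  then show ?thesis
    using add_map_closed[OF assms(1) M.zero_closed] by (metis N.add.r_cancel_one')
qed

lemma add_map_neg:
  assumes "h \<in> add_map M N" "abelian_group M" "abelian_group N" "x \<in> carrier M"
  shows "h (\<ominus>\<^bsub>M\<^esub> x) = \<ominus>\<^bsub>N\<^esub> h x"
proof -
  interpret M: abelian_group M by fact
  interpret N: abelian_group N by fact
  have "h (\<ominus>\<^bsub>M\<^esub> x) \<oplus>\<^bsub>N\<^esub> h x = \<zero>\<^bsub>N\<^esub>"
    using add_map_add[OF assms(1), of "\<ominus>\<^bsub>M\<^esub> x" x] add_map_zero[OF assms(1-3)] assms(4)
    by (simp add: M.l_neg)
  then show ?thesis
    using add_map_closed[OF assms(1)] assms(4) by (metis M.a_inv_closed N.minus_equality)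
qed

lemma add_map_minus:
  assumes "h \<in> add_map M N" "abelian_group M" "abelian_group N" "x \<in> carrier M" "y \<in> carrier M"
  shows "h (x \<ominus>\<^bsub>M\<^esub> y) = h x \<ominus>\<^bsub>N\<^esub> h y"
proof -
  interpret M: abelian_group M by fact
  show ?thesis
    unfolding a_minus_def
    using add_map_add[OF assms(1)] add_map_neg[OF assms(1-3)] assms(4,5) by simp
qed

lemma add_map_comp: "h \<in> add_map M N \<Longrightarrow> k \<in> add_map N P \<Longrightarrow> (\<lambda>x. k (h x)) \<in> add_map M P"
  by (auto simp: add_map_def Pi_def)

lemma add_map_plus:
  assumes "abelian_group N" "h \<in> add_map M N" "k \<in> add_map M N"
  shows "(\<lambda>x. h x \<oplus>\<^bsub>N\<^esub> k x) \<in> add_map M N"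
proof -
  interpret N: abelian_group N by fact
  show ?thesis
    using assms(2,3) by (auto simp: add_map_def Pi_def N.a_ac)
qed

lemma lin_homI:
  assumes "\<And>x. x \<in> carrier M \<Longrightarrow> h x \<in> carrier N"
    and "\<And>x y. x \<in> carrier M \<Longrightarrow> y \<in> carrier M \<Longrightarrow> h (x \<oplus>\<^bsub>M\<^esub> y) = h x \<oplus>\<^bsub>N\<^esub> h y"
    and "\<And>k x. k \<in> carrier K \<Longrightarrow> x \<in> carrier M \<Longrightarrow> h (k \<odot>\<^bsub>M\<^esub> x) = k \<odot>\<^bsub>N\<^esub> h x"
  shows "h \<in> lin_hom K M N"
  using assms by (auto simp: lin_hom_def)

lemma lin_hom_add_map: "h \<in> lin_hom K M N \<Longrightarrow> h \<in> add_map M N"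
  by (auto simp: lin_hom_def add_map_def)

lemma lin_hom_smult:
  "h \<in> lin_hom K M N \<Longrightarrow> k \<in> carrier K \<Longrightarrow> x \<in> carrier M \<Longrightarrow> h (k \<odot>\<^bsub>M\<^esub> x) = k \<odot>\<^bsub>N\<^esub> h x"
  by (auto simp: lin_hom_def)

lemma lin_hom_closed: "h \<in> lin_hom K M N \<Longrightarrow> x \<in> carrier M \<Longrightarrow> h x \<in> carrier N"
  by (auto simp: lin_hom_def)

lemma lin_hom_comp: "h \<in> lin_hom K M N \<Longrightarrow> k \<in> lin_hom K N P \<Longrightarrow> (\<lambda>x. k (h x)) \<in> lin_hom K M P"
  by (auto simp: lin_hom_def Pi_def)

text \<open>Sums without coefficients or signs: scalars and negatives have to be absorbed by the
  generating set. This is the right notion of generation for maps that obey a Leibniz rule instead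
  of linearity.\<close>

inductive_set add_span :: "('a, 'm) ring_scheme \<Rightarrow> 'a set \<Rightarrow> 'a set" for M G where
  zero: "\<zero>\<^bsub>M\<^esub> \<in> add_span M G"
| add: "g \<in> G \<Longrightarrow> x \<in> add_span M G \<Longrightarrow> g \<oplus>\<^bsub>M\<^esub> x \<in> add_span M G"

context abelian_monoid
begin

lemma add_span_closed: "H \<subseteq> carrier G \<Longrightarrow> x \<in> add_span G H \<Longrightarrow> x \<in> carrier G"
  by (erule add_span.induct) auto

lemma add_span_base:
  assumes "H \<subseteq> carrier G" "g \<in> H"
  shows "g \<in> add_span G H"
proof -
  have "g \<oplus> \<zero> \<in> add_span G H"
    by (rule add_span.add[OF assms(2) add_span.zero])
  then show ?thesis
    using assms by auto
qed

lemma add_span_add: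
  assumes "H \<subseteq> carrier G" "x \<in> add_span G H" "y \<in> add_span G H"
  shows "x \<oplus> y \<in> add_span G H"
  using assms(2)
proof induction
  case zero
  show ?case using add_span_closed assms by auto
next
  case (add g x)
  have "g \<oplus> x \<oplus> y = g \<oplus> (x \<oplus> y)"
    using add add_span_closed assms by (intro a_assoc) blast+
  then show ?case
    using add_span.add[OF add(1,3)] by simp
qed

lemma add_span_least:
  assumes "x \<in> add_span G H" "\<zero> \<in> T" "\<And>g. g \<in> H \<Longrightarrow> g \<in> T"
    "\<And>x y. x \<in> T \<Longrightarrow> y \<in> T \<Longrightarrow> x \<oplus> y \<in> T"
  shows "x \<in> T"
  using assms(1) by induction (auto intro: assms)

lemma add_span_finsum:
  assumes "H \<subseteq> carrier G" "\<And>i. i \<in> A \<Longrightarrow> f i \<in> add_span G H"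
  shows "finsum G f A \<in> add_span G H"
proof (cases "finite A")
  case True
  then show ?thesis using assms(2)
  proof (induction A)
    case empty
    then show ?case by (simp add: add_span.zero)
  next
    case (insert i A)
    have "finsum G f (insert i A) = f i \<oplus> finsum G f A"
      using insert add_span_closed[OF assms(1)] by (intro finsum_insert) auto
    then show ?case
      using add_span_add[OF assms(1)] insert by auto
  qed
next
  case False
  then show ?thesis by (simp add: finsum_infinite add_span.zero)
qed

end

lemma add_span_mono: "G \<subseteq> H \<Longrightarrow> add_span M G \<subseteq> add_span M H"
proof
  fix x assume "G \<subseteq> H" "x \<in> add_span M G"
  from this(2,1) show "x \<in> add_span M H"
    by induction (auto intro: add_span.intros)
qed

lemma add_map_add_span:
  assumes "h \<in> add_map M N" "abelian_group M" "abelian_group N" "G \<subseteq> carrier M" "H \<subseteq> carrier N"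
    and "\<And>g. g \<in> G \<Longrightarrow> h g \<in> add_span N H" "x \<in> add_span M G"
  shows "h x \<in> add_span N H"
  using assms(7)
proof induction
  case zero
  show ?case using add_map_zero[OF assms(1-3)] by (simp add: add_span.zero)
next
  case (add g x)
  interpret M: abelian_group M by fact
  interpret N: abelian_group N by fact
  have "h (g \<oplus>\<^bsub>M\<^esub> x) = h g \<oplus>\<^bsub>N\<^esub> h x"
    using add_map_add[OF assms(1)] add M.add_span_closed assms by blast
  then show ?case
    using N.add_span_add[OF assms(5)] add assms(6) by simp
qed

lemma add_map_eq_on_span:
  assumes "h \<in> add_map M N" "k \<in> add_map M N" "abelian_group M" "abelian_group N"
    and "G \<subseteq> carrier M" "\<And>g. g \<in> G \<Longrightarrow> h g = k g" "x \<in> add_span M G"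
  shows "h x = k x"
  using assms(7)
proof induction
  case zero
  show ?case using add_map_zero assms by metis
next
  case (add g x)
  interpret M: abelian_group M by fact
  have "x \<in> carrier M" using M.add_span_closed add assms by blast
  then show ?case
    using add_map_add[OF assms(1), of g x] add_map_add[OF assms(2), of g x] add assms(5,6) by auto
qed

lemma (in abelian_group) neg_zero: "\<ominus> \<zero> = \<zero>"
  by (rule minus_equality) auto

section \<open>Free modules\<close>

definition single :: "('k, 'c) ring_scheme \<Rightarrow> 'x \<Rightarrow> 'k \<Rightarrow> 'x \<Rightarrow> 'k"
  where "single K x a = (\<lambda>y. if y = x then a else \<zero>\<^bsub>K\<^esub>)"

text \<open>The map out of a direct sum of copies of \<open>K\<close> that is
  \<open>\<psi> x\<close> on the copy at \<open>x\<close>. The \<open>\<psi> x\<close> are arbitrary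
  additive maps, not multiples of one value, so that \<open>dsum\<close> also produces operators
  that differentiate the coefficients.\<close>

definition dsum :: "('k, 'c) ring_scheme \<Rightarrow> ('n, 'd) ring_scheme \<Rightarrow> ('x \<Rightarrow> 'k \<Rightarrow> 'n) \<Rightarrow> ('x \<Rightarrow> 'k) \<Rightarrow> 'n"
  where "dsum K N \<psi> f = finsum N (\<lambda>x. \<psi> x (f x)) {x. f x \<noteq> \<zero>\<^bsub>K\<^esub>}"

lemma free_module_simps [simp]:
  "zero (free_module K X) = (\<lambda>_. \<zero>\<^bsub>K\<^esub>)"
  "add (free_module K X) = (\<lambda>f g x. f x \<oplus>\<^bsub>K\<^esub> g x)"
  "smult (free_module K X) = (\<lambda>k f x. k \<otimes>\<^bsub>K\<^esub> f x)"
  by (auto simp: free_module_def)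

lemma free_module_carrier:
  "f \<in> carrier (free_module K X) \<longleftrightarrow>
    (\<forall>x. f x \<in> carrier K) \<and> finite {x. f x \<noteq> \<zero>\<^bsub>K\<^esub>} \<and> (\<forall>x. f x \<noteq> \<zero>\<^bsub>K\<^esub> \<longrightarrow> x \<in> X)"
  by (auto simp: free_module_def)

lemma basis_elt_single: "basis_elt K x = single K x \<one>\<^bsub>K\<^esub>"
  by (auto simp: basis_elt_def single_def)

context cring
begin

lemma free_module_carrierI:
  assumes "\<And>x. f x \<in> carrier R" "finite F" "\<And>x. x \<notin> F \<Longrightarrow> f x = \<zero>" "\<And>x. f x \<noteq> \<zero> \<Longrightarrow> x \<in> X"
  shows "f \<in> carrier (free_module R X)"
  unfolding free_module_carrier using assms
  by (auto intro: finite_subset[of _ F])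

lemma free_module_module: "module R (free_module R X)"
proof (rule moduleI)
  have add: "(\<lambda>x. f x \<oplus> g x) \<in> carrier (free_module R X)"
    if "f \<in> carrier (free_module R X)" "g \<in> carrier (free_module R X)" for f g
    using that
    by (intro free_module_carrierI[where F="{x. f x \<noteq> \<zero>} \<union> {x. g x \<noteq> \<zero>}"])
       (auto simp: free_module_carrier, metis l_zero zero_closed)
  show "abelian_group (free_module R X)"
  proof (rule abelian_groupI)
    fix f assume f: "f \<in> carrier (free_module R X)"
    have "(\<lambda>x. \<ominus> f x) \<in> carrier (free_module R X)"
      using f unfolding free_module_carrier
      by (auto intro: finite_subset[of _ "{x. f x \<noteq> \<zero>}"])
    then show "\<exists>g\<in>carrier (free_module R X). g \<oplus>\<^bsub>free_module R X\<^esub> f = \<zero>\<^bsub>free_module R X\<^esub>"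
      using f by (intro bexI[of _ "\<lambda>x. \<ominus> f x"]) (auto simp: free_module_carrier l_neg)
  qed (simp_all add: add, simp_all add: free_module_carrier a_ac)
  fix a f assume "a \<in> carrier R" "f \<in> carrier (free_module R X)"
  then show "a \<odot>\<^bsub>free_module R X\<^esub> f \<in> carrier (free_module R X)"
    by (intro free_module_carrierI[where F="{x. f x \<noteq> \<zero>}"])
       (auto simp: free_module_carrier, metis r_null)
qed (auto simp: free_module_carrier l_distr r_distr m_assoc is_cring)

lemma free_module_group: "abelian_group (free_module R X)"
  using free_module_module module.axioms(2) by blast

lemma free_module_neg:
  assumes "f \<in> carrier (free_module R X)"
  shows "\<ominus>\<^bsub>free_module R X\<^esub> f = (\<lambda>x. \<ominus> f x)"
proof -
  interpret F: abelian_group "free_module R X" by (rule free_module_group)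
  have "(\<lambda>x. \<ominus> f x) \<in> carrier (free_module R X)"
    using assms unfolding free_module_carrier
    by (auto intro: finite_subset[of _ "{x. f x \<noteq> \<zero>}"])
  then show ?thesis
    using assms by (intro F.minus_equality) (auto simp: free_module_carrier l_neg)
qed

lemma free_module_minus:
  assumes "f \<in> carrier (free_module R X)" "g \<in> carrier (free_module R X)"
  shows "f \<ominus>\<^bsub>free_module R X\<^esub> g = (\<lambda>x. f x \<ominus> g x)"
  using assms by (simp add: a_minus_def free_module_neg)

lemma single_closed: "x \<in> X \<Longrightarrow> a \<in> carrier R \<Longrightarrow> single R x a \<in> carrier (free_module R X)"
  by (rule free_module_carrierI[where F="{x}"]) (auto simp: single_def split: if_splits)

lemma single_add_map: "x \<in> X \<Longrightarrow> single R x \<in> add_map R (free_module R X)"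
  by (rule add_mapI) (use single_closed in \<open>auto simp: single_def\<close>)

lemma single_smult:
  "k \<in> carrier R \<Longrightarrow> k \<odot>\<^bsub>free_module R X\<^esub> single R x a = single R x (k \<otimes> a)"
  by (auto simp: single_def)

lemma single_basis_elt: "a \<in> carrier R \<Longrightarrow> single R x a = a \<odot>\<^bsub>free_module R X\<^esub> basis_elt R x"
  by (auto simp: single_def basis_elt_def)

lemma singles_closed: "{single R x a |x a. x \<in> X \<and> a \<in> carrier R} \<subseteq> carrier (free_module R X)"
  using single_closed by auto

lemma free_module_span:
  assumes "f \<in> carrier (free_module R X)"
  shows "f \<in> add_span (free_module R X) {single R x a |x a. x \<in> X \<and> a \<in> carrier R}"
  using assms
proof (induction "card {x. f x \<noteq> \<zero>}" arbitrary: f)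
  case 0
  have "finite {x. f x \<noteq> \<zero>}"
    using 0(2) unfolding free_module_carrier by blast
  then have "{x. f x \<noteq> \<zero>} = {}"
    using 0(1) by (metis card_0_eq)
  then have "f = (\<lambda>_. \<zero>)"
    by blast
  then have "f = \<zero>\<^bsub>free_module R X\<^esub>"
    by (simp only: free_module_simps)
  then show ?case
    by (simp only: add_span.zero)
next
  case (Suc n)
  then have fin: "finite {x. f x \<noteq> \<zero>}" by (simp add: free_module_carrier)
  obtain x where x: "f x \<noteq> \<zero>"
    using Suc(2) by (metis (mono_tags, lifting) Collect_empty_eq card.empty nat.distinct(1))
  let ?g = "f(x := \<zero>)"
  have g: "?g \<in> carrier (free_module R X)"
    using Suc(3) by (auto simp: free_module_carrier intro: finite_subset[of _ "{x. f x \<noteq> \<zero>}"])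
  have "{y. ?g y \<noteq> \<zero>} = {y. f y \<noteq> \<zero>} - {x}" by auto
  then have "card {y. ?g y \<noteq> \<zero>} = n"
    using Suc(2) x fin by (simp add: card_Diff_singleton)
  then have "?g \<in> add_span (free_module R X) {single R x a |x a. x \<in> X \<and> a \<in> carrier R}"
    using Suc(1) g by blast
  moreover have "f = single R x (f x) \<oplus>\<^bsub>free_module R X\<^esub> ?g"
    using Suc(3) by (auto simp: single_def free_module_carrier)
  moreover have "x \<in> X" "f x \<in> carrier R"
    using Suc(3) x by (auto simp: free_module_carrier)
  ultimately show ?case
    using add_span.add[of "single R x (f x)" "{single R x a |x a. x \<in> X \<and> a \<in> carrier R}" ?g "free_module R X"]
    by auto
qed

lemma free_module_carrier_eq_span:
  "carrier (free_module R X) = add_span (free_module R X) {single R x a |x a. x \<in> X \<and> a \<in> carrier R}"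
proof -
  interpret F: abelian_group "free_module R X" by (rule free_module_group)
  show ?thesis
    using free_module_span F.add_span_closed[OF singles_closed] by auto
qed

text \<open>Zero coefficients contribute nothing, so arguments with different supports can be summed
  over a common finite index set; this is what additivity of \<open>dsum\<close> rests on.\<close>

lemma dsum_superset:
  assumes "abelian_group N" "f \<in> carrier (free_module R X)"
    and "\<And>x. x \<in> X \<Longrightarrow> \<psi> x \<in> add_map R N"
    and "finite Z" "{x. f x \<noteq> \<zero>} \<subseteq> Z" "Z \<subseteq> X"
  shows "dsum R N \<psi> f = finsum N (\<lambda>x. \<psi> x (f x)) Z"
proof -
  interpret N: abelian_group N by fact
  have "\<psi> x \<zero> = \<zero>\<^bsub>N\<^esub>" if "x \<in> X" for x
    using add_map_zero assms(1,3) that is_abelian_group by blast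
  moreover have "\<psi> x (f x) \<in> carrier N" if "x \<in> X" for x
    using assms(2) add_map_closed[OF assms(3)[OF that]] by (simp add: free_module_carrier)
  ultimately show ?thesis
    unfolding dsum_def using assms
    by (intro N.add.finprod_mono_neutral_cong_left) auto
qed

lemma dsum_add_map:
  assumes "abelian_group N" "\<And>x. x \<in> X \<Longrightarrow> \<psi> x \<in> add_map R N"
  shows "dsum R N \<psi> \<in> add_map (free_module R X) N"
proof (rule add_mapI)
  interpret N: abelian_group N by fact
  have cl: "\<psi> x a \<in> carrier N" if "x \<in> X" "a \<in> carrier R" for x a
    using add_map_closed[OF assms(2)] that by blast
  fix f assume f: "f \<in> carrier (free_module R X)"
  then show "dsum R N \<psi> f \<in> carrier N"
    unfolding dsum_def using cl
    by (intro N.finsum_closed) (auto simp: free_module_carrier)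
  fix g assume g: "g \<in> carrier (free_module R X)"
  let ?Z = "{x. f x \<noteq> \<zero>} \<union> {x. g x \<noteq> \<zero>}"
  have fg: "f \<oplus>\<^bsub>free_module R X\<^esub> g \<in> carrier (free_module R X)"
    using f g abelian_groupE(1)[OF free_module_group] by blast
  have Z: "finite ?Z" "?Z \<subseteq> X" using f g by (auto simp: free_module_carrier)
  have "dsum R N \<psi> (f \<oplus>\<^bsub>free_module R X\<^esub> g) = finsum N (\<lambda>x. \<psi> x (f x \<oplus> g x)) ?Z"
    using dsum_superset[OF assms(1) fg assms(2) Z(1) _ Z(2)] f g
    by (fastforce simp: free_module_carrier)
  also have "\<dots> = finsum N (\<lambda>x. \<psi> x (f x) \<oplus>\<^bsub>N\<^esub> \<psi> x (g x)) ?Z"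
    using f g Z cl add_map_add[OF assms(2)]
    by (intro N.finsum_cong') (auto simp: free_module_carrier subset_iff)
  also have "\<dots> = finsum N (\<lambda>x. \<psi> x (f x)) ?Z \<oplus>\<^bsub>N\<^esub> finsum N (\<lambda>x. \<psi> x (g x)) ?Z"
    using f g Z cl
    by (intro N.finsum_addf) (auto simp: free_module_carrier subset_iff)
  also have "\<dots> = dsum R N \<psi> f \<oplus>\<^bsub>N\<^esub> dsum R N \<psi> g"
    using dsum_superset[OF assms(1) f assms(2) Z(1) _ Z(2)]
      dsum_superset[OF assms(1) g assms(2) Z(1) _ Z(2)] by simp
  finally show "dsum R N \<psi> (f \<oplus>\<^bsub>free_module R X\<^esub> g) = dsum R N \<psi> f \<oplus>\<^bsub>N\<^esub> dsum R N \<psi> g" .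
qed

lemma dsum_single:
  assumes "abelian_group N" "\<And>x. x \<in> X \<Longrightarrow> \<psi> x \<in> add_map R N" "x \<in> X" "a \<in> carrier R"
  shows "dsum R N \<psi> (single R x a) = \<psi> x a"
proof -
  interpret N: abelian_group N by fact
  have "dsum R N \<psi> (single R x a) = finsum N (\<lambda>y. \<psi> y (single R x a y)) {x}"
    by (rule dsum_superset[OF assms(1) single_closed[OF assms(3,4)]])
       (use assms(2,3) in \<open>auto simp: single_def split: if_splits\<close>)
  also have "\<dots> = \<psi> x a"
    using assms add_map_closed[of "\<psi> x" R N a] by (simp add: single_def)
  finally show ?thesis .
qed

lemma dsum_lin_hom:
  assumes "module R N" "\<And>x. x \<in> X \<Longrightarrow> \<psi> x \<in> add_map R N"
    and "\<And>x k a. x \<in> X \<Longrightarrow> k \<in> carrier R \<Longrightarrow> a \<in> carrier R \<Longrightarrow> \<psi> x (k \<otimes> a) = k \<odot>\<^bsub>N\<^esub> \<psi> x a"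
  shows "dsum R N \<psi> \<in> lin_hom R (free_module R X) N"
proof (rule lin_homI)
  interpret N: module R N by fact
  interpret F: module R "free_module R X" by (rule free_module_module)
  have N: "abelian_group N" ..
  have F: "abelian_group (free_module R X)" ..
  have D: "dsum R N \<psi> \<in> add_map (free_module R X) N"
    by (rule dsum_add_map[OF N]) (rule assms(2))
  have Ds: "dsum R N \<psi> (single R x a) = \<psi> x a" if "x \<in> X" "a \<in> carrier R" for x a
    by (rule dsum_single[OF N _ that]) (rule assms(2))
  show "dsum R N \<psi> x \<in> carrier N" if "x \<in> carrier (free_module R X)" for x
    by (rule add_map_closed[OF D that])
  show "dsum R N \<psi> (x \<oplus>\<^bsub>free_module R X\<^esub> y) = dsum R N \<psi> x \<oplus>\<^bsub>N\<^esub> dsum R N \<psi> y"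
    if "x \<in> carrier (free_module R X)" "y \<in> carrier (free_module R X)" for x y
    by (rule add_map_add[OF D that])
  fix k f assume k: "k \<in> carrier R" and f: "f \<in> carrier (free_module R X)"
  show "dsum R N \<psi> (k \<odot>\<^bsub>free_module R X\<^esub> f) = k \<odot>\<^bsub>N\<^esub> dsum R N \<psi> f"
  proof (rule add_map_eq_on_span[OF _ _ F N singles_closed _ free_module_span[OF f],
        of "\<lambda>f. dsum R N \<psi> (k \<odot>\<^bsub>free_module R X\<^esub> f)"])
    have "(\<lambda>f. k \<odot>\<^bsub>free_module R X\<^esub> f) \<in> add_map (free_module R X) (free_module R X)"
      by (rule add_mapI) (use k in \<open>simp_all del: free_module_simps add: F.smult_r_distr\<close>)
    then show "(\<lambda>f. dsum R N \<psi> (k \<odot>\<^bsub>free_module R X\<^esub> f)) \<in> add_map (free_module R X) N"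
      using D by (rule add_map_comp)
    have "(\<lambda>f. k \<odot>\<^bsub>N\<^esub> f) \<in> add_map N N"
      by (rule add_mapI) (use k N.smult_r_distr in auto)
    then show "(\<lambda>f. k \<odot>\<^bsub>N\<^esub> dsum R N \<psi> f) \<in> add_map (free_module R X) N"
      by (rule add_map_comp[OF D])
    fix g assume "g \<in> {single R x a |x a. x \<in> X \<and> a \<in> carrier R}"
    then obtain x a where g: "g = single R x a" "x \<in> X" "a \<in> carrier R" by blast
    then show "dsum R N \<psi> (k \<odot>\<^bsub>free_module R X\<^esub> g) = k \<odot>\<^bsub>N\<^esub> dsum R N \<psi> g"
      unfolding g(1) single_smult[OF k]
      using k assms(3) by (simp add: Ds)
  qed
qed

end

section \<open>Associative algebras\<close>

lemma alg_homI:
  assumes "h \<in> lin_hom K A B"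
    and "\<And>x y. x \<in> carrier A \<Longrightarrow> y \<in> carrier A \<Longrightarrow> h (x \<otimes>\<^bsub>A\<^esub> y) = h x \<otimes>\<^bsub>B\<^esub> h y"
    and "h \<one>\<^bsub>A\<^esub> = \<one>\<^bsub>B\<^esub>"
  shows "h \<in> alg_hom K A B"
  using assms by (auto simp: alg_hom_def ring_hom_def lin_hom_def)

lemma alg_homD:
  assumes "h \<in> alg_hom K A B"
  shows "h \<in> lin_hom K A B" "h \<in> ring_hom A B"
  using assms by (auto simp: alg_hom_def)

lemma alg_hom_closed: "h \<in> alg_hom K A B \<Longrightarrow> x \<in> carrier A \<Longrightarrow> h x \<in> carrier B"
  by (auto simp: alg_hom_def lin_hom_def)

lemma alg_hom_mult:
  "h \<in> alg_hom K A B \<Longrightarrow> x \<in> carrier A \<Longrightarrow> y \<in> carrier A \<Longrightarrow> h (x \<otimes>\<^bsub>A\<^esub> y) = h x \<otimes>\<^bsub>B\<^esub> h y"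
  by (auto simp: alg_hom_def ring_hom_def)

lemma alg_hom_one: "h \<in> alg_hom K A B \<Longrightarrow> h \<one>\<^bsub>A\<^esub> = \<one>\<^bsub>B\<^esub>"
  by (auto simp: alg_hom_def ring_hom_def)

lemma alg_hom_smult:
  "h \<in> alg_hom K A B \<Longrightarrow> k \<in> carrier K \<Longrightarrow> x \<in> carrier A \<Longrightarrow> h (k \<odot>\<^bsub>A\<^esub> x) = k \<odot>\<^bsub>B\<^esub> h x"
  by (auto simp: alg_hom_def lin_hom_def)

lemma alg_hom_add_map: "h \<in> alg_hom K A B \<Longrightarrow> h \<in> add_map A B"
  by (auto simp: alg_hom_def intro: lin_hom_add_map)

lemma alg_hom_comp: "h \<in> alg_hom K A B \<Longrightarrow> k \<in> alg_hom K B C \<Longrightarrow> (\<lambda>x. k (h x)) \<in> alg_hom K A C"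
  by (auto simp: alg_hom_def lin_hom_def ring_hom_def Pi_def)

lemma list_prod_simps [simp]:
  "list_prod U [] = \<one>\<^bsub>U\<^esub>"
  "list_prod U (x # xs) = x \<otimes>\<^bsub>U\<^esub> list_prod U xs"
  by (simp_all add: list_prod_def)

context ring
begin

lemma list_prod_closed: "set xs \<subseteq> carrier R \<Longrightarrow> list_prod R xs \<in> carrier R"
  by (induction xs) auto

lemma list_prod_append:
  "set xs \<subseteq> carrier R \<Longrightarrow> set ys \<subseteq> carrier R \<Longrightarrow>
    list_prod R (xs @ ys) = list_prod R xs \<otimes> list_prod R ys"
  by (induction xs) (auto simp: list_prod_closed m_assoc)

end

lemma alg_hom_list_prod:
  assumes "h \<in> alg_hom K A B" "ring A" "set xs \<subseteq> carrier A"
  shows "h (list_prod A xs) = list_prod B (map h xs)"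
  using assms(3)
  by (induction xs) (auto simp: alg_hom_mult[OF assms(1)] alg_hom_one[OF assms(1)] ring.list_prod_closed[OF assms(2)])

lemma assoc_algebraI:
  assumes "module K S" "ring S"
    and "\<And>r x y. r \<in> carrier K \<Longrightarrow> x \<in> carrier S \<Longrightarrow> y \<in> carrier S \<Longrightarrow>
      (r \<odot>\<^bsub>S\<^esub> x) \<otimes>\<^bsub>S\<^esub> y = r \<odot>\<^bsub>S\<^esub> (x \<otimes>\<^bsub>S\<^esub> y)"
    and "\<And>r x y. r \<in> carrier K \<Longrightarrow> x \<in> carrier S \<Longrightarrow> y \<in> carrier S \<Longrightarrow>
      x \<otimes>\<^bsub>S\<^esub> (r \<odot>\<^bsub>S\<^esub> y) = r \<odot>\<^bsub>S\<^esub> (x \<otimes>\<^bsub>S\<^esub> y)"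
  shows "assoc_algebra K S"
  using assms by (intro assoc_algebra.intro assoc_algebra_axioms.intro)

lemma algebra_assoc_algebra:
  assumes "algebra K A"
  shows "assoc_algebra K A"
proof -
  interpret algebra K A by fact
  show ?thesis
  proof (rule assoc_algebraI)
    show "module K A" "ring A" by unfold_locales
    fix r x y assume "r \<in> carrier K" "x \<in> carrier A" "y \<in> carrier A"
    then show "(r \<odot>\<^bsub>A\<^esub> x) \<otimes>\<^bsub>A\<^esub> y = r \<odot>\<^bsub>A\<^esub> (x \<otimes>\<^bsub>A\<^esub> y)" "x \<otimes>\<^bsub>A\<^esub> (r \<odot>\<^bsub>A\<^esub> y) = r \<odot>\<^bsub>A\<^esub> (x \<otimes>\<^bsub>A\<^esub> y)"
      using smult_assoc2[of r x y] smult_assoc2[of r y x] by (simp_all add: m_comm)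
  qed
qed

text \<open>Both sides of every identity are additive in each argument separately, so the arguments
  can be freed from \<open>G\<close> to \<open>carrier S\<close> one at a time, as in
  \<open>assoc1\<close> to \<open>assoc3\<close>. Closure and distributivity are demanded on all of
  \<open>carrier S\<close> because they make the multiplications additive maps in the first
  place.\<close>

lemma assoc_algebra_by_span:
  assumes "module K S" and G: "G \<subseteq> carrier S" "carrier S = add_span S G"
    and closed: "\<And>x y. x \<in> carrier S \<Longrightarrow> y \<in> carrier S \<Longrightarrow> x \<otimes>\<^bsub>S\<^esub> y \<in> carrier S"
    and one: "\<one>\<^bsub>S\<^esub> \<in> carrier S"
    and ld: "\<And>x y z. x \<in> carrier S \<Longrightarrow> y \<in> carrier S \<Longrightarrow> z \<in> carrier S \<Longrightarrow>
      (x \<oplus>\<^bsub>S\<^esub> y) \<otimes>\<^bsub>S\<^esub> z = x \<otimes>\<^bsub>S\<^esub> z \<oplus>\<^bsub>S\<^esub> y \<otimes>\<^bsub>S\<^esub> z"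
    and rd: "\<And>x y z. x \<in> carrier S \<Longrightarrow> y \<in> carrier S \<Longrightarrow> z \<in> carrier S \<Longrightarrow>
      z \<otimes>\<^bsub>S\<^esub> (x \<oplus>\<^bsub>S\<^esub> y) = z \<otimes>\<^bsub>S\<^esub> x \<oplus>\<^bsub>S\<^esub> z \<otimes>\<^bsub>S\<^esub> y"
    and assc: "\<And>x y z. x \<in> G \<Longrightarrow> y \<in> G \<Longrightarrow> z \<in> G \<Longrightarrow> (x \<otimes>\<^bsub>S\<^esub> y) \<otimes>\<^bsub>S\<^esub> z = x \<otimes>\<^bsub>S\<^esub> (y \<otimes>\<^bsub>S\<^esub> z)"
    and lone: "\<And>x. x \<in> G \<Longrightarrow> \<one>\<^bsub>S\<^esub> \<otimes>\<^bsub>S\<^esub> x = x"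
    and rone: "\<And>x. x \<in> G \<Longrightarrow> x \<otimes>\<^bsub>S\<^esub> \<one>\<^bsub>S\<^esub> = x"
    and smult_l: "\<And>r x y. r \<in> carrier K \<Longrightarrow> x \<in> G \<Longrightarrow> y \<in> G \<Longrightarrow>
      (r \<odot>\<^bsub>S\<^esub> x) \<otimes>\<^bsub>S\<^esub> y = r \<odot>\<^bsub>S\<^esub> (x \<otimes>\<^bsub>S\<^esub> y)"
    and smult_r: "\<And>r x y. r \<in> carrier K \<Longrightarrow> x \<in> G \<Longrightarrow> y \<in> G \<Longrightarrow>
      x \<otimes>\<^bsub>S\<^esub> (r \<odot>\<^bsub>S\<^esub> y) = r \<odot>\<^bsub>S\<^esub> (x \<otimes>\<^bsub>S\<^esub> y)"
  shows "assoc_algebra K S"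
proof -
  interpret module K S by fact
  have S: "abelian_group S" ..
  have ml: "(\<lambda>x. x \<otimes>\<^bsub>S\<^esub> y) \<in> add_map S S" if "y \<in> carrier S" for y
    using that by (intro add_mapI closed ld)
  have mr: "(\<lambda>x. y \<otimes>\<^bsub>S\<^esub> x) \<in> add_map S S" if "y \<in> carrier S" for y
    using that by (intro add_mapI closed rd)
  have sm: "(\<lambda>x. r \<odot>\<^bsub>S\<^esub> x) \<in> add_map S S" if "r \<in> carrier K" for r
    using that by (intro add_mapI smult_closed smult_r_distr)
  have ident: "(\<lambda>x. x) \<in> add_map S S"
    by (rule add_mapI) auto
  note ext = add_map_eq_on_span[OF _ _ S S G(1)]
  have sub: "x \<in> carrier S" if "x \<in> G" for x using G(1) that by blast
  have assoc1: "(x \<otimes>\<^bsub>S\<^esub> y) \<otimes>\<^bsub>S\<^esub> z = x \<otimes>\<^bsub>S\<^esub> (y \<otimes>\<^bsub>S\<^esub> z)" if "x \<in> carrier S" "y \<in> G" "z \<in> G" for x y z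
    by (rule ext[of "\<lambda>x. (x \<otimes>\<^bsub>S\<^esub> y) \<otimes>\<^bsub>S\<^esub> z" "\<lambda>x. x \<otimes>\<^bsub>S\<^esub> (y \<otimes>\<^bsub>S\<^esub> z)" x])
       (use that ml sub assc closed G(2) add_map_comp[OF ml ml] in auto)
  have assoc2: "(x \<otimes>\<^bsub>S\<^esub> y) \<otimes>\<^bsub>S\<^esub> z = x \<otimes>\<^bsub>S\<^esub> (y \<otimes>\<^bsub>S\<^esub> z)" if "x \<in> carrier S" "y \<in> carrier S" "z \<in> G" for x y z
    by (rule ext[of "\<lambda>y. (x \<otimes>\<^bsub>S\<^esub> y) \<otimes>\<^bsub>S\<^esub> z" "\<lambda>y. x \<otimes>\<^bsub>S\<^esub> (y \<otimes>\<^bsub>S\<^esub> z)" y])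
       (use that sub assoc1 G(2) add_map_comp[OF mr ml] add_map_comp[OF ml mr] in auto)
  have assoc3: "(x \<otimes>\<^bsub>S\<^esub> y) \<otimes>\<^bsub>S\<^esub> z = x \<otimes>\<^bsub>S\<^esub> (y \<otimes>\<^bsub>S\<^esub> z)" if "x \<in> carrier S" "y \<in> carrier S" "z \<in> carrier S" for x y z
    by (rule ext[of "\<lambda>z. (x \<otimes>\<^bsub>S\<^esub> y) \<otimes>\<^bsub>S\<^esub> z" "\<lambda>z. x \<otimes>\<^bsub>S\<^esub> (y \<otimes>\<^bsub>S\<^esub> z)" z])
       (use that sub assoc2 G(2) closed mr add_map_comp[OF mr mr] in auto)
  have "\<one>\<^bsub>S\<^esub> \<otimes>\<^bsub>S\<^esub> x = x" if "x \<in> carrier S" for x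
    by (rule ext[of "\<lambda>x. \<one>\<^bsub>S\<^esub> \<otimes>\<^bsub>S\<^esub> x" "\<lambda>x. x" x]) (use that G(2) mr[OF one] ident lone in auto)
  moreover have "x \<otimes>\<^bsub>S\<^esub> \<one>\<^bsub>S\<^esub> = x" if "x \<in> carrier S" for x
    by (rule ext[of "\<lambda>x. x \<otimes>\<^bsub>S\<^esub> \<one>\<^bsub>S\<^esub>" "\<lambda>x. x" x]) (use that G(2) ml[OF one] ident rone in auto)
  ultimately have "ring S"
    using assoc3 closed one ld rd S by (intro ringI monoidI) auto
  have sl1: "(r \<odot>\<^bsub>S\<^esub> x) \<otimes>\<^bsub>S\<^esub> y = r \<odot>\<^bsub>S\<^esub> (x \<otimes>\<^bsub>S\<^esub> y)" if "r \<in> carrier K" "x \<in> carrier S" "y \<in> G" for r x y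
    by (rule ext[of "\<lambda>x. (r \<odot>\<^bsub>S\<^esub> x) \<otimes>\<^bsub>S\<^esub> y" "\<lambda>x. r \<odot>\<^bsub>S\<^esub> (x \<otimes>\<^bsub>S\<^esub> y)" x])
       (use that sub smult_l G(2) add_map_comp[OF sm ml] add_map_comp[OF ml sm] in auto)
  have sl2: "(r \<odot>\<^bsub>S\<^esub> x) \<otimes>\<^bsub>S\<^esub> y = r \<odot>\<^bsub>S\<^esub> (x \<otimes>\<^bsub>S\<^esub> y)" if "r \<in> carrier K" "x \<in> carrier S" "y \<in> carrier S" for r x y
    by (rule ext[of "\<lambda>y. (r \<odot>\<^bsub>S\<^esub> x) \<otimes>\<^bsub>S\<^esub> y" "\<lambda>y. r \<odot>\<^bsub>S\<^esub> (x \<otimes>\<^bsub>S\<^esub> y)" y])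
       (use that sub sl1 G(2) mr[OF smult_closed[OF that(1,2)]] add_map_comp[OF mr sm] in auto)
  have sr1: "x \<otimes>\<^bsub>S\<^esub> (r \<odot>\<^bsub>S\<^esub> y) = r \<odot>\<^bsub>S\<^esub> (x \<otimes>\<^bsub>S\<^esub> y)" if "r \<in> carrier K" "x \<in> carrier S" "y \<in> G" for r x y
    by (rule ext[of "\<lambda>x. x \<otimes>\<^bsub>S\<^esub> (r \<odot>\<^bsub>S\<^esub> y)" "\<lambda>x. r \<odot>\<^bsub>S\<^esub> (x \<otimes>\<^bsub>S\<^esub> y)" x])
       (use that sub smult_r G(2) ml[OF smult_closed[OF that(1) sub[OF that(3)]]] add_map_comp[OF ml sm] in auto)
  have sr2: "x \<otimes>\<^bsub>S\<^esub> (r \<odot>\<^bsub>S\<^esub> y) = r \<odot>\<^bsub>S\<^esub> (x \<otimes>\<^bsub>S\<^esub> y)" if "r \<in> carrier K" "x \<in> carrier S" "y \<in> carrier S" for r x y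
    by (rule ext[of "\<lambda>y. x \<otimes>\<^bsub>S\<^esub> (r \<odot>\<^bsub>S\<^esub> y)" "\<lambda>y. r \<odot>\<^bsub>S\<^esub> (x \<otimes>\<^bsub>S\<^esub> y)" y])
       (use that sub sr1 G(2) add_map_comp[OF sm mr] add_map_comp[OF mr sm] in auto)
  show ?thesis
    using \<open>ring S\<close> sl2 sr2 by (intro assoc_algebraI assms(1)) auto
qed

lemma alg_hom_by_span:
  assumes "h \<in> lin_hom K S T" "ring S" "ring T" "G \<subseteq> carrier S" "carrier S = add_span S G"
    and "\<And>x y. x \<in> G \<Longrightarrow> y \<in> G \<Longrightarrow> h (x \<otimes>\<^bsub>S\<^esub> y) = h x \<otimes>\<^bsub>T\<^esub> h y"
    and "h \<one>\<^bsub>S\<^esub> = \<one>\<^bsub>T\<^esub>"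
  shows "h \<in> alg_hom K S T"
proof -
  interpret S: ring S by fact
  interpret T: ring T by fact
  note h = lin_hom_add_map[OF assms(1)]
  have S: "abelian_group S" and T: "abelian_group T" by unfold_locales
  have sub: "x \<in> carrier S" if "x \<in> G" for x using assms(4) that by blast
  have hc: "h x \<in> carrier T" if "x \<in> carrier S" for x using add_map_closed[OF h that] .
  note ext = add_map_eq_on_span[OF _ _ S T assms(4)]
  have ml: "(\<lambda>x. x \<otimes>\<^bsub>S\<^esub> y) \<in> add_map S S" if "y \<in> carrier S" for y
    using that by (intro add_mapI S.m_closed S.l_distr)
  have mr: "(\<lambda>x. y \<otimes>\<^bsub>S\<^esub> x) \<in> add_map S S" if "y \<in> carrier S" for y
    using that by (intro add_mapI S.m_closed S.r_distr)
  have ml': "(\<lambda>x. x \<otimes>\<^bsub>T\<^esub> y) \<in> add_map T T" if "y \<in> carrier T" for y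
    using that by (intro add_mapI T.m_closed T.l_distr)
  have mr': "(\<lambda>x. y \<otimes>\<^bsub>T\<^esub> x) \<in> add_map T T" if "y \<in> carrier T" for y
    using that by (intro add_mapI T.m_closed T.r_distr)
  have 1: "h (x \<otimes>\<^bsub>S\<^esub> y) = h x \<otimes>\<^bsub>T\<^esub> h y" if "x \<in> carrier S" "y \<in> G" for x y
    by (rule ext[of "\<lambda>x. h (x \<otimes>\<^bsub>S\<^esub> y)" "\<lambda>x. h x \<otimes>\<^bsub>T\<^esub> h y" x])
       (use that sub hc assms(5,6) add_map_comp[OF ml h] add_map_comp[OF h ml'] in auto)
  have 2: "h (x \<otimes>\<^bsub>S\<^esub> y) = h x \<otimes>\<^bsub>T\<^esub> h y" if "x \<in> carrier S" "y \<in> carrier S" for x y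
    by (rule ext[of "\<lambda>y. h (x \<otimes>\<^bsub>S\<^esub> y)" "\<lambda>y. h x \<otimes>\<^bsub>T\<^esub> h y" y])
       (use that sub hc 1 assms(5) add_map_comp[OF mr h] add_map_comp[OF h mr'] in auto)
  show ?thesis
    using assms(1,7) 2 by (intro alg_homI)
qed

section \<open>Quotients\<close>

lemma submodule_additive_subgroup: "submodule N K M \<Longrightarrow> additive_subgroup N M"
  by (simp add: additive_subgroupI submodule.axioms(1))

lemma additive_subgroup_abelian_subgroup:
  "additive_subgroup N M \<Longrightarrow> abelian_group M \<Longrightarrow> abelian_subgroup N M"
  by (rule abelian_subgroupI3)

lemma additive_subgroup_mem:
  assumes "additive_subgroup N M" "abelian_group M"
  shows "\<zero>\<^bsub>M\<^esub> \<in> N"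
    and "x \<in> N \<Longrightarrow> y \<in> N \<Longrightarrow> x \<oplus>\<^bsub>M\<^esub> y \<in> N"
    and "x \<in> N \<Longrightarrow> \<ominus>\<^bsub>M\<^esub> x \<in> N"
    and "x \<in> N \<Longrightarrow> y \<in> N \<Longrightarrow> x \<ominus>\<^bsub>M\<^esub> y \<in> N"
    and "x \<in> N \<Longrightarrow> x \<in> carrier M"
proof -
  interpret abelian_subgroup N M
    using assms by (rule additive_subgroup_abelian_subgroup)
  show "\<zero>\<^bsub>M\<^esub> \<in> N" "x \<in> N \<Longrightarrow> y \<in> N \<Longrightarrow> x \<oplus>\<^bsub>M\<^esub> y \<in> N" "x \<in> N \<Longrightarrow> x \<in> carrier M"
    by auto
  have n: "x \<in> N \<Longrightarrow> \<ominus>\<^bsub>M\<^esub> x \<in> N" for x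
    using subgroup.m_inv_closed[OF a_subgroup] by (simp add: a_inv_def)
  then show "x \<in> N \<Longrightarrow> \<ominus>\<^bsub>M\<^esub> x \<in> N" .
  show "x \<in> N \<Longrightarrow> y \<in> N \<Longrightarrow> x \<ominus>\<^bsub>M\<^esub> y \<in> N"
    unfolding a_minus_def using n by auto
qed

lemma coset_eq_iff:
  assumes "additive_subgroup N M" "abelian_group M" "x \<in> carrier M" "y \<in> carrier M"
  shows "N +>\<^bsub>M\<^esub> x = N +>\<^bsub>M\<^esub> y \<longleftrightarrow> x \<ominus>\<^bsub>M\<^esub> y \<in> N"
proof -
  interpret abelian_subgroup N M
    using assms(1,2) by (rule additive_subgroup_abelian_subgroup)
  have "x \<in> N +>\<^bsub>M\<^esub> y \<longleftrightarrow> x \<ominus>\<^bsub>M\<^esub> y \<in> N"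
    unfolding a_minus_def using assms by (intro a_rcos_module) auto
  then show ?thesis
    using a_repr_independence'[of x y] a_rcos_self[of x] assms by auto
qed

lemma coset_eq_self_iff:
  assumes "additive_subgroup N M" "abelian_group M" "x \<in> carrier M"
  shows "N +>\<^bsub>M\<^esub> x = N \<longleftrightarrow> x \<in> N"
proof -
  interpret abelian_subgroup N M
    using assms(1,2) by (rule additive_subgroup_abelian_subgroup)
  show ?thesis
    using a_rcos_const[of x] a_rcos_self[of x] assms by auto
qed

lemma mem_coset_iff:
  assumes "additive_subgroup N M" "abelian_group M" "x \<in> carrier M"
  shows "y \<in> N +>\<^bsub>M\<^esub> x \<longleftrightarrow> y \<in> carrier M \<and> y \<ominus>\<^bsub>M\<^esub> x \<in> N"
proof -
  interpret abelian_subgroup N M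
    using assms(1,2) by (rule additive_subgroup_abelian_subgroup)
  show ?thesis
    using a_rcos_module[OF assms(3), of y] a_elemrcos_carrier[OF assms(3), of y]
    by (auto simp: a_minus_def)
qed

lemma quot_module_carrier: "carrier (quot_module M N) = (\<lambda>x. N +>\<^bsub>M\<^esub> x) ` carrier M"
  by (auto simp: quot_module_def FactRing_def A_RCOSETS_def RCOSETS_def a_r_coset_def)

lemma quot_module_zero [simp]: "\<zero>\<^bsub>quot_module M N\<^esub> = N"
  by (simp add: quot_module_def FactRing_def)

lemma quot_module_one [simp]: "\<one>\<^bsub>quot_module M N\<^esub> = N +>\<^bsub>M\<^esub> \<one>\<^bsub>M\<^esub>"
  by (simp add: quot_module_def FactRing_def)

lemma quot_module_add:
  assumes "additive_subgroup N M" "abelian_group M" "x \<in> carrier M" "y \<in> carrier M"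
  shows "(N +>\<^bsub>M\<^esub> x) \<oplus>\<^bsub>quot_module M N\<^esub> (N +>\<^bsub>M\<^esub> y) = N +>\<^bsub>M\<^esub> (x \<oplus>\<^bsub>M\<^esub> y)"
proof -
  interpret abelian_subgroup N M
    using assms(1,2) by (rule additive_subgroup_abelian_subgroup)
  show ?thesis
    using a_rcos_sum assms by (simp add: quot_module_def FactRing_def)
qed

lemma quot_module_mult:
  assumes "ideal N M" "x \<in> carrier M" "y \<in> carrier M"
  shows "(N +>\<^bsub>M\<^esub> x) \<otimes>\<^bsub>quot_module M N\<^esub> (N +>\<^bsub>M\<^esub> y) = N +>\<^bsub>M\<^esub> (x \<otimes>\<^bsub>M\<^esub> y)"
  using ideal.rcoset_mult_add[OF assms] by (simp add: quot_module_def FactRing_def)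

lemma quot_module_smult:
  assumes "submodule N K M" "module K M" "k \<in> carrier K" "x \<in> carrier M"
  shows "k \<odot>\<^bsub>quot_module M N\<^esub> (N +>\<^bsub>M\<^esub> x) = N +>\<^bsub>M\<^esub> (k \<odot>\<^bsub>M\<^esub> x)"
proof -
  interpret module K M by fact
  have N: "additive_subgroup N M" and M: "abelian_group M"
    using submodule_additive_subgroup[OF assms(1)] by (auto intro: M.abelian_group_axioms)
  interpret N: abelian_subgroup N M
    using N M by (rule additive_subgroup_abelian_subgroup)
  have "N +>\<^bsub>M\<^esub> (k \<odot>\<^bsub>M\<^esub> y) = N +>\<^bsub>M\<^esub> (k \<odot>\<^bsub>M\<^esub> x)" if "y \<in> N +>\<^bsub>M\<^esub> x" for y
  proof -
    have y: "y \<in> carrier M" "y \<ominus>\<^bsub>M\<^esub> x \<in> N"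
      using that mem_coset_iff[OF N M assms(4)] by auto
    have "k \<odot>\<^bsub>M\<^esub> y \<ominus>\<^bsub>M\<^esub> k \<odot>\<^bsub>M\<^esub> x = k \<odot>\<^bsub>M\<^esub> (y \<ominus>\<^bsub>M\<^esub> x)"
      using y(1) assms(3,4) by (simp add: a_minus_def smult_r_distr smult_r_minus)
    then have "k \<odot>\<^bsub>M\<^esub> y \<ominus>\<^bsub>M\<^esub> k \<odot>\<^bsub>M\<^esub> x \<in> N"
      using submodule.smult_closed[OF assms(1,3) y(2)] by simp
    then show ?thesis
      using coset_eq_iff[OF N M] y(1) assms(3,4) by simp
  qed
  then have "(\<Union>y\<in>N +>\<^bsub>M\<^esub> x. N +>\<^bsub>M\<^esub> (k \<odot>\<^bsub>M\<^esub> y)) = N +>\<^bsub>M\<^esub> (k \<odot>\<^bsub>M\<^esub> x)"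
    using N.a_rcos_self[OF assms(4)] by blast
  then show ?thesis
    by (simp add: quot_module_def)
qed

lemma quot_module_group:
  assumes "additive_subgroup N M" "abelian_group M"
  shows "abelian_group (quot_module M N)"
proof -
  interpret M: abelian_group M by fact
  interpret N: additive_subgroup N M by fact
  have z: "N = N +>\<^bsub>M\<^esub> \<zero>\<^bsub>M\<^esub>"
    using coset_eq_self_iff[OF assms, of "\<zero>\<^bsub>M\<^esub>"] by simp
  show ?thesis
  proof (rule abelian_groupI)
    fix X assume "X \<in> carrier (quot_module M N)"
    then obtain x where x: "x \<in> carrier M" "X = N +>\<^bsub>M\<^esub> x"
      by (auto simp: quot_module_carrier)
    have "\<zero>\<^bsub>quot_module M N\<^esub> \<oplus>\<^bsub>quot_module M N\<^esub> X = X"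
      using quot_module_add[OF assms, of "\<zero>\<^bsub>M\<^esub>" x] x z by simp
    then show "\<zero>\<^bsub>quot_module M N\<^esub> \<oplus>\<^bsub>quot_module M N\<^esub> X = X" .
    have "(N +>\<^bsub>M\<^esub> (\<ominus>\<^bsub>M\<^esub> x)) \<oplus>\<^bsub>quot_module M N\<^esub> X = \<zero>\<^bsub>quot_module M N\<^esub>"
      using quot_module_add[OF assms, of "\<ominus>\<^bsub>M\<^esub> x" x] x z by (simp add: M.l_neg)
    then show "\<exists>Y\<in>carrier (quot_module M N). Y \<oplus>\<^bsub>quot_module M N\<^esub> X = \<zero>\<^bsub>quot_module M N\<^esub>"
      using x by (auto simp: quot_module_carrier)
  next
    show "\<zero>\<^bsub>quot_module M N\<^esub> \<in> carrier (quot_module M N)"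
      using z M.zero_closed by (subst quot_module_zero) (auto simp: quot_module_carrier)
  qed (auto simp: quot_module_carrier quot_module_add[OF assms] M.a_ac)
qed

lemma quot_module_module:
  assumes "submodule N K M" "module K M"
  shows "module K (quot_module M N)"
proof -
  interpret module K M by fact
  have N: "additive_subgroup N M" and M: "abelian_group M"
    using submodule_additive_subgroup[OF assms(1)] by (auto intro: M.abelian_group_axioms)
  show ?thesis
    by (rule moduleI[OF is_cring quot_module_group[OF N M]])
       (auto simp: quot_module_carrier quot_module_smult[OF assms] quot_module_add[OF N M]
          smult_l_distr smult_r_distr smult_assoc1)
qed

lemma coset_add_map:
  assumes "additive_subgroup N M" "abelian_group M"
  shows "(\<lambda>x. N +>\<^bsub>M\<^esub> x) \<in> add_map M (quot_module M N)"
  using quot_module_add[OF assms] by (auto intro!: add_mapI simp: quot_module_carrier)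

lemma coset_lin_hom:
  assumes "submodule N K M" "module K M"
  shows "(\<lambda>x. N +>\<^bsub>M\<^esub> x) \<in> lin_hom K M (quot_module M N)"
proof -
  have N: "additive_subgroup N M" and M: "abelian_group M"
    using submodule_additive_subgroup[OF assms(1)] assms(2) by (auto simp: module_def)
  show ?thesis
    using quot_module_add[OF N M] quot_module_smult[OF assms]
    by (auto intro!: lin_homI simp: quot_module_carrier)
qed

lemma quot_module_minus:
  assumes "additive_subgroup N M" "abelian_group M" "x \<in> carrier M" "y \<in> carrier M"
  shows "(N +>\<^bsub>M\<^esub> x) \<ominus>\<^bsub>quot_module M N\<^esub> (N +>\<^bsub>M\<^esub> y) = N +>\<^bsub>M\<^esub> (x \<ominus>\<^bsub>M\<^esub> y)"
  using add_map_minus[OF coset_add_map[OF assms(1,2)] assms(2) quot_module_group[OF assms(1,2)] assms(3,4)]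
  by simp

lemma quot_module_span:
  assumes "additive_subgroup N M" "abelian_group M" "G \<subseteq> carrier M" "carrier M = add_span M G"
    and "X \<in> carrier (quot_module M N)"
  shows "X \<in> add_span (quot_module M N) ((\<lambda>x. N +>\<^bsub>M\<^esub> x) ` G)"
proof -
  interpret Q: abelian_group "quot_module M N" by (rule quot_module_group[OF assms(1,2)])
  obtain x where x: "x \<in> add_span M G" "X = N +>\<^bsub>M\<^esub> x"
    using assms(4,5) by (auto simp: quot_module_carrier)
  have G: "(\<lambda>x. N +>\<^bsub>M\<^esub> x) ` G \<subseteq> carrier (quot_module M N)"
    using assms(3) by (auto simp: quot_module_carrier)
  show ?thesis
    unfolding x(2)
    by (rule add_map_add_span[OF coset_add_map[OF assms(1,2)] assms(2) Q.abelian_group_axioms assms(3) G _ x(1)])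
       (auto intro: Q.add_span_base[OF G])
qed

text \<open>Evaluation at an arbitrary representative. It is the induced map on the quotient as soon
  as \<open>h\<close> is additive and vanishes on the subgroup, see
  \<open>quot_lift_eq\<close>.\<close>

definition quot_lift :: "('a \<Rightarrow> 'b) \<Rightarrow> 'a set \<Rightarrow> 'b"
  where "quot_lift h X = h (SOME x. x \<in> X)"

lemma quot_lift_eq:
  assumes "additive_subgroup N M" "abelian_group M" "abelian_group P" "h \<in> add_map M P"
    and "\<And>x. x \<in> N \<Longrightarrow> h x = \<zero>\<^bsub>P\<^esub>" "x \<in> carrier M"
  shows "quot_lift h (N +>\<^bsub>M\<^esub> x) = h x"
proof -
  interpret M: abelian_group M by fact
  interpret P: abelian_group P by fact
  let ?y = "SOME y. y \<in> N +>\<^bsub>M\<^esub> x"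
  interpret N: abelian_subgroup N M
    using assms(1,2) by (rule additive_subgroup_abelian_subgroup)
  have "?y \<in> N +>\<^bsub>M\<^esub> x"
    using N.a_rcos_self[OF assms(6)] by (rule someI)
  then have y: "?y \<in> carrier M" "?y \<ominus>\<^bsub>M\<^esub> x \<in> N"
    using mem_coset_iff[OF assms(1,2,6)] by auto
  have "h ?y \<ominus>\<^bsub>P\<^esub> h x = \<zero>\<^bsub>P\<^esub>"
    using add_map_minus[OF assms(4,2,3) y(1) assms(6)] assms(5)[OF y(2)] by simp
  then have "h ?y = h x"
    using add_map_closed[OF assms(4)] y(1) assms(6) by (simp add: a_minus_def P.add.inv_solve_right' P.minus_equality)
  then show ?thesis by (simp add: quot_lift_def)
qed

lemma quot_lift_add_map:
  assumes "additive_subgroup N M" "abelian_group M" "abelian_group P" "h \<in> add_map M P"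
    and "\<And>x. x \<in> N \<Longrightarrow> h x = \<zero>\<^bsub>P\<^esub>"
  shows "quot_lift h \<in> add_map (quot_module M N) P"
proof -
  interpret M: abelian_group M by fact
  show ?thesis
    using quot_lift_eq[OF assms] add_map_closed[OF assms(4)] add_map_add[OF assms(4)]
    by (auto intro!: add_mapI simp: quot_module_carrier quot_module_add[OF assms(1,2)])
qed

lemma quot_lift_lin_hom:
  assumes "submodule N K M" "module K M" "module K P" "h \<in> lin_hom K M P"
    and "\<And>x. x \<in> N \<Longrightarrow> h x = \<zero>\<^bsub>P\<^esub>"
  shows "quot_lift h \<in> lin_hom K (quot_module M N) P"
proof -
  have N: "additive_subgroup N M" and M: "abelian_group M" and P: "abelian_group P"
    using submodule_additive_subgroup[OF assms(1)] assms(2,3) by (auto simp: module_def)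
  note h = lin_hom_add_map[OF assms(4)]
  interpret M: module K M by fact
  note L = quot_lift_add_map[OF N M P h assms(5)]
  show ?thesis
    using add_map_closed[OF L] add_map_add[OF L] quot_lift_eq[OF N M P h assms(5)] lin_hom_smult[OF assms(4)]
    by (auto intro!: lin_homI simp: quot_module_carrier quot_module_smult[OF assms(1,2)])
qed

text \<open>A scalar acts as multiplication by its multiple of the unit, so an ideal absorbs
  scalars.\<close>

lemma ideal_submodule:
  assumes "assoc_algebra K S" "ideal J S"
  shows "submodule J K S"
proof -
  interpret S: assoc_algebra K S by fact
  interpret J: ideal J S by fact
  show ?thesis
  proof (intro submodule.intro submodule_axioms.intro J.a_subgroup)
    fix k x assume k: "k \<in> carrier K" and x: "x \<in> J"
    have "k \<odot>\<^bsub>S\<^esub> x = (k \<odot>\<^bsub>S\<^esub> \<one>\<^bsub>S\<^esub>) \<otimes>\<^bsub>S\<^esub> x"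
      using k x S.smult_mult_left[of k "\<one>\<^bsub>S\<^esub>" x] by simp
    then show "k \<odot>\<^bsub>S\<^esub> x \<in> J"
      using k x J.I_l_closed by simp
  qed
qed

lemma quot_module_assoc_algebra:
  assumes "assoc_algebra K S" "ideal J S"
  shows "assoc_algebra K (quot_module S J)"
proof -
  interpret S: assoc_algebra K S by fact
  interpret J: ideal J S by fact
  note sub = ideal_submodule[OF assms]
  have J: "additive_subgroup J S" and S: "abelian_group S" and M: "module K S" by unfold_locales
  note [simp] = quot_module_mult[OF assms(2)] quot_module_add[OF J S] quot_module_smult[OF sub M]
  show ?thesis
  proof (rule assoc_algebraI)
    show "module K (quot_module S J)"
      by (rule quot_module_module[OF sub M])
    show "ring (quot_module S J)"
      using quot_module_group[OF J S]
      by (intro ringI monoidI) (auto simp: quot_module_carrier S.m_assoc S.l_distr S.r_distr)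
  qed (auto simp: quot_module_carrier S.smult_mult_left S.smult_mult_right)
qed

lemma coset_alg_hom:
  assumes "assoc_algebra K S" "ideal J S"
  shows "(\<lambda>x. J +>\<^bsub>S\<^esub> x) \<in> alg_hom K S (quot_module S J)"
proof -
  interpret S: assoc_algebra K S by fact
  have "module K S" by unfold_locales
  then show ?thesis
    using coset_lin_hom[OF ideal_submodule[OF assms]] quot_module_mult[OF assms(2)]
    by (intro alg_homI) auto
qed

lemma quot_lift_alg_hom:
  assumes "assoc_algebra K S" "ideal J S" "assoc_algebra K T" "h \<in> alg_hom K S T"
    and "\<And>x. x \<in> J \<Longrightarrow> h x = \<zero>\<^bsub>T\<^esub>"
  shows "quot_lift h \<in> alg_hom K (quot_module S J) T"
proof -
  interpret S: assoc_algebra K S by fact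
  interpret T: assoc_algebra K T by fact
  interpret J: ideal J S by fact
  have J: "additive_subgroup J S" and S: "abelian_group S" "module K S" and T: "abelian_group T" "module K T"
    by unfold_locales
  note h = alg_hom_add_map[OF assms(4)]
  note eq = quot_lift_eq[OF J S(1) T(1) h assms(5)]
  show ?thesis
  proof (rule alg_homI)
    show "quot_lift h \<in> lin_hom K (quot_module S J) T"
      by (rule quot_lift_lin_hom[OF ideal_submodule[OF assms(1,2)] S(2) T(2) alg_homD(1)[OF assms(4)] assms(5)])
  qed (auto simp: quot_module_carrier quot_module_mult[OF assms(2)] eq
         alg_hom_mult[OF assms(4)] alg_hom_one[OF assms(4)])
qed

lemma kernel_ideal:
  assumes "ring S" "ring T" "h \<in> ring_hom S T"
  shows "ideal {x \<in> carrier S. h x = \<zero>\<^bsub>T\<^esub>} S"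
proof -
  interpret ring_hom_ring S T h
    using assms by (rule ring_hom_ringI2)
  show ?thesis
    using kernel_is_ideal unfolding a_kernel_def' .
qed

section \<open>Generated submodules\<close>

context module
begin

lemma submodule_gen_self: "S \<subseteq> submodule_gen R M S"
  by (auto simp: submodule_gen_def)

lemma submodule_gen_minimal: "submodule N R M \<Longrightarrow> S \<subseteq> N \<Longrightarrow> submodule_gen R M S \<subseteq> N"
  by (auto simp: submodule_gen_def)

lemma submodule_gen_submodule:
  assumes "S \<subseteq> carrier M"
  shows "submodule (submodule_gen R M S) R M"
proof (rule submoduleI)
  show "submodule_gen R M S \<subseteq> carrier M"
    using submodule_gen_minimal[OF carrier_is_submodule assms] .
  show "\<zero>\<^bsub>M\<^esub> \<in> submodule_gen R M S"
    using additive_subgroup_mem(1)[OF submodule_additive_subgroup] M.abelian_group_axioms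
    by (auto simp: submodule_gen_def)
  show "\<ominus>\<^bsub>M\<^esub> a \<in> submodule_gen R M S" if "a \<in> submodule_gen R M S" for a
    using that submoduleE(3) unfolding submodule_gen_def by blast
  show "a \<oplus>\<^bsub>M\<^esub> b \<in> submodule_gen R M S"
    if "a \<in> submodule_gen R M S" "b \<in> submodule_gen R M S" for a b
    using that submoduleE(5) unfolding submodule_gen_def by blast
  show "a \<odot>\<^bsub>M\<^esub> x \<in> submodule_gen R M S" if "a \<in> carrier R" "x \<in> submodule_gen R M S" for a x
    using that submoduleE(4) unfolding submodule_gen_def by blast
qed

end

section \<open>Free algebras\<close>

lemma (in module) smult_left_commute:
  "a \<in> carrier R \<Longrightarrow> b \<in> carrier R \<Longrightarrow> x \<in> carrier M \<Longrightarrow>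
    a \<odot>\<^bsub>M\<^esub> (b \<odot>\<^bsub>M\<^esub> x) = b \<odot>\<^bsub>M\<^esub> (a \<odot>\<^bsub>M\<^esub> x)"
  by (metis R.m_comm smult_assoc1)

lemma free_algebra_simps [simp]:
  "carrier (free_algebra K X) = carrier (free_module K (lists X))"
  "zero (free_algebra K X) = zero (free_module K (lists X))"
  "add (free_algebra K X) = add (free_module K (lists X))"
  "smult (free_algebra K X) = smult (free_module K (lists X))"
  "one (free_algebra K X) = basis_elt K []"
  by (simp_all add: free_algebra_def)

text \<open>Being a module does not involve the fields \<open>mult\<close> and \<open>one\<close>,
  in which for instance \<open>free_algebra\<close> differs from \<open>free_module\<close>.\<close>

lemma module_cong:
  assumes "module K M" "carrier N = carrier M" "zero N = zero M" "add N = add M" "smult N = smult M"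
  shows "module K N"
proof -
  interpret module K M by fact
  have "abelian_group N"
    by (rule abelian_groupI) (use assms(2-4) M.a_ac abelian_groupE(6)[OF M.abelian_group_axioms] in auto)
  then show ?thesis
    by (intro moduleI is_cring) (use assms smult_l_distr smult_r_distr smult_assoc1 in auto)
qed

lemma add_span_cong:
  assumes "zero N = zero M" "add N = add M"
  shows "add_span N G = add_span M G"
proof -
  have "x \<in> add_span M G" if "x \<in> add_span N G" for x
    using that by induction (use assms add_span.intros[where M=M and G=G] in auto)
  moreover have "x \<in> add_span N G" if "x \<in> add_span M G" for x
    using that by induction (use assms add_span.intros[where M=N and G=G] in auto)
  ultimately show ?thesis
    by blast
qed

lemma lin_hom_cong:
  assumes "carrier M' = carrier M" "add M' = add M" "smult M' = smult M"
  shows "lin_hom K M' N = lin_hom K M N"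
  using assms by (simp add: lin_hom_def)

context cring
begin

lemma free_algebra_module: "module R (free_algebra R X)"
  by (rule module_cong[OF free_module_module]) auto

lemma free_algebra_mult:
  "(f \<otimes>\<^bsub>free_algebra R X\<^esub> g) w = (\<Oplus>\<^bsub>R\<^esub>i\<in>{..length w}. f (take i w) \<otimes> g (drop i w))"
  by (simp add: free_algebra_def)

lemma free_algebra_mult_closed:
  assumes "f \<in> carrier (free_algebra R X)" "g \<in> carrier (free_algebra R X)"
  shows "f \<otimes>\<^bsub>free_algebra R X\<^esub> g \<in> carrier (free_algebra R X)"
proof -
  \<comment> \<open>A product is supported on concatenations of words from the two supports, a
    finite set.\<close>
  let ?F = "(\<lambda>(u, v). u @ v) ` ({u. f u \<noteq> \<zero>} \<times> {v. g v \<noteq> \<zero>})"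
  have f: "f u \<in> carrier R" "f u \<noteq> \<zero> \<Longrightarrow> set u \<subseteq> X" and g: "g u \<in> carrier R" "g u \<noteq> \<zero> \<Longrightarrow> set u \<subseteq> X" for u
    using assms by (auto simp: free_module_carrier)
  have out: "(f \<otimes>\<^bsub>free_algebra R X\<^esub> g) w = \<zero>" if "w \<notin> ?F" for w
  proof -
    have "f (take i w) \<otimes> g (drop i w) = \<zero>" for i
    proof (rule ccontr)
      assume n: "f (take i w) \<otimes> g (drop i w) \<noteq> \<zero>"
      then have "f (take i w) \<noteq> \<zero>" "g (drop i w) \<noteq> \<zero>"
        using f(1) g(1) l_null r_null by metis+
      then have "w \<in> ?F"
        by (intro image_eqI[of _ _ "(take i w, drop i w)"]) auto
      with that show False by simp
    qed
    then show ?thesis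
      unfolding free_algebra_mult by (simp add: add.finprod_one_eqI)
  qed
  have "?F \<subseteq> lists X"
    using f(2) g(2) by fastforce
  have "(f \<otimes>\<^bsub>free_algebra R X\<^esub> g) \<in> carrier (free_module R (lists X))"
  proof (rule free_module_carrierI[of _ ?F])
    show "(f \<otimes>\<^bsub>free_algebra R X\<^esub> g) w \<in> carrier R" for w
      using f(1) g(1) by (simp add: free_algebra_mult)
    show "finite ?F" using assms by (simp add: free_module_carrier)
    show "w \<in> lists X" if "(f \<otimes>\<^bsub>free_algebra R X\<^esub> g) w \<noteq> \<zero>" for w
      using that out[of w] \<open>?F \<subseteq> lists X\<close> by blast
  qed (rule out)
  then show ?thesis by simp
qed

text \<open>Of the cuts of the word \<open>u @ v\<close> only the one at \<open>length u\<close> has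
  \<open>u\<close> as its first part; for any other word no cut fits.\<close>

lemma single_mult_single:
  assumes "a \<in> carrier R" "b \<in> carrier R"
  shows "single R u a \<otimes>\<^bsub>free_algebra R X\<^esub> single R v b = single R (u @ v) (a \<otimes> b)"
proof
  fix w
  show "(single R u a \<otimes>\<^bsub>free_algebra R X\<^esub> single R v b) w = single R (u @ v) (a \<otimes> b) w"
  proof (cases "w = u @ v")
    case True
    have "(single R u a \<otimes>\<^bsub>free_algebra R X\<^esub> single R v b) w
        = (\<Oplus>\<^bsub>R\<^esub>i\<in>{length u}. single R u a (take i w) \<otimes> single R v b (drop i w))"
      unfolding free_algebra_mult
    proof (rule add.finprod_mono_neutral_cong_right)
      fix i assume "i \<in> {..length w} - {length u}"
      then have "take i w \<noteq> u" by auto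
      then show "single R u a (take i w) \<otimes> single R v b (drop i w) = \<zero>"
        using assms by (auto simp: single_def)
    qed (use assms True in \<open>auto simp: single_def\<close>)
    also have "\<dots> = a \<otimes> b"
      using assms True by (simp add: single_def)
    finally show ?thesis
      using True by (simp add: single_def)
  next
    case False
    have "single R u a (take i w) \<otimes> single R v b (drop i w) = \<zero>" for i
      using False assms by (auto simp: single_def)
    then show ?thesis
      using False unfolding free_algebra_mult by (simp add: add.finprod_one_eqI single_def)
  qed
qed

lemma words_span:
  "carrier (free_algebra R X) = add_span (free_algebra R X) {single R w a |w a. w \<in> lists X \<and> a \<in> carrier R}"
  using free_module_carrier_eq_span[of "lists X"]
    add_span_cong[of "free_algebra R X" "free_module R (lists X)"] by simp

lemma free_algebra_assoc_algebra: "assoc_algebra R (free_algebra R X)"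
proof (rule assoc_algebra_by_span[OF free_algebra_module _ words_span])
  show "{single R w a |w a. w \<in> lists X \<and> a \<in> carrier R} \<subseteq> carrier (free_algebra R X)"
    unfolding free_algebra_simps by (rule singles_closed)
  show "f \<otimes>\<^bsub>free_algebra R X\<^esub> g \<in> carrier (free_algebra R X)"
    if "f \<in> carrier (free_algebra R X)" "g \<in> carrier (free_algebra R X)" for f g
    using free_algebra_mult_closed that by blast
  show "\<one>\<^bsub>free_algebra R X\<^esub> \<in> carrier (free_algebra R X)"
    using single_closed[of "[]" "lists X" \<one>] by (simp add: basis_elt_single)
next
  fix f g h
  assume "f \<in> carrier (free_algebra R X)" "g \<in> carrier (free_algebra R X)" "h \<in> carrier (free_algebra R X)"
  then have c: "f u \<in> carrier R" "g u \<in> carrier R" "h u \<in> carrier R" for u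
    by (auto simp: free_module_carrier)
  show "(f \<oplus>\<^bsub>free_algebra R X\<^esub> g) \<otimes>\<^bsub>free_algebra R X\<^esub> h
      = f \<otimes>\<^bsub>free_algebra R X\<^esub> h \<oplus>\<^bsub>free_algebra R X\<^esub> g \<otimes>\<^bsub>free_algebra R X\<^esub> h"
    using c by (intro ext) (simp add: free_algebra_mult l_distr Pi_def flip: finsum_addf)
  show "h \<otimes>\<^bsub>free_algebra R X\<^esub> (f \<oplus>\<^bsub>free_algebra R X\<^esub> g)
      = h \<otimes>\<^bsub>free_algebra R X\<^esub> f \<oplus>\<^bsub>free_algebra R X\<^esub> h \<otimes>\<^bsub>free_algebra R X\<^esub> g"
    using c by (intro ext) (simp add: free_algebra_mult r_distr Pi_def flip: finsum_addf)
qed (auto simp: single_mult_single basis_elt_single m_assoc single_smult m_lcomm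
       simp del: free_module_simps)

end

definition free_eval ::
  "('k, 'c) ring_scheme \<Rightarrow> ('k, 'a, 'm) module_scheme \<Rightarrow> ('x \<Rightarrow> 'a) \<Rightarrow> ('x list \<Rightarrow> 'k) \<Rightarrow> 'a"
  where "free_eval K S f = dsum K S (\<lambda>w a. a \<odot>\<^bsub>S\<^esub> list_prod S (map f w))"

lemma free_eval_single:
  assumes "assoc_algebra K S" "f \<in> X \<rightarrow> carrier S" "w \<in> lists X" "a \<in> carrier K"
  shows "free_eval K S f (single K w a) = a \<odot>\<^bsub>S\<^esub> list_prod S (map f w)"
proof -
  interpret assoc_algebra K S by fact
  have p: "list_prod S (map f w) \<in> carrier S" if "w \<in> lists X" for w
    using assms(2) that by (intro U.list_prod_closed) auto
  have "(\<lambda>a. a \<odot>\<^bsub>S\<^esub> list_prod S (map f w)) \<in> add_map K S" if "w \<in> lists X" for w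
    using p[OF that] by (intro add_mapI smult_closed smult_l_distr)
  then show ?thesis
    unfolding free_eval_def using assms(3,4) by (intro dsum_single) (auto intro: M.abelian_group_axioms)
qed

lemma free_eval_alg_hom:
  assumes "assoc_algebra K S" "f \<in> X \<rightarrow> carrier S"
  shows "free_eval K S f \<in> alg_hom K (free_algebra K X) S"
proof -
  interpret assoc_algebra K S by fact
  interpret F: assoc_algebra K "free_algebra K X" by (rule free_algebra_assoc_algebra)
  have p: "list_prod S (map f w) \<in> carrier S" if "w \<in> lists X" for w
    using assms(2) that by (intro U.list_prod_closed) auto
  have "dsum K S (\<lambda>w a. a \<odot>\<^bsub>S\<^esub> list_prod S (map f w)) \<in> lin_hom K (free_module K (lists X)) S"
  proof (rule dsum_lin_hom)
    show "module K S" by unfold_locales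
    show "(\<lambda>a. a \<odot>\<^bsub>S\<^esub> list_prod S (map f w)) \<in> add_map K S" if "w \<in> lists X" for w
      using p[OF that] by (intro add_mapI smult_closed smult_l_distr)
    show "(k \<otimes>\<^bsub>K\<^esub> a) \<odot>\<^bsub>S\<^esub> list_prod S (map f w) = k \<odot>\<^bsub>S\<^esub> (a \<odot>\<^bsub>S\<^esub> list_prod S (map f w))"
      if "w \<in> lists X" "k \<in> carrier K" "a \<in> carrier K" for w k a
      using p[OF that(1)] that by (simp add: smult_assoc1)
  qed
  then have lin: "free_eval K S f \<in> lin_hom K (free_algebra K X) S"
    unfolding free_eval_def by (subst lin_hom_cong) auto
  show ?thesis
  proof (rule alg_hom_by_span[OF lin _ _ _ words_span])
    show "ring (free_algebra K X)" "ring S" by unfold_locales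
    show "{single K w a |w a. w \<in> lists X \<and> a \<in> carrier K} \<subseteq> carrier (free_algebra K X)"
      unfolding free_algebra_simps by (rule singles_closed)
    have "free_eval K S f (single K [] \<one>\<^bsub>K\<^esub>) = \<one>\<^bsub>S\<^esub>"
      using free_eval_single[OF assms, of "[]" "\<one>\<^bsub>K\<^esub>"] by simp
    then show "free_eval K S f \<one>\<^bsub>free_algebra K X\<^esub> = \<one>\<^bsub>S\<^esub>"
      by (simp add: basis_elt_single)
    fix x y
    assume "x \<in> {single K w a |w a. w \<in> lists X \<and> a \<in> carrier K}"
      "y \<in> {single K w a |w a. w \<in> lists X \<and> a \<in> carrier K}"
    then obtain u a v b where x: "x = single K u a" "u \<in> lists X" "a \<in> carrier K"
      and y: "y = single K v b" "v \<in> lists X" "b \<in> carrier K" by blast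
    have "list_prod S (map f (u @ v)) = list_prod S (map f u) \<otimes>\<^bsub>S\<^esub> list_prod S (map f v)"
      using x(2) y(2) assms(2) by (simp, intro U.list_prod_append) auto
    then show "free_eval K S f (x \<otimes>\<^bsub>free_algebra K X\<^esub> y) = free_eval K S f x \<otimes>\<^bsub>S\<^esub> free_eval K S f y"
      using x y p
      by (simp add: single_mult_single free_eval_single[OF assms] smult_mult_left smult_mult_right smult_assoc1
          smult_left_commute[of b a] del: map_append)
  qed
qed

lemma free_eval_basis:
  assumes "assoc_algebra K S" "f \<in> X \<rightarrow> carrier S" "x \<in> X"
  shows "free_eval K S f (basis_elt K [x]) = f x"
proof -
  interpret assoc_algebra K S by fact
  show ?thesis
    using free_eval_single[OF assms(1,2), of "[x]" "\<one>\<^bsub>K\<^esub>"] assms(3) funcset_mem[OF assms(2,3)]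
    by (simp add: basis_elt_single)
qed

section \<open>Kaehler differentials\<close>

locale comm_algebra =
  fixes R :: "('r, 'c) ring_scheme" and A :: "('r, 'a, 'm) module_scheme" (structure)
  assumes algebra: "algebra R A"
begin

sublocale A: cring A
  by (rule algebra.M_cring[OF algebra])

sublocale RA: module R A
  by (rule algebra.module[OF algebra])

abbreviation "Om \<equiv> kaehler R A"
abbreviation "d \<equiv> kaehler_d R A"
abbreviation "ofR r \<equiv> r \<odot> \<one>"
abbreviation "FA \<equiv> free_module A (carrier A)"

sublocale FA: module A FA
  by (rule A.free_module_module)

lemma ofR_mult: "r \<in> carrier R \<Longrightarrow> x \<in> carrier A \<Longrightarrow> ofR r \<otimes> x = r \<odot> x"
  using algebra.smult_assoc2[OF algebra, of r \<one> x] by simp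

definition kaehler_gens :: "('a \<Rightarrow> 'a) set" where
  "kaehler_gens =
      ({basis_elt A (x \<oplus> y) \<ominus>\<^bsub>FA\<^esub> (basis_elt A x \<oplus>\<^bsub>FA\<^esub> basis_elt A y) |x y. x \<in> carrier A \<and> y \<in> carrier A} \<union>
       {basis_elt A (r \<odot> x) \<ominus>\<^bsub>FA\<^esub> (ofR r \<odot>\<^bsub>FA\<^esub> basis_elt A x) |r x. r \<in> carrier R \<and> x \<in> carrier A} \<union>
       {basis_elt A (x \<otimes> y) \<ominus>\<^bsub>FA\<^esub> ((x \<odot>\<^bsub>FA\<^esub> basis_elt A y) \<oplus>\<^bsub>FA\<^esub> (y \<odot>\<^bsub>FA\<^esub> basis_elt A x)) |x y. x \<in> carrier A \<and> y \<in> carrier A})"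

lemma kaehler_relations_eq: "kaehler_relations R A = submodule_gen A FA kaehler_gens"
  by (simp add: kaehler_relations_def kaehler_gens_def Let_def)

lemma basis_closed: "x \<in> carrier A \<Longrightarrow> basis_elt A x \<in> carrier FA"
  unfolding basis_elt_single by (rule A.single_closed) auto

lemma kaehler_gens_closed: "kaehler_gens \<subseteq> carrier FA"
  unfolding kaehler_gens_def
  by (auto simp del: free_module_simps intro!: FA.minus_closed FA.a_closed FA.smult_closed basis_closed)

lemma kaehler_relations_submodule: "submodule (kaehler_relations R A) A FA"
  unfolding kaehler_relations_eq by (rule FA.submodule_gen_submodule[OF kaehler_gens_closed])

lemma kaehler_relations_group: "additive_subgroup (kaehler_relations R A) FA"
  by (rule submodule_additive_subgroup[OF kaehler_relations_submodule])

lemma FA_group: "abelian_group FA" and FA_module: "module A FA"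
  by unfold_locales

sublocale Om: module A Om
  unfolding kaehler_def by (rule quot_module_module[OF kaehler_relations_submodule FA_module])

lemma Om_group: "abelian_group Om" and Om_module: "module A Om"
  by unfold_locales

abbreviation "cls f \<equiv> kaehler_relations R A +>\<^bsub>FA\<^esub> f"

lemma cls_lin_hom: "(\<lambda>f. cls f) \<in> lin_hom A FA Om"
  unfolding kaehler_def by (rule coset_lin_hom[OF kaehler_relations_submodule FA_module])

lemma d_cls: "d x = cls (basis_elt A x)"
  by (simp add: kaehler_d_def)

lemma d_closed [simp]: "x \<in> carrier A \<Longrightarrow> d x \<in> carrier Om"
  unfolding d_cls by (rule lin_hom_closed[OF cls_lin_hom basis_closed])

lemma cls_eqI:
  assumes "f \<ominus>\<^bsub>FA\<^esub> g \<in> kaehler_gens" "f \<in> carrier FA" "g \<in> carrier FA"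
  shows "cls f = cls g"
  using coset_eq_iff[OF kaehler_relations_group FA_group assms(2,3)] assms(1) FA.submodule_gen_self[of kaehler_gens]
  unfolding kaehler_relations_eq by blast

lemma d_add: "x \<in> carrier A \<Longrightarrow> y \<in> carrier A \<Longrightarrow> d (x \<oplus> y) = d x \<oplus>\<^bsub>Om\<^esub> d y"
  unfolding d_cls add_map_add[OF lin_hom_add_map[OF cls_lin_hom] basis_closed basis_closed, symmetric]
  by (rule cls_eqI) (auto simp del: free_module_simps simp: kaehler_gens_def intro!: basis_closed FA.a_closed)

lemma d_smult: "r \<in> carrier R \<Longrightarrow> x \<in> carrier A \<Longrightarrow> d (r \<odot> x) = ofR r \<odot>\<^bsub>Om\<^esub> d x"
  unfolding d_cls using lin_hom_smult[OF cls_lin_hom _ basis_closed, symmetric, of "ofR r" x]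
  by (simp del: free_module_simps, intro cls_eqI)
     (auto simp del: free_module_simps simp: kaehler_gens_def intro!: basis_closed FA.smult_closed)

lemma d_mult: "x \<in> carrier A \<Longrightarrow> y \<in> carrier A \<Longrightarrow> d (x \<otimes> y) = x \<odot>\<^bsub>Om\<^esub> d y \<oplus>\<^bsub>Om\<^esub> y \<odot>\<^bsub>Om\<^esub> d x"
proof -
  assume x: "x \<in> carrier A" and y: "y \<in> carrier A"
  have "x \<odot>\<^bsub>Om\<^esub> d y \<oplus>\<^bsub>Om\<^esub> y \<odot>\<^bsub>Om\<^esub> d x
      = cls ((x \<odot>\<^bsub>FA\<^esub> basis_elt A y) \<oplus>\<^bsub>FA\<^esub> (y \<odot>\<^bsub>FA\<^esub> basis_elt A x))"
    unfolding d_cls lin_hom_smult[OF cls_lin_hom x basis_closed[OF y], symmetric]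
      lin_hom_smult[OF cls_lin_hom y basis_closed[OF x], symmetric]
    by (rule add_map_add[OF lin_hom_add_map[OF cls_lin_hom]
          FA.smult_closed[OF x basis_closed[OF y]] FA.smult_closed[OF y basis_closed[OF x]], symmetric])
  also have "\<dots> = d (x \<otimes> y)"
  proof -
    have "basis_elt A (x \<otimes> y) \<ominus>\<^bsub>FA\<^esub> ((x \<odot>\<^bsub>FA\<^esub> basis_elt A y) \<oplus>\<^bsub>FA\<^esub> (y \<odot>\<^bsub>FA\<^esub> basis_elt A x)) \<in> kaehler_gens"
      unfolding kaehler_gens_def using x y by blast
    then show ?thesis
      unfolding d_cls
      by (rule cls_eqI[symmetric])
         (intro basis_closed FA.M.a_closed FA.smult_closed A.m_closed x y)+
  qed
  finally show ?thesis by simp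
qed

lemma d_add_map: "d \<in> add_map A Om"
  by (intro add_mapI d_closed d_add)

definition "differentials = {a \<odot>\<^bsub>Om\<^esub> d x |a x. a \<in> carrier A \<and> x \<in> carrier A}"

lemma differentials_closed: "differentials \<subseteq> carrier Om"
  by (auto simp: differentials_def)

lemma cls_single: "a \<in> carrier A \<Longrightarrow> x \<in> carrier A \<Longrightarrow> cls (single A x a) = a \<odot>\<^bsub>Om\<^esub> d x"
  unfolding A.single_basis_elt[of a x "carrier A"] d_cls
  using lin_hom_smult[OF cls_lin_hom _ basis_closed, of a x] by (simp del: free_module_simps)

lemma Om_span:
  assumes "\<omega> \<in> carrier Om"
  shows "\<omega> \<in> add_span Om differentials"
proof -
  let ?G = "{single A x a |x a. x \<in> carrier A \<and> a \<in> carrier A}"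
  have "\<omega> \<in> add_span Om ((\<lambda>f. cls f) ` ?G)"
    using quot_module_span[OF kaehler_relations_group FA_group A.singles_closed A.free_module_carrier_eq_span] assms
    unfolding kaehler_def by blast
  moreover have "(\<lambda>f. cls f) ` ?G \<subseteq> differentials"
    unfolding differentials_def using cls_single by blast
  ultimately show ?thesis
    using add_span_mono by blast
qed

lemma Om_map_eqI:
  assumes "h \<in> add_map Om N" "k \<in> add_map Om N" "abelian_group N" "\<omega> \<in> carrier Om"
    and "\<And>a x. a \<in> carrier A \<Longrightarrow> x \<in> carrier A \<Longrightarrow> h (a \<odot>\<^bsub>Om\<^esub> d x) = k (a \<odot>\<^bsub>Om\<^esub> d x)"
  shows "h \<omega> = k \<omega>"
  using assms(5)
  by (intro add_map_eq_on_span[OF assms(1,2) Om_group assms(3) differentials_closed _ Om_span[OF assms(4)]])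
     (auto simp: differentials_def)

text \<open>\<open>R\<close>-linearity is encoded by vanishing on the image of \<open>R\<close>;
  together with the Leibniz rule this gives \<open>D (r \<odot> x) = r \<odot> D x\<close>.\<close>

definition derivation :: "('a \<Rightarrow> 'a) \<Rightarrow> bool" where
  "derivation D \<longleftrightarrow> D \<in> add_map A A \<and>
     (\<forall>x\<in>carrier A. \<forall>y\<in>carrier A. D (x \<otimes> y) = x \<otimes> D y \<oplus> y \<otimes> D x) \<and> (\<forall>r\<in>carrier R. D (ofR r) = \<zero>)"

lemma derivation_closed: "derivation D \<Longrightarrow> x \<in> carrier A \<Longrightarrow> D x \<in> carrier A"
  by (auto simp: derivation_def dest: add_map_closed)

lemma derivation_one: "derivation D \<Longrightarrow> D \<one> = \<zero>"
  unfolding derivation_def using RA.R.one_closed RA.smult_one[OF A.one_closed] by metis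

lemma derivation_zero_fun: "derivation (\<lambda>_. \<zero>)"
  by (auto simp: derivation_def intro: add_mapI)

text \<open>The universal property of \<open>d\<close>, twisted by a derivation:
  \<open>\<Psi>\<close> is a first-order operator whose failure of linearity is \<open>D a\<close>
  times \<open>\<tau>\<close>. With \<open>D = 0\<close> it gives linear maps out of the
  differentials, with \<open>\<tau>\<close> the identity it gives Lie derivatives. The hypothesis
  \<open>\<theta>_mult\<close> is what \<open>d (x y) = x dy + y dx\<close> forces on the values at
  exact differentials.\<close>

lemma kaehler_extension:
  assumes P: "module A P" and \<tau>: "\<tau> \<in> lin_hom A Om P" and D: "derivation D" and \<theta>: "\<theta> \<in> add_map A P"
    and \<theta>_mult: "\<And>x y. x \<in> carrier A \<Longrightarrow> y \<in> carrier A \<Longrightarrow>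
      \<theta> (x \<otimes> y) = (x \<odot>\<^bsub>P\<^esub> \<theta> y \<oplus>\<^bsub>P\<^esub> D x \<odot>\<^bsub>P\<^esub> \<tau> (d y)) \<oplus>\<^bsub>P\<^esub> (y \<odot>\<^bsub>P\<^esub> \<theta> x \<oplus>\<^bsub>P\<^esub> D y \<odot>\<^bsub>P\<^esub> \<tau> (d x))"
    and \<theta>_smult: "\<And>r x. r \<in> carrier R \<Longrightarrow> x \<in> carrier A \<Longrightarrow> \<theta> (r \<odot> x) = ofR r \<odot>\<^bsub>P\<^esub> \<theta> x"
  obtains \<Psi> where "\<Psi> \<in> add_map Om P"
    and "\<And>a \<omega>. a \<in> carrier A \<Longrightarrow> \<omega> \<in> carrier Om \<Longrightarrow> \<Psi> (a \<odot>\<^bsub>Om\<^esub> \<omega>) = a \<odot>\<^bsub>P\<^esub> \<Psi> \<omega> \<oplus>\<^bsub>P\<^esub> D a \<odot>\<^bsub>P\<^esub> \<tau> \<omega>"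
    and "\<And>x. x \<in> carrier A \<Longrightarrow> \<Psi> (d x) = \<theta> x"
proof -
  interpret P: module A P by fact
  have Pg: "abelian_group P" ..
  have Dc: "D x \<in> carrier A" if "x \<in> carrier A" for x
    using derivation_closed[OF D that] .
  have Dm: "D (x \<otimes> y) = x \<otimes> D y \<oplus> y \<otimes> D x" if "x \<in> carrier A" "y \<in> carrier A" for x y
    using D that by (auto simp: derivation_def)
  have Da: "D \<in> add_map A A" using D by (simp add: derivation_def)
  have \<theta>c: "\<theta> x \<in> carrier P" if "x \<in> carrier A" for x using add_map_closed[OF \<theta> that] .
  have \<tau>c: "\<tau> x \<in> carrier P" if "x \<in> carrier Om" for x using lin_hom_closed[OF \<tau> that] .
  note \<tau>a = lin_hom_add_map[OF \<tau>]
  \<comment> \<open>The value that \<open>\<Psi>\<close> must take on \<open>a \<odot> d x\<close>,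
    prescribed first on the free module over the symbols.\<close>
  define \<psi> where "\<psi> x a = a \<odot>\<^bsub>P\<^esub> \<theta> x \<oplus>\<^bsub>P\<^esub> D a \<odot>\<^bsub>P\<^esub> \<tau> (d x)" for x a
  have \<psi>: "\<psi> x \<in> add_map A P" if "x \<in> carrier A" for x
    unfolding \<psi>_def using that \<theta>c \<tau>c Dc
    by (intro add_mapI) (auto simp: add_map_add[OF Da] P.smult_l_distr P.M.a_ac)
  define \<Phi> where "\<Phi> = dsum A P \<psi>"
  have \<Phi>: "\<Phi> \<in> add_map FA P"
    unfolding \<Phi>_def by (rule A.dsum_add_map[OF Pg]) (rule \<psi>)
  have \<Phi>s: "\<Phi> (single A x a) = \<psi> x a" if "x \<in> carrier A" "a \<in> carrier A" for x a
    unfolding \<Phi>_def by (rule A.dsum_single[OF Pg _ that]) (rule \<psi>)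
  have \<Phi>b: "\<Phi> (basis_elt A x) = \<theta> x" if "x \<in> carrier A" for x
    using \<Phi>s[OF that A.one_closed] that \<theta>c \<tau>c by (simp add: basis_elt_single \<psi>_def derivation_one[OF D])
  note clsa = lin_hom_add_map[OF cls_lin_hom]
  have clsc: "cls f \<in> carrier Om" if "f \<in> carrier FA" for f
    using lin_hom_closed[OF cls_lin_hom that] .
  have \<Phi>sm: "\<Phi> (c \<odot>\<^bsub>FA\<^esub> f) = c \<odot>\<^bsub>P\<^esub> \<Phi> f \<oplus>\<^bsub>P\<^esub> D c \<odot>\<^bsub>P\<^esub> \<tau> (cls f)" if c: "c \<in> carrier A" and f: "f \<in> carrier FA" for c f
  proof (rule add_map_eq_on_span[OF _ _ FA_group Pg A.singles_closed _ A.free_module_span[OF f],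
        of "\<lambda>f. \<Phi> (c \<odot>\<^bsub>FA\<^esub> f)" "\<lambda>f. c \<odot>\<^bsub>P\<^esub> \<Phi> f \<oplus>\<^bsub>P\<^esub> D c \<odot>\<^bsub>P\<^esub> \<tau> (cls f)"])
    have "(\<lambda>f. c \<odot>\<^bsub>FA\<^esub> f) \<in> add_map FA FA"
      using c by (intro add_mapI FA.smult_closed FA.smult_r_distr)
    then show "(\<lambda>f. \<Phi> (c \<odot>\<^bsub>FA\<^esub> f)) \<in> add_map FA P"
      by (rule add_map_comp[OF _ \<Phi>])
    have sm: "(\<lambda>x. e \<odot>\<^bsub>P\<^esub> x) \<in> add_map P P" if "e \<in> carrier A" for e
      using that by (intro add_mapI P.smult_closed P.smult_r_distr)
    show "(\<lambda>f. c \<odot>\<^bsub>P\<^esub> \<Phi> f \<oplus>\<^bsub>P\<^esub> D c \<odot>\<^bsub>P\<^esub> \<tau> (cls f)) \<in> add_map FA P"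
      by (intro add_map_plus[OF Pg] add_map_comp[OF \<Phi> sm[OF c]] add_map_comp[OF add_map_comp[OF clsa \<tau>a] sm[OF Dc[OF c]]])
    fix g assume "g \<in> {single A x a |x a. x \<in> carrier A \<and> a \<in> carrier A}"
    then obtain x a where g: "g = single A x a" and x: "x \<in> carrier A" and a: "a \<in> carrier A" by blast
    have "\<Phi> (c \<odot>\<^bsub>FA\<^esub> g) = \<psi> x (c \<otimes> a)"
      unfolding g A.single_smult[OF c] using \<Phi>s x a c by simp
    also have "\<dots> = c \<odot>\<^bsub>P\<^esub> \<psi> x a \<oplus>\<^bsub>P\<^esub> D c \<odot>\<^bsub>P\<^esub> \<tau> (cls g)"
      unfolding g cls_single[OF a x] \<psi>_def lin_hom_smult[OF \<tau> a d_closed[OF x]] using a c x \<theta>c \<tau>c Dc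
      by (simp add: Dm P.smult_l_distr P.smult_r_distr P.smult_assoc1 P.M.a_ac P.smult_left_commute[of a])
    finally show "\<Phi> (c \<odot>\<^bsub>FA\<^esub> g) = c \<odot>\<^bsub>P\<^esub> \<Phi> g \<oplus>\<^bsub>P\<^esub> D c \<odot>\<^bsub>P\<^esub> \<tau> (cls g)"
      unfolding g using \<Phi>s[OF x a] by simp
  qed
  \<comment> \<open>\<open>\<Phi>\<close> is not linear, so its zeros alone need not form a
    submodule. Inside the relations they do, because there the correction term in
    \<open>\<Phi>sm\<close> contains the class \<open>0\<close>.\<close>
  let ?T = "{f \<in> kaehler_relations R A. \<Phi> f = \<zero>\<^bsub>P\<^esub>}"
  note rel = additive_subgroup_mem[OF kaehler_relations_group FA_group]
  have clsz: "cls f = \<zero>\<^bsub>Om\<^esub>" if "f \<in> kaehler_relations R A" for f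
    using coset_eq_self_iff[OF kaehler_relations_group FA_group rel(5)[OF that]] that by (simp add: kaehler_def)
  have "submodule ?T A FA"
  proof (rule FA.submoduleI)
    show "?T \<subseteq> carrier FA" using rel(5) by blast
    show "\<zero>\<^bsub>FA\<^esub> \<in> ?T" using rel(1) add_map_zero[OF \<Phi> FA_group Pg] by simp
    show "\<ominus>\<^bsub>FA\<^esub> f \<in> ?T" if "f \<in> ?T" for f
      using that rel(3,5) add_map_neg[OF \<Phi> FA_group Pg] by (auto simp: P.M.neg_zero)
    show "f \<oplus>\<^bsub>FA\<^esub> g \<in> ?T" if "f \<in> ?T" "g \<in> ?T" for f g
      using that rel(2)[of f g] rel(5) add_map_add[OF \<Phi>, of f g] by (auto simp del: free_module_simps)
    show "c \<odot>\<^bsub>FA\<^esub> f \<in> ?T" if "c \<in> carrier A" "f \<in> ?T" for c f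
      using that rel(5)[of f] \<Phi>sm[OF that(1), of f] clsz[of f] add_map_zero[OF \<tau>a Om_group Pg] Dc[OF that(1)]
        submodule.smult_closed[OF kaehler_relations_submodule that(1), of f]
      by (auto simp del: free_module_simps)
  qed
  moreover have "kaehler_gens \<subseteq> ?T"
  proof
    fix g assume g: "g \<in> kaehler_gens"
    then have "g \<in> kaehler_relations R A"
      unfolding kaehler_relations_eq using FA.submodule_gen_self by blast
    note mi = add_map_minus[OF \<Phi> FA_group Pg] and ad = add_map_add[OF \<Phi>]
    have tz: "u \<ominus>\<^bsub>P\<^esub> u = \<zero>\<^bsub>P\<^esub>" if "u \<in> carrier P" for u
      using that by (simp add: a_minus_def P.M.r_neg)
    have \<Phi>A: "\<Phi> (a \<odot>\<^bsub>FA\<^esub> basis_elt A x) = a \<odot>\<^bsub>P\<^esub> \<theta> x \<oplus>\<^bsub>P\<^esub> D a \<odot>\<^bsub>P\<^esub> \<tau> (d x)" if "a \<in> carrier A" "x \<in> carrier A" for a x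
      using \<Phi>sm[OF that(1) basis_closed[OF that(2)]] \<Phi>b[OF that(2)] by (simp add: d_cls)
    from g consider x y where "x \<in> carrier A" "y \<in> carrier A" "g = basis_elt A (x \<oplus> y) \<ominus>\<^bsub>FA\<^esub> (basis_elt A x \<oplus>\<^bsub>FA\<^esub> basis_elt A y)"
      | r x where "r \<in> carrier R" "x \<in> carrier A" "g = basis_elt A (r \<odot> x) \<ominus>\<^bsub>FA\<^esub> (ofR r \<odot>\<^bsub>FA\<^esub> basis_elt A x)"
      | x y where "x \<in> carrier A" "y \<in> carrier A" "g = basis_elt A (x \<otimes> y) \<ominus>\<^bsub>FA\<^esub> ((x \<odot>\<^bsub>FA\<^esub> basis_elt A y) \<oplus>\<^bsub>FA\<^esub> (y \<odot>\<^bsub>FA\<^esub> basis_elt A x))"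
      unfolding kaehler_gens_def by blast
    then have "\<Phi> g = \<zero>\<^bsub>P\<^esub>"
    proof cases
      case 1
      have "\<Phi> g = \<theta> (x \<oplus> y) \<ominus>\<^bsub>P\<^esub> (\<theta> x \<oplus>\<^bsub>P\<^esub> \<theta> y)"
        unfolding 1(3) using 1(1,2)
        by (simp add: mi ad \<Phi>b basis_closed FA.M.a_closed del: free_module_simps)
      then show ?thesis using 1(1,2) \<theta>c by (simp add: add_map_add[OF \<theta>] tz)
    next
      case 2
      have "D (ofR r) = \<zero>" using D 2(1) by (simp add: derivation_def)
      then have "\<Phi> g = \<theta> (r \<odot> x) \<ominus>\<^bsub>P\<^esub> (ofR r \<odot>\<^bsub>P\<^esub> \<theta> x)"
        unfolding 2(3) using 2(1,2) \<theta>c \<tau>c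
        by (simp add: mi \<Phi>A \<Phi>b basis_closed FA.smult_closed del: free_module_simps)
      then show ?thesis using 2(1,2) \<theta>c by (simp add: \<theta>_smult tz)
    next
      case 3
      have "\<Phi> g = \<theta> (x \<otimes> y) \<ominus>\<^bsub>P\<^esub> ((x \<odot>\<^bsub>P\<^esub> \<theta> y \<oplus>\<^bsub>P\<^esub> D x \<odot>\<^bsub>P\<^esub> \<tau> (d y)) \<oplus>\<^bsub>P\<^esub> (y \<odot>\<^bsub>P\<^esub> \<theta> x \<oplus>\<^bsub>P\<^esub> D y \<odot>\<^bsub>P\<^esub> \<tau> (d x)))"
        unfolding 3(3) using 3(1,2)
        by (simp add: mi ad \<Phi>A \<Phi>b basis_closed FA.smult_closed FA.M.a_closed del: free_module_simps)
      then show ?thesis using 3(1,2) \<theta>c \<tau>c Dc by (simp add: \<theta>_mult tz)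
    qed
    with \<open>g \<in> kaehler_relations R A\<close> show "g \<in> ?T" by simp
  qed
  ultimately have van: "\<Phi> f = \<zero>\<^bsub>P\<^esub>" if "f \<in> kaehler_relations R A" for f
    using FA.submodule_gen_minimal[of ?T kaehler_gens] that unfolding kaehler_relations_eq by blast
  have L: "quot_lift \<Phi> \<in> add_map (quot_module FA (kaehler_relations R A)) P"
    by (rule quot_lift_add_map[OF kaehler_relations_group FA_group Pg \<Phi>]) (rule van)
  have Le: "quot_lift \<Phi> (cls f) = \<Phi> f" if "f \<in> carrier FA" for f
    by (rule quot_lift_eq[OF kaehler_relations_group FA_group Pg \<Phi> _ that]) (rule van)
  show thesis
  proof (rule that[of "quot_lift \<Phi>"])
    show "quot_lift \<Phi> \<in> add_map Om P" unfolding kaehler_def by (rule L)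
    show "quot_lift \<Phi> (d x) = \<theta> x" if "x \<in> carrier A" for x
      using Le[OF basis_closed[OF that]] \<Phi>b[OF that] by (simp add: d_cls)
    fix a \<omega> assume a: "a \<in> carrier A" and "\<omega> \<in> carrier Om"
    then obtain f where f: "f \<in> carrier FA" "\<omega> = cls f"
      unfolding kaehler_def by (auto simp: quot_module_carrier)
    show "quot_lift \<Phi> (a \<odot>\<^bsub>Om\<^esub> \<omega>) = a \<odot>\<^bsub>P\<^esub> quot_lift \<Phi> \<omega> \<oplus>\<^bsub>P\<^esub> D a \<odot>\<^bsub>P\<^esub> \<tau> \<omega>"
      using Le[OF f(1)] Le[OF FA.smult_closed[OF a f(1)]] \<Phi>sm[OF a f(1)] lin_hom_smult[OF cls_lin_hom a f(1)]
      unfolding f(2) by simp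
  qed
qed

lemma kaehler_linear_extension:
  assumes P: "module A P" and \<theta>: "\<theta> \<in> add_map A P"
    and \<theta>_mult: "\<And>x y. x \<in> carrier A \<Longrightarrow> y \<in> carrier A \<Longrightarrow> \<theta> (x \<otimes> y) = x \<odot>\<^bsub>P\<^esub> \<theta> y \<oplus>\<^bsub>P\<^esub> y \<odot>\<^bsub>P\<^esub> \<theta> x"
    and \<theta>_smult: "\<And>r x. r \<in> carrier R \<Longrightarrow> x \<in> carrier A \<Longrightarrow> \<theta> (r \<odot> x) = ofR r \<odot>\<^bsub>P\<^esub> \<theta> x"
  obtains \<Psi> where "\<Psi> \<in> lin_hom A Om P" "\<And>x. x \<in> carrier A \<Longrightarrow> \<Psi> (d x) = \<theta> x"
proof -
  interpret P: module A P by fact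
  have z: "(\<lambda>_. \<zero>\<^bsub>P\<^esub>) \<in> lin_hom A Om P"
    by (rule lin_homI) auto
  have \<theta>c: "\<theta> x \<in> carrier P" if "x \<in> carrier A" for x using add_map_closed[OF \<theta> that] .
  obtain \<Psi> where \<Psi>: "\<Psi> \<in> add_map Om P"
    "\<And>a \<omega>. a \<in> carrier A \<Longrightarrow> \<omega> \<in> carrier Om \<Longrightarrow> \<Psi> (a \<odot>\<^bsub>Om\<^esub> \<omega>) = a \<odot>\<^bsub>P\<^esub> \<Psi> \<omega> \<oplus>\<^bsub>P\<^esub> \<zero> \<odot>\<^bsub>P\<^esub> \<zero>\<^bsub>P\<^esub>"
    "\<And>x. x \<in> carrier A \<Longrightarrow> \<Psi> (d x) = \<theta> x"
    using \<theta>_mult \<theta>_smult \<theta>c by (rule_tac kaehler_extension[OF P z derivation_zero_fun \<theta>]) auto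
  have "\<Psi> \<in> lin_hom A Om P"
    using \<Psi>(2) add_map_closed[OF \<Psi>(1)] add_map_add[OF \<Psi>(1)] by (intro lin_homI) auto
  with \<Psi>(3) show thesis using that by blast
qed

lemma kaehler_lie_derivative:
  assumes D: "derivation D"
  obtains L where "L \<in> add_map Om Om"
    "\<And>a \<omega>. a \<in> carrier A \<Longrightarrow> \<omega> \<in> carrier Om \<Longrightarrow> L (a \<odot>\<^bsub>Om\<^esub> \<omega>) = a \<odot>\<^bsub>Om\<^esub> L \<omega> \<oplus>\<^bsub>Om\<^esub> D a \<odot>\<^bsub>Om\<^esub> \<omega>"
    "\<And>x. x \<in> carrier A \<Longrightarrow> L (d x) = d (D x)"
proof (rule kaehler_extension[OF Om_module _ D, of "\<lambda>\<omega>. \<omega>" "\<lambda>x. d (D x)"])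
  have Da: "D \<in> add_map A A" and Dm: "\<And>x y. x \<in> carrier A \<Longrightarrow> y \<in> carrier A \<Longrightarrow> D (x \<otimes> y) = x \<otimes> D y \<oplus> y \<otimes> D x"
    using D by (auto simp: derivation_def)
  have Dc: "D x \<in> carrier A" if "x \<in> carrier A" for x
    using derivation_closed[OF D that] .
  show "(\<lambda>\<omega>. \<omega>) \<in> lin_hom A Om Om" by (rule lin_homI) auto
  show "(\<lambda>x. d (D x)) \<in> add_map A Om" by (rule add_map_comp[OF Da d_add_map])
  show "d (D (x \<otimes> y)) = (x \<odot>\<^bsub>Om\<^esub> d (D y) \<oplus>\<^bsub>Om\<^esub> D x \<odot>\<^bsub>Om\<^esub> d y) \<oplus>\<^bsub>Om\<^esub> (y \<odot>\<^bsub>Om\<^esub> d (D x) \<oplus>\<^bsub>Om\<^esub> D y \<odot>\<^bsub>Om\<^esub> d x)"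
    if "x \<in> carrier A" "y \<in> carrier A" for x y
    using that Dc by (simp add: Dm d_add d_mult Om.M.a_ac)
  show "d (D (r \<odot> x)) = ofR r \<odot>\<^bsub>Om\<^esub> d (D x)" if "r \<in> carrier R" "x \<in> carrier A" for r x
  proof -
    have "D (r \<odot> x) = ofR r \<otimes> D x \<oplus> x \<otimes> D (ofR r)"
      using that Dm[of "ofR r" x] ofR_mult by simp
    also have "\<dots> = r \<odot> D x"
      using D that Dc ofR_mult by (simp add: derivation_def)
    finally show ?thesis
      using d_smult that Dc by simp
  qed
qed (use that in blast)

end

section \<open>Lie--Rinehart algebras\<close>

lemma (in abelian_group) minus_eq_zero_iff:
  assumes "x \<in> carrier G" "y \<in> carrier G"
  shows "x \<ominus> y = \<zero> \<longleftrightarrow> x = y"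
  using assms minus_equality[of x "\<ominus> y"] by (auto simp: a_minus_def r_neg)

text \<open>The axioms that can be verified directly from the universal constructions. The Jacobi
  identity and the compatibility of the anchor with brackets are split off to
  \<open>lie_rinehart\<close>: for the differentials they are checked on generators, and spreading
  them from there uses the axioms collected here.\<close>

locale pre_lie_rinehart = A: cring A + L: module A L
  for A :: "('a, 'm) ring_scheme" (structure) and L :: "('a, 'l, 'n) module_scheme" +
  fixes br :: "'l \<Rightarrow> 'l \<Rightarrow> 'l" and anc :: "'l \<Rightarrow> 'a \<Rightarrow> 'a"
  assumes anc_closed: "u \<in> carrier L \<Longrightarrow> a \<in> carrier A \<Longrightarrow> anc u a \<in> carrier A"
    and anc_add: "u \<in> carrier L \<Longrightarrow> a \<in> carrier A \<Longrightarrow> b \<in> carrier A \<Longrightarrow> anc u (a \<oplus> b) = anc u a \<oplus> anc u b"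
    and anc_mult: "u \<in> carrier L \<Longrightarrow> a \<in> carrier A \<Longrightarrow> b \<in> carrier A \<Longrightarrow>
      anc u (a \<otimes> b) = a \<otimes> anc u b \<oplus> b \<otimes> anc u a"
    and anc_add_left: "u \<in> carrier L \<Longrightarrow> v \<in> carrier L \<Longrightarrow> a \<in> carrier A \<Longrightarrow>
      anc (u \<oplus>\<^bsub>L\<^esub> v) a = anc u a \<oplus> anc v a"
    and anc_smult_left: "c \<in> carrier A \<Longrightarrow> u \<in> carrier L \<Longrightarrow> a \<in> carrier A \<Longrightarrow>
      anc (c \<odot>\<^bsub>L\<^esub> u) a = c \<otimes> anc u a"
    and br_closed: "u \<in> carrier L \<Longrightarrow> v \<in> carrier L \<Longrightarrow> br u v \<in> carrier L"
    and br_add: "u \<in> carrier L \<Longrightarrow> v \<in> carrier L \<Longrightarrow> w \<in> carrier L \<Longrightarrow>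
      br u (v \<oplus>\<^bsub>L\<^esub> w) = br u v \<oplus>\<^bsub>L\<^esub> br u w"
    and br_anti: "u \<in> carrier L \<Longrightarrow> v \<in> carrier L \<Longrightarrow> br v u = \<ominus>\<^bsub>L\<^esub> br u v"
    and br_alt: "u \<in> carrier L \<Longrightarrow> br u u = \<zero>\<^bsub>L\<^esub>"
    and br_smult: "c \<in> carrier A \<Longrightarrow> u \<in> carrier L \<Longrightarrow> v \<in> carrier L \<Longrightarrow>
      br u (c \<odot>\<^bsub>L\<^esub> v) = c \<odot>\<^bsub>L\<^esub> br u v \<oplus>\<^bsub>L\<^esub> anc u c \<odot>\<^bsub>L\<^esub> v"
begin

lemma L_group: "abelian_group L" and A_group: "abelian_group A"
  by unfold_locales

lemma anc_add_map: "u \<in> carrier L \<Longrightarrow> anc u \<in> add_map A A"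
  by (intro add_mapI anc_closed anc_add)

lemma anc_add_map_left: "a \<in> carrier A \<Longrightarrow> (\<lambda>u. anc u a) \<in> add_map L A"
  by (intro add_mapI anc_closed anc_add_left)

lemma br_add_map: "u \<in> carrier L \<Longrightarrow> br u \<in> add_map L L"
  by (intro add_mapI br_closed br_add)

lemma br_add_left:
  assumes "u \<in> carrier L" "v \<in> carrier L" "w \<in> carrier L"
  shows "br (u \<oplus>\<^bsub>L\<^esub> v) w = br u w \<oplus>\<^bsub>L\<^esub> br v w"
proof -
  have "br (u \<oplus>\<^bsub>L\<^esub> v) w = \<ominus>\<^bsub>L\<^esub> (br w u \<oplus>\<^bsub>L\<^esub> br w v)"
    using br_anti[of w "u \<oplus>\<^bsub>L\<^esub> v"] br_add[of w u v] assms by simp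
  also have "\<dots> = br u w \<oplus>\<^bsub>L\<^esub> br v w"
    using br_anti[of w u] br_anti[of w v] br_closed assms by (simp add: L.M.minus_add)
  finally show ?thesis .
qed

lemma br_add_map_left: "w \<in> carrier L \<Longrightarrow> (\<lambda>u. br u w) \<in> add_map L L"
  by (intro add_mapI br_closed br_add_left)

lemma anc_zero: "u \<in> carrier L \<Longrightarrow> anc u \<zero> = \<zero>"
  by (rule add_map_zero[OF anc_add_map A_group A_group])

lemma anc_one: "u \<in> carrier L \<Longrightarrow> anc u \<one> = \<zero>"
  using anc_mult[of u \<one> \<one>] anc_closed[of u \<one>] A.add.r_cancel_one' by simp

lemma br_neg: "u \<in> carrier L \<Longrightarrow> v \<in> carrier L \<Longrightarrow> br u (\<ominus>\<^bsub>L\<^esub> v) = \<ominus>\<^bsub>L\<^esub> br u v"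
  by (rule add_map_neg[OF br_add_map L_group L_group])

lemma br_neg_left: "u \<in> carrier L \<Longrightarrow> v \<in> carrier L \<Longrightarrow> br (\<ominus>\<^bsub>L\<^esub> u) v = \<ominus>\<^bsub>L\<^esub> br u v"
  using add_map_neg[OF br_add_map_left L_group L_group] .

lemma anc_neg_left: "u \<in> carrier L \<Longrightarrow> a \<in> carrier A \<Longrightarrow> anc (\<ominus>\<^bsub>L\<^esub> u) a = \<ominus> anc u a"
  using add_map_neg[OF anc_add_map_left L_group A_group] .

abbreviation "jac u v w \<equiv> br u (br v w) = br (br u v) w \<oplus>\<^bsub>L\<^esub> br v (br u w)"
abbreviation "anc_rep u v \<equiv> \<forall>a\<in>carrier A. anc u (anc v a) = anc (br u v) a \<oplus> anc v (anc u a)"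

lemma anc_rep_swap:
  assumes "u \<in> carrier L" "v \<in> carrier L" "anc_rep u v"
  shows "anc_rep v u"
proof
  fix a assume a: "a \<in> carrier A"
  have "anc (br v u) a \<oplus> anc u (anc v a) = anc (br v u) a \<oplus> (anc (br u v) a \<oplus> anc v (anc u a))"
    using assms(3) a by simp
  also have "\<dots> = anc v (anc u a)"
    using a assms(1,2) br_anti[OF assms(1,2)] anc_closed br_closed
    by (simp add: anc_neg_left A.r_neg1)
  finally show "anc v (anc u a) = anc (br v u) a \<oplus> anc u (anc v a)" by simp
qed

text \<open>Replacing \<open>v\<close> by \<open>c v\<close> adds \<open>anc u c\<close> times
  \<open>anc v a\<close> to both sides: on the left by the Leibniz rule of \<open>anc u\<close>, on
  the right through the anchor term of \<open>br_smult\<close>.\<close>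

lemma anc_rep_submodule:
  assumes u: "u \<in> carrier L"
  shows "submodule {v \<in> carrier L. anc_rep u v} A L"
proof (rule L.submoduleI)
  show add: "v \<oplus>\<^bsub>L\<^esub> w \<in> {v \<in> carrier L. anc_rep u v}"
    if "v \<in> {v \<in> carrier L. anc_rep u v}" "w \<in> {v \<in> carrier L. anc_rep u v}" for v w
    using that u by (auto simp: anc_add_left anc_add br_add anc_closed br_closed A.a_ac)
  show sm: "c \<odot>\<^bsub>L\<^esub> v \<in> {v \<in> carrier L. anc_rep u v}"
    if "c \<in> carrier A" "v \<in> {v \<in> carrier L. anc_rep u v}" for c v
  proof -
    have "anc u (anc (c \<odot>\<^bsub>L\<^esub> v) a) = anc (br u (c \<odot>\<^bsub>L\<^esub> v)) a \<oplus> anc (c \<odot>\<^bsub>L\<^esub> v) (anc u a)"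
      if a: "a \<in> carrier A" for a
    proof -
      have v: "v \<in> carrier L" "anc u (anc v a) = anc (br u v) a \<oplus> anc v (anc u a)"
        using \<open>v \<in> {v \<in> carrier L. anc_rep u v}\<close> a by auto
      show ?thesis
        using u a v(1) \<open>c \<in> carrier A\<close>
        by (simp add: anc_smult_left anc_mult br_smult anc_add_left anc_closed br_closed v(2) A.r_distr A.a_ac A.m_comm[of "anc v a"])
    qed
    then show ?thesis using that by auto
  qed
  show "\<ominus>\<^bsub>L\<^esub> v \<in> {v \<in> carrier L. anc_rep u v}" if "v \<in> {v \<in> carrier L. anc_rep u v}" for v
    using sm[of "\<ominus> \<one>" v] that by (simp add: L.smult_l_minus)
  show "\<zero>\<^bsub>L\<^esub> \<in> {v \<in> carrier L. anc_rep u v}"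
    using u add_map_zero[OF anc_add_map_left L_group A_group] add_map_zero[OF br_add_map[OF u] L_group L_group]
    by (auto simp: anc_closed anc_zero)
qed auto

text \<open>\<open>jac_submodule\<close> frees only the last argument from a generating set.
  Together with \<open>jac_swap23\<close> this transposition brings each argument in turn to the
  last place.\<close>

lemma jac_swap12:
  assumes "u \<in> carrier L" "v \<in> carrier L" "w \<in> carrier L" "jac u v w"
  shows "jac v u w"
proof -
  have "br (br v u) w \<oplus>\<^bsub>L\<^esub> br u (br v w) = br (br v u) w \<oplus>\<^bsub>L\<^esub> (br (br u v) w \<oplus>\<^bsub>L\<^esub> br v (br u w))"
    using assms(4) by simp
  also have "\<dots> = br v (br u w)"
    using assms(1-3) br_anti[OF assms(1,2)] br_closed by (simp add: br_neg_left L.M.r_neg1)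
  finally show ?thesis by simp
qed

lemma jac_swap23:
  assumes "u \<in> carrier L" "v \<in> carrier L" "w \<in> carrier L" "jac u v w"
  shows "jac u w v"
proof -
  have "br u (br w v) = \<ominus>\<^bsub>L\<^esub> br u (br v w)"
    using assms(1-3) br_anti[OF assms(2,3)] br_closed by (simp add: br_neg)
  also have "\<dots> = \<ominus>\<^bsub>L\<^esub> br (br u v) w \<oplus>\<^bsub>L\<^esub> \<ominus>\<^bsub>L\<^esub> br v (br u w)"
    using assms br_closed by (simp add: L.M.minus_add)
  also have "\<dots> = br (br u w) v \<oplus>\<^bsub>L\<^esub> br w (br u v)"
    using assms(1-3) br_anti[of "br u v" w] br_anti[of v "br u w"] br_closed by (simp add: L.M.a_comm)
  finally show ?thesis .
qed

text \<open>For a multiple \<open>c w\<close> the terms with a first derivative of \<open>c\<close>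
  match crosswise. What remains are multiples of \<open>w\<close> itself, and these match by
  \<open>anc_rep u v\<close> applied to \<open>c\<close>.\<close>

lemma jac_submodule:
  assumes u: "u \<in> carrier L" and v: "v \<in> carrier L" and rep: "anc_rep u v"
  shows "submodule {w \<in> carrier L. jac u v w} A L"
proof (rule L.submoduleI)
  show add: "w \<oplus>\<^bsub>L\<^esub> z \<in> {w \<in> carrier L. jac u v w}"
    if "w \<in> {w \<in> carrier L. jac u v w}" "z \<in> {w \<in> carrier L. jac u v w}" for w z
    using that u v by (auto simp: br_add br_closed L.M.a_ac)
  show sm: "c \<odot>\<^bsub>L\<^esub> w \<in> {w \<in> carrier L. jac u v w}"
    if "c \<in> carrier A" "w \<in> {w \<in> carrier L. jac u v w}" for c w
  proof -
    have w: "w \<in> carrier L" "jac u v w" and c: "c \<in> carrier A"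
      using that by auto
    have "br u (br v (c \<odot>\<^bsub>L\<^esub> w)) =
        (c \<odot>\<^bsub>L\<^esub> br u (br v w) \<oplus>\<^bsub>L\<^esub> anc u c \<odot>\<^bsub>L\<^esub> br v w)
        \<oplus>\<^bsub>L\<^esub> (anc v c \<odot>\<^bsub>L\<^esub> br u w \<oplus>\<^bsub>L\<^esub> anc u (anc v c) \<odot>\<^bsub>L\<^esub> w)"
      using u v w(1) c by (simp add: br_smult br_add anc_closed br_closed)
    also have "\<dots> = (c \<odot>\<^bsub>L\<^esub> br (br u v) w \<oplus>\<^bsub>L\<^esub> c \<odot>\<^bsub>L\<^esub> br v (br u w) \<oplus>\<^bsub>L\<^esub> anc u c \<odot>\<^bsub>L\<^esub> br v w)
        \<oplus>\<^bsub>L\<^esub> (anc v c \<odot>\<^bsub>L\<^esub> br u w \<oplus>\<^bsub>L\<^esub> (anc (br u v) c \<odot>\<^bsub>L\<^esub> w \<oplus>\<^bsub>L\<^esub> anc v (anc u c) \<odot>\<^bsub>L\<^esub> w))"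
      using u v w c rep by (simp add: anc_closed br_closed L.smult_r_distr L.smult_l_distr)
    also have "\<dots> = br (br u v) (c \<odot>\<^bsub>L\<^esub> w) \<oplus>\<^bsub>L\<^esub> br v (br u (c \<odot>\<^bsub>L\<^esub> w))"
      using u v w(1) c by (simp add: br_smult br_add anc_closed br_closed L.M.a_ac)
    finally show ?thesis using w c by simp
  qed
  show "\<ominus>\<^bsub>L\<^esub> w \<in> {w \<in> carrier L. jac u v w}" if "w \<in> {w \<in> carrier L. jac u v w}" for w
    using sm[of "\<ominus> \<one>" w] that by (simp add: L.smult_l_minus)
  show "\<zero>\<^bsub>L\<^esub> \<in> {w \<in> carrier L. jac u v w}"
    using u v add_map_zero[OF br_add_map L_group L_group] br_closed by auto
qed auto

end

locale lie_rinehart = pre_lie_rinehart A L br anc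
  for A :: "('a, 'm) ring_scheme" (structure) and L :: "('a, 'l, 'n) module_scheme"
    and br :: "'l \<Rightarrow> 'l \<Rightarrow> 'l" and anc :: "'l \<Rightarrow> 'a \<Rightarrow> 'a" +
  assumes jacobi: "u \<in> carrier L \<Longrightarrow> v \<in> carrier L \<Longrightarrow> w \<in> carrier L \<Longrightarrow> jac u v w"
    and anc_br: "u \<in> carrier L \<Longrightarrow> v \<in> carrier L \<Longrightarrow> a \<in> carrier A \<Longrightarrow>
      anc u (anc v a) = anc (br u v) a \<oplus> anc v (anc u a)"

text \<open>The defects of both axioms are tensorial, so it suffices to check them on generators.\<close>

lemma (in pre_lie_rinehart) lie_rinehart_by_generators:
  assumes G: "G \<subseteq> carrier L" and gen: "\<And>T. submodule T A L \<Longrightarrow> G \<subseteq> T \<Longrightarrow> carrier L \<subseteq> T"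
    and rep: "\<And>u v. u \<in> G \<Longrightarrow> v \<in> G \<Longrightarrow> anc_rep u v"
    and jac: "\<And>u v w. u \<in> G \<Longrightarrow> v \<in> G \<Longrightarrow> w \<in> G \<Longrightarrow> jac u v w"
  shows "lie_rinehart A L br anc"
proof -
  have sub: "u \<in> carrier L" if "u \<in> G" for u using G that by blast
  have rep1: "anc_rep u v" if "u \<in> G" "v \<in> carrier L" for u v
    using gen[OF anc_rep_submodule[OF sub[OF that(1)]]] rep[OF that(1)] G that(2) by blast
  have rep2: "anc_rep u v" if "u \<in> carrier L" "v \<in> carrier L" for u v
  proof -
    have "anc_rep u w" if "w \<in> G" for w
      using anc_rep_swap[OF sub[OF that] \<open>u \<in> carrier L\<close> rep1[OF that \<open>u \<in> carrier L\<close>]] .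
    then show ?thesis
      using gen[OF anc_rep_submodule[OF that(1)]] G that(2) by blast
  qed
  have jac1: "jac u v w" if "u \<in> G" "v \<in> G" "w \<in> carrier L" for u v w
    using gen[OF jac_submodule[OF sub[OF that(1)] sub[OF that(2)] rep2[OF sub[OF that(1)] sub[OF that(2)]]]]
      jac[OF that(1,2)] G that(3) by blast
  have jac2: "jac u v w" if "u \<in> G" "v \<in> carrier L" "w \<in> carrier L" for u v w
  proof -
    have "jac u v z" if "z \<in> G" for z
      using jac_swap23[OF sub[OF \<open>u \<in> G\<close>] sub[OF that] \<open>v \<in> carrier L\<close> jac1[OF \<open>u \<in> G\<close> that \<open>v \<in> carrier L\<close>]] .
    then show ?thesis
      using gen[OF jac_submodule[OF sub[OF that(1)] that(2) rep2[OF sub[OF that(1)] that(2)]]] G that(3) by blast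
  qed
  have jac3: "jac u v w" if "u \<in> carrier L" "v \<in> carrier L" "w \<in> carrier L" for u v w
  proof -
    have "jac u v z" if "z \<in> G" for z
    proof -
      have "jac u z v"
        by (rule jac_swap12[OF sub[OF that] \<open>u \<in> carrier L\<close> \<open>v \<in> carrier L\<close> jac2[OF that \<open>u \<in> carrier L\<close> \<open>v \<in> carrier L\<close>]])
      then show ?thesis
        by (rule jac_swap23[OF \<open>u \<in> carrier L\<close> sub[OF that] \<open>v \<in> carrier L\<close>])
    qed
    then show ?thesis
      using gen[OF jac_submodule[OF that(1,2) rep2[OF that(1,2)]]] G that(3) by blast
  qed
  show ?thesis
    using rep2 jac3 by unfold_locales blast+
qed

section \<open>The Lie--Rinehart structure on the differentials of a Poisson algebra\<close>

definition self_module :: "('a, 'm) ring_scheme \<Rightarrow> ('a, 'a) module" where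
  "self_module A = \<lparr>carrier = carrier A, monoid.mult = monoid.mult A, one = one A, zero = zero A, add = add A, smult = monoid.mult A\<rparr>"

lemma self_module_simps [simp]:
  "carrier (self_module A) = carrier A" "zero (self_module A) = zero A"
  "add (self_module A) = add A" "smult (self_module A) = monoid.mult A"
  by (simp_all add: self_module_def)

lemma (in cring) self_module_module: "module R (self_module R)"
proof (rule moduleI)
  show "abelian_group (self_module R)"
    by (rule abelian_groupI) (use a_ac abelian_groupE(6)[OF is_abelian_group] in auto)
qed (auto simp: l_distr r_distr m_assoc is_cring)

lemma (in comm_algebra) Om_lin_eqI:
  assumes "h \<in> lin_hom A Om N" "k \<in> lin_hom A Om N" "abelian_group N" "\<omega> \<in> carrier Om"
    and "\<And>x. x \<in> carrier A \<Longrightarrow> h (d x) = k (d x)"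
  shows "h \<omega> = k \<omega>"
  using assms(5)
  by (intro Om_map_eqI[OF lin_hom_add_map[OF assms(1)] lin_hom_add_map[OF assms(2)] assms(3,4)])
     (simp add: lin_hom_smult[OF assms(1)] lin_hom_smult[OF assms(2)])

locale poisson_kaehler = comm_algebra R A
  for R :: "('r, 'c) ring_scheme" and A :: "('r, 'a) poisson" (structure) +
  assumes poisson: "poisson_algebra R A"
begin

abbreviation pb :: "'a \<Rightarrow> 'a \<Rightarrow> 'a" where "pb \<equiv> bracket A"

lemmas pb_closed = poisson_algebra.bracket_closed[OF poisson]
  and pb_add_left = poisson_algebra.bracket_add_left[OF poisson]
  and pb_add = poisson_algebra.bracket_add_right[OF poisson]
  and pb_smult_left = poisson_algebra.bracket_smult_left[OF poisson]
  and pb_smult = poisson_algebra.bracket_smult_right[OF poisson]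
  and pb_alt = poisson_algebra.bracket_alternating[OF poisson]
  and pb_leibniz_left = poisson_algebra.bracket_leibniz[OF poisson]

lemma pb_anti:
  assumes "x \<in> carrier A" "y \<in> carrier A"
  shows "pb y x = \<ominus> pb x y"
proof -
  have "pb (x \<oplus> y) x \<oplus> pb (x \<oplus> y) y = \<zero>"
    using assms pb_add[of "x \<oplus> y" x y] pb_alt[of "x \<oplus> y"] by simp
  then have "pb y x \<oplus> pb x y = \<zero>"
    using assms pb_closed pb_alt by (simp add: pb_add_left)
  then show ?thesis
    using A.minus_equality assms pb_closed by metis
qed

lemma pb_leibniz:
  assumes "x \<in> carrier A" "y \<in> carrier A" "z \<in> carrier A"
  shows "pb x (y \<otimes> z) = y \<otimes> pb x z \<oplus> z \<otimes> pb x y"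
proof -
  have "pb x (y \<otimes> z) = \<ominus> pb (y \<otimes> z) x"
    using pb_anti[of "y \<otimes> z" x] assms by simp
  also have "\<dots> = \<ominus> (y \<otimes> pb z x \<oplus> z \<otimes> pb y x)"
    using pb_leibniz_left assms by simp
  also have "\<dots> = y \<otimes> pb x z \<oplus> z \<otimes> pb x y"
    using assms pb_anti[of x z] pb_anti[of x y] pb_closed by (simp add: A.r_minus A.minus_add)
  finally show ?thesis .
qed

lemma pb_jacobi:
  assumes "x \<in> carrier A" "y \<in> carrier A" "z \<in> carrier A"
  shows "pb x (pb y z) = pb (pb x y) z \<oplus> pb y (pb x z)"
proof -
  have "pb y \<in> add_map A A"
    using assms by (intro add_mapI pb_closed pb_add)
  then have xz: "pb y (pb z x) = \<ominus> pb y (pb x z)"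
    using assms pb_anti[of x z] pb_closed add_map_neg[of "pb y" A A "pb x z"] A.is_abelian_group
    by simp
  have "pb x (pb y z) \<oplus> \<ominus> pb y (pb x z) \<oplus> \<ominus> pb (pb x y) z = \<zero>"
    using poisson_algebra.bracket_jacobi[OF poisson assms] xz pb_anti[of "pb x y" z] assms pb_closed by simp
  then have "pb x (pb y z) \<ominus> (pb (pb x y) z \<oplus> pb y (pb x z)) = \<zero>"
    using assms pb_closed by (simp add: A.minus_eq A.minus_add A.a_ac)
  then show ?thesis
    using assms pb_closed A.minus_eq_zero_iff by simp
qed

lemma pb_one: "x \<in> carrier A \<Longrightarrow> pb x \<one> = \<zero>"
  using pb_leibniz[of x \<one> \<one>] pb_closed[of x \<one>] A.add.r_cancel_one' by simp

text \<open>The anchor, that is, the Hamiltonian derivation attached to a differential. The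
  extension from the \<open>d x\<close> to all differentials is made for one fixed \<open>b\<close>
  at a time, so additivity and the Leibniz rule in \<open>b\<close> have to be recovered afterwards
  from their validity on the \<open>d x\<close>.\<close>

definition anch :: "('a \<Rightarrow> 'a) set \<Rightarrow> 'a \<Rightarrow> 'a" where
  "anch \<omega> b = (SOME \<Psi>. \<Psi> \<in> lin_hom A Om (self_module A) \<and> (\<forall>x\<in>carrier A. \<Psi> (d x) = pb x b)) \<omega>"

lemma anch_props:
  assumes b: "b \<in> carrier A"
  shows "(\<lambda>\<omega>. anch \<omega> b) \<in> lin_hom A Om (self_module A)" "\<And>x. x \<in> carrier A \<Longrightarrow> anch (d x) b = pb x b"
proof -
  have "\<exists>\<Psi>. \<Psi> \<in> lin_hom A Om (self_module A) \<and> (\<forall>x\<in>carrier A. \<Psi> (d x) = pb x b)"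
  proof (rule kaehler_linear_extension[OF A.self_module_module, of "\<lambda>x. pb x b"])
    show "(\<lambda>x. pb x b) \<in> add_map A (self_module A)"
      using b by (auto intro!: add_mapI simp: pb_closed pb_add_left)
    show "pb (r \<odot> x) b = ofR r \<odot>\<^bsub>self_module A\<^esub> pb x b" if "r \<in> carrier R" "x \<in> carrier A" for r x
      using that b pb_closed ofR_mult by (simp add: pb_smult_left)
  qed (use b in \<open>auto simp: pb_leibniz_left\<close>)
  from someI_ex[OF this]
  show "(\<lambda>\<omega>. anch \<omega> b) \<in> lin_hom A Om (self_module A)" "\<And>x. x \<in> carrier A \<Longrightarrow> anch (d x) b = pb x b"
    unfolding anch_def by auto
qed

lemma anch_closed: "\<omega> \<in> carrier Om \<Longrightarrow> b \<in> carrier A \<Longrightarrow> anch \<omega> b \<in> carrier A"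
  using lin_hom_closed[OF anch_props(1)] by simp

lemma anch_add_left: "\<omega> \<in> carrier Om \<Longrightarrow> \<eta> \<in> carrier Om \<Longrightarrow> b \<in> carrier A \<Longrightarrow>
    anch (\<omega> \<oplus>\<^bsub>Om\<^esub> \<eta>) b = anch \<omega> b \<oplus> anch \<eta> b"
  using add_map_add[OF lin_hom_add_map[OF anch_props(1)]] by simp

lemma anch_smult_left: "c \<in> carrier A \<Longrightarrow> \<omega> \<in> carrier Om \<Longrightarrow> b \<in> carrier A \<Longrightarrow>
    anch (c \<odot>\<^bsub>Om\<^esub> \<omega>) b = c \<otimes> anch \<omega> b"
  using lin_hom_smult[OF anch_props(1)] by simp

lemma self_group: "abelian_group (self_module A)"
  using A.self_module_module module.axioms(2) by blast

lemma anch_add: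
  assumes "\<omega> \<in> carrier Om" "a \<in> carrier A" "b \<in> carrier A"
  shows "anch \<omega> (a \<oplus> b) = anch \<omega> a \<oplus> anch \<omega> b"
  by (rule Om_lin_eqI[OF _ _ self_group assms(1), of "\<lambda>\<omega>. anch \<omega> (a \<oplus> b)" "\<lambda>\<omega>. anch \<omega> a \<oplus> anch \<omega> b"])
     (use assms in \<open>auto intro!: anch_props(1) lin_homI simp: anch_closed anch_add_left anch_smult_left
        anch_props(2) pb_add A.r_distr A.a_ac\<close>)

lemma anch_mult:
  assumes "\<omega> \<in> carrier Om" "a \<in> carrier A" "b \<in> carrier A"
  shows "anch \<omega> (a \<otimes> b) = a \<otimes> anch \<omega> b \<oplus> b \<otimes> anch \<omega> a"
  by (rule Om_lin_eqI[OF _ _ self_group assms(1), of "\<lambda>\<omega>. anch \<omega> (a \<otimes> b)" "\<lambda>\<omega>. a \<otimes> anch \<omega> b \<oplus> b \<otimes> anch \<omega> a"])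
     (use assms in \<open>auto intro!: anch_props(1) lin_homI simp: anch_closed anch_add_left anch_smult_left
        anch_props(2) pb_leibniz A.r_distr A.a_ac A.m_lcomm\<close>)

lemma anch_ofR:
  assumes "\<omega> \<in> carrier Om" "r \<in> carrier R"
  shows "anch \<omega> (ofR r) = \<zero>"
  by (rule Om_lin_eqI[OF _ _ self_group assms(1), of "\<lambda>\<omega>. anch \<omega> (ofR r)" "\<lambda>\<omega>. \<zero>"])
     (use assms in \<open>auto intro!: anch_props(1) lin_homI simp: anch_props(2) pb_smult pb_one\<close>)

lemma anch_derivation: "\<omega> \<in> carrier Om \<Longrightarrow> derivation (anch \<omega>)"
  unfolding derivation_def
  by (auto intro!: add_mapI simp: anch_closed anch_add anch_mult anch_ofR)

text \<open>The Poisson bivector as a bilinear form on differentials, with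
  \<open>pair (d x) (d y) = pb x y\<close>.\<close>

definition pair :: "('a \<Rightarrow> 'a) set \<Rightarrow> ('a \<Rightarrow> 'a) set \<Rightarrow> 'a" where
  "pair \<omega> = (SOME \<Psi>. \<Psi> \<in> lin_hom A Om (self_module A) \<and> (\<forall>y\<in>carrier A. \<Psi> (d y) = anch \<omega> y))"

lemma anch_smult: "\<omega> \<in> carrier Om \<Longrightarrow> r \<in> carrier R \<Longrightarrow> x \<in> carrier A \<Longrightarrow> anch \<omega> (r \<odot> x) = ofR r \<otimes> anch \<omega> x"
  using anch_mult[of \<omega> "ofR r" x] by (simp add: ofR_mult anch_ofR anch_closed)

lemma pair_props:
  assumes \<omega>: "\<omega> \<in> carrier Om"
  shows "pair \<omega> \<in> lin_hom A Om (self_module A)" "\<And>y. y \<in> carrier A \<Longrightarrow> pair \<omega> (d y) = anch \<omega> y"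
proof -
  have "\<exists>\<Psi>. \<Psi> \<in> lin_hom A Om (self_module A) \<and> (\<forall>y\<in>carrier A. \<Psi> (d y) = anch \<omega> y)"
  proof (rule kaehler_linear_extension[OF A.self_module_module, of "anch \<omega>"])
    show "anch \<omega> \<in> add_map A (self_module A)"
      using \<omega> by (auto intro!: add_mapI simp: anch_closed anch_add)
  qed (use \<omega> in \<open>auto simp: anch_mult anch_smult\<close>)
  from someI_ex[OF this]
  show "pair \<omega> \<in> lin_hom A Om (self_module A)" "\<And>y. y \<in> carrier A \<Longrightarrow> pair \<omega> (d y) = anch \<omega> y"
    unfolding pair_def by auto
qed

lemma pair_closed: "\<omega> \<in> carrier Om \<Longrightarrow> \<eta> \<in> carrier Om \<Longrightarrow> pair \<omega> \<eta> \<in> carrier A"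
  using lin_hom_closed[OF pair_props(1)] by simp

lemma pair_add: "\<omega> \<in> carrier Om \<Longrightarrow> \<eta> \<in> carrier Om \<Longrightarrow> \<zeta> \<in> carrier Om \<Longrightarrow>
    pair \<omega> (\<eta> \<oplus>\<^bsub>Om\<^esub> \<zeta>) = pair \<omega> \<eta> \<oplus> pair \<omega> \<zeta>"
  using add_map_add[OF lin_hom_add_map[OF pair_props(1)]] by simp

lemma pair_smult: "\<omega> \<in> carrier Om \<Longrightarrow> c \<in> carrier A \<Longrightarrow> \<eta> \<in> carrier Om \<Longrightarrow>
    pair \<omega> (c \<odot>\<^bsub>Om\<^esub> \<eta>) = c \<otimes> pair \<omega> \<eta>"
  using lin_hom_smult[OF pair_props(1)] by simp

lemma pair_add_left:
  assumes "\<omega> \<in> carrier Om" "\<omega>' \<in> carrier Om" "\<eta> \<in> carrier Om"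
  shows "pair (\<omega> \<oplus>\<^bsub>Om\<^esub> \<omega>') \<eta> = pair \<omega> \<eta> \<oplus> pair \<omega>' \<eta>"
  by (rule Om_lin_eqI[OF _ _ self_group assms(3), of "pair (\<omega> \<oplus>\<^bsub>Om\<^esub> \<omega>')" "\<lambda>\<eta>. pair \<omega> \<eta> \<oplus> pair \<omega>' \<eta>"])
     (use assms in \<open>auto intro!: pair_props(1) lin_homI simp: pair_closed pair_add pair_smult
        pair_props(2) anch_add_left A.r_distr A.a_ac\<close>)

lemma pair_smult_left:
  assumes "c \<in> carrier A" "\<omega> \<in> carrier Om" "\<eta> \<in> carrier Om"
  shows "pair (c \<odot>\<^bsub>Om\<^esub> \<omega>) \<eta> = c \<otimes> pair \<omega> \<eta>"
  by (rule Om_lin_eqI[OF _ _ self_group assms(3), of "pair (c \<odot>\<^bsub>Om\<^esub> \<omega>)" "\<lambda>\<eta>. c \<otimes> pair \<omega> \<eta>"])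
     (use assms in \<open>auto intro!: pair_props(1) lin_homI simp: pair_closed pair_add pair_smult
        pair_props(2) anch_smult_left A.r_distr A.m_lcomm\<close>)

lemma pair_d_left:
  assumes "x \<in> carrier A" "\<eta> \<in> carrier Om"
  shows "pair (d x) \<eta> = \<ominus> anch \<eta> x"
  by (rule Om_lin_eqI[OF _ _ self_group assms(2), of "pair (d x)" "\<lambda>\<eta>. \<ominus> anch \<eta> x"])
     (use assms pb_anti[of _ x] in \<open>auto intro!: pair_props(1) lin_homI simp: anch_closed anch_add_left anch_smult_left
        pair_props(2) anch_props(2) A.minus_add A.r_minus\<close>)

lemma pair_anti:
  assumes "\<omega> \<in> carrier Om" "\<eta> \<in> carrier Om"
  shows "pair \<eta> \<omega> = \<ominus> pair \<omega> \<eta>"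
  by (rule Om_lin_eqI[OF _ _ self_group assms(1), of "pair \<eta>" "\<lambda>\<omega>. \<ominus> pair \<omega> \<eta>"])
     (use assms in \<open>auto intro!: pair_props(1) lin_homI simp: pair_closed pair_add_left pair_smult_left
        pair_props(2) pair_d_left anch_closed A.minus_add A.r_minus\<close>)

text \<open>Antisymmetry yields only that twice \<open>pair \<omega> \<omega>\<close> vanishes, so
  alternation is derived by additive induction: the diagonal terms vanish by \<open>pb_alt\<close>,
  the mixed ones cancel by antisymmetry.\<close>

lemma pair_alt:
  assumes "\<omega> \<in> carrier Om"
  shows "pair \<omega> \<omega> = \<zero>"
  using Om_span[OF assms]
proof induction
  case zero
  show ?case
    using add_map_zero[OF lin_hom_add_map[OF pair_props(1)] Om_group self_group] by simp
next
  case (add g \<omega>)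
  obtain a x where g: "g = a \<odot>\<^bsub>Om\<^esub> d x" "a \<in> carrier A" "x \<in> carrier A"
    using add(1) by (auto simp: differentials_def)
  have c: "g \<in> carrier Om" "\<omega> \<in> carrier Om"
    using g Om.M.add_span_closed[OF differentials_closed add(2)] by auto
  have "pair g g = \<zero>"
    using g by (simp add: pair_smult pair_smult_left pair_props(2) anch_smult_left anch_props(2) pb_alt)
  then show ?case
    using c add.IH pair_anti[OF c] pair_closed by (simp add: pair_add pair_add_left A.l_neg)
qed

definition Lie :: "('a \<Rightarrow> 'a) set \<Rightarrow> ('a \<Rightarrow> 'a) set \<Rightarrow> ('a \<Rightarrow> 'a) set" where
  "Lie \<omega> = (SOME L. L \<in> add_map Om Om \<and>
     (\<forall>a\<in>carrier A. \<forall>\<eta>\<in>carrier Om. L (a \<odot>\<^bsub>Om\<^esub> \<eta>) = a \<odot>\<^bsub>Om\<^esub> L \<eta> \<oplus>\<^bsub>Om\<^esub> anch \<omega> a \<odot>\<^bsub>Om\<^esub> \<eta>) \<and>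
     (\<forall>x\<in>carrier A. L (d x) = d (anch \<omega> x)))"

lemma Lie_props:
  assumes \<omega>: "\<omega> \<in> carrier Om"
  shows "Lie \<omega> \<in> add_map Om Om"
    "\<And>a \<eta>. a \<in> carrier A \<Longrightarrow> \<eta> \<in> carrier Om \<Longrightarrow> Lie \<omega> (a \<odot>\<^bsub>Om\<^esub> \<eta>) = a \<odot>\<^bsub>Om\<^esub> Lie \<omega> \<eta> \<oplus>\<^bsub>Om\<^esub> anch \<omega> a \<odot>\<^bsub>Om\<^esub> \<eta>"
    "\<And>x. x \<in> carrier A \<Longrightarrow> Lie \<omega> (d x) = d (anch \<omega> x)"
proof -
  have "\<exists>L. L \<in> add_map Om Om \<and>
     (\<forall>a\<in>carrier A. \<forall>\<eta>\<in>carrier Om. L (a \<odot>\<^bsub>Om\<^esub> \<eta>) = a \<odot>\<^bsub>Om\<^esub> L \<eta> \<oplus>\<^bsub>Om\<^esub> anch \<omega> a \<odot>\<^bsub>Om\<^esub> \<eta>) \<and>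
     (\<forall>x\<in>carrier A. L (d x) = d (anch \<omega> x))"
    by (rule kaehler_lie_derivative[OF anch_derivation[OF \<omega>]]) blast
  from someI_ex[OF this]
  show "Lie \<omega> \<in> add_map Om Om"
    "\<And>a \<eta>. a \<in> carrier A \<Longrightarrow> \<eta> \<in> carrier Om \<Longrightarrow> Lie \<omega> (a \<odot>\<^bsub>Om\<^esub> \<eta>) = a \<odot>\<^bsub>Om\<^esub> Lie \<omega> \<eta> \<oplus>\<^bsub>Om\<^esub> anch \<omega> a \<odot>\<^bsub>Om\<^esub> \<eta>"
    "\<And>x. x \<in> carrier A \<Longrightarrow> Lie \<omega> (d x) = d (anch \<omega> x)"
    unfolding Lie_def by blast+
qed

lemma Lie_closed: "\<omega> \<in> carrier Om \<Longrightarrow> \<eta> \<in> carrier Om \<Longrightarrow> Lie \<omega> \<eta> \<in> carrier Om"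
  by (rule add_map_closed[OF Lie_props(1)])

lemma Lie_add: "\<omega> \<in> carrier Om \<Longrightarrow> \<eta> \<in> carrier Om \<Longrightarrow> \<zeta> \<in> carrier Om \<Longrightarrow>
    Lie \<omega> (\<eta> \<oplus>\<^bsub>Om\<^esub> \<zeta>) = Lie \<omega> \<eta> \<oplus>\<^bsub>Om\<^esub> Lie \<omega> \<zeta>"
  by (rule add_map_add[OF Lie_props(1)])

lemma Lie_add_left:
  assumes "\<omega> \<in> carrier Om" "\<omega>' \<in> carrier Om" "\<eta> \<in> carrier Om"
  shows "Lie (\<omega> \<oplus>\<^bsub>Om\<^esub> \<omega>') \<eta> = Lie \<omega> \<eta> \<oplus>\<^bsub>Om\<^esub> Lie \<omega>' \<eta>"
proof (rule Om_map_eqI[OF _ _ Om_group assms(3), of "Lie (\<omega> \<oplus>\<^bsub>Om\<^esub> \<omega>')" "\<lambda>\<eta>. Lie \<omega> \<eta> \<oplus>\<^bsub>Om\<^esub> Lie \<omega>' \<eta>"])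
  show "Lie (\<omega> \<oplus>\<^bsub>Om\<^esub> \<omega>') \<in> add_map Om Om" "(\<lambda>\<eta>. Lie \<omega> \<eta> \<oplus>\<^bsub>Om\<^esub> Lie \<omega>' \<eta>) \<in> add_map Om Om"
    using assms by (auto intro!: Lie_props(1) add_map_plus[OF Om_group])
qed (use assms in \<open>simp add: Lie_props(2,3) anch_add_left anch_closed d_add
        Om.smult_l_distr Om.smult_r_distr Om.M.a_ac\<close>)

text \<open>The last term stems from the derivative of the product of \<open>c\<close> and
  \<open>anch \<omega> x\<close>. In \<open>kbr\<close> it cancels against the derivative of the
  pairing, which leaves the Leibniz rule of a Lie--Rinehart bracket.\<close>

lemma Lie_smult_left:
  assumes "c \<in> carrier A" "\<omega> \<in> carrier Om" "\<eta> \<in> carrier Om"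
  shows "Lie (c \<odot>\<^bsub>Om\<^esub> \<omega>) \<eta> = c \<odot>\<^bsub>Om\<^esub> Lie \<omega> \<eta> \<oplus>\<^bsub>Om\<^esub> pair \<omega> \<eta> \<odot>\<^bsub>Om\<^esub> d c"
proof (rule Om_map_eqI[OF _ _ Om_group assms(3), of "Lie (c \<odot>\<^bsub>Om\<^esub> \<omega>)" "\<lambda>\<eta>. c \<odot>\<^bsub>Om\<^esub> Lie \<omega> \<eta> \<oplus>\<^bsub>Om\<^esub> pair \<omega> \<eta> \<odot>\<^bsub>Om\<^esub> d c"])
  show "Lie (c \<odot>\<^bsub>Om\<^esub> \<omega>) \<in> add_map Om Om"
    using assms by (auto intro!: Lie_props(1))
  show "(\<lambda>\<eta>. c \<odot>\<^bsub>Om\<^esub> Lie \<omega> \<eta> \<oplus>\<^bsub>Om\<^esub> pair \<omega> \<eta> \<odot>\<^bsub>Om\<^esub> d c) \<in> add_map Om Om"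
    using assms by (intro add_mapI)
      (auto simp: Lie_add Lie_closed pair_add pair_closed Om.smult_l_distr Om.smult_r_distr Om.M.a_ac)
  fix a x assume a: "a \<in> carrier A" and x: "x \<in> carrier A"
  show "Lie (c \<odot>\<^bsub>Om\<^esub> \<omega>) (a \<odot>\<^bsub>Om\<^esub> d x)
      = c \<odot>\<^bsub>Om\<^esub> Lie \<omega> (a \<odot>\<^bsub>Om\<^esub> d x) \<oplus>\<^bsub>Om\<^esub> pair \<omega> (a \<odot>\<^bsub>Om\<^esub> d x) \<odot>\<^bsub>Om\<^esub> d c"
    using a x assms
    by (simp add: Lie_props(2,3) anch_smult_left pair_smult pair_props(2) anch_closed d_mult
        Om.smult_r_distr Om.smult_assoc1 Om.smult_left_commute[of a c] Om.M.a_ac)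
qed

text \<open>The Koszul bracket of one-forms. \<open>Lie \<omega>\<close> is the Lie derivative along
  the derivation \<open>anch \<omega>\<close>, and the exact term corrects the difference of the two
  Lie derivatives so that it becomes linear in \<open>\<eta>\<close> up to the anchor term.\<close>

definition kbr :: "('a \<Rightarrow> 'a) set \<Rightarrow> ('a \<Rightarrow> 'a) set \<Rightarrow> ('a \<Rightarrow> 'a) set" where
  "kbr \<omega> \<eta> = Lie \<omega> \<eta> \<ominus>\<^bsub>Om\<^esub> (Lie \<eta> \<omega> \<oplus>\<^bsub>Om\<^esub> d (pair \<omega> \<eta>))"

lemma d_neg: "x \<in> carrier A \<Longrightarrow> d (\<ominus> x) = \<ominus>\<^bsub>Om\<^esub> d x"
  by (rule add_map_neg[OF d_add_map A.is_abelian_group Om_group])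

lemma d_zero: "d \<zero> = \<zero>\<^bsub>Om\<^esub>"
  by (rule add_map_zero[OF d_add_map A.is_abelian_group Om_group])

text \<open>The two Lie derivatives contribute \<open>d (pb x y)\<close> each, and the pairing term
  takes one of these away.\<close>

lemma kbr_d:
  assumes "x \<in> carrier A" "y \<in> carrier A"
  shows "kbr (d x) (d y) = d (pb x y)"
  using assms pb_anti[OF assms] pb_closed
  by (simp add: kbr_def Lie_props(3) anch_props(2) pair_props(2) d_neg a_minus_def Om.M.minus_add Om.M.l_neg)

lemma kaehler_pre: "pre_lie_rinehart A Om kbr anch"
proof
  fix u v w c assume u: "u \<in> carrier Om" and v: "v \<in> carrier Om"
  show "kbr u v \<in> carrier Om"
    using u v by (simp add: kbr_def Lie_closed pair_closed)
  show "kbr v u = \<ominus>\<^bsub>Om\<^esub> kbr u v"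
    using u v pair_anti[OF u v]
    by (simp add: kbr_def Lie_closed pair_closed d_neg a_minus_def Om.M.minus_add Om.M.a_ac)
  show "kbr u u = \<zero>\<^bsub>Om\<^esub>"
    using u by (simp add: kbr_def Lie_closed pair_alt d_zero a_minus_def Om.M.r_neg)
  show "kbr u (v \<oplus>\<^bsub>Om\<^esub> w) = kbr u v \<oplus>\<^bsub>Om\<^esub> kbr u w" if "w \<in> carrier Om"
    using u v that
    by (simp add: kbr_def Lie_closed Lie_add Lie_add_left pair_add pair_closed d_add a_minus_def Om.M.minus_add Om.M.a_ac)
  show "kbr u (c \<odot>\<^bsub>Om\<^esub> v) = c \<odot>\<^bsub>Om\<^esub> kbr u v \<oplus>\<^bsub>Om\<^esub> anch u c \<odot>\<^bsub>Om\<^esub> v" if c: "c \<in> carrier A"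
  proof -
    have cl: "Lie u v \<in> carrier Om" "Lie v u \<in> carrier Om" "pair u v \<in> carrier A" "anch u c \<in> carrier A"
      using u v c by (auto simp: Lie_closed pair_closed anch_closed)
    have "kbr u (c \<odot>\<^bsub>Om\<^esub> v) = (c \<odot>\<^bsub>Om\<^esub> Lie u v \<oplus>\<^bsub>Om\<^esub> anch u c \<odot>\<^bsub>Om\<^esub> v) \<ominus>\<^bsub>Om\<^esub>
        ((c \<odot>\<^bsub>Om\<^esub> Lie v u \<oplus>\<^bsub>Om\<^esub> \<ominus>\<^bsub>Om\<^esub> (pair u v \<odot>\<^bsub>Om\<^esub> d c)) \<oplus>\<^bsub>Om\<^esub> (c \<odot>\<^bsub>Om\<^esub> d (pair u v) \<oplus>\<^bsub>Om\<^esub> pair u v \<odot>\<^bsub>Om\<^esub> d c))"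
      using u v c cl pair_anti[OF u v]
      by (simp add: kbr_def Lie_props(2) Lie_smult_left pair_smult d_mult Om.smult_l_minus)
    also have "(c \<odot>\<^bsub>Om\<^esub> Lie v u \<oplus>\<^bsub>Om\<^esub> \<ominus>\<^bsub>Om\<^esub> (pair u v \<odot>\<^bsub>Om\<^esub> d c)) \<oplus>\<^bsub>Om\<^esub> (c \<odot>\<^bsub>Om\<^esub> d (pair u v) \<oplus>\<^bsub>Om\<^esub> pair u v \<odot>\<^bsub>Om\<^esub> d c)
        = c \<odot>\<^bsub>Om\<^esub> Lie v u \<oplus>\<^bsub>Om\<^esub> c \<odot>\<^bsub>Om\<^esub> d (pair u v)"
      using c cl by (simp add: Om.M.a_ac Om.M.l_neg Om.M.r_neg)
    also have "(c \<odot>\<^bsub>Om\<^esub> Lie u v \<oplus>\<^bsub>Om\<^esub> anch u c \<odot>\<^bsub>Om\<^esub> v) \<ominus>\<^bsub>Om\<^esub> (c \<odot>\<^bsub>Om\<^esub> Lie v u \<oplus>\<^bsub>Om\<^esub> c \<odot>\<^bsub>Om\<^esub> d (pair u v))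
        = c \<odot>\<^bsub>Om\<^esub> kbr u v \<oplus>\<^bsub>Om\<^esub> anch u c \<odot>\<^bsub>Om\<^esub> v"
      using u v c cl
      by (simp add: kbr_def a_minus_def Om.smult_r_distr Om.smult_r_minus Om.M.minus_add Om.M.a_ac)
    finally show ?thesis .
  qed
qed (auto simp: anch_closed anch_add anch_mult anch_add_left anch_smult_left)

text \<open>The exact differentials generate, and on them \<open>kbr_d\<close> turns both remaining
  axioms into the Jacobi identity of the Poisson bracket.\<close>

lemma kaehler_lie_rinehart: "lie_rinehart A Om kbr anch"
proof -
  interpret K: pre_lie_rinehart A Om kbr anch by (rule kaehler_pre)
  show ?thesis
  proof (rule K.lie_rinehart_by_generators[of "d ` carrier A"])
    fix T assume T: "submodule T A Om" "d ` carrier A \<subseteq> T"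
    interpret N: additive_subgroup T Om by (rule submodule_additive_subgroup[OF T(1)])
    show "carrier Om \<subseteq> T"
    proof
      fix \<omega> assume "\<omega> \<in> carrier Om"
      then show "\<omega> \<in> T"
        by (rule Om.M.add_span_least[OF Om_span])
           (use T in \<open>auto simp: differentials_def intro!: submodule.smult_closed[OF T(1)]\<close>)
    qed
  next
    fix u v assume "u \<in> d ` carrier A" "v \<in> d ` carrier A"
    then obtain x y where x: "x \<in> carrier A" "u = d x" and y: "y \<in> carrier A" "v = d y" by blast
    show "K.anc_rep u v"
      using x y pb_jacobi[OF x(1) y(1)] by (auto simp: kbr_d anch_props(2) pb_closed)
    fix w assume "w \<in> d ` carrier A"
    then obtain z where z: "z \<in> carrier A" "w = d z" by blast
    show "K.jac u v w"
      using x y z pb_jacobi[OF x(1) y(1) z(1)] by (simp add: kbr_d pb_closed d_add)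
  qed auto
qed

end

section \<open>The Poincare--Birkhoff--Witt theorem for free Lie--Rinehart algebras\<close>

declare free_module_simps [simp del]

text \<open>From here on sums in free modules stay folded, so that the module laws apply to them;
  this and the next lemma give the coefficientwise form where it is wanted.\<close>

lemma (in cring) free_module_add_apply:
  "(f \<oplus>\<^bsub>free_module R X\<^esub> g) x = f x \<oplus> g x"
  by (simp add: free_module_simps)

lemma (in cring) free_module_smult_apply:
  "(k \<odot>\<^bsub>free_module R X\<^esub> f) x = k \<otimes> f x"
  by (simp add: free_module_simps)

lemma (in cring) free_module_induct:
  assumes "f \<in> carrier (free_module R X)" "P \<zero>\<^bsub>free_module R X\<^esub>"
    and "\<And>x a. x \<in> X \<Longrightarrow> a \<in> carrier R \<Longrightarrow> P (single R x a)"
    and "\<And>f g. f \<in> carrier (free_module R X) \<Longrightarrow> g \<in> carrier (free_module R X) \<Longrightarrow>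
      P f \<Longrightarrow> P g \<Longrightarrow> P (f \<oplus>\<^bsub>free_module R X\<^esub> g)"
  shows "P f"
proof -
  interpret F: abelian_group "free_module R X" by (rule free_module_group)
  have "f \<in> {f \<in> carrier (free_module R X). P f}"
    by (rule F.add_span_least[OF free_module_span[OF assms(1)]])
       (use assms(2-4) single_closed in auto)
  then show ?thesis by simp
qed

text \<open>Freeness is expressed by a coordinate isomorphism \<open>co\<close> onto the free module
  over a whole type, which is the form in which the swindle delivers it. The order \<open>le\<close>
  singles out the smallest variable of a monomial.\<close>

locale lie_rinehart_basis = lie_rinehart A L br anc
  for A :: "('a, 'm) ring_scheme" (structure) and L :: "('a, 'l, 'n) module_scheme"
    and br :: "'l \<Rightarrow> 'l \<Rightarrow> 'l" and anc :: "'l \<Rightarrow> 'a \<Rightarrow> 'a" +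
  fixes co :: "'l \<Rightarrow> 'y \<Rightarrow> 'a" and le :: "'y \<Rightarrow> 'y \<Rightarrow> bool"
  assumes co_lin: "co \<in> lin_hom A L (free_module A UNIV)"
    and co_bij: "bij_betw co (carrier L) (carrier (free_module A UNIV))"
    and le_total: "le x y \<or> le y x"
    and le_trans: "le x y \<Longrightarrow> le y z \<Longrightarrow> le x z"
    and le_antisym: "le x y \<Longrightarrow> le y x \<Longrightarrow> x = y"
begin

text \<open>A multiset \<open>m\<close> of basis indices stands for a monomial, and \<open>S\<close> for the polynomial ring.\<close>

abbreviation F :: "('a, 'y \<Rightarrow> 'a) module" where "F \<equiv> free_module A UNIV"
abbreviation S :: "('a, 'y multiset \<Rightarrow> 'a) module" where "S \<equiv> free_module A UNIV"
abbreviation mon :: "'y multiset \<Rightarrow> 'y multiset \<Rightarrow> 'a" where "mon m \<equiv> basis_elt A m"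

sublocale S: module A S
  by (rule A.free_module_module)

lemma S_group: "abelian_group S" and S_module: "module A S"
  by unfold_locales

lemma mon_closed [simp]: "mon m \<in> carrier S"
  unfolding basis_elt_single by (rule A.single_closed) auto

lemma single_mon: "a \<in> carrier A \<Longrightarrow> single A m a = a \<odot>\<^bsub>S\<^esub> mon m"
  by (rule A.single_basis_elt)

definition e :: "'y \<Rightarrow> 'l" where "e k = inv_into (carrier L) co (basis_elt A k)"

lemma e_closed [simp]: "e k \<in> carrier L" and co_e: "co (e k) = basis_elt A k"
proof -
  have "basis_elt A k \<in> co ` carrier L"
    using A.single_closed[of k UNIV \<one>] co_bij by (simp add: bij_betw_def basis_elt_single)
  then show "e k \<in> carrier L" "co (e k) = basis_elt A k"
    unfolding e_def by (auto intro: inv_into_into f_inv_into_f)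
qed

lemma co_closed: "u \<in> carrier L \<Longrightarrow> co u \<in> carrier F"
  by (rule lin_hom_closed[OF co_lin])

lemma L_generated:
  assumes "submodule T A L" "range e \<subseteq> T"
  shows "carrier L \<subseteq> T"
proof
  fix u assume u: "u \<in> carrier L"
  interpret T: additive_subgroup T L by (rule submodule_additive_subgroup[OF assms(1)])
  have inj: "inj_on co (carrier L)" using co_bij by (simp add: bij_betw_def)
  interpret F: module A F by (rule A.free_module_module)
  have "co u \<in> co ` T"
  proof (rule A.free_module_induct[OF co_closed[OF u]])
    show "\<zero>\<^bsub>F\<^esub> \<in> co ` T"
      using add_map_zero[OF lin_hom_add_map[OF co_lin] L_group F.abelian_group_axioms, symmetric] T.zero_closed by blast
    fix x and a assume "a \<in> carrier A"
    then have "single A x a = co (a \<odot>\<^bsub>L\<^esub> e x)"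
      using A.single_basis_elt[of a x UNIV] by (simp add: lin_hom_smult[OF co_lin] co_e)
    moreover have "a \<odot>\<^bsub>L\<^esub> e x \<in> T"
      using submodule.smult_closed[OF assms(1) \<open>a \<in> carrier A\<close>] assms(2) by blast
    ultimately show "single A x a \<in> co ` T" by blast
  next
    fix f g assume "f \<in> co ` T" "g \<in> co ` T"
    then obtain v w where v: "v \<in> T" "f = co v" and w: "w \<in> T" "g = co w" by blast
    then have "f \<oplus>\<^bsub>F\<^esub> g = co (v \<oplus>\<^bsub>L\<^esub> w)"
      using add_map_add[OF lin_hom_add_map[OF co_lin]] by simp
    then show "f \<oplus>\<^bsub>F\<^esub> g \<in> co ` T"
      using v w T.a_closed by blast
  qed
  then show "u \<in> T"
    using inj u by (auto dest: inj_onD)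
qed

section \<open>Polynomials of bounded degree, and operators given by tables\<close>

definition Sle :: "nat \<Rightarrow> ('y multiset \<Rightarrow> 'a) set" where
  "Sle n = carrier (free_module A {m. size m \<le> n})"

lemma Sle_iff: "f \<in> Sle n \<longleftrightarrow> f \<in> carrier S \<and> (\<forall>m. f m \<noteq> \<zero> \<longrightarrow> size m \<le> n)"
  by (auto simp: Sle_def free_module_carrier)

lemma Sle_closed: "f \<in> Sle n \<Longrightarrow> f \<in> carrier S"
  by (simp add: Sle_iff)

lemma Sle_mono: "f \<in> Sle n \<Longrightarrow> n \<le> k \<Longrightarrow> f \<in> Sle k"
  by (auto simp: Sle_iff)

lemma Sle_submodule: "submodule (Sle n) A S"
proof -
  have "module A (S\<lparr>carrier := Sle n\<rparr>)"
    by (rule module_cong[OF A.free_module_module[of "{m. size m \<le> n}"]])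
       (auto simp: Sle_def free_module_simps)
  then show ?thesis
    using Sle_closed by (intro S.module_incl_imp_submodule) auto
qed

lemma Sle_add: "f \<in> Sle n \<Longrightarrow> g \<in> Sle n \<Longrightarrow> f \<oplus>\<^bsub>S\<^esub> g \<in> Sle n"
  using additive_subgroup_mem(2)[OF submodule_additive_subgroup[OF Sle_submodule] S_group] .

lemma Sle_zero: "\<zero>\<^bsub>S\<^esub> \<in> Sle n"
  using additive_subgroup_mem(1)[OF submodule_additive_subgroup[OF Sle_submodule] S_group] .

lemma Sle_smult: "a \<in> carrier A \<Longrightarrow> f \<in> Sle n \<Longrightarrow> a \<odot>\<^bsub>S\<^esub> f \<in> Sle n"
  by (rule submodule.smult_closed[OF Sle_submodule])

lemma mon_Sle: "size m \<le> n \<Longrightarrow> mon m \<in> Sle n"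
  using mon_closed[of m] unfolding Sle_iff by (auto simp: basis_elt_def split: if_splits)

lemma Sle_induct:
  assumes "f \<in> Sle n" "P \<zero>\<^bsub>S\<^esub>"
    and "\<And>m a. size m \<le> n \<Longrightarrow> a \<in> carrier A \<Longrightarrow> P (a \<odot>\<^bsub>S\<^esub> mon m)"
    and "\<And>f g. f \<in> Sle n \<Longrightarrow> g \<in> Sle n \<Longrightarrow> P f \<Longrightarrow> P g \<Longrightarrow> P (f \<oplus>\<^bsub>S\<^esub> g)"
  shows "P f"
  using assms(1) unfolding Sle_def
proof (rule A.free_module_induct)
  show "P \<zero>\<^bsub>free_module A {m. size m \<le> n}\<^esub>"
    using assms(2) by (simp add: free_module_simps)
  show "P (single A m a)" if "m \<in> {m. size m \<le> n}" "a \<in> carrier A" for m a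
    using assms(3) that by (simp add: single_mon)
  show "P (f \<oplus>\<^bsub>free_module A {m. size m \<le> n}\<^esub> g)"
    if "f \<in> carrier (free_module A {m. size m \<le> n})" "g \<in> carrier (free_module A {m. size m \<le> n})" "P f" "P g" for f g
    using assms(4)[of f g] that by (simp add: free_module_simps Sle_def)
qed

lemma S_in_Sle:
  assumes "f \<in> carrier S"
  obtains n where "f \<in> Sle n"
proof -
  have "finite (size ` {m. f m \<noteq> \<zero>})" using assms by (simp add: free_module_carrier)
  then obtain n where "\<forall>k\<in>size ` {m. f m \<noteq> \<zero>}. k \<le> n"
    using finite_nat_set_iff_bounded_le by auto
  then have "f \<in> Sle n" using assms by (auto simp: Sle_iff)
  then show ?thesis by (rule that)
qed

text \<open>A table \<open>t\<close> prescribes the value \<open>t m k\<close> of the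
  \<open>k\<close>-th basis vector on the monomial \<open>m\<close>; this is the linear extension
  from basis vectors to \<open>u\<close>, at one fixed monomial.\<close>

definition inn :: "('y multiset \<Rightarrow> 'y \<Rightarrow> 'y multiset \<Rightarrow> 'a) \<Rightarrow> 'l \<Rightarrow> 'y multiset \<Rightarrow> 'y multiset \<Rightarrow> 'a" where
  "inn t u m = dsum A S (\<lambda>k c. c \<odot>\<^bsub>S\<^esub> t m k) (co u)"

text \<open>The first-order operator with table \<open>t\<close> on monomials and derivation
  \<open>D u\<close> on coefficients. With \<open>tab\<close> and \<open>anc\<close> it becomes the
  action \<open>E\<close>, with \<open>shift\<close> and the zero derivation it becomes
  multiplication by a linear form.\<close>

definition opr :: "('y multiset \<Rightarrow> 'y \<Rightarrow> 'y multiset \<Rightarrow> 'a) \<Rightarrow> ('l \<Rightarrow> 'a \<Rightarrow> 'a) \<Rightarrow> 'l \<Rightarrow>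
    ('y multiset \<Rightarrow> 'a) \<Rightarrow> ('y multiset \<Rightarrow> 'a)" where
  "opr t D u = dsum A S (\<lambda>m a. D u a \<odot>\<^bsub>S\<^esub> mon m \<oplus>\<^bsub>S\<^esub> a \<odot>\<^bsub>S\<^esub> inn t u m)"

abbreviation "tclosed t \<equiv> \<forall>m k. t m k \<in> carrier S"

lemma smult_map: "f \<in> carrier S \<Longrightarrow> (\<lambda>c. c \<odot>\<^bsub>S\<^esub> f) \<in> add_map A S"
  by (intro add_mapI S.smult_closed S.smult_l_distr)

lemma inn_lin:
  assumes "tclosed t"
  shows "(\<lambda>u. inn t u m) \<in> lin_hom A L S"
proof -
  have "dsum A S (\<lambda>k c. c \<odot>\<^bsub>S\<^esub> t m k) \<in> lin_hom A F S"
    by (rule A.dsum_lin_hom[OF S_module]) (use assms smult_map in \<open>auto simp: S.smult_assoc1\<close>)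
  then show ?thesis
    unfolding inn_def by (rule lin_hom_comp[OF co_lin])
qed

lemma inn_closed: "tclosed t \<Longrightarrow> u \<in> carrier L \<Longrightarrow> inn t u m \<in> carrier S"
  using lin_hom_closed[OF inn_lin] .

lemma inn_e:
  assumes "tclosed t"
  shows "inn t (e k) m = t m k"
proof -
  have "dsum A S (\<lambda>k c. c \<odot>\<^bsub>S\<^esub> t m k) (single A k \<one>) = \<one> \<odot>\<^bsub>S\<^esub> t m k"
    by (rule A.dsum_single[OF S_group]) (use assms smult_map in auto)
  then show ?thesis
    using assms by (simp add: inn_def co_e basis_elt_single)
qed

lemma L_lin_mem:
  assumes h: "h \<in> lin_hom A L S" and N: "submodule N A S" and "\<And>k. h (e k) \<in> N" and u: "u \<in> carrier L"
  shows "h u \<in> N"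
proof -
  note N' = additive_subgroup_mem[OF submodule_additive_subgroup[OF N] S_group]
  note ha = lin_hom_add_map[OF h]
  have "submodule {u \<in> carrier L. h u \<in> N} A L"
  proof (rule L.submoduleI)
    show "\<zero>\<^bsub>L\<^esub> \<in> {u \<in> carrier L. h u \<in> N}"
      using add_map_zero[OF ha L_group S_group] N'(1) by simp
    show "\<ominus>\<^bsub>L\<^esub> u \<in> {u \<in> carrier L. h u \<in> N}" if "u \<in> {u \<in> carrier L. h u \<in> N}" for u
      using that add_map_neg[OF ha L_group S_group, of u] N'(3) by auto
    show "u \<oplus>\<^bsub>L\<^esub> v \<in> {u \<in> carrier L. h u \<in> N}"
      if "u \<in> {u \<in> carrier L. h u \<in> N}" "v \<in> {u \<in> carrier L. h u \<in> N}" for u v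
      using that add_map_add[OF ha, of u v] N'(2) by auto
    show "a \<odot>\<^bsub>L\<^esub> u \<in> {u \<in> carrier L. h u \<in> N}"
      if "a \<in> carrier A" "u \<in> {u \<in> carrier L. h u \<in> N}" for a u
      using that lin_hom_smult[OF h, of a u] submodule.smult_closed[OF N] by auto
  qed auto
  then show ?thesis
    using L_generated assms(3) u by fastforce
qed

lemma inn_Sle:
  assumes "tclosed t" "\<And>k. t m k \<in> Sle n" "u \<in> carrier L"
  shows "inn t u m \<in> Sle n"
  by (rule L_lin_mem[OF inn_lin[OF assms(1)] Sle_submodule _ assms(3)]) (simp add: inn_e assms)

abbreviation "dgood D \<equiv> \<forall>u\<in>carrier L. D u \<in> add_map A A"

lemma opr_summand:
  assumes "tclosed t" "dgood D" "u \<in> carrier L"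
  shows "(\<lambda>a. D u a \<odot>\<^bsub>S\<^esub> mon m \<oplus>\<^bsub>S\<^esub> a \<odot>\<^bsub>S\<^esub> inn t u m) \<in> add_map A S"
proof (rule add_map_plus[OF S_group])
  have "D u \<in> add_map A A" using assms(2,3) by blast
  then show "(\<lambda>a. D u a \<odot>\<^bsub>S\<^esub> mon m) \<in> add_map A S"
    by (rule add_map_comp[OF _ smult_map[OF mon_closed]])
  show "(\<lambda>a. a \<odot>\<^bsub>S\<^esub> inn t u m) \<in> add_map A S"
    by (rule smult_map[OF inn_closed[OF assms(1,3)]])
qed

lemma opr_add_map:
  assumes "tclosed t" "dgood D" "u \<in> carrier L"
  shows "opr t D u \<in> add_map S S"
  unfolding opr_def by (rule A.dsum_add_map[OF S_group]) (rule opr_summand[OF assms])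

lemma opr_mon:
  assumes "tclosed t" "dgood D" "u \<in> carrier L" "a \<in> carrier A"
  shows "opr t D u (a \<odot>\<^bsub>S\<^esub> mon m) = D u a \<odot>\<^bsub>S\<^esub> mon m \<oplus>\<^bsub>S\<^esub> a \<odot>\<^bsub>S\<^esub> inn t u m"
proof -
  have "opr t D u (single A m a) = D u a \<odot>\<^bsub>S\<^esub> mon m \<oplus>\<^bsub>S\<^esub> a \<odot>\<^bsub>S\<^esub> inn t u m"
    unfolding opr_def by (rule A.dsum_single[OF S_group _ _ assms(4)]) (use opr_summand[OF assms(1-3)] in auto)
  then show ?thesis by (simp add: single_mon assms(4))
qed

lemma opr_Sle:
  assumes "tclosed t" "dgood D" "u \<in> carrier L" "\<And>m k. size m \<le> n \<Longrightarrow> t m k \<in> Sle k'" "n \<le> k'" "f \<in> Sle n"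
  shows "opr t D u f \<in> Sle k'"
  using assms(6)
proof (rule Sle_induct)
  show "opr t D u \<zero>\<^bsub>S\<^esub> \<in> Sle k'"
    using add_map_zero[OF opr_add_map[OF assms(1-3)] S_group S_group] by (simp add: Sle_zero)
  show "opr t D u (a \<odot>\<^bsub>S\<^esub> mon m) \<in> Sle k'" if m: "size m \<le> n" and a: "a \<in> carrier A" for m a
  proof -
    have "D u a \<in> carrier A" using add_map_closed[of "D u" A A a] assms(2,3) a by simp
    moreover have "inn t u m \<in> Sle k'"
      by (rule inn_Sle[OF assms(1) assms(4)[OF m] assms(3)])
    ultimately show ?thesis
      unfolding opr_mon[OF assms(1-3) a]
      using m a assms(5) by (intro Sle_add Sle_smult mon_Sle) auto
  qed
  show "opr t D u (f \<oplus>\<^bsub>S\<^esub> g) \<in> Sle k'"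
    if "f \<in> Sle n" "g \<in> Sle n" "opr t D u f \<in> Sle k'" "opr t D u g \<in> Sle k'" for f g
    using that by (simp add: add_map_add[OF opr_add_map[OF assms(1-3)]] Sle_closed Sle_add)
qed

text \<open>Lets the cut-off table of the recursion be exchanged for \<open>tab\<close> itself, as
  long as the argument has small degree.\<close>

lemma opr_cong:
  assumes "tclosed t" "tclosed t'" "dgood D" "u \<in> carrier L" "\<And>m k. size m \<le> n \<Longrightarrow> t m k = t' m k" "f \<in> Sle n"
  shows "opr t D u f = opr t' D u f"
  using assms(6)
proof (rule Sle_induct)
  note o = opr_add_map[OF assms(1,3,4)] opr_add_map[OF assms(2,3,4)]
  show "opr t D u \<zero>\<^bsub>S\<^esub> = opr t' D u \<zero>\<^bsub>S\<^esub>"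
    using add_map_zero[OF o(1) S_group S_group] add_map_zero[OF o(2) S_group S_group] by simp
  show "opr t D u (a \<odot>\<^bsub>S\<^esub> mon m) = opr t' D u (a \<odot>\<^bsub>S\<^esub> mon m)" if m: "size m \<le> n" and a: "a \<in> carrier A" for m a
    unfolding opr_mon[OF assms(1,3,4) a] opr_mon[OF assms(2,3,4) a]
    using assms(5)[OF m] by (simp add: inn_def)
  show "opr t D u (f \<oplus>\<^bsub>S\<^esub> g) = opr t' D u (f \<oplus>\<^bsub>S\<^esub> g)"
    if "f \<in> Sle n" "g \<in> Sle n" "opr t D u f = opr t' D u f" "opr t D u g = opr t' D u g" for f g
    using that by (simp add: add_map_add[OF o(1)] add_map_add[OF o(2)] Sle_closed)
qed

definition shift :: "'y multiset \<Rightarrow> 'y \<Rightarrow> 'y multiset \<Rightarrow> 'a" where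
  "shift m k = mon (add_mset k m)"

lemma shift_closed: "tclosed shift"
  by (simp add: shift_def)

lemma shift_Sle: "size m \<le> n \<Longrightarrow> shift m k \<in> Sle (Suc n)"
  by (simp add: shift_def mon_Sle)

lemma anc_good: "dgood anc"
  using anc_add_map by blast

section \<open>The action of basis vectors on ordered monomials\<close>

definition below :: "'y \<Rightarrow> 'y multiset \<Rightarrow> bool" where
  "below k m \<longleftrightarrow> (\<forall>j\<in>#m. le k j)"

definition least :: "'y multiset \<Rightarrow> 'y" where
  "least m = (SOME j. j \<in># m \<and> below j m)"

lemma least_props:
  assumes "m \<noteq> {#}"
  shows "least m \<in># m" "below (least m) m"
proof -
  have "\<exists>j. j \<in># m \<and> below j m"
    using assms
  proof (induction m)
    case empty
    then show ?case by simp
  next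
    case (add x m)
    show ?case
    proof (cases "m = {#}")
      case True
      then show ?thesis using le_total[of x x] by (auto simp: below_def)
    next
      case False
      then obtain j where j: "j \<in># m" "below j m" using add by blast
      show ?thesis
      proof (cases "le j x")
        case True
        then show ?thesis using j by (auto simp: below_def)
      next
        case False
        then have "le x j" using le_total by blast
        then have "below x (add_mset x m)"
          using j le_trans[of x j] le_total[of x x] by (auto simp: below_def)
        then show ?thesis by (intro exI[of _ x]) auto
      qed
    qed
  qed
  from someI_ex[OF this] show "least m \<in># m" "below (least m) m"
    by (auto simp: least_def)
qed

lemma least_add: "below j m \<Longrightarrow> least (add_mset j m) = j"
  using least_props[of "add_mset j m"] le_total[of j j] le_antisym
  by (fastforce simp: below_def)

text \<open>The action of a basis vector on monomials, by recursion on the degree. The recursive calls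
  for smaller monomials are cut off explicitly, since the operators \<open>opr\<close> mention the table at all
  monomials.\<close>

definition cut_tab :: "nat \<Rightarrow> ('y multiset \<Rightarrow> 'y \<Rightarrow> 'y multiset \<Rightarrow> 'a) \<Rightarrow> ('y multiset \<Rightarrow> 'y \<Rightarrow> 'y multiset \<Rightarrow> 'a)" where
  "cut_tab n t = (\<lambda>m k. if size m < n then t m k else \<zero>\<^bsub>S\<^esub>)"

text \<open>If \<open>k\<close> is below \<open>m\<close>, the product is already ordered and the
  basis vector acts by multiplication. Otherwise \<open>m\<close> is \<open>j\<close> times
  \<open>p\<close> with \<open>j\<close> smaller than \<open>k\<close>, and the relation
  \<open>E (e k) E (e j) = E (e j) E (e k) + E (br (e k) (e j))\<close> is imposed on
  \<open>mon p\<close>. The monomial \<open>shift p k\<close> is split off beforehand: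
  \<open>E (e j)\<close> must send it to \<open>shift m k\<close>, but its degree is
  \<open>size m\<close>, where the recursion is not yet available.\<close>

definition tab_step :: "('y multiset \<Rightarrow> 'y \<Rightarrow> 'y multiset \<Rightarrow> 'a) \<Rightarrow> 'y multiset \<Rightarrow> 'y \<Rightarrow> 'y multiset \<Rightarrow> 'a" where
  "tab_step t m k =
    (if below k m then shift m k
     else let j = least m; p = m - {#j#} in
       shift m k \<oplus>\<^bsub>S\<^esub> (opr t anc (e j) (t p k \<ominus>\<^bsub>S\<^esub> shift p k) \<oplus>\<^bsub>S\<^esub> opr t anc (br (e k) (e j)) (mon p)))"

definition tab :: "'y multiset \<Rightarrow> 'y \<Rightarrow> 'y multiset \<Rightarrow> 'a" where
  "tab = wfrec (measure size) (\<lambda>t m. tab_step (cut_tab (size m) t) m)"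

lemma tab_eq: "tab m = tab_step (cut_tab (size m) tab) m"
proof -
  have "tab m = tab_step (cut_tab (size m) (cut tab (measure size) m)) m"
    unfolding tab_def by (subst wfrec) auto
  moreover have "cut_tab (size m) (cut tab (measure size) m) = cut_tab (size m) tab"
    by (auto simp: cut_tab_def cut_def fun_eq_iff)
  ultimately show ?thesis by simp
qed

text \<open>Closure and leading term are proved together: the recursive call applies an operator to
  \<open>tab p k\<close> minus its leading monomial, and only the bound on the degree of this
  difference keeps that call within the part of the table already known.\<close>

lemma tab_closed_lead: "tab m k \<in> carrier S \<and> tab m k \<ominus>\<^bsub>S\<^esub> shift m k \<in> Sle (size m)"
proof (induction "size m" arbitrary: m k rule: less_induct)
  case less
  let ?t = "cut_tab (size m) tab"
  have t: "tclosed ?t"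
    using less by (simp add: cut_tab_def)
  have sm: "x \<ominus>\<^bsub>S\<^esub> x = \<zero>\<^bsub>S\<^esub>" if "x \<in> carrier S" for x
    using that by (simp add: a_minus_def S.M.r_neg)
  show ?case
  proof (cases "below k m")
    case True
    then show ?thesis
      using shift_closed by (simp add: tab_eq tab_step_def sm Sle_zero)
  next
    case False
    then have ne: "m \<noteq> {#}" by (auto simp: below_def)
    let ?j = "least m" let ?p = "m - {#?j#}"
    have p: "size ?p < size m" using least_props(1)[OF ne] by (rule size_Diff1_less)
    then have tp: "?t ?p k = tab ?p k" by (simp add: cut_tab_def)
    \<comment> \<open>On smaller monomials the table raises the degree by at most one, hence stays
      within degree \<open>size m\<close>.\<close>
    have tS: "?t q i \<in> Sle (size m)" if "size q \<le> size ?p" for q i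
    proof -
      have q: "size q < size m" using that p by simp
      have "tab q i = shift q i \<oplus>\<^bsub>S\<^esub> (tab q i \<ominus>\<^bsub>S\<^esub> shift q i)"
        using less(1)[OF q, of i] shift_closed by (simp add: a_minus_def S.M.a_ac S.M.r_neg2)
      moreover have "shift q i \<oplus>\<^bsub>S\<^esub> (tab q i \<ominus>\<^bsub>S\<^esub> shift q i) \<in> Sle (size m)"
        using less(1)[OF q, of i] q shift_Sle[of q "size q" i] by (auto intro!: Sle_add intro: Sle_mono)
      ultimately show ?thesis using q by (simp add: cut_tab_def)
    qed
    let ?r = "opr ?t anc (e ?j) (?t ?p k \<ominus>\<^bsub>S\<^esub> shift ?p k) \<oplus>\<^bsub>S\<^esub> opr ?t anc (br (e k) (e ?j)) (mon ?p)"
    have "?r \<in> Sle (size m)"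
    proof (rule Sle_add)
      show "opr ?t anc (e ?j) (?t ?p k \<ominus>\<^bsub>S\<^esub> shift ?p k) \<in> Sle (size m)"
        by (rule opr_Sle[OF t anc_good e_closed tS]) (use p less(1)[OF p, of k] tp in auto)
      show "opr ?t anc (br (e k) (e ?j)) (mon ?p) \<in> Sle (size m)"
        by (rule opr_Sle[OF t anc_good br_closed[OF e_closed e_closed] tS]) (use p in \<open>auto intro: mon_Sle\<close>)
    qed
    moreover have "tab m k = shift m k \<oplus>\<^bsub>S\<^esub> ?r"
      using False by (simp add: tab_eq[of m] tab_step_def Let_def)
    moreover have "shift m k \<oplus>\<^bsub>S\<^esub> x \<ominus>\<^bsub>S\<^esub> shift m k = x" if "x \<in> carrier S" for x
      using that shift_closed by (simp add: a_minus_def S.M.a_ac S.M.r_neg)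
    ultimately show ?thesis
      using Sle_closed shift_closed by auto
  qed
qed

lemma tab_closed: "tclosed tab"
  using tab_closed_lead by blast

definition E :: "'l \<Rightarrow> ('y multiset \<Rightarrow> 'a) \<Rightarrow> ('y multiset \<Rightarrow> 'a)" where
  "E u = opr tab anc u"

text \<open>Multiplication by the linear form \<open>u\<close>: the leading part of \<open>E u\<close>.\<close>

definition mu :: "'l \<Rightarrow> ('y multiset \<Rightarrow> 'a) \<Rightarrow> ('y multiset \<Rightarrow> 'a)" where
  "mu u = opr shift (\<lambda>_ _. \<zero>) u"

lemma zero_good: "dgood (\<lambda>_ _. \<zero>)"
  by (auto intro: add_mapI)

lemma E_add_map: "u \<in> carrier L \<Longrightarrow> E u \<in> add_map S S"
  unfolding E_def by (rule opr_add_map[OF tab_closed anc_good])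

lemma E_closed: "u \<in> carrier L \<Longrightarrow> f \<in> carrier S \<Longrightarrow> E u f \<in> carrier S"
  by (rule add_map_closed[OF E_add_map])

lemma E_add: "u \<in> carrier L \<Longrightarrow> f \<in> carrier S \<Longrightarrow> g \<in> carrier S \<Longrightarrow> E u (f \<oplus>\<^bsub>S\<^esub> g) = E u f \<oplus>\<^bsub>S\<^esub> E u g"
  by (rule add_map_add[OF E_add_map])

lemma E_zero: "u \<in> carrier L \<Longrightarrow> E u \<zero>\<^bsub>S\<^esub> = \<zero>\<^bsub>S\<^esub>"
  by (rule add_map_zero[OF E_add_map S_group S_group])

lemma E_minus: "u \<in> carrier L \<Longrightarrow> f \<in> carrier S \<Longrightarrow> g \<in> carrier S \<Longrightarrow> E u (f \<ominus>\<^bsub>S\<^esub> g) = E u f \<ominus>\<^bsub>S\<^esub> E u g"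
  by (rule add_map_minus[OF E_add_map S_group S_group])

lemma mu_add_map: "u \<in> carrier L \<Longrightarrow> mu u \<in> add_map S S"
  unfolding mu_def by (rule opr_add_map[OF shift_closed zero_good])

lemma mu_closed: "u \<in> carrier L \<Longrightarrow> f \<in> carrier S \<Longrightarrow> mu u f \<in> carrier S"
  by (rule add_map_closed[OF mu_add_map])

lemma mon_E:
  assumes "u \<in> carrier L" "a \<in> carrier A"
  shows "E u (a \<odot>\<^bsub>S\<^esub> mon m) = anc u a \<odot>\<^bsub>S\<^esub> mon m \<oplus>\<^bsub>S\<^esub> a \<odot>\<^bsub>S\<^esub> inn tab u m"
  unfolding E_def by (rule opr_mon[OF tab_closed anc_good assms])

lemma mon_mu:
  assumes "u \<in> carrier L" "a \<in> carrier A"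
  shows "mu u (a \<odot>\<^bsub>S\<^esub> mon m) = a \<odot>\<^bsub>S\<^esub> inn shift u m"
  unfolding mu_def using opr_mon[OF shift_closed zero_good assms] assms inn_closed[OF shift_closed] by simp

lemma S_map_eqI:
  assumes "h \<in> add_map S N" "k \<in> add_map S N" "abelian_group N" "f \<in> carrier S"
    and "\<And>m a. a \<in> carrier A \<Longrightarrow> h (a \<odot>\<^bsub>S\<^esub> mon m) = k (a \<odot>\<^bsub>S\<^esub> mon m)"
  shows "h f = k f"
  by (rule add_map_eq_on_span[OF assms(1,2) S_group assms(3) A.singles_closed _ A.free_module_span[OF assms(4)]])
     (use assms(5) single_mon in auto)

lemma E_smult:
  assumes "u \<in> carrier L" "c \<in> carrier A" "f \<in> carrier S"
  shows "E u (c \<odot>\<^bsub>S\<^esub> f) = c \<odot>\<^bsub>S\<^esub> E u f \<oplus>\<^bsub>S\<^esub> anc u c \<odot>\<^bsub>S\<^esub> f"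
proof (rule S_map_eqI[OF _ _ S_group assms(3), of "\<lambda>f. E u (c \<odot>\<^bsub>S\<^esub> f)" "\<lambda>f. c \<odot>\<^bsub>S\<^esub> E u f \<oplus>\<^bsub>S\<^esub> anc u c \<odot>\<^bsub>S\<^esub> f"])
  show "(\<lambda>f. E u (c \<odot>\<^bsub>S\<^esub> f)) \<in> add_map S S" "(\<lambda>f. c \<odot>\<^bsub>S\<^esub> E u f \<oplus>\<^bsub>S\<^esub> anc u c \<odot>\<^bsub>S\<^esub> f) \<in> add_map S S"
    using assms(1,2) by (auto intro!: add_mapI simp: E_closed E_add anc_closed S.smult_r_distr S.M.a_ac)
  fix m :: "'y multiset" and a assume "a \<in> carrier A"
  then show "E u (c \<odot>\<^bsub>S\<^esub> (a \<odot>\<^bsub>S\<^esub> mon m)) = c \<odot>\<^bsub>S\<^esub> E u (a \<odot>\<^bsub>S\<^esub> mon m) \<oplus>\<^bsub>S\<^esub> anc u c \<odot>\<^bsub>S\<^esub> (a \<odot>\<^bsub>S\<^esub> mon m)"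
    using assms(1,2) mon_E[of u "c \<otimes> a"]
    by (simp add: mon_E anc_mult anc_closed inn_closed tab_closed S.smult_r_distr S.smult_l_distr
        S.smult_assoc1 S.smult_left_commute[of a] S.M.a_ac)
qed

lemma inn_add_left: "tclosed t \<Longrightarrow> u \<in> carrier L \<Longrightarrow> v \<in> carrier L \<Longrightarrow>
    inn t (u \<oplus>\<^bsub>L\<^esub> v) m = inn t u m \<oplus>\<^bsub>S\<^esub> inn t v m"
  by (rule add_map_add[OF lin_hom_add_map[OF inn_lin]])

lemma inn_smult_left: "tclosed t \<Longrightarrow> c \<in> carrier A \<Longrightarrow> u \<in> carrier L \<Longrightarrow>
    inn t (c \<odot>\<^bsub>L\<^esub> u) m = c \<odot>\<^bsub>S\<^esub> inn t u m"
  by (rule lin_hom_smult[OF inn_lin])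

lemma E_add_left:
  assumes "u \<in> carrier L" "v \<in> carrier L" "f \<in> carrier S"
  shows "E (u \<oplus>\<^bsub>L\<^esub> v) f = E u f \<oplus>\<^bsub>S\<^esub> E v f"
proof (rule S_map_eqI[OF _ _ S_group assms(3), of "E (u \<oplus>\<^bsub>L\<^esub> v)" "\<lambda>f. E u f \<oplus>\<^bsub>S\<^esub> E v f"])
  show "E (u \<oplus>\<^bsub>L\<^esub> v) \<in> add_map S S" "(\<lambda>f. E u f \<oplus>\<^bsub>S\<^esub> E v f) \<in> add_map S S"
    using assms(1,2) by (auto intro!: E_add_map add_map_plus[OF S_group])
qed (use assms in \<open>simp add: mon_E inn_add_left tab_closed inn_closed anc_add_left anc_closed
       S.smult_l_distr S.smult_r_distr S.M.a_ac\<close>)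

lemma E_smult_left:
  assumes "c \<in> carrier A" "u \<in> carrier L" "f \<in> carrier S"
  shows "E (c \<odot>\<^bsub>L\<^esub> u) f = c \<odot>\<^bsub>S\<^esub> E u f"
proof (rule S_map_eqI[OF _ _ S_group assms(3), of "E (c \<odot>\<^bsub>L\<^esub> u)" "\<lambda>f. c \<odot>\<^bsub>S\<^esub> E u f"])
  show "E (c \<odot>\<^bsub>L\<^esub> u) \<in> add_map S S" "(\<lambda>f. c \<odot>\<^bsub>S\<^esub> E u f) \<in> add_map S S"
    using assms(1,2) by (auto intro!: E_add_map add_mapI simp: E_closed E_add S.smult_r_distr)
qed (use assms in \<open>simp add: mon_E inn_smult_left tab_closed inn_closed anc_smult_left anc_closed
       S.smult_r_distr S.smult_assoc1 S.smult_left_commute[of c]\<close>)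

lemma E_add_map_left: "f \<in> carrier S \<Longrightarrow> (\<lambda>u. E u f) \<in> add_map L S"
  by (intro add_mapI E_closed E_add_left)

lemma E_neg_left: "u \<in> carrier L \<Longrightarrow> f \<in> carrier S \<Longrightarrow> E (\<ominus>\<^bsub>L\<^esub> u) f = \<ominus>\<^bsub>S\<^esub> E u f"
  using add_map_neg[OF E_add_map_left L_group S_group] .

lemma E_zero_left: "f \<in> carrier S \<Longrightarrow> E \<zero>\<^bsub>L\<^esub> f = \<zero>\<^bsub>S\<^esub>"
  using add_map_zero[OF E_add_map_left L_group S_group] .

lemma E_e_mon: "E (e k) (mon m) = tab m k"
  using mon_E[of "e k" \<one> m] tab_closed by (simp add: anc_one inn_e)

text \<open>On a monomial this is \<open>tab_closed_lead\<close>, extended linearly in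
  \<open>u\<close>; the term with the derivative \<open>anc u a\<close> of a coefficient does not
  raise the degree.\<close>

lemma E_lead:
  assumes u: "u \<in> carrier L" and "f \<in> Sle n"
  shows "E u f \<ominus>\<^bsub>S\<^esub> mu u f \<in> Sle n"
  using assms(2)
proof (rule Sle_induct)
  show "E u \<zero>\<^bsub>S\<^esub> \<ominus>\<^bsub>S\<^esub> mu u \<zero>\<^bsub>S\<^esub> \<in> Sle n"
    using u add_map_zero[OF mu_add_map S_group S_group]
    by (simp add: E_zero a_minus_def S.M.neg_zero Sle_zero)
  fix f g assume fg: "f \<in> Sle n" "g \<in> Sle n" "E u f \<ominus>\<^bsub>S\<^esub> mu u f \<in> Sle n" "E u g \<ominus>\<^bsub>S\<^esub> mu u g \<in> Sle n"
  have "E u (f \<oplus>\<^bsub>S\<^esub> g) \<ominus>\<^bsub>S\<^esub> mu u (f \<oplus>\<^bsub>S\<^esub> g) = (E u f \<ominus>\<^bsub>S\<^esub> mu u f) \<oplus>\<^bsub>S\<^esub> (E u g \<ominus>\<^bsub>S\<^esub> mu u g)"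
    using u fg(1,2)[THEN Sle_closed] E_closed[OF u] mu_closed[OF u]
    by (simp add: E_add add_map_add[OF mu_add_map] a_minus_def S.M.minus_add S.M.a_ac)
  then show "E u (f \<oplus>\<^bsub>S\<^esub> g) \<ominus>\<^bsub>S\<^esub> mu u (f \<oplus>\<^bsub>S\<^esub> g) \<in> Sle n"
    using Sle_add fg by simp
next
  fix m :: "'y multiset" and a assume m: "size m \<le> n" and a: "a \<in> carrier A"
  have "(\<lambda>u. inn tab u m \<ominus>\<^bsub>S\<^esub> inn shift u m) \<in> lin_hom A L S"
    using tab_closed shift_closed
    by (intro lin_homI) (auto simp: inn_closed inn_add_left inn_smult_left a_minus_def S.smult_r_distr
        S.smult_r_minus S.M.minus_add S.M.a_ac)
  then have "inn tab u m \<ominus>\<^bsub>S\<^esub> inn shift u m \<in> Sle n"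
  proof (rule L_lin_mem[OF _ Sle_submodule _ u])
    show "inn tab (e k) m \<ominus>\<^bsub>S\<^esub> inn shift (e k) m \<in> Sle n" for k
      using Sle_mono[OF conjunct2[OF tab_closed_lead[of m k]] m]
      by (simp add: inn_e tab_closed shift_closed)
  qed
  moreover have "E u (a \<odot>\<^bsub>S\<^esub> mon m) \<ominus>\<^bsub>S\<^esub> mu u (a \<odot>\<^bsub>S\<^esub> mon m)
      = anc u a \<odot>\<^bsub>S\<^esub> mon m \<oplus>\<^bsub>S\<^esub> a \<odot>\<^bsub>S\<^esub> (inn tab u m \<ominus>\<^bsub>S\<^esub> inn shift u m)"
    using u a tab_closed shift_closed
    by (simp add: mon_E mon_mu inn_closed anc_closed a_minus_def S.smult_r_distr S.smult_r_minus S.M.a_ac)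
  ultimately show "E u (a \<odot>\<^bsub>S\<^esub> mon m) \<ominus>\<^bsub>S\<^esub> mu u (a \<odot>\<^bsub>S\<^esub> mon m) \<in> Sle n"
    using u a m anc_closed mon_Sle by (simp add: Sle_add Sle_smult)
qed

lemma E_below: "below k m \<Longrightarrow> E (e k) (mon m) = mon (add_mset k m)"
  by (simp add: E_e_mon tab_eq[of m] tab_step_def shift_def)

text \<open>The recursion of \<open>tab_step\<close> read as a relation between operators: the
  monomial split off there is recovered as \<open>E (e j)\<close> applied to the leading monomial of
  \<open>E (e k) (mon p)\<close>.\<close>

lemma E_above:
  assumes j: "below j p" and k: "\<not> le k j"
  shows "E (e k) (mon (add_mset j p)) = E (e j) (E (e k) (mon p)) \<oplus>\<^bsub>S\<^esub> E (br (e k) (e j)) (mon p)"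
proof -
  let ?m = "add_mset j p"
  define t where "t = cut_tab (size ?m) tab"
  have nb: "\<not> below k ?m" using k by (auto simp: below_def)
  have jk: "below j (add_mset k p)" using j k le_total by (auto simp: below_def)
  have t: "tclosed t" using tab_closed by (simp add: t_def cut_tab_def)
  have tt: "t q i = tab q i" if "size q \<le> size p" for q i using that by (simp add: t_def cut_tab_def)
  let ?g = "tab p k \<ominus>\<^bsub>S\<^esub> shift p k"
  have g: "?g \<in> Sle (size p)" using tab_closed_lead by blast
  have "E (e k) (mon ?m) = shift ?m k \<oplus>\<^bsub>S\<^esub> (opr t anc (e j) ?g \<oplus>\<^bsub>S\<^esub> opr t anc (br (e k) (e j)) (mon p))"
    using nb by (simp add: E_e_mon tab_eq[of ?m, folded t_def] tab_step_def Let_def least_add[OF j] tt)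
  \<comment> \<open>The arguments here and in the next step have degree at most
    \<open>size p\<close>, where the cut-off table agrees with \<open>tab\<close>.\<close>
  also have "opr t anc (e j) ?g = E (e j) ?g"
    unfolding E_def by (rule opr_cong[OF t tab_closed anc_good e_closed tt g])
  also have "opr t anc (br (e k) (e j)) (mon p) = E (br (e k) (e j)) (mon p)"
    unfolding E_def by (rule opr_cong[OF t tab_closed anc_good br_closed[OF e_closed e_closed] tt mon_Sle]) auto
  also have "E (e j) ?g = E (e j) (E (e k) (mon p)) \<ominus>\<^bsub>S\<^esub> mon (add_mset j (add_mset k p))"
    unfolding E_e_mon[symmetric] shift_def using E_below[OF jk] by (simp add: E_minus E_closed)
  finally show ?thesis
    using br_closed[OF e_closed e_closed, of k j]
    by (simp add: shift_def a_minus_def E_closed S.M.a_ac S.M.r_neg1 S.M.r_neg2 add_mset_commute[of k j])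
qed

section \<open>Commutation relations of the action\<close>

abbreviation "comm u v f \<equiv> E u (E v f) = E v (E u f) \<oplus>\<^bsub>S\<^esub> E (br u v) f"

lemma comm_swap:
  assumes "u \<in> carrier L" "v \<in> carrier L" "f \<in> carrier S" "comm u v f"
  shows "comm v u f"
proof -
  have "E u (E v f) \<oplus>\<^bsub>S\<^esub> E (br v u) f = (E v (E u f) \<oplus>\<^bsub>S\<^esub> E (br u v) f) \<oplus>\<^bsub>S\<^esub> \<ominus>\<^bsub>S\<^esub> E (br u v) f"
    using assms br_anti[OF assms(1,2)] br_closed by (simp add: E_neg_left)
  also have "\<dots> = E v (E u f)"
    using assms(1-3) br_closed E_closed by (simp add: S.M.a_assoc S.M.r_neg)
  finally show ?thesis by simp
qed

lemma comm_submodule: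
  assumes u: "u \<in> carrier L" and f: "f \<in> carrier S"
  shows "submodule {v \<in> carrier L. comm u v f} A L"
proof (rule L.submoduleI)
  show sm: "c \<odot>\<^bsub>L\<^esub> v \<in> {v \<in> carrier L. comm u v f}"
    if "c \<in> carrier A" "v \<in> {v \<in> carrier L. comm u v f}" for c v
    using that u f br_closed anc_closed
    by (auto simp: E_smult_left E_closed E_smult br_smult E_add_left S.smult_r_distr S.M.a_ac)
  show "\<ominus>\<^bsub>L\<^esub> v \<in> {v \<in> carrier L. comm u v f}" if "v \<in> {v \<in> carrier L. comm u v f}" for v
    using sm[of "\<ominus> \<one>" v] that by (simp add: L.smult_l_minus)
  show "v \<oplus>\<^bsub>L\<^esub> w \<in> {v \<in> carrier L. comm u v f}"
    if "v \<in> {v \<in> carrier L. comm u v f}" "w \<in> {v \<in> carrier L. comm u v f}" for v w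
    using that u f br_closed by (auto simp: E_add_left E_closed E_add br_add S.M.a_ac)
  have "br u \<zero>\<^bsub>L\<^esub> = \<zero>\<^bsub>L\<^esub>" by (rule add_map_zero[OF br_add_map[OF u] L_group L_group])
  then show "\<zero>\<^bsub>L\<^esub> \<in> {v \<in> carrier L. comm u v f}"
    using u f by (simp add: E_zero_left E_zero E_closed)
qed auto

lemma comm_basis:
  assumes "\<And>i j. comm (e i) (e j) f" "f \<in> carrier S" "u \<in> carrier L" "v \<in> carrier L"
  shows "comm u v f"
proof -
  have 1: "comm (e i) v f" if "v \<in> carrier L" for i v
  proof -
    have "range e \<subseteq> {v \<in> carrier L. comm (e i) v f}"
      using assms(1) by auto
    then show ?thesis
      using L_generated[OF comm_submodule[OF e_closed[of i] assms(2)]] that by blast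
  qed
  have 2: "comm u (e i) f" if "u \<in> carrier L" for i u
    by (rule comm_swap[OF e_closed that assms(2) 1[OF that]])
  have "range e \<subseteq> {v \<in> carrier L. comm u v f}"
    using 2[OF assms(3)] by auto
  then show ?thesis
    using L_generated[OF comm_submodule[OF assms(3,2)]] assms(4) by blast
qed

text \<open>The two terms that differentiate \<open>a\<close> once and act on \<open>f\<close> once
  appear on both sides; the multiples of \<open>f\<close> itself match by
  \<open>anc_br\<close>.\<close>

lemma comm_smult:
  assumes "comm u v f" "u \<in> carrier L" "v \<in> carrier L" "f \<in> carrier S" "a \<in> carrier A"
  shows "comm u v (a \<odot>\<^bsub>S\<^esub> f)"
proof -
  have "E u (E v (a \<odot>\<^bsub>S\<^esub> f)) = (a \<odot>\<^bsub>S\<^esub> E u (E v f) \<oplus>\<^bsub>S\<^esub> anc u a \<odot>\<^bsub>S\<^esub> E v f) \<oplus>\<^bsub>S\<^esub>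
      (anc v a \<odot>\<^bsub>S\<^esub> E u f \<oplus>\<^bsub>S\<^esub> anc u (anc v a) \<odot>\<^bsub>S\<^esub> f)"
    using assms(2-5) by (simp add: E_smult E_add E_closed anc_closed)
  also have "\<dots> = (a \<odot>\<^bsub>S\<^esub> E v (E u f) \<oplus>\<^bsub>S\<^esub> a \<odot>\<^bsub>S\<^esub> E (br u v) f \<oplus>\<^bsub>S\<^esub> anc u a \<odot>\<^bsub>S\<^esub> E v f) \<oplus>\<^bsub>S\<^esub>
      (anc v a \<odot>\<^bsub>S\<^esub> E u f \<oplus>\<^bsub>S\<^esub> (anc (br u v) a \<odot>\<^bsub>S\<^esub> f \<oplus>\<^bsub>S\<^esub> anc v (anc u a) \<odot>\<^bsub>S\<^esub> f))"
    using assms anc_br[OF assms(2,3,5)] br_closed[OF assms(2,3)]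
    by (simp add: E_closed anc_closed S.smult_r_distr S.smult_l_distr)
  also have "\<dots> = E v (E u (a \<odot>\<^bsub>S\<^esub> f)) \<oplus>\<^bsub>S\<^esub> E (br u v) (a \<odot>\<^bsub>S\<^esub> f)"
    using assms(2-5) br_closed[OF assms(2,3)] by (simp add: E_smult E_add E_closed anc_closed S.M.a_ac)
  finally show ?thesis .
qed

lemma comm_add:
  assumes "comm u v f" "comm u v g" "u \<in> carrier L" "v \<in> carrier L" "f \<in> carrier S" "g \<in> carrier S"
  shows "comm u v (f \<oplus>\<^bsub>S\<^esub> g)"
  using assms br_closed[OF assms(3,4)] by (simp add: E_add E_closed S.M.a_ac)

lemma comm_Sle:
  assumes "\<And>m. size m \<le> n \<Longrightarrow> comm u v (mon m)" "u \<in> carrier L" "v \<in> carrier L" "f \<in> Sle n"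
  shows "comm u v f"
  using assms(4)
proof (rule Sle_induct)
  show "comm u v \<zero>\<^bsub>S\<^esub>" using assms(2,3) br_closed by (simp add: E_zero)
  show "comm u v (a \<odot>\<^bsub>S\<^esub> mon m)" if "size m \<le> n" "a \<in> carrier A" for m a
    using comm_smult[OF assms(1)[OF that(1)] assms(2,3) mon_closed that(2)] .
  show "comm u v (f \<oplus>\<^bsub>S\<^esub> g)" if "f \<in> Sle n" "g \<in> Sle n" "comm u v f" "comm u v g" for f g
    using comm_add[OF that(3,4) assms(2,3) that(1,2)[THEN Sle_closed]] .
qed

text \<open>If \<open>i\<close> is larger than \<open>j\<close>, this is the relation built into the
  recursion. If it is smaller, then \<open>i\<close> is below \<open>m\<close> as well, and the same
  relation holds with the roles of \<open>i\<close> and \<open>j\<close> exchanged.\<close>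

lemma comm_low:
  assumes j: "below j m"
  shows "comm (e i) (e j) (mon m)"
proof (cases "le i j")
  case False
  then show ?thesis
    using E_above[OF j False] E_below[OF j] by simp
next
  case True
  show ?thesis
  proof (cases "i = j")
    case True
    then show ?thesis by (simp add: br_alt E_zero_left E_closed)
  next
    case False
    then have n: "\<not> le j i" using True le_antisym by blast
    have i: "below i m" using j True le_trans by (auto simp: below_def)
    have "comm (e j) (e i) (mon m)"
      using E_above[OF i n] E_below[OF i] by simp
    then show ?thesis by (rule comm_swap[OF e_closed e_closed mon_closed])
  qed
qed

text \<open>Induction on the degree. In the case not covered by \<open>comm_low\<close> the least
  variable \<open>l\<close> of \<open>m\<close> lies below both \<open>i\<close> and
  \<open>j\<close>, so \<open>E (e l)\<close> can be moved to the left past both operators. The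
  commutators that arise act on \<open>p\<close>, which has smaller degree, and cancel by the Jacobi
  identity of \<open>L\<close>.\<close>

lemma comm_mon: "comm (e i) (e j) (mon m)"
proof (induction "size m" arbitrary: i j m rule: less_induct)
  case less
  show ?case
  proof (cases "below j m \<or> below i m")
    case True
    then show ?thesis
      using comm_low comm_swap[OF e_closed e_closed mon_closed] by blast
  next
    case False
    then have ne: "m \<noteq> {#}" by (auto simp: below_def)
    define l where "l = least m"
    define p where "p = m - {#l#}"
    have m: "m = add_mset l p" using least_props(1)[OF ne] by (simp add: p_def l_def)
    have lm: "below l m" using least_props(2)[OF ne] by (simp add: l_def)
    then have lp: "below l p" by (auto simp: m below_def)
    have li: "le l i" and lj: "le l j"
      using False lm le_total le_trans by (auto simp: below_def) blast+
    \<comment> \<open>The induction hypothesis concerns basis vectors and monomials; linearity in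
      the vectors and the Leibniz rule in the polynomial extend it to everything of degree at most
      \<open>size p\<close>.\<close>
    have IH: "comm u v f" if "u \<in> carrier L" "v \<in> carrier L" "f \<in> Sle (size p)" for u v f
    proof (rule comm_Sle[OF _ that])
      fix q :: "'y multiset" assume "size q \<le> size p"
      then have "size q < size m" by (simp add: m)
      then show "comm u v (mon q)"
        using comm_basis[OF _ mon_closed that(1,2)] less by blast
    qed
    have pS: "mon p \<in> Sle (size p)" by (simp add: mon_Sle)
    \<comment> \<open>\<open>E (e h) (mon p)\<close> may have degree \<open>size m\<close>, beyond
      the reach of \<open>IH\<close>. But \<open>l\<close> is below its leading monomial, where
      \<open>comm_low\<close> applies, and the rest has degree at most
      \<open>size p\<close>.\<close>
    have low: "comm (e k) (e l) (E (e h) (mon p))" if h: "le l h" for k h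
    proof -
      let ?g = "tab p h \<ominus>\<^bsub>S\<^esub> shift p h"
      have g: "?g \<in> Sle (size p)" using tab_closed_lead by blast
      have "E (e h) (mon p) = shift p h \<oplus>\<^bsub>S\<^esub> ?g"
        using tab_closed shift_closed by (simp add: E_e_mon a_minus_def S.M.a_ac S.M.r_neg2)
      moreover have "comm (e k) (e l) (shift p h)"
        unfolding shift_def by (rule comm_low) (use lp h in \<open>auto simp: below_def\<close>)
      ultimately show ?thesis
        using comm_add[OF _ IH[OF e_closed e_closed g] e_closed e_closed _ Sle_closed[OF g], where f="shift p h"] shift_closed
        by simp
    qed
    have bc: "br u v \<in> carrier L" if "u \<in> carrier L" "v \<in> carrier L" for u v
      using br_closed that .
    let ?i = "e i" and ?j = "e j" and ?l = "e l" and ?p = "mon p"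
    have M: "mon m = E ?l ?p" using E_below[OF lp] by (simp add: m)
    \<comment> \<open>\<open>E (e l)\<close> is moved past \<open>E (e b)\<close> by
      \<open>IH\<close> and past \<open>E (e a)\<close> by \<open>low\<close>; the formula serves
      both orders of \<open>i\<close> and \<open>j\<close>.\<close>
    have half: "E (e a) (E (e b) (mon m)) =
        (E ?l (E (e a) (E (e b) ?p)) \<oplus>\<^bsub>S\<^esub> E (br (e a) ?l) (E (e b) ?p)) \<oplus>\<^bsub>S\<^esub> E (e a) (E (br (e b) ?l) ?p)"
      if "le l b" for a b
    proof -
      have "E (e b) (mon m) = E ?l (E (e b) ?p) \<oplus>\<^bsub>S\<^esub> E (br (e b) ?l) ?p"
        unfolding M by (rule IH[OF e_closed e_closed pS])
      then show ?thesis
        using low[OF that, of a] bc by (simp add: E_add E_closed)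
    qed
    have "E ?i (E ?j (mon m)) =
        (E ?l (E ?j (E ?i ?p)) \<oplus>\<^bsub>S\<^esub> E ?l (E (br ?i ?j) ?p))
        \<oplus>\<^bsub>S\<^esub> (E ?j (E (br ?i ?l) ?p) \<oplus>\<^bsub>S\<^esub> E (br (br ?i ?l) ?j) ?p)
        \<oplus>\<^bsub>S\<^esub> (E (br ?j ?l) (E ?i ?p) \<oplus>\<^bsub>S\<^esub> E (br ?i (br ?j ?l)) ?p)"
      using half[OF lj, of i] IH[OF e_closed[of i] e_closed[of j] pS] IH[OF bc[OF e_closed[of i] e_closed[of l]] e_closed[of j] pS]
        IH[OF e_closed[of i] bc[OF e_closed[of j] e_closed[of l]] pS] bc
      by (simp add: E_add E_closed)
    moreover have "E ?j (E ?i (mon m)) =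
        (E ?l (E ?j (E ?i ?p)) \<oplus>\<^bsub>S\<^esub> E (br ?j ?l) (E ?i ?p)) \<oplus>\<^bsub>S\<^esub> E ?j (E (br ?i ?l) ?p)"
      by (rule half[OF li])
    moreover have "E (br ?i ?j) (mon m) = E ?l (E (br ?i ?j) ?p) \<oplus>\<^bsub>S\<^esub> E (br (br ?i ?j) ?l) ?p"
      unfolding M by (rule IH[OF bc e_closed pS]) auto
    \<comment> \<open>The Jacobi identity in the form in which the two double brackets left over on
      one side become the one that \<open>br ?i ?j\<close> produces when it passes
      \<open>E ?l\<close>.\<close>
    moreover have "br (br ?i ?l) ?j \<oplus>\<^bsub>L\<^esub> br ?i (br ?j ?l) = br (br ?i ?j) ?l"
    proof -
      have "br ?i (br ?j ?l) = br (br ?i ?j) ?l \<oplus>\<^bsub>L\<^esub> \<ominus>\<^bsub>L\<^esub> br (br ?i ?l) ?j"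
        using jacobi[of ?i ?j ?l] br_anti[of "br ?i ?l" ?j] bc by simp
      then show ?thesis
        using bc by (simp add: L.M.a_lcomm L.M.r_neg)
    qed
    then have "E (br (br ?i ?j) ?l) ?p = E (br (br ?i ?l) ?j) ?p \<oplus>\<^bsub>S\<^esub> E (br ?i (br ?j ?l)) ?p"
      using E_add_left[of "br (br ?i ?l) ?j" "br ?i (br ?j ?l)" ?p] bc by simp
    ultimately show ?thesis
      using bc by (simp add: E_closed S.M.a_ac)
  qed
qed

theorem E_commutator:
  assumes "u \<in> carrier L" "v \<in> carrier L" "f \<in> carrier S"
  shows "comm u v f"
proof -
  obtain n where "f \<in> Sle n" using S_in_Sle[OF assms(3)] .
  then show ?thesis
    by (rule comm_Sle[OF comm_basis[OF comm_mon mon_closed assms(1,2)] assms(1,2)])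
qed

end

section \<open>Enlarging a projective Lie--Rinehart algebra to a free one\<close>

definition semidirect :: "('a, 'm) ring_scheme \<Rightarrow> ('a, 'l, 'n) module_scheme \<Rightarrow> ('a, 'l \<times> ('y \<Rightarrow> 'a)) module" where
  "semidirect A L =
    \<lparr>carrier = carrier L \<times> carrier (free_module A (UNIV :: 'y set)),
     monoid.mult = (\<lambda>_ _. undefined), one = undefined,
     zero = (\<zero>\<^bsub>L\<^esub>, \<zero>\<^bsub>free_module A (UNIV :: 'y set)\<^esub>),
     add = (\<lambda>(p, m) (q, n). (p \<oplus>\<^bsub>L\<^esub> q, m \<oplus>\<^bsub>free_module A (UNIV :: 'y set)\<^esub> n)),
     smult = (\<lambda>a (p, m). (a \<odot>\<^bsub>L\<^esub> p, a \<odot>\<^bsub>free_module A (UNIV :: 'y set)\<^esub> m))\<rparr>"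

lemma semidirect_simps [simp]:
  "carrier (semidirect A L :: ('a, 'l \<times> ('y \<Rightarrow> 'a)) module) = carrier L \<times> carrier (free_module A (UNIV :: 'y set))"
  "zero (semidirect A L :: ('a, 'l \<times> ('y \<Rightarrow> 'a)) module) = (\<zero>\<^bsub>L\<^esub>, \<zero>\<^bsub>free_module A (UNIV :: 'y set)\<^esub>)"
  "(p, m) \<oplus>\<^bsub>semidirect A L\<^esub> (q, n) = (p \<oplus>\<^bsub>L\<^esub> q, m \<oplus>\<^bsub>free_module A UNIV\<^esub> n)"
  "a \<odot>\<^bsub>semidirect A L\<^esub> (p, m) = (a \<odot>\<^bsub>L\<^esub> p, a \<odot>\<^bsub>free_module A UNIV\<^esub> m)"
  by (simp_all add: semidirect_def)

lemma semidirect_module: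
  assumes "module A L"
  shows "module A (semidirect A L :: ('a, 'l \<times> ('y \<Rightarrow> 'a)) module)"
proof -
  interpret L: module A L by fact
  interpret F: module A "free_module A (UNIV :: 'y set)" by (rule L.free_module_module)
  let ?S = "semidirect A L :: ('a, 'l \<times> ('y \<Rightarrow> 'a)) module"
  show ?thesis
  proof (rule moduleI[OF L.is_cring])
    show "abelian_group ?S"
    proof (rule abelian_groupI)
      fix u assume "u \<in> carrier ?S"
      then obtain p m where u: "u = (p, m)" "p \<in> carrier L" "m \<in> carrier (free_module A UNIV)" by auto
      then have "(\<ominus>\<^bsub>L\<^esub> p, \<ominus>\<^bsub>free_module A UNIV\<^esub> m) \<oplus>\<^bsub>?S\<^esub> u = \<zero>\<^bsub>?S\<^esub>"
        by (simp add: L.M.l_neg F.M.l_neg)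
      moreover have "(\<ominus>\<^bsub>L\<^esub> p, \<ominus>\<^bsub>free_module A UNIV\<^esub> m) \<in> carrier ?S"
        using u by simp
      ultimately show "\<exists>v\<in>carrier ?S. v \<oplus>\<^bsub>?S\<^esub> u = \<zero>\<^bsub>?S\<^esub>" by blast
    qed (auto simp: L.M.a_ac F.M.a_ac)
  qed (auto simp: L.smult_l_distr L.smult_r_distr L.smult_assoc1 F.smult_l_distr F.smult_r_distr F.smult_assoc1)
qed

context lie_rinehart
begin

text \<open>The semidirect product of \<open>L\<close> with a free module, on whose coordinates \<open>L\<close> acts by the anchor.
  The coordinates of a general projective complement would only carry a connection with curvature.\<close>

definition sd_br :: "'l \<times> ('y \<Rightarrow> 'a) \<Rightarrow> 'l \<times> ('y \<Rightarrow> 'a) \<Rightarrow> 'l \<times> ('y \<Rightarrow> 'a)" where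
  "sd_br u v = (br (fst u) (fst v), \<lambda>y. anc (fst u) (snd v y) \<ominus> anc (fst v) (snd u y))"

definition sd_anc :: "'l \<times> ('y \<Rightarrow> 'a) \<Rightarrow> 'a \<Rightarrow> 'a" where
  "sd_anc u = anc (fst u)"

lemma anc_minus:
  "p \<in> carrier L \<Longrightarrow> a \<in> carrier A \<Longrightarrow> b \<in> carrier A \<Longrightarrow> anc p (a \<ominus> b) = anc p a \<ominus> anc p b"
  by (rule add_map_minus[OF anc_add_map A_group A_group])

text \<open>In the second component the Jacobi identity is checked coordinate by coordinate, where
  it amounts to three instances of \<open>anc_br\<close>. This works because every coordinate
  carries the anchor action itself, which is flat.\<close>

lemma semidirect_lie_rinehart:
  "lie_rinehart A (semidirect A L :: ('a, 'l \<times> ('y \<Rightarrow> 'a)) module) sd_br sd_anc"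
proof -
  let ?S = "semidirect A L :: ('a, 'l \<times> ('y \<Rightarrow> 'a)) module"
  let ?F = "free_module A (UNIV :: 'y set)"
  have "module A L" by unfold_locales
  interpret SD: module A ?S by (rule semidirect_module[OF \<open>module A L\<close>])
  interpret F: module A ?F by (rule A.free_module_module)
  have neg: "\<ominus>\<^bsub>?S\<^esub> (p, m) = (\<ominus>\<^bsub>L\<^esub> p, \<ominus>\<^bsub>?F\<^esub> m)" if "p \<in> carrier L" "m \<in> carrier ?F" for p m
    using that by (intro SD.M.minus_equality) (auto simp: L.M.l_neg F.M.l_neg)
  have fc: "f y \<in> carrier A" if "f \<in> carrier ?F" for f y
    using that by (simp add: free_module_carrier)
  note fa = A.free_module_add_apply A.free_module_smult_apply
  have Fneg: "(\<ominus>\<^bsub>?F\<^esub> f) y = \<ominus> f y" if "f \<in> carrier ?F" for f y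
    by (simp add: A.free_module_neg[OF that])
  have brc: "(\<lambda>y. anc p (n y) \<ominus> anc q (m y)) \<in> carrier ?F"
    if "p \<in> carrier L" "q \<in> carrier L" "m \<in> carrier ?F" "n \<in> carrier ?F" for p q m n
  proof (rule A.free_module_carrierI)
    show "anc p (n y) \<ominus> anc q (m y) \<in> carrier A" for y
      using that anc_closed fc by auto
    show "finite ({y. n y \<noteq> \<zero>} \<union> {y. m y \<noteq> \<zero>})"
      using that by (auto simp: free_module_carrier)
    show "anc p (n y) \<ominus> anc q (m y) = \<zero>" if "y \<notin> {y. n y \<noteq> \<zero>} \<union> {y. m y \<noteq> \<zero>}" for y
      using that \<open>p \<in> carrier L\<close> \<open>q \<in> carrier L\<close> by (simp add: anc_zero A.minus_eq)
  qed auto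
  show ?thesis
  proof
    fix u v w :: "'l \<times> ('y \<Rightarrow> 'a)" and a b c
    assume "u \<in> carrier ?S" "v \<in> carrier ?S"
    then obtain p m q n where u: "u = (p, m)" "p \<in> carrier L" "m \<in> carrier ?F"
      and v: "v = (q, n)" "q \<in> carrier L" "n \<in> carrier ?F" by auto
    show "sd_anc (u \<oplus>\<^bsub>?S\<^esub> v) a = sd_anc u a \<oplus> sd_anc v a" if "a \<in> carrier A"
      using u v that by (simp add: sd_anc_def anc_add_left)
    show "sd_br u v \<in> carrier ?S"
      using u v brc by (simp add: sd_br_def br_closed)
    show "sd_br v u = \<ominus>\<^bsub>?S\<^esub> sd_br u v"
      using u v brc[of p q m n] br_closed
      by (auto simp: sd_br_def neg br_anti[of p q] A.free_module_neg anc_closed fc A.minus_eq A.minus_add A.a_comm)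
    show "sd_br u (c \<odot>\<^bsub>?S\<^esub> v) = c \<odot>\<^bsub>?S\<^esub> sd_br u v \<oplus>\<^bsub>?S\<^esub> sd_anc u c \<odot>\<^bsub>?S\<^esub> v" if c: "c \<in> carrier A"
      using u v c
      by (auto simp: sd_br_def sd_anc_def br_smult fa fun_eq_iff anc_smult_left anc_mult anc_closed fc
          A.minus_eq A.r_distr A.r_minus A.a_ac A.m_comm)
    show "sd_anc u (sd_anc v a) = sd_anc (sd_br u v) a \<oplus> sd_anc v (sd_anc u a)" if "a \<in> carrier A"
      using u v that anc_br[of p q a] by (simp add: sd_anc_def sd_br_def)
    assume "w \<in> carrier ?S"
    then obtain r k where w: "w = (r, k)" "r \<in> carrier L" "k \<in> carrier ?F" by auto
    show "sd_br u (v \<oplus>\<^bsub>?S\<^esub> w) = sd_br u v \<oplus>\<^bsub>?S\<^esub> sd_br u w"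
      using u v w
      by (auto simp: sd_br_def br_add fa fun_eq_iff anc_add anc_add_left anc_closed fc A.minus_eq A.minus_add A.a_ac)
    show "sd_br u (sd_br v w) = sd_br (sd_br u v) w \<oplus>\<^bsub>?S\<^esub> sd_br v (sd_br u w)"
    proof -
      have "anc p (anc q (k y) \<ominus> anc r (n y)) \<ominus> anc (br q r) (m y) =
          (anc (br p q) (k y) \<ominus> anc r (anc p (n y) \<ominus> anc q (m y))) \<oplus>
          (anc q (anc p (k y) \<ominus> anc r (m y)) \<ominus> anc (br p r) (n y))" for y
      proof -
        define a b c where "a = m y" and "b = n y" and "c = k y"
        have abc: "a \<in> carrier A" "b \<in> carrier A" "c \<in> carrier A"
          using u v w fc by (auto simp: a_def b_def c_def)
        have cl: "anc x t \<in> carrier A" if "x \<in> {p, q, r, br p q, br p r, br q r}" "t \<in> carrier A" for x t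
          using that u v w br_closed anc_closed by blast
        define t1 where "t1 = anc q (anc p c)"
        define t2 where "t2 = anc (br p q) c"
        define t3 where "t3 = anc (br p r) b"
        define t4 where "t4 = anc r (anc p b)"
        define t5 where "t5 = anc (br q r) a"
        define t6 where "t6 = anc r (anc q a)"
        have t: "t1 \<in> carrier A" "t2 \<in> carrier A" "t3 \<in> carrier A" "t4 \<in> carrier A" "t5 \<in> carrier A" "t6 \<in> carrier A"
          using abc cl by (auto simp: t1_def t2_def t3_def t4_def t5_def t6_def)
        have r1: "anc p (anc q c) = t2 \<oplus> t1" unfolding t1_def t2_def using u v abc by (intro anc_br)
        have r2: "anc p (anc r b) = t3 \<oplus> t4" unfolding t3_def t4_def using u w abc by (intro anc_br)
        have r3: "anc q (anc r a) = t5 \<oplus> t6" unfolding t5_def t6_def using v w abc by (intro anc_br)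
        have "anc p (anc q c \<ominus> anc r b) \<ominus> t5 = ((t2 \<oplus> t1) \<ominus> (t3 \<oplus> t4)) \<ominus> t5"
          using u abc cl by (simp add: anc_minus r1 r2)
        also have "\<dots> = (t2 \<ominus> (t4 \<ominus> t6)) \<oplus> ((t1 \<ominus> (t5 \<oplus> t6)) \<ominus> t3)"
          using t by algebra
        also have "\<dots> = (t2 \<ominus> anc r (anc p b \<ominus> anc q a)) \<oplus> (anc q (anc p c \<ominus> anc r a) \<ominus> t3)"
          using v w abc cl by (simp add: anc_minus r3 t4_def t6_def t1_def)
        finally show ?thesis
          by (simp add: a_def b_def c_def t2_def t3_def t5_def)
      qed
      then show ?thesis
        using u v w jacobi[of p q r] by (simp add: sd_br_def fa fun_eq_iff)
    qed
  next
    fix u :: "'l \<times> ('y \<Rightarrow> 'a)" and a b c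
    assume u: "u \<in> carrier ?S"
    then obtain p m where u': "u = (p, m)" "p \<in> carrier L" "m \<in> carrier ?F" by auto
    show "sd_br u u = \<zero>\<^bsub>?S\<^esub>"
      using u' by (auto simp: sd_br_def br_alt free_module_simps A.minus_eq A.r_neg anc_closed fc)
    show "sd_anc u a \<in> carrier A" if "a \<in> carrier A"
      using u' that by (simp add: sd_anc_def anc_closed)
    show "sd_anc u (a \<oplus> b) = sd_anc u a \<oplus> sd_anc u b" if "a \<in> carrier A" "b \<in> carrier A"
      using u' that by (simp add: sd_anc_def anc_add)
    show "sd_anc u (a \<otimes> b) = a \<otimes> sd_anc u b \<oplus> b \<otimes> sd_anc u a" if "a \<in> carrier A" "b \<in> carrier A"
      using u' that by (simp add: sd_anc_def anc_mult)
  next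
    fix c a and u :: "'l \<times> ('y \<Rightarrow> 'a)"
    assume "c \<in> carrier A" "u \<in> carrier ?S" "a \<in> carrier A"
    then show "sd_anc (c \<odot>\<^bsub>?S\<^esub> u) a = c \<otimes> sd_anc u a"
      by (auto simp: sd_anc_def anc_smult_left)
  qed
qed

end

text \<open>The identity of \<open>P\<close> is lifted along the canonical surjection from the free
  module on \<open>carrier P\<close>, and the splitting is then read in the free module over the
  whole type.\<close>

lemma projective_splitting:
  fixes P :: "('a, 'p) module"
  assumes "projective_module A P"
  obtains s g where "s \<in> lin_hom A P (free_module A (UNIV :: 'p set))"
    "g \<in> lin_hom A (free_module A (UNIV :: 'p set)) P" "\<And>x. x \<in> carrier P \<Longrightarrow> g (s x) = x"
proof -
  have P: "module A P" using assms by (simp add: projective_module_def)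
  interpret P: module A P by fact
  let ?F = "free_module A (carrier P)"
  \<comment> \<open>Basis vectors outside \<open>carrier P\<close> go to \<open>0\<close>, so that
    the surjection is defined on the free module over the whole type.\<close>
  define \<psi> where "\<psi> x a = a \<odot>\<^bsub>P\<^esub> (if x \<in> carrier P then x else \<zero>\<^bsub>P\<^esub>)" for x a
  have \<psi>: "\<psi> x \<in> add_map A P" for x
    unfolding \<psi>_def by (rule add_mapI) (auto simp: P.smult_l_distr)
  define g where "g = dsum A P \<psi>"
  have g: "g \<in> lin_hom A (free_module A UNIV) P"
    unfolding g_def by (rule P.dsum_lin_hom[OF P \<psi>]) (simp add: \<psi>_def P.smult_assoc1)
  have sub: "carrier ?F \<subseteq> carrier (free_module A UNIV)" by (auto simp: free_module_carrier)
  have g': "g \<in> lin_hom A ?F P"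
  proof (rule lin_homI)
    show "g x \<in> carrier P" if "x \<in> carrier ?F" for x
      using lin_hom_closed[OF g] sub that by blast
    show "g (x \<oplus>\<^bsub>?F\<^esub> y) = g x \<oplus>\<^bsub>P\<^esub> g y" if "x \<in> carrier ?F" "y \<in> carrier ?F" for x y
      using add_map_add[OF lin_hom_add_map[OF g], of x y] sub that by (auto simp: free_module_simps)
    show "g (k \<odot>\<^bsub>?F\<^esub> x) = k \<odot>\<^bsub>P\<^esub> g x" if "k \<in> carrier A" "x \<in> carrier ?F" for k x
      using lin_hom_smult[OF g, of k x] sub that by (auto simp: free_module_simps)
  qed
  have gs: "g (single A x \<one>\<^bsub>A\<^esub>) = x" if "x \<in> carrier P" for x
    unfolding g_def using P.dsum_single[where N=P and \<psi>=\<psi> and X=UNIV and x=x and a="\<one>\<^bsub>A\<^esub>"] \<psi> that P.M.abelian_group_axioms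
    by (simp add: \<psi>_def)
  have "g ` carrier ?F = carrier P"
    using lin_hom_closed[OF g'] gs P.single_closed[of _ "carrier P" "\<one>\<^bsub>A\<^esub>"] by (auto intro!: rev_image_eqI)
  moreover have "(\<lambda>x. x) \<in> lin_hom A P P" by (rule lin_homI) auto
  ultimately have "\<exists>h \<in> lin_hom A P ?F. \<forall>x\<in>carrier P. g (h x) = x"
    using assms g' P P.free_module_module[of "carrier P"] unfolding projective_module_def by blast
  then obtain s where s: "s \<in> lin_hom A P ?F" "\<forall>x\<in>carrier P. g (s x) = x" by blast
  have "s \<in> lin_hom A P (free_module A UNIV)"
    using s(1) sub by (auto simp: lin_hom_def free_module_simps Pi_def)
  then show thesis using that g s(2) by blast
qed

text \<open>An Eilenberg swindle: \<open>P \<oplus> A\<^bsup>(X \<times> \<nat>)\<^esup>\<close> is free when \<open>P\<close> is a direct summand of \<open>A\<^bsup>(X)\<^esup>\<close>.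
  With \<open>e = s g\<close> the idempotent of \<open>P\<close>, the new coordinates regroup
  \<open>P \<oplus> ((1 - e) \<oplus> e) \<oplus> ((1 - e) \<oplus> e) \<oplus> \<dots>\<close> as \<open>(P \<oplus> (1 - e)) \<oplus> (e \<oplus> (1 - e)) \<oplus> \<dots>\<close>.\<close>

locale projective_split =
  fixes A :: "('a, 'm) ring_scheme" (structure) and P :: "('a, 'p, 'n) module_scheme"
    and s :: "'p \<Rightarrow> 'x \<Rightarrow> 'a" and g :: "('x \<Rightarrow> 'a) \<Rightarrow> 'p"
  assumes P: "module A P"
    and s: "s \<in> lin_hom A P (free_module A (UNIV :: 'x set))"
    and g: "g \<in> lin_hom A (free_module A (UNIV :: 'x set)) P"
    and gs: "x \<in> carrier P \<Longrightarrow> g (s x) = x"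
begin

sublocale P: module A P by (rule P)

abbreviation "F \<equiv> free_module A (UNIV :: 'x set)"
abbreviation "F2 \<equiv> free_module A (UNIV :: ('x \<times> nat) set)"
abbreviation "W \<equiv> (semidirect A P :: ('a, 'p \<times> ('x \<times> nat \<Rightarrow> 'a)) module)"

sublocale F: module A F by (rule P.free_module_module)
sublocale F2: module A F2 by (rule P.free_module_module)
sublocale W: module A W by (rule semidirect_module[OF P])

definition slice :: "nat \<Rightarrow> ('x \<times> nat \<Rightarrow> 'a) \<Rightarrow> 'x \<Rightarrow> 'a" where "slice n m = (\<lambda>x. m (x, n))"
definition glue :: "(nat \<Rightarrow> 'x \<Rightarrow> 'a) \<Rightarrow> 'x \<times> nat \<Rightarrow> 'a" where "glue c = (\<lambda>(x, n). c n x)"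

lemma slice_glue [simp]: "slice n (glue c) = c n"
  by (simp add: slice_def glue_def)

lemma slice_eqI: "(\<And>n. slice n m = slice n m') \<Longrightarrow> m = m'"
  by (auto simp: slice_def fun_eq_iff)

lemma slice_lin: "slice n \<in> lin_hom A F2 F"
proof (rule lin_homI)
  fix m assume m: "m \<in> carrier F2"
  have "finite ((\<lambda>x. (x, n)) -` {y. m y \<noteq> \<zero>})"
    using m by (intro finite_vimageI) (auto simp: free_module_carrier inj_on_def)
  then show "slice n m \<in> carrier F"
    using m by (auto simp: free_module_carrier slice_def vimage_def)
qed (auto simp: slice_def free_module_simps)

lemma glue_closed:
  assumes "\<And>n. c n \<in> carrier F" "finite N" "\<And>n. n \<notin> N \<Longrightarrow> c n = \<zero>\<^bsub>F\<^esub>"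
  shows "glue c \<in> carrier F2"
proof (rule P.free_module_carrierI)
  show "glue c y \<in> carrier A" for y
    using assms(1) by (cases y) (auto simp: glue_def free_module_carrier)
  show "finite (\<Union>n\<in>N. (\<lambda>x. (x, n)) ` {x. c n x \<noteq> \<zero>})"
    using assms(1,2) by (auto simp: free_module_carrier)
  show "glue c y = \<zero>" if "y \<notin> (\<Union>n\<in>N. (\<lambda>x. (x, n)) ` {x. c n x \<noteq> \<zero>})" for y
  proof (cases y)
    case (Pair x n)
    then show ?thesis
      using that assms(3)[of n] by (cases "n \<in> N") (auto simp: glue_def free_module_simps)
  qed
qed auto

lemma slice_finite:
  assumes "m \<in> carrier F2"
  shows "finite {n. slice n m \<noteq> \<zero>\<^bsub>F\<^esub>}"
proof -
  have "{n. slice n m \<noteq> \<zero>\<^bsub>F\<^esub>} \<subseteq> snd ` {y. m y \<noteq> \<zero>}"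
    by (force simp: slice_def free_module_simps)
  then show ?thesis
    using assms finite_subset by (fastforce simp: free_module_carrier)
qed

definition e :: "('x \<Rightarrow> 'a) \<Rightarrow> 'x \<Rightarrow> 'a" where "e f = s (g f)"

lemma e_lin: "e \<in> lin_hom A F F"
  unfolding e_def by (rule lin_hom_comp[OF g s])

lemma e_closed: "f \<in> carrier F \<Longrightarrow> e f \<in> carrier F"
  by (rule lin_hom_closed[OF e_lin])

lemma s_closed: "x \<in> carrier P \<Longrightarrow> s x \<in> carrier F"
  by (rule lin_hom_closed[OF s])

lemma g_closed: "f \<in> carrier F \<Longrightarrow> g f \<in> carrier P"
  by (rule lin_hom_closed[OF g])

lemma sl_closed: "m \<in> carrier F2 \<Longrightarrow> slice n m \<in> carrier F"
  by (rule lin_hom_closed[OF slice_lin])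

lemma e_idem: "f \<in> carrier F \<Longrightarrow> e (e f) = e f"
  by (simp add: e_def gs g_closed)

lemma e_s: "x \<in> carrier P \<Longrightarrow> e (s x) = s x"
  by (simp add: e_def gs)

lemma g_e: "f \<in> carrier F \<Longrightarrow> g (e f) = g f"
  by (simp add: e_def gs g_closed)

lemmas e_add = add_map_add[OF lin_hom_add_map[OF e_lin]]
  and e_neg = add_map_neg[OF lin_hom_add_map[OF e_lin] F.abelian_group_axioms F.abelian_group_axioms]
  and g_neg = add_map_neg[OF lin_hom_add_map[OF g] F.abelian_group_axioms P.abelian_group_axioms]
  and e_zero = add_map_zero[OF lin_hom_add_map[OF e_lin] F.abelian_group_axioms F.abelian_group_axioms]
  and g_add = add_map_add[OF lin_hom_add_map[OF g]]
  and sl_add = add_map_add[OF lin_hom_add_map[OF slice_lin]]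

text \<open>The incoming summand of block \<open>n\<close> in the regrouping: \<open>P\<close> for
  the first block, afterwards the \<open>e\<close>-part of the previous slice. \<open>T\<close>
  fills the block with the \<open>1 - e\<close> part of slice \<open>n\<close>.\<close>

definition T1 :: "nat \<Rightarrow> 'p \<times> ('x \<times> nat \<Rightarrow> 'a) \<Rightarrow> 'x \<Rightarrow> 'a" where
  "T1 n u = (case n of 0 \<Rightarrow> s (fst u) | Suc k \<Rightarrow> e (slice k (snd u)))"

definition T :: "nat \<Rightarrow> 'p \<times> ('x \<times> nat \<Rightarrow> 'a) \<Rightarrow> 'x \<Rightarrow> 'a" where
  "T n u = T1 n u \<oplus>\<^bsub>F\<^esub> (slice n (snd u) \<ominus>\<^bsub>F\<^esub> e (slice n (snd u)))"

lemma T1_lin: "T1 n \<in> lin_hom A W F"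
proof -
  have fst: "fst \<in> lin_hom A W P" and snd: "snd \<in> lin_hom A W F2"
    by (auto intro!: lin_homI)
  show ?thesis
  proof (cases n)
    case 0
    then show ?thesis using lin_hom_comp[OF fst s] by (simp add: T1_def[abs_def])
  next
    case (Suc k)
    then show ?thesis
      using lin_hom_comp[OF lin_hom_comp[OF snd slice_lin] e_lin] by (simp add: T1_def[abs_def])
  qed
qed

lemma T1_closed: "u \<in> carrier W \<Longrightarrow> T1 n u \<in> carrier F"
  by (rule lin_hom_closed[OF T1_lin])

lemma T_closed: "u \<in> carrier W \<Longrightarrow> T n u \<in> carrier F"
  unfolding T_def by (intro F.M.a_closed T1_closed F.M.minus_closed e_closed sl_closed) auto

lemma T_lin: "T n \<in> lin_hom A W F"
proof (rule lin_homI)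
  fix u v assume uv: "u \<in> carrier W" "v \<in> carrier W"
  then have "snd (u \<oplus>\<^bsub>W\<^esub> v) = snd u \<oplus>\<^bsub>F2\<^esub> snd v" by auto
  then show "T n (u \<oplus>\<^bsub>W\<^esub> v) = T n u \<oplus>\<^bsub>F\<^esub> T n v"
    using uv add_map_add[OF lin_hom_add_map[OF T1_lin] uv] T1_closed
    by (auto simp: T_def sl_add sl_closed e_add e_closed a_minus_def F.M.minus_add F.M.a_ac)
next
  fix a u assume a: "a \<in> carrier A" and u: "u \<in> carrier W"
  then have "snd (a \<odot>\<^bsub>W\<^esub> u) = a \<odot>\<^bsub>F2\<^esub> snd u" by auto
  then show "T n (a \<odot>\<^bsub>W\<^esub> u) = a \<odot>\<^bsub>F\<^esub> T n u"
    using a u lin_hom_smult[OF T1_lin a u] T1_closed[OF u]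
    by (auto simp: T_def lin_hom_smult[OF slice_lin] sl_closed lin_hom_smult[OF e_lin] e_closed a_minus_def
        F.smult_r_distr F.smult_r_minus)
qed (rule T_closed)

definition Theta :: "'p \<times> ('x \<times> nat \<Rightarrow> 'a) \<Rightarrow> 'x \<times> nat \<Rightarrow> 'a" where
  "Theta u = glue (\<lambda>n. T n u)"

text \<open>The inverse regrouping: block \<open>0\<close> gives back \<open>P\<close> through
  \<open>g\<close>, and slice \<open>n\<close> is reassembled from the \<open>1 - e\<close> part of
  block \<open>n\<close> and the \<open>e\<close>-part of block \<open>n + 1\<close>.\<close>

definition Xi :: "('x \<times> nat \<Rightarrow> 'a) \<Rightarrow> 'p \<times> ('x \<times> nat \<Rightarrow> 'a)" where
  "Xi z = (g (slice 0 z), glue (\<lambda>n. (slice n z \<ominus>\<^bsub>F\<^esub> e (slice n z)) \<oplus>\<^bsub>F\<^esub> e (slice (Suc n) z)))"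

lemma Theta_closed:
  assumes "u \<in> carrier W"
  shows "Theta u \<in> carrier F2"
  unfolding Theta_def
proof (rule glue_closed)
  let ?N = "{n. slice n (snd u) \<noteq> \<zero>\<^bsub>F\<^esub>}"
  have m: "snd u \<in> carrier F2" using assms by auto
  \<comment> \<open>Block \<open>n\<close> draws on slices \<open>n\<close> and
    \<open>n - 1\<close>, block \<open>0\<close> also on \<open>P\<close>.\<close>
  show "finite (insert 0 (?N \<union> Suc ` ?N))"
    using slice_finite[OF m] by simp
  show "T n u = \<zero>\<^bsub>F\<^esub>" if "n \<notin> insert 0 (?N \<union> Suc ` ?N)" for n
  proof -
    have "n \<noteq> 0" using that by auto
    then obtain k where "n = Suc k" using not0_implies_Suc by blast
    then show ?thesis
      using that by (auto simp: T_def T1_def e_zero a_minus_def F.M.neg_zero)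
  qed
qed (rule T_closed[OF assms])

lemma Theta_lin: "Theta \<in> lin_hom A W F2"
proof (rule lin_homI[OF Theta_closed])
  show "Theta (u \<oplus>\<^bsub>W\<^esub> v) = Theta u \<oplus>\<^bsub>F2\<^esub> Theta v" if "u \<in> carrier W" "v \<in> carrier W" for u v
    using add_map_add[OF lin_hom_add_map[OF T_lin] that]
    by (auto simp: Theta_def glue_def fun_eq_iff P.free_module_add_apply)
  show "Theta (a \<odot>\<^bsub>W\<^esub> u) = a \<odot>\<^bsub>F2\<^esub> Theta u" if "a \<in> carrier A" "u \<in> carrier W" for a u
    using lin_hom_smult[OF T_lin that]
    by (auto simp: Theta_def glue_def fun_eq_iff P.free_module_smult_apply)
qed

lemma Xi_closed:
  assumes z: "z \<in> carrier F2"
  shows "Xi z \<in> carrier W"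
proof -
  let ?N = "{n. slice n z \<noteq> \<zero>\<^bsub>F\<^esub>}"
  have "glue (\<lambda>n. (slice n z \<ominus>\<^bsub>F\<^esub> e (slice n z)) \<oplus>\<^bsub>F\<^esub> e (slice (Suc n) z)) \<in> carrier F2"
  proof (rule glue_closed)
    show "finite (?N \<union> {n. Suc n \<in> ?N})"
      using slice_finite[OF z] finite_vimageI[of ?N Suc] by (auto simp: vimage_def)
    show "(slice n z \<ominus>\<^bsub>F\<^esub> e (slice n z)) \<oplus>\<^bsub>F\<^esub> e (slice (Suc n) z) = \<zero>\<^bsub>F\<^esub>"
      if "n \<notin> ?N \<union> {n. Suc n \<in> ?N}" for n
      using that by (auto simp: e_zero a_minus_def F.M.neg_zero)
  qed (use z sl_closed e_closed in auto)
  then show ?thesis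
    using g_closed sl_closed[OF z] by (simp add: Xi_def)
qed

text \<open>\<open>T1\<close> takes values in the image of the idempotent and the other summand of
  \<open>T\<close> is killed by it, so \<open>e\<close> recovers the incoming part of a block. Both
  inverse laws rest on this separation of the two parts.\<close>

lemma e_T:
  assumes "u \<in> carrier W"
  shows "e (T n u) = T1 n u"
proof -
  have m: "snd u \<in> carrier F2" "fst u \<in> carrier P" using assms by auto
  have "e (T1 n u) = T1 n u"
    using m sl_closed by (cases n) (auto simp: T1_def e_s e_idem)
  then show ?thesis
    using T1_closed[OF assms] sl_closed[OF m(1)] e_closed
    by (simp add: T_def e_add e_neg e_idem a_minus_def F.M.r_neg)
qed

lemma Xi_Theta:
  assumes u: "u \<in> carrier W"
  shows "Xi (Theta u) = u"
proof -
  have m: "snd u \<in> carrier F2" "fst u \<in> carrier P" using u by auto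
  have "g (T 0 u) = fst u"
    using m sl_closed[OF m(1)] s_closed e_closed g_closed
    by (simp add: T_def T1_def g_add g_neg g_e gs a_minus_def P.M.r_neg)
  moreover have "(T n u \<ominus>\<^bsub>F\<^esub> e (T n u)) \<oplus>\<^bsub>F\<^esub> e (T (Suc n) u) = slice n (snd u)" for n
    using sl_closed[OF m(1)] e_closed T1_closed[OF u, of n]
    unfolding e_T[OF u]
    by (simp add: T_def T1_def[of "Suc n"] a_minus_def F.M.a_ac F.M.r_neg1 F.M.r_neg2 F.M.l_neg F.M.r_neg)
  then have "glue (\<lambda>n. (T n u \<ominus>\<^bsub>F\<^esub> e (T n u)) \<oplus>\<^bsub>F\<^esub> e (T (Suc n) u)) = snd u"
    by (intro slice_eqI) simp
  ultimately show ?thesis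
    by (simp add: Xi_def Theta_def)
qed

lemma Theta_Xi:
  assumes z: "z \<in> carrier F2"
  shows "Theta (Xi z) = z"
proof (rule slice_eqI)
  fix n
  have c: "slice k z \<in> carrier F" "e (slice k z) \<in> carrier F" for k
    using sl_closed[OF z] e_closed by auto
  have em: "e ((slice k z \<ominus>\<^bsub>F\<^esub> e (slice k z)) \<oplus>\<^bsub>F\<^esub> e (slice (Suc k) z)) = e (slice (Suc k) z)" for k
    using c by (simp add: e_add e_neg e_idem a_minus_def F.M.r_neg)
  have T1: "T1 n (Xi z) = e (slice n z)"
    by (cases n) (simp_all add: T1_def Xi_def em e_def[of "slice 0 z"])
  have "T n (Xi z) = e (slice n z) \<oplus>\<^bsub>F\<^esub>
      (((slice n z \<ominus>\<^bsub>F\<^esub> e (slice n z)) \<oplus>\<^bsub>F\<^esub> e (slice (Suc n) z)) \<ominus>\<^bsub>F\<^esub> e (slice (Suc n) z))"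
    unfolding T_def T1 by (simp add: Xi_def em)
  also have "\<dots> = slice n z"
    using c by (simp add: a_minus_def F.M.a_assoc F.M.r_neg) (simp add: F.M.a_lcomm F.M.r_neg)
  finally show "slice n (Theta (Xi z)) = slice n z"
    by (simp add: Theta_def)
qed

lemma Theta_bij: "bij_betw Theta (carrier W) (carrier F2)"
  by (rule bij_betwI[where g=Xi]) (use Theta_closed Xi_closed Xi_Theta Theta_Xi in auto)

end

lemma total_order_exists:
  obtains le :: "'y \<Rightarrow> 'y \<Rightarrow> bool" where "\<And>x y. le x y \<or> le y x"
    "\<And>x y z. le x y \<Longrightarrow> le y z \<Longrightarrow> le x z" "\<And>x y. le x y \<Longrightarrow> le y x \<Longrightarrow> x = y"
proof -
  obtain r :: "('y \<times> 'y) set" where r: "well_order_on UNIV r"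
    using well_order_on by blast
  then have "refl r" "trans r" "antisym r" "total r"
    by (auto simp: well_order_on_def linear_order_on_def partial_order_on_def preorder_on_def)
  then show thesis
    by (intro that[of "\<lambda>x y. (x, y) \<in> r"])
       (auto simp: refl_on_def total_on_def dest: transD antisymD, metis)
qed

section \<open>The normal element\<close>

lemma (in abelian_monoid) finsum_mem:
  assumes "\<zero> \<in> T" "\<And>x y. x \<in> T \<Longrightarrow> y \<in> T \<Longrightarrow> x \<oplus> y \<in> T" "T \<subseteq> carrier G" "\<And>i. i \<in> K \<Longrightarrow> f i \<in> T"
  shows "finsum G f K \<in> T"
proof (cases "finite K")
  case True
  then show ?thesis using assms(4)
  proof (induction K)
    case (insert i K)
    then have "finsum G f (insert i K) = f i \<oplus> finsum G f K"
      using assms(3) by (intro finsum_insert) auto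
    then show ?case using insert assms(2) by simp
  qed (simp add: assms(1))
qed (simp add: assms(1) finsum_infinite)

text \<open>\<open>u x\<close> plays the part of \<open>dx\<close> in a free Lie--Rinehart algebra
  \<open>L\<close> that contains the differentials. Recording only its properties keeps the
  construction of \<open>L\<close> out of the argument. The ideal enters as a prime ideal, all of
  whose elements are multiples of \<open>f0\<close>.\<close>

locale poisson_pbw = poisson_kaehler R A + lie_rinehart_basis A L br anc co le
  for R :: "('r, 'c) ring_scheme" and A :: "('r, 'a) poisson" (structure)
    and L :: "('a, 'l, 'n) module_scheme" and br :: "'l \<Rightarrow> 'l \<Rightarrow> 'l" and anc :: "'l \<Rightarrow> 'a \<Rightarrow> 'a"
    and co :: "'l \<Rightarrow> 'y \<Rightarrow> 'a" and le :: "'y \<Rightarrow> 'y \<Rightarrow> bool" +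
  fixes u :: "'a \<Rightarrow> 'l" and I :: "'a set" and f0 :: 'a
  assumes u_add_map: "u \<in> add_map A L"
    and u_smult: "r \<in> carrier R \<Longrightarrow> x \<in> carrier A \<Longrightarrow> u (r \<odot> x) = ofR r \<odot>\<^bsub>L\<^esub> u x"
    and u_mult: "x \<in> carrier A \<Longrightarrow> y \<in> carrier A \<Longrightarrow> u (x \<otimes> y) = x \<odot>\<^bsub>L\<^esub> u y \<oplus>\<^bsub>L\<^esub> y \<odot>\<^bsub>L\<^esub> u x"
    and br_u: "x \<in> carrier A \<Longrightarrow> y \<in> carrier A \<Longrightarrow> br (u x) (u y) = u (pb x y)"
    and anc_u: "x \<in> carrier A \<Longrightarrow> a \<in> carrier A \<Longrightarrow> anc (u x) a = pb x a"
    and poisson_ideal: "poisson_ideal R A I"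
    and prime: "primeideal I A"
    and f0: "f0 \<in> I" and I_gen: "x \<in> I \<Longrightarrow> \<exists>c\<in>carrier A. x = c \<otimes> f0"
begin

sublocale I: primeideal I A by (rule prime)

lemma u_closed: "x \<in> carrier A \<Longrightarrow> u x \<in> carrier L"
  by (rule add_map_closed[OF u_add_map])

lemma I_closed: "x \<in> I \<Longrightarrow> x \<in> carrier A"
  using I.Icarr .

lemma f0_closed: "f0 \<in> carrier A"
  using I_closed f0 .

lemma pb_I: "a \<in> carrier A \<Longrightarrow> x \<in> I \<Longrightarrow> pb a x \<in> I"
  using poisson_ideal by (simp add: poisson_ideal_def)

lemma I_neg: "x \<in> I \<Longrightarrow> \<ominus> x \<in> I"
  using additive_subgroup_mem(3)[OF I.additive_subgroup_axioms A.is_abelian_group] .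

lemma I_minus: "x \<in> I \<Longrightarrow> y \<in> I \<Longrightarrow> x \<ominus> y \<in> I"
  using additive_subgroup_mem(4)[OF I.additive_subgroup_axioms A.is_abelian_group] .

lemma pb_I_left: "a \<in> carrier A \<Longrightarrow> x \<in> I \<Longrightarrow> pb x a \<in> I"
  using pb_I[of a x] pb_anti[of a x] I_closed[of x] I_neg by simp

lemma S_coeff: "f \<in> carrier S \<Longrightarrow> f m \<in> carrier A"
  by (simp add: free_module_carrier)

lemma S_minus_apply: "f \<in> carrier S \<Longrightarrow> g \<in> carrier S \<Longrightarrow> (f \<ominus>\<^bsub>S\<^esub> g) m = f m \<ominus> g m"
  by (simp add: A.free_module_minus)

section \<open>Polynomials with coefficients in the ideal, and the submodule of relations\<close>

definition IS :: "('y multiset \<Rightarrow> 'a) set" where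
  "IS = {f \<in> carrier S. \<forall>m. f m \<in> I}"

lemma IS_closed: "f \<in> IS \<Longrightarrow> f \<in> carrier S"
  by (simp add: IS_def)

lemma IS_add: "f \<in> IS \<Longrightarrow> g \<in> IS \<Longrightarrow> f \<oplus>\<^bsub>S\<^esub> g \<in> IS"
  by (auto simp: IS_def A.free_module_add_apply)

lemma IS_zero: "\<zero>\<^bsub>S\<^esub> \<in> IS"
  using S.M.zero_closed by (auto simp: IS_def free_module_simps)

lemma IS_smult: "c \<in> carrier A \<Longrightarrow> f \<in> IS \<Longrightarrow> c \<odot>\<^bsub>S\<^esub> f \<in> IS"
  using S.smult_closed by (auto simp: IS_def A.free_module_smult_apply intro: I.I_l_closed)

lemma I_smult: "c \<in> I \<Longrightarrow> f \<in> carrier S \<Longrightarrow> c \<odot>\<^bsub>S\<^esub> f \<in> IS"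
  using S.smult_closed[OF I_closed] by (auto simp: IS_def A.free_module_smult_apply S_coeff intro: I.I_r_closed)

text \<open>The expansion of \<open>f\<close> into its own terms, obtained by recognising the
  \<open>dsum\<close> of the maps \<open>single\<close> as the identity; in this expansion the
  coefficients stay in \<open>I\<close>.\<close>

lemma IS_span:
  assumes "f \<in> IS"
  shows "f \<in> add_span S {a \<odot>\<^bsub>S\<^esub> mon m |a m. a \<in> I}"
proof -
  have f: "f \<in> carrier S" using IS_closed[OF assms] .
  have \<psi>: "single A m \<in> add_map A S" for m
    by (rule A.single_add_map[OF UNIV_I])
  have "dsum A S (\<lambda>m a. single A m a) f = f"
  proof (rule S_map_eqI[OF _ _ S_group f])
    show "dsum A S (single A) \<in> add_map S S" by (rule A.dsum_add_map[OF S_group \<psi>])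
    show "(\<lambda>f. f) \<in> add_map S S" by (rule add_mapI) auto
    show "dsum A S (single A) (a \<odot>\<^bsub>S\<^esub> mon m) = a \<odot>\<^bsub>S\<^esub> mon m" if "a \<in> carrier A" for a m
      unfolding single_mon[OF that, symmetric] by (rule A.dsum_single[where X=UNIV, OF S_group \<psi> _ that]) simp
  qed
  then have "f = finsum S (\<lambda>m. single A m (f m)) {m. f m \<noteq> \<zero>}"
    by (simp add: dsum_def)
  moreover have "finsum S (\<lambda>m. single A m (f m)) {m. f m \<noteq> \<zero>} \<in> add_span S {a \<odot>\<^bsub>S\<^esub> mon m |a m. a \<in> I}"
  proof (rule S.M.add_span_finsum)
    show cl: "{a \<odot>\<^bsub>S\<^esub> mon m |a m. a \<in> I} \<subseteq> carrier S" using I_closed by auto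
    fix m
    have "f m \<in> I" using assms by (simp add: IS_def)
    then have "single A m (f m) \<in> {a \<odot>\<^bsub>S\<^esub> mon m |a m. a \<in> I}" using single_mon I_closed by blast
    then show "single A m (f m) \<in> add_span S {a \<odot>\<^bsub>S\<^esub> mon m |a m. a \<in> I}"
      by (rule S.M.add_span_base[OF cl])
  qed
  ultimately show ?thesis by simp
qed

lemma IS_map:
  assumes "h \<in> add_map S S" "\<And>a m. a \<in> I \<Longrightarrow> h (a \<odot>\<^bsub>S\<^esub> mon m) \<in> IS" "f \<in> IS"
  shows "h f \<in> IS"
proof -
  have cl: "{a \<odot>\<^bsub>S\<^esub> mon m |a m. a \<in> I} \<subseteq> carrier S" using I_closed by auto
  have "f \<in> {f \<in> carrier S. h f \<in> IS}"
    by (rule S.M.add_span_least[OF IS_span[OF assms(3)]])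
       (use assms(2) cl add_map_zero[OF assms(1) S_group S_group] IS_zero IS_add add_map_add[OF assms(1)] in auto)
  then show ?thesis by simp
qed

lemma E_IS:
  assumes x: "x \<in> carrier A" and f: "f \<in> IS"
  shows "E (u x) f \<in> IS"
proof (rule IS_map[OF E_add_map[OF u_closed[OF x]] _ f])
  fix a m assume a: "a \<in> I"
  show "E (u x) (a \<odot>\<^bsub>S\<^esub> mon m) \<in> IS"
    unfolding mon_E[OF u_closed[OF x] I_closed[OF a]] using a x u_closed[OF x]
    by (intro IS_add I_smult) (auto simp: anc_u I_closed pb_I inn_closed tab_closed)
qed

definition w :: 'l where "w = u f0"

lemma w_closed: "w \<in> carrier L"
  unfolding w_def by (rule u_closed[OF f0_closed])

text \<open>\<open>f0\<close> lies in a Poisson ideal, so bracketing with it maps \<open>A\<close>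
  into \<open>I\<close>. Consequently \<open>E w\<close> is \<open>A\<close>-linear modulo
  \<open>IS\<close>, and this is what makes \<open>N\<close> closed under scalars in
  \<open>smult_E_w\<close>.\<close>

lemma anc_w: "a \<in> carrier A \<Longrightarrow> anc w a \<in> I"
  unfolding w_def using f0 pb_I_left by (simp add: anc_u f0_closed)

lemma E_w_IS: "f \<in> IS \<Longrightarrow> E w f \<in> IS"
  unfolding w_def by (rule E_IS[OF f0_closed])

text \<open>\<open>N\<close> is stable under \<open>E (u x)\<close>: this operator commutes with \<open>E w\<close> up to \<open>E (u (pb x f0))\<close>, and
  \<open>pb x f0\<close> is a multiple of \<open>f0\<close>.\<close>

definition N :: "('y multiset \<Rightarrow> 'a) set" where
  "N = {i \<oplus>\<^bsub>S\<^esub> E w h |i h. i \<in> IS \<and> h \<in> carrier S}"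

lemma N_I: "i \<in> IS \<Longrightarrow> h \<in> carrier S \<Longrightarrow> i \<oplus>\<^bsub>S\<^esub> E w h \<in> N"
  by (auto simp: N_def)

lemma N_closed: "f \<in> N \<Longrightarrow> f \<in> carrier S"
  by (auto simp: N_def IS_closed E_closed w_closed)

lemma IS_N: "i \<in> IS \<Longrightarrow> i \<in> N"
  using N_I[of i "\<zero>\<^bsub>S\<^esub>"] by (simp add: E_zero w_closed IS_closed)

lemma E_w_N: "h \<in> carrier S \<Longrightarrow> E w h \<in> N"
  using N_I[of "\<zero>\<^bsub>S\<^esub>" h] by (simp add: E_closed w_closed IS_zero)

lemma N_add:
  assumes "f \<in> N" "g \<in> N"
  shows "f \<oplus>\<^bsub>S\<^esub> g \<in> N"
proof -
  obtain i h j k where f: "f = i \<oplus>\<^bsub>S\<^esub> E w h" "i \<in> IS" "h \<in> carrier S"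
    and g: "g = j \<oplus>\<^bsub>S\<^esub> E w k" "j \<in> IS" "k \<in> carrier S"
    using assms by (auto simp: N_def)
  have "f \<oplus>\<^bsub>S\<^esub> g = (i \<oplus>\<^bsub>S\<^esub> j) \<oplus>\<^bsub>S\<^esub> E w (h \<oplus>\<^bsub>S\<^esub> k)"
    using f g by (simp add: E_add E_closed w_closed IS_closed S.M.a_ac)
  then show ?thesis using f g N_I IS_add by simp
qed

lemma smult_E_w:
  assumes "c \<in> carrier A" "h \<in> carrier S"
  shows "c \<odot>\<^bsub>S\<^esub> E w h \<in> N"
proof -
  have "c \<odot>\<^bsub>S\<^esub> E w h = (\<ominus> anc w c) \<odot>\<^bsub>S\<^esub> h \<oplus>\<^bsub>S\<^esub> E w (c \<odot>\<^bsub>S\<^esub> h)"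
    using assms anc_closed[OF w_closed assms(1)] E_closed[OF w_closed assms(2)]
    by (simp add: E_smult w_closed S.smult_l_minus S.M.a_ac S.M.r_neg1 S.M.r_neg2)
  then show ?thesis
    using N_I[OF I_smult[OF I_neg[OF anc_w]]] assms by simp
qed

lemma N_smult:
  assumes "c \<in> carrier A" "f \<in> N"
  shows "c \<odot>\<^bsub>S\<^esub> f \<in> N"
proof -
  obtain i h where f: "f = i \<oplus>\<^bsub>S\<^esub> E w h" "i \<in> IS" "h \<in> carrier S"
    using assms by (auto simp: N_def)
  then have "c \<odot>\<^bsub>S\<^esub> f = c \<odot>\<^bsub>S\<^esub> i \<oplus>\<^bsub>S\<^esub> c \<odot>\<^bsub>S\<^esub> E w h"
    using assms by (simp add: S.smult_r_distr E_closed w_closed IS_closed)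
  then show ?thesis
    using N_add[OF IS_N[OF IS_smult] smult_E_w] f assms by simp
qed

lemma N_submodule: "submodule N A S"
proof (rule S.submoduleI)
  show "\<ominus>\<^bsub>S\<^esub> f \<in> N" if "f \<in> N" for f
    using N_smult[of "\<ominus> \<one>" f] that N_closed by (simp add: S.smult_l_minus)
qed (use N_closed N_add N_smult IS_N IS_zero in auto)

text \<open>With \<open>y = c f0\<close> the Leibniz rule gives \<open>u y = c w + f0 u c\<close>,
  so the operator is a multiple of \<open>E w\<close> plus a multiple of \<open>f0\<close>. Here the
  single generator controls all of \<open>I\<close>.\<close>

lemma E_I_N:
  assumes y: "y \<in> I" and f: "f \<in> carrier S"
  shows "E (u y) f \<in> N"
proof -
  obtain c where c: "c \<in> carrier A" "y = c \<otimes> f0" using I_gen[OF y] by blast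
  have "E (u y) f = c \<odot>\<^bsub>S\<^esub> E w f \<oplus>\<^bsub>S\<^esub> f0 \<odot>\<^bsub>S\<^esub> E (u c) f"
    using c f f0_closed u_closed by (simp add: u_mult E_add_left E_smult_left w_def)
  then show ?thesis
    using N_add[OF smult_E_w[OF c(1) f] IS_N[OF I_smult[OF f0 E_closed[OF u_closed[OF c(1)] f]]]] by simp
qed

lemma E_N:
  assumes x: "x \<in> carrier A" and f: "f \<in> N"
  shows "E (u x) f \<in> N"
proof -
  obtain i h where f: "f = i \<oplus>\<^bsub>S\<^esub> E w h" "i \<in> IS" "h \<in> carrier S"
    using assms by (auto simp: N_def)
  have "E (u x) (E w h) = E w (E (u x) h) \<oplus>\<^bsub>S\<^esub> E (u (pb x f0)) h"
    using E_commutator[OF u_closed[OF x] w_closed f(3)] x f0_closed by (simp add: w_def br_u)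
  then have "E (u x) (E w h) \<in> N"
    using N_add[OF E_w_N[OF E_closed[OF u_closed[OF x] f(3)]] E_I_N[OF pb_I[OF x f0] f(3)]] by simp
  then show ?thesis
    using f x u_closed[OF x] N_add[OF IS_N[OF E_IS[OF x f(2)]]]
    by (simp add: E_add IS_closed E_closed w_closed)
qed

section \<open>Leading forms modulo the ideal\<close>

lemma L_map_eqI:
  assumes "h \<in> lin_hom A L M" "k \<in> lin_hom A L M" "abelian_group M" "\<And>i. h (e i) = k (e i)" "v \<in> carrier L"
  shows "h v = k v"
proof -
  note ha = lin_hom_add_map[OF assms(1)] and ka = lin_hom_add_map[OF assms(2)]
  have "submodule {v \<in> carrier L. h v = k v} A L"
  proof (rule L.submoduleI)
    show "\<zero>\<^bsub>L\<^esub> \<in> {v \<in> carrier L. h v = k v}"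
      using add_map_zero[OF ha L_group assms(3)] add_map_zero[OF ka L_group assms(3)] by simp
    show "\<ominus>\<^bsub>L\<^esub> v \<in> {v \<in> carrier L. h v = k v}" if "v \<in> {v \<in> carrier L. h v = k v}" for v
      using that add_map_neg[OF ha L_group assms(3), of v] add_map_neg[OF ka L_group assms(3), of v] by auto
    show "v \<oplus>\<^bsub>L\<^esub> z \<in> {v \<in> carrier L. h v = k v}"
      if "v \<in> {v \<in> carrier L. h v = k v}" "z \<in> {v \<in> carrier L. h v = k v}" for v z
      using that add_map_add[OF ha, of v z] add_map_add[OF ka, of v z] by auto
    show "a \<odot>\<^bsub>L\<^esub> v \<in> {v \<in> carrier L. h v = k v}"
      if "a \<in> carrier A" "v \<in> {v \<in> carrier L. h v = k v}" for a v
      using that lin_hom_smult[OF assms(1), of a v] lin_hom_smult[OF assms(2), of a v] by auto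
  qed auto
  moreover have "range e \<subseteq> {v \<in> carrier L. h v = k v}" using assms(4) by auto
  ultimately show ?thesis using L_generated assms(5) by blast
qed

lemma co_coeff: "v \<in> carrier L \<Longrightarrow> co v k \<in> carrier A"
  using co_closed[of v] by (simp add: free_module_carrier)

text \<open>The coefficient formula for the product of \<open>h\<close> with the linear form whose
  coefficients are the \<open>co v k\<close>. A variable that is repeated in \<open>m\<close> still
  gives a single way of writing \<open>m\<close> as that variable times a monomial, hence the sum
  over \<open>set_mset m\<close>.\<close>

lemma mu_coeff:
  assumes v: "v \<in> carrier L" and h: "h \<in> carrier S"
  shows "mu v h m = (\<Oplus>\<^bsub>A\<^esub>k\<in>set_mset m. co v k \<otimes> h (m - {#k#}))"
proof -
  let ?A = "self_module A"
  have sg: "abelian_group ?A" by (rule self_group)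
  have ev: "(\<lambda>f. f m) \<in> lin_hom A S ?A"
    by (rule lin_homI) (auto simp: S_coeff A.free_module_add_apply A.free_module_smult_apply)
  have Rlin: "(\<lambda>v. \<Oplus>\<^bsub>A\<^esub>k\<in>set_mset m. co v k \<otimes> c k) \<in> lin_hom A L ?A"
    if "\<And>k. c k \<in> carrier A" for c
  proof (rule lin_homI)
    show "(\<Oplus>\<^bsub>A\<^esub>k\<in>set_mset m. co v k \<otimes> c k) \<in> carrier ?A" if "v \<in> carrier L" for v
      using \<open>\<And>k. c k \<in> carrier A\<close> co_coeff[OF that] by (auto intro!: A.finsum_closed)
    show "(\<Oplus>\<^bsub>A\<^esub>k\<in>set_mset m. co (v \<oplus>\<^bsub>L\<^esub> z) k \<otimes> c k) =
        (\<Oplus>\<^bsub>A\<^esub>k\<in>set_mset m. co v k \<otimes> c k) \<oplus>\<^bsub>?A\<^esub> (\<Oplus>\<^bsub>A\<^esub>k\<in>set_mset m. co z k \<otimes> c k)"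
      if "v \<in> carrier L" "z \<in> carrier L" for v z
      using \<open>\<And>k. c k \<in> carrier A\<close> co_coeff that add_map_add[OF lin_hom_add_map[OF co_lin] that]
      by (simp add: A.free_module_add_apply A.l_distr Pi_def flip: A.finsum_addf)
    show "(\<Oplus>\<^bsub>A\<^esub>k\<in>set_mset m. co (a \<odot>\<^bsub>L\<^esub> v) k \<otimes> c k) = a \<odot>\<^bsub>?A\<^esub> (\<Oplus>\<^bsub>A\<^esub>k\<in>set_mset m. co v k \<otimes> c k)"
      if "a \<in> carrier A" "v \<in> carrier L" for a v
      using \<open>\<And>k. c k \<in> carrier A\<close> co_coeff that lin_hom_smult[OF co_lin that]
      by (simp add: A.free_module_smult_apply A.m_assoc Pi_def A.finsum_rdistr)
  qed
  have inn: "inn shift v q m = (\<Oplus>\<^bsub>A\<^esub>k\<in>set_mset m. co v k \<otimes> mon q (m - {#k#}))" for q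
  proof (rule L_map_eqI[OF _ _ sg _ v])
    have mc: "mon q p \<in> carrier A" for p using mon_closed S_coeff by blast
    show "(\<lambda>v. inn shift v q m) \<in> lin_hom A L ?A"
      by (rule lin_hom_comp[OF inn_lin[OF shift_closed] ev])
    show "(\<lambda>v. \<Oplus>\<^bsub>A\<^esub>k\<in>set_mset m. co v k \<otimes> mon q (m - {#k#})) \<in> lin_hom A L ?A"
      by (rule Rlin[OF mc])
    fix j
    have z: "co (e j) k \<otimes> mon q (m - {#k#}) = (if k = j then mon q (m - {#j#}) else \<zero>)" for k
      using mc by (auto simp: co_e) (auto simp: basis_elt_def)
    show "inn shift (e j) q m = (\<Oplus>\<^bsub>A\<^esub>k\<in>set_mset m. co (e j) k \<otimes> mon q (m - {#k#}))"
    proof (cases "j \<in># m")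
      case True
      then obtain p where m: "m = add_mset j p" by (blast dest: multi_member_split)
      have "(\<Oplus>\<^bsub>A\<^esub>k\<in>set_mset m. co (e j) k \<otimes> mon q (m - {#k#})) = (\<Oplus>\<^bsub>A\<^esub>k\<in>set_mset m. if k = j then mon q (m - {#j#}) else \<zero>)"
        by (simp add: z)
      also have "\<dots> = mon q (m - {#j#})"
        using A.add.finprod_singleton[of j "set_mset m" "\<lambda>_. mon q (m - {#j#})"] True mc by (simp add: eq_commute)
      also have "\<dots> = shift q j m"
        by (auto simp: m shift_def basis_elt_def)
      finally show ?thesis by (simp add: inn_e shift_closed)
    next
      case False
      have "(\<Oplus>\<^bsub>A\<^esub>k\<in>set_mset m. co (e j) k \<otimes> mon q (m - {#k#})) = \<zero>"
        unfolding z using False by (intro A.add.finprod_one_eqI) auto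
      moreover have "shift q j m = \<zero>"
        using False by (auto simp: shift_def basis_elt_def)
      ultimately show ?thesis by (simp add: inn_e shift_closed)
    qed
  qed
  show ?thesis
  proof (rule S_map_eqI[OF _ _ sg h, of "\<lambda>h. mu v h m" "\<lambda>h. \<Oplus>\<^bsub>A\<^esub>k\<in>set_mset m. co v k \<otimes> h (m - {#k#})"])
    show "(\<lambda>h. mu v h m) \<in> add_map S ?A"
      by (rule add_map_comp[OF mu_add_map[OF v] lin_hom_add_map[OF ev]])
    show "(\<lambda>h. \<Oplus>\<^bsub>A\<^esub>k\<in>set_mset m. co v k \<otimes> h (m - {#k#})) \<in> add_map S ?A"
    proof (rule add_mapI)
      fix f g assume f: "f \<in> carrier S" and g: "g \<in> carrier S"
      show "(\<Oplus>\<^bsub>A\<^esub>k\<in>set_mset m. co v k \<otimes> f (m - {#k#})) \<in> carrier ?A"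
        using co_coeff[OF v] S_coeff[OF f] by (auto intro!: A.finsum_closed)
      show "(\<Oplus>\<^bsub>A\<^esub>k\<in>set_mset m. co v k \<otimes> (f \<oplus>\<^bsub>S\<^esub> g) (m - {#k#})) =
          (\<Oplus>\<^bsub>A\<^esub>k\<in>set_mset m. co v k \<otimes> f (m - {#k#})) \<oplus>\<^bsub>?A\<^esub> (\<Oplus>\<^bsub>A\<^esub>k\<in>set_mset m. co v k \<otimes> g (m - {#k#}))"
        using co_coeff[OF v] S_coeff[OF f] S_coeff[OF g]
        by (simp add: A.free_module_add_apply A.r_distr Pi_def flip: A.finsum_addf)
    qed
    fix q a assume a: "a \<in> carrier A"
    have mc: "mon q p \<in> carrier A" for p using mon_closed S_coeff by blast
    have "mu v (a \<odot>\<^bsub>S\<^esub> mon q) m = a \<otimes> (\<Oplus>\<^bsub>A\<^esub>k\<in>set_mset m. co v k \<otimes> mon q (m - {#k#}))"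
      unfolding mon_mu[OF v a] by (simp add: A.free_module_smult_apply inn)
    also have "\<dots> = (\<Oplus>\<^bsub>A\<^esub>k\<in>set_mset m. a \<otimes> (co v k \<otimes> mon q (m - {#k#})))"
      using a co_coeff[OF v] mc by (intro A.finsum_rdistr) auto
    also have "\<dots> = (\<Oplus>\<^bsub>A\<^esub>k\<in>set_mset m. co v k \<otimes> (a \<odot>\<^bsub>S\<^esub> mon q) (m - {#k#}))"
      using a co_coeff[OF v] mc by (intro A.finsum_cong') (auto simp: A.free_module_smult_apply A.m_lcomm)
    finally show "mu v (a \<odot>\<^bsub>S\<^esub> mon q) m = (\<Oplus>\<^bsub>A\<^esub>k\<in>set_mset m. co v k \<otimes> (a \<odot>\<^bsub>S\<^esub> mon q) (m - {#k#}))" .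
  qed
qed

definition trunc :: "('y multiset \<Rightarrow> bool) \<Rightarrow> ('y multiset \<Rightarrow> 'a) \<Rightarrow> 'y multiset \<Rightarrow> 'a" where
  "trunc P f = (\<lambda>m. if P m then f m else \<zero>)"

lemma trunc_closed: "f \<in> carrier S \<Longrightarrow> trunc P f \<in> carrier S"
  by (rule A.free_module_carrierI[of _ "{m. f m \<noteq> \<zero>}"]) (auto simp: trunc_def free_module_carrier)

lemma trunc_split:
  "f \<in> carrier S \<Longrightarrow> f = trunc P f \<oplus>\<^bsub>S\<^esub> trunc (\<lambda>m. \<not> P m) f"
  by (rule ext) (auto simp: trunc_def A.free_module_add_apply S_coeff)

text \<open>The degenerate case in which \<open>w\<close> vanishes modulo \<open>I\<close>: the
  table part of \<open>E w\<close> has coefficients in \<open>I\<close> by hypothesis, the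
  derivation part by \<open>anc_w\<close>.\<close>

lemma E_w_coords_I:
  assumes "\<And>k. co w k \<in> I" "h \<in> carrier S"
  shows "E w h \<in> IS"
proof -
  have inn: "inn tab w m \<in> IS" for m
    unfolding inn_def dsum_def
    by (rule S.M.finsum_mem[OF IS_zero IS_add]) (use IS_closed I_smult assms(1) tab_closed in auto)
  show ?thesis
    using assms(2)
  proof (rule A.free_module_induct)
    show "E w \<zero>\<^bsub>S\<^esub> \<in> IS" by (simp add: E_zero w_closed IS_zero)
    show "E w (single A m a) \<in> IS" if "a \<in> carrier A" for m a
      using that inn anc_w by (simp add: single_mon mon_E w_closed IS_add IS_smult I_smult)
    show "E w (f \<oplus>\<^bsub>S\<^esub> g) \<in> IS" if "f \<in> carrier S" "g \<in> carrier S" "E w f \<in> IS" "E w g \<in> IS" for f g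
      using that by (simp add: E_add w_closed IS_add)
  qed
qed

text \<open>The part of \<open>h\<close> above degree \<open>dg\<close> lies in \<open>IS\<close>,
  and both operators keep it there. To the rest \<open>E_lead\<close> applies, whose error term has
  no component in degree \<open>dg + 1\<close>.\<close>

lemma E_w_top:
  assumes h: "h \<in> carrier S" and high: "\<And>m. size m > dg \<Longrightarrow> h m \<in> I" and m: "size m = Suc dg"
  shows "E w h m \<ominus> mu w h m \<in> I"
proof -
  let ?h1 = "trunc (\<lambda>m. size m > dg) h" and ?h2 = "trunc (\<lambda>m. \<not> size m > dg) h"
  have h1: "?h1 \<in> IS"
    using trunc_closed[OF h] high by (auto simp: IS_def trunc_def)
  have h2: "?h2 \<in> Sle dg"
    using trunc_closed[OF h] by (auto simp: Sle_iff trunc_def)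
  note c1 = IS_closed[OF h1] and c2 = Sle_closed[OF h2]
  have split: "h = ?h1 \<oplus>\<^bsub>S\<^esub> ?h2" by (rule trunc_split[OF h])
  have muh1: "mu w ?h1 m \<in> I"
    unfolding mu_coeff[OF w_closed c1]
    by (rule A.finsum_mem) (use h1 co_coeff[OF w_closed] I_closed in \<open>auto simp: IS_def intro: I.I_l_closed\<close>)
  have Eh1: "E w ?h1 m \<in> I" using E_w_IS[OF h1] by (simp add: IS_def)
  have "E w ?h2 \<ominus>\<^bsub>S\<^esub> mu w ?h2 \<in> Sle dg" by (rule E_lead[OF w_closed h2])
  then have z: "E w ?h2 m \<ominus> mu w ?h2 m = \<zero>"
    using m E_closed[OF w_closed c2] mu_closed[OF w_closed c2]
    by (auto simp: Sle_iff S_minus_apply)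
  have "E w h m = E w ?h1 m \<oplus> E w ?h2 m"
    by (subst split) (simp add: E_add w_closed c1 c2 A.free_module_add_apply)
  moreover have "mu w h m = mu w ?h1 m \<oplus> mu w ?h2 m"
    by (subst split) (simp add: add_map_add[OF mu_add_map] w_closed c1 c2 A.free_module_add_apply)
  moreover have cl: "E w ?h1 m \<in> carrier A" "E w ?h2 m \<in> carrier A" "mu w ?h1 m \<in> carrier A" "mu w ?h2 m \<in> carrier A"
    using S_coeff E_closed[OF w_closed] mu_closed[OF w_closed] c1 c2 by auto
  ultimately have "E w h m \<ominus> mu w h m = (E w ?h1 m \<ominus> mu w ?h1 m) \<oplus> (E w ?h2 m \<ominus> mu w ?h2 m)"
    by (simp add: A.minus_eq A.minus_add A.a_ac)
  then show ?thesis
    using z Eh1 muh1 I_minus I_closed by simp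
qed

text \<open>Over the domain \<open>A / I\<close> a nonzero linear form is not a zero divisor; the coefficient of \<open>mu w h\<close>
  that shows this is found by maximising first the degree and then the exponent of \<open>x\<^sub>k\<close>.\<close>

lemma E_w_degree:
  assumes k: "co w k \<notin> I" and h: "h \<in> carrier S" and top: "\<And>m. size m > n \<Longrightarrow> E w h m \<in> I"
    and m: "size m \<ge> n"
  shows "h m \<in> I"
proof (rule ccontr)
  assume "h m \<notin> I"
  let ?D = "{q. h q \<notin> I}"
  have fin: "finite ?D"
    using h by (rule_tac finite_subset[of _ "{q. h q \<noteq> \<zero>}"]) (auto simp: free_module_carrier)
  have mD: "m \<in> ?D" using \<open>h m \<notin> I\<close> by simp
  define dg where "dg = Max (size ` ?D)"
  have dg: "size q \<le> dg" if "h q \<notin> I" for q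
    unfolding dg_def using that fin by (intro Max_ge) auto
  let ?D' = "{q. h q \<notin> I \<and> size q = dg}"
  have "dg \<in> size ` ?D" unfolding dg_def using fin mD by (intro Max_in) auto
  then have ne: "?D' \<noteq> {}" by auto
  have fin': "finite ?D'" by (rule finite_subset[OF _ fin]) auto
  define c where "c = Max ((\<lambda>q. count q k) ` ?D')"
  have "c \<in> (\<lambda>q. count q k) ` ?D'" unfolding c_def using fin' ne by (intro Max_in) auto
  then obtain p where p: "h p \<notin> I" "size p = dg" "count p k = c" by auto
  have c: "count q k \<le> c" if "h q \<notin> I" "size q = dg" for q
    unfolding c_def using that fin' by (intro Max_ge) auto
  let ?m = "add_mset k p"
  have "E w h ?m \<ominus> mu w h ?m \<in> I"
  proof (rule E_w_top[OF h])
    show "h q \<in> I" if "dg < size q" for q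
      using dg[of q] that by (cases "h q \<in> I") auto
  qed (use p(2) in simp)
  \<comment> \<open>\<open>dg\<close> is at least \<open>size m\<close>, hence at least
    \<open>n\<close>, so \<open>?m\<close> lies above degree \<open>n\<close>.\<close>
  moreover have "E w h ?m \<in> I"
    using top[of ?m] dg[OF \<open>h m \<notin> I\<close>] m p(2) by simp
  ultimately have "E w h ?m \<ominus> (E w h ?m \<ominus> mu w h ?m) \<in> I" by (rule I_minus[rotated])
  moreover have "E w h ?m \<ominus> (E w h ?m \<ominus> mu w h ?m) = mu w h ?m"
    using S_coeff[OF E_closed[OF w_closed h]] S_coeff[OF mu_closed[OF w_closed h]]
    by (simp add: A.minus_eq A.minus_add A.r_neg2 A.r_neg1 A.r_neg A.a_ac)
  ultimately have mu: "mu w h ?m \<in> I" by simp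
  let ?s = "\<Oplus>\<^bsub>A\<^esub>j\<in>set_mset ?m - {k}. co w j \<otimes> h (?m - {#j#})"
  have cl: "co w j \<otimes> h q \<in> carrier A" for j q
    using co_coeff[OF w_closed] S_coeff[OF h] by simp
  have "mu w h ?m = co w k \<otimes> h p \<oplus> ?s"
  proof -
    have "set_mset ?m = insert k (set_mset ?m - {k})" by auto
    then have "mu w h ?m = (\<Oplus>\<^bsub>A\<^esub>j\<in>insert k (set_mset ?m - {k}). co w j \<otimes> h (?m - {#j#}))"
      unfolding mu_coeff[OF w_closed h] by simp
    also have "\<dots> = co w k \<otimes> h (?m - {#k#}) \<oplus> ?s"
      by (rule A.finsum_insert) (use cl in auto)
    finally show ?thesis by simp
  qed
  moreover have s: "?s \<in> I"
  proof (rule A.finsum_mem)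
    fix j assume j: "j \<in> set_mset ?m - {k}"
    let ?q = "?m - {#j#}"
    have "Suc (size ?q) = size ?m" using j by (intro size_Suc_Diff1) auto
    then have "size ?q = dg" by (metis Suc_inject p(2) size_add_mset)
    \<comment> \<open>\<open>?q\<close> arises from \<open>?m\<close> by removing a variable other
      than \<open>k\<close>, so its exponent of \<open>k\<close> exceeds the maximum
      \<open>c\<close> and its coefficient must lie in \<open>I\<close>.\<close>
    moreover have "count ?q k = Suc c" using j p(3) by simp
    ultimately have "h ?q \<in> I" using c[of ?q] by (cases "h ?q \<in> I") auto
    then show "co w j \<otimes> h ?q \<in> I" using co_coeff[OF w_closed] by (intro I.I_l_closed)
  qed (use I_closed in auto)
  ultimately have "(co w k \<otimes> h p \<oplus> ?s) \<ominus> ?s \<in> I" using mu I_minus by simp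
  moreover have "(co w k \<otimes> h p \<oplus> ?s) \<ominus> ?s = co w k \<otimes> h p"
    using cl[of k p] I_closed[OF s] by (simp add: A.minus_eq A.a_assoc A.r_neg)
  ultimately have "co w k \<in> I \<or> h p \<in> I"
    using I.I_prime[of "co w k" "h p"] co_coeff[OF w_closed] S_coeff[OF h] by simp
  then show False using k p(1) by blast
qed

end

text \<open>In the application \<open>C\<close> is the symmetric algebra of the differentials of \<open>A / I\<close>.\<close>

locale poisson_pbw_eval = poisson_pbw R A L br anc co le u I f0
  for R :: "('r, 'c) ring_scheme" and A :: "('r, 'a) poisson" (structure)
    and L :: "('a, 'l, 'n) module_scheme" and br :: "'l \<Rightarrow> 'l \<Rightarrow> 'l" and anc :: "'l \<Rightarrow> 'a \<Rightarrow> 'a"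
    and co :: "'l \<Rightarrow> 'y \<Rightarrow> 'a" and le :: "'y \<Rightarrow> 'y \<Rightarrow> bool"
    and u :: "'a \<Rightarrow> 'l" and I :: "'a set" and f0 :: 'a +
  fixes C :: "('s, 'd) ring_scheme" and \<eta> :: "'a \<Rightarrow> 's" and \<tau> :: "'l \<Rightarrow> 's"
  assumes C: "cring C" and \<eta>: "\<eta> \<in> ring_hom A C" and \<eta>_I: "x \<in> I \<Longrightarrow> \<eta> x = \<zero>\<^bsub>C\<^esub>"
    and \<tau>: "\<tau> \<in> add_map L C" and \<tau>_smult: "a \<in> carrier A \<Longrightarrow> v \<in> carrier L \<Longrightarrow> \<tau> (a \<odot>\<^bsub>L\<^esub> v) = \<eta> a \<otimes>\<^bsub>C\<^esub> \<tau> v"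
    and \<tau>_w: "\<tau> (u f0) = \<zero>\<^bsub>C\<^esub>"
begin

sublocale C: cring C by (rule C)

lemma C_group: "abelian_group C" ..

lemma \<eta>_closed: "a \<in> carrier A \<Longrightarrow> \<eta> a \<in> carrier C"
  using ring_hom_closed[OF \<eta>] .

lemma \<tau>_closed: "v \<in> carrier L \<Longrightarrow> \<tau> v \<in> carrier C"
  using add_map_closed[OF \<tau>] .

text \<open>Acting as the identity outside \<open>carrier C\<close> makes the steps commute as total
  functions, which folding over a multiset requires.\<close>

definition step :: "'y \<Rightarrow> 's \<Rightarrow> 's" where
  "step k z = (if z \<in> carrier C then \<tau> (e k) \<otimes>\<^bsub>C\<^esub> z else z)"

definition mprod :: "'y multiset \<Rightarrow> 's" where
  "mprod m = fold_mset step \<one>\<^bsub>C\<^esub> m"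

sublocale step: comp_fun_commute step
  by standard (auto simp: step_def fun_eq_iff \<tau>_closed C.m_lcomm)

lemma mprod_closed [simp]: "mprod m \<in> carrier C"
  unfolding mprod_def
proof (induction m)
  case (add k m)
  then show ?case
    by (simp add: step_def[of k] \<tau>_closed)
qed simp

lemma mprod_empty: "mprod {#} = \<one>\<^bsub>C\<^esub>"
  by (simp add: mprod_def)

lemma mprod_add: "mprod (add_mset k m) = \<tau> (e k) \<otimes>\<^bsub>C\<^esub> mprod m"
  using mprod_closed[of m] by (simp add: mprod_def step_def)

text \<open>Evaluation of polynomials, with coefficients mapped by \<open>\<eta>\<close> and
  variables by \<open>\<tau>\<close>. As \<open>S\<close> carries only a module structure,
  multiplicativity takes the form \<open>rho_mu\<close>.\<close>

definition rho :: "('y multiset \<Rightarrow> 'a) \<Rightarrow> 's" where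
  "rho = dsum A C (\<lambda>m a. \<eta> a \<otimes>\<^bsub>C\<^esub> mprod m)"

lemma \<eta>_add_map: "\<eta> \<in> add_map A C"
  using ring_hom_closed[OF \<eta>] ring_hom_add[OF \<eta>] by (intro add_mapI)

lemma rho_summand: "(\<lambda>a. \<eta> a \<otimes>\<^bsub>C\<^esub> mprod m) \<in> add_map A C"
  by (rule add_map_comp[OF \<eta>_add_map]) (auto intro: add_mapI simp: C.l_distr)

lemma rho_add_map: "rho \<in> add_map S C"
  unfolding rho_def by (rule A.dsum_add_map[OF C_group rho_summand])

lemma rho_mon: "a \<in> carrier A \<Longrightarrow> rho (a \<odot>\<^bsub>S\<^esub> mon m) = \<eta> a \<otimes>\<^bsub>C\<^esub> mprod m"
  unfolding single_mon[symmetric] rho_def by (rule A.dsum_single[OF C_group rho_summand]) auto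

lemma rho_closed: "f \<in> carrier S \<Longrightarrow> rho f \<in> carrier C"
  by (rule add_map_closed[OF rho_add_map])

lemma rho_smult:
  assumes "a \<in> carrier A" "f \<in> carrier S"
  shows "rho (a \<odot>\<^bsub>S\<^esub> f) = \<eta> a \<otimes>\<^bsub>C\<^esub> rho f"
proof (rule S_map_eqI[OF _ _ C_group assms(2), of "\<lambda>f. rho (a \<odot>\<^bsub>S\<^esub> f)" "\<lambda>f. \<eta> a \<otimes>\<^bsub>C\<^esub> rho f"])
  show "(\<lambda>f. rho (a \<odot>\<^bsub>S\<^esub> f)) \<in> add_map S C" "(\<lambda>f. \<eta> a \<otimes>\<^bsub>C\<^esub> rho f) \<in> add_map S C"
    using assms(1) by (auto intro!: add_mapI simp: rho_closed \<eta>_closed S.smult_r_distr C.r_distr add_map_add[OF rho_add_map])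
  fix m b assume "b \<in> carrier A"
  then show "rho (a \<odot>\<^bsub>S\<^esub> (b \<odot>\<^bsub>S\<^esub> mon m)) = \<eta> a \<otimes>\<^bsub>C\<^esub> rho (b \<odot>\<^bsub>S\<^esub> mon m)"
    using assms(1) rho_mon[of "a \<otimes> b" m]
    by (simp add: S.smult_assoc1 rho_mon ring_hom_mult[OF \<eta>] \<eta>_closed C.m_assoc)
qed

lemma rho_mon1: "rho (mon m) = mprod m"
  using rho_mon[of \<one> m] by (simp add: ring_hom_one[OF \<eta>])

lemma rho_one: "rho (mon {#}) = \<one>\<^bsub>C\<^esub>"
  by (simp add: rho_mon1 mprod_empty)

lemma rho_mu:
  assumes v: "v \<in> carrier L" and f: "f \<in> carrier S"
  shows "rho (mu v f) = \<tau> v \<otimes>\<^bsub>C\<^esub> rho f"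
proof -
  have 1: "rho (inn shift v m) = \<tau> v \<otimes>\<^bsub>C\<^esub> mprod m" for m
  proof -
    have sub: "submodule {v \<in> carrier L. rho (inn shift v m) = \<tau> v \<otimes>\<^bsub>C\<^esub> mprod m} A L"
    proof (rule L.submoduleI)
      show sm: "a \<odot>\<^bsub>L\<^esub> v \<in> {v \<in> carrier L. rho (inn shift v m) = \<tau> v \<otimes>\<^bsub>C\<^esub> mprod m}"
        if "a \<in> carrier A" "v \<in> {v \<in> carrier L. rho (inn shift v m) = \<tau> v \<otimes>\<^bsub>C\<^esub> mprod m}" for a v
        using that by (auto simp: inn_smult_left shift_closed rho_smult inn_closed \<tau>_smult \<eta>_closed \<tau>_closed C.m_assoc)
      show "\<ominus>\<^bsub>L\<^esub> v \<in> {v \<in> carrier L. rho (inn shift v m) = \<tau> v \<otimes>\<^bsub>C\<^esub> mprod m}"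
        if "v \<in> {v \<in> carrier L. rho (inn shift v m) = \<tau> v \<otimes>\<^bsub>C\<^esub> mprod m}" for v
        using sm[of "\<ominus> \<one>" v] that by (simp add: L.smult_l_minus)
      show "v \<oplus>\<^bsub>L\<^esub> z \<in> {v \<in> carrier L. rho (inn shift v m) = \<tau> v \<otimes>\<^bsub>C\<^esub> mprod m}"
        if "v \<in> {v \<in> carrier L. rho (inn shift v m) = \<tau> v \<otimes>\<^bsub>C\<^esub> mprod m}"
          "z \<in> {v \<in> carrier L. rho (inn shift v m) = \<tau> v \<otimes>\<^bsub>C\<^esub> mprod m}" for v z
        using that by (auto simp: inn_add_left shift_closed add_map_add[OF rho_add_map] inn_closed
            add_map_add[OF \<tau>] \<tau>_closed C.l_distr)
      show "\<zero>\<^bsub>L\<^esub> \<in> {v \<in> carrier L. rho (inn shift v m) = \<tau> v \<otimes>\<^bsub>C\<^esub> mprod m}"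
        using add_map_zero[OF lin_hom_add_map[OF inn_lin[OF shift_closed]] L_group S_group]
          add_map_zero[OF rho_add_map S_group C_group] add_map_zero[OF \<tau> L_group C_group] by simp
    qed auto
    have "rho (inn shift (e k) m) = \<tau> (e k) \<otimes>\<^bsub>C\<^esub> mprod m" for k
      using rho_mon[of \<one> "add_mset k m"] \<tau>_closed[OF e_closed]
      by (simp add: inn_e shift_closed) (simp add: shift_def mprod_add ring_hom_one[OF \<eta>])
    then have "range e \<subseteq> {v \<in> carrier L. rho (inn shift v m) = \<tau> v \<otimes>\<^bsub>C\<^esub> mprod m}" by auto
    then show ?thesis using L_generated[OF sub] v by blast
  qed
  show ?thesis
  proof (rule S_map_eqI[OF _ _ C_group f, of "\<lambda>f. rho (mu v f)" "\<lambda>f. \<tau> v \<otimes>\<^bsub>C\<^esub> rho f"])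
    show "(\<lambda>f. rho (mu v f)) \<in> add_map S C" by (rule add_map_comp[OF mu_add_map[OF v] rho_add_map])
    show "(\<lambda>f. \<tau> v \<otimes>\<^bsub>C\<^esub> rho f) \<in> add_map S C"
      using v by (auto intro!: add_mapI simp: rho_closed \<tau>_closed C.r_distr add_map_add[OF rho_add_map])
    show "rho (mu v (a \<odot>\<^bsub>S\<^esub> mon m)) = \<tau> v \<otimes>\<^bsub>C\<^esub> rho (a \<odot>\<^bsub>S\<^esub> mon m)" if "a \<in> carrier A" for m a
      using that v 1 by (simp add: mon_mu rho_smult inn_closed shift_closed rho_mon1 \<tau>_closed \<eta>_closed C.m_lcomm)
  qed
qed

lemma rho_IS:
  assumes "f \<in> IS"
  shows "rho f = \<zero>\<^bsub>C\<^esub>"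
proof -
  have cl: "{a \<odot>\<^bsub>S\<^esub> mon m |a m. a \<in> I} \<subseteq> carrier S" using I_closed by auto
  have "f \<in> {f \<in> carrier S. rho f = \<zero>\<^bsub>C\<^esub>}"
    by (rule S.M.add_span_least[OF IS_span[OF assms]])
       (use cl add_map_zero[OF rho_add_map S_group C_group] in
         \<open>auto simp: add_map_add[OF rho_add_map] rho_mon I_closed \<eta>_I\<close>)
  then show ?thesis by simp
qed

lemma rho_cong:
  assumes "f \<in> carrier S" "g \<in> carrier S" "\<And>m. f m \<ominus> g m \<in> I"
  shows "rho f = rho g"
proof -
  have "f \<ominus>\<^bsub>S\<^esub> g \<in> IS" using assms by (simp add: IS_def S_minus_apply)
  then have "rho f \<ominus>\<^bsub>C\<^esub> rho g = \<zero>\<^bsub>C\<^esub>"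
    using rho_IS add_map_minus[OF rho_add_map S_group C_group assms(1,2)] by simp
  then show ?thesis using rho_closed assms(1,2) C.minus_eq_zero_iff by simp
qed

text \<open>Write \<open>f - l = i + E w h\<close>. From degree \<open>n\<close> on,
  \<open>E w h\<close> agrees with \<open>f\<close> modulo \<open>I\<close>. Either \<open>w\<close>
  vanishes modulo \<open>I\<close>, and then so does \<open>f\<close>; or \<open>h\<close> has
  degree below \<open>n\<close> modulo \<open>I\<close>, and \<open>f\<close> is congruent to
  \<open>w\<close> times the part of \<open>h\<close> of degree \<open>n - 1\<close>. The first is
  killed by \<open>rho\<close> through \<open>\<eta>_I\<close>, the second through
  \<open>\<tau>_w\<close>.\<close>

theorem symbol_detection:
  assumes f: "f \<in> carrier S" and hom: "\<And>m. f m \<noteq> \<zero> \<Longrightarrow> size m = n"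
    and l: "l \<in> carrier S" and low: "\<And>m. l m \<noteq> \<zero> \<Longrightarrow> size m < n"
    and mem: "f \<ominus>\<^bsub>S\<^esub> l \<in> N"
  shows "rho f = \<zero>\<^bsub>C\<^esub>"
proof -
  obtain i h where i: "i \<in> IS" and h: "h \<in> carrier S" and fl: "f \<ominus>\<^bsub>S\<^esub> l = i \<oplus>\<^bsub>S\<^esub> E w h"
    using mem by (auto simp: N_def)
  note Ec = S_coeff[OF E_closed[OF w_closed h]] and mc = S_coeff[OF mu_closed[OF w_closed h]]
    and fc = S_coeff[OF f] and lc = S_coeff[OF l] and ic = S_coeff[OF IS_closed[OF i]]
  have pt: "f m \<ominus> l m = i m \<oplus> E w h m" for m
    using fl S_minus_apply[OF f l, of m] A.free_module_add_apply[of UNIV i "E w h" m] by simp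
  have iI: "i m \<in> I" for m using i by (simp add: IS_def)
  have EI: "E w h m \<ominus> f m \<in> I" if "size m \<ge> n" for m
  proof -
    have "l m = \<zero>" using low[of m] that by auto
    then have "f m = i m \<oplus> E w h m" using pt[of m] fc by (simp add: A.minus_eq)
    then have "E w h m \<ominus> f m = \<ominus> i m"
      using ic Ec by (simp add: A.minus_eq A.minus_add A.a_ac A.r_neg1 A.r_neg2 A.r_neg)
    then show ?thesis using iI I_neg by simp
  qed
  show ?thesis
  proof (cases "\<forall>k. co w k \<in> I")
    case True
    then have "E w h \<in> IS" using E_w_coords_I h by blast
    then have Eh: "E w h m \<in> I" for m by (simp add: IS_def)
    have "f m \<in> I" for m
    proof (cases "size m = n")
      case True
      have "E w h m \<ominus> (E w h m \<ominus> f m) \<in> I" using EI[of m] True Eh I_minus by simp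
      then show ?thesis
        using Ec fc by (simp add: A.minus_eq A.minus_add A.a_ac A.r_neg1 A.r_neg2 A.r_neg)
    next
      case False
      then show ?thesis using hom[of m] by (cases "f m = \<zero>") auto
    qed
    then show ?thesis using f by (intro rho_IS) (simp add: IS_def)
  next
    case False
    then obtain k where k: "co w k \<notin> I" by blast
    have top: "E w h m \<in> I" if "size m > n" for m
      using EI[of m] hom[of m] that Ec by (cases "f m = \<zero>") (auto simp: A.minus_eq)
    have hI: "h m \<in> I" if "size m \<ge> n" for m
      by (rule E_w_degree[OF k h top that])
    \<comment> \<open>The part of \<open>h\<close> of degree \<open>n - 1\<close>, written so that
      it is \<open>0\<close> when \<open>n = 0\<close>.\<close>
    let ?h = "trunc (\<lambda>m. Suc (size m) = n) h"
    have hc: "?h \<in> carrier S" by (rule trunc_closed[OF h])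
    have pos: "0 < size q" if "j \<in># q" for j and q :: "'y multiset"
      using that by (metis empty_iff gr0I set_mset_empty size_eq_0_iff_empty)
    have "f m \<ominus> mu w ?h m \<in> I" for m
    proof (cases "size m = n")
      case True
      have mu: "mu w ?h m = mu w h m"
        unfolding mu_coeff[OF w_closed hc] mu_coeff[OF w_closed h]
        using co_coeff[OF w_closed] S_coeff[OF h] True pos
        by (intro A.finsum_cong') (auto simp: trunc_def size_Diff_singleton size_Suc_Diff1)
      have "E w h m \<ominus> mu w h m \<in> I"
      \<comment> \<open>For \<open>n = 0\<close> there is no degree \<open>n - 1\<close> to which
        \<open>E_w_top\<close> could refer; then all coefficients of \<open>h\<close> lie in
        \<open>I\<close> and both terms vanish modulo \<open>I\<close>.\<close>
      proof (cases n)
        case 0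
        then have "m = {#}" using True by simp
        then have "mu w h m = \<zero>" by (simp add: mu_coeff[OF w_closed h])
        moreover have "E w h m \<in> I"
        proof -
          have "h \<in> IS" using hI h 0 by (simp add: IS_def)
          then show ?thesis using E_w_IS by (simp add: IS_def)
        qed
        ultimately show ?thesis using Ec by (simp add: A.minus_eq)
      next
        case (Suc dg)
        then show ?thesis using E_w_top[OF h, of dg m] hI True by simp
      qed
      then have "(E w h m \<ominus> mu w h m) \<ominus> (E w h m \<ominus> f m) \<in> I" using EI[of m] True I_minus by simp
      moreover have "(E w h m \<ominus> mu w h m) \<ominus> (E w h m \<ominus> f m) = f m \<ominus> mu w h m"
        using Ec[of m] mc[of m] fc[of m] by algebra
      ultimately show ?thesis using mu by simp
    next
      case False
      have "mu w ?h m = \<zero>"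
        unfolding mu_coeff[OF w_closed hc] using False co_coeff[OF w_closed] pos
        by (intro A.add.finprod_one_eqI) (auto simp: trunc_def size_Diff_singleton size_Suc_Diff1)
      moreover have "f m = \<zero>" using hom False by blast
      ultimately show ?thesis by (simp add: A.minus_eq)
    qed
    then have "rho f = rho (mu w ?h)"
      by (intro rho_cong f mu_closed[OF w_closed hc])
    also have "\<dots> = \<zero>\<^bsub>C\<^esub>"
      using rho_mu[OF w_closed hc] \<tau>_w rho_closed[OF hc] by (simp add: w_def)
    finally show ?thesis .
  qed
qed

end

section \<open>Symmetric algebras\<close>

locale sym_alg =
  fixes K :: "('k, 'c) ring_scheme" and P :: "('k, 'p) module"
  assumes P: "module K P"
begin

sublocale P: module K P by (rule P)

abbreviation "FP \<equiv> free_algebra K (carrier P)"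
abbreviation "Sym \<equiv> sym_algebra K P"
abbreviation "incl \<equiv> sym_incl K P"
abbreviation "cl f \<equiv> sym_ideal K P +>\<^bsub>FP\<^esub> f"

sublocale FP: assoc_algebra K FP
  by (rule P.free_algebra_assoc_algebra)

definition gens :: "('p list \<Rightarrow> 'k) set" where
  "gens =
      {basis_elt K [x \<oplus>\<^bsub>P\<^esub> y] \<ominus>\<^bsub>FP\<^esub> (basis_elt K [x] \<oplus>\<^bsub>FP\<^esub> basis_elt K [y]) |x y. x \<in> carrier P \<and> y \<in> carrier P} \<union>
       {basis_elt K [k \<odot>\<^bsub>P\<^esub> x] \<ominus>\<^bsub>FP\<^esub> (k \<odot>\<^bsub>FP\<^esub> basis_elt K [x]) |k x. k \<in> carrier K \<and> x \<in> carrier P} \<union>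
       {(basis_elt K [x] \<otimes>\<^bsub>FP\<^esub> basis_elt K [y]) \<ominus>\<^bsub>FP\<^esub> (basis_elt K [y] \<otimes>\<^bsub>FP\<^esub> basis_elt K [x]) |x y. x \<in> carrier P \<and> y \<in> carrier P}"

lemma sym_ideal_eq: "sym_ideal K P = Idl\<^bsub>FP\<^esub> gens"
  by (simp add: sym_ideal_def gens_def Let_def)

lemma single_closed: "w \<in> lists (carrier P) \<Longrightarrow> a \<in> carrier K \<Longrightarrow> single K w a \<in> carrier FP"
  unfolding free_algebra_simps by (rule P.single_closed)

lemma basis_closed: "x \<in> carrier P \<Longrightarrow> basis_elt K [x] \<in> carrier FP"
  unfolding basis_elt_single by (rule single_closed) auto

lemma gens_closed: "gens \<subseteq> carrier FP"
  unfolding gens_def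
  by (auto simp del: free_algebra_simps intro!: FP.M.minus_closed FP.M.a_closed FP.smult_closed FP.U.m_closed basis_closed)

lemma sym_ideal_ideal: "ideal (sym_ideal K P) FP"
  unfolding sym_ideal_eq by (rule FP.U.genideal_ideal[OF gens_closed])

lemma FP_assoc: "assoc_algebra K FP"
  by (rule FP.assoc_algebra_axioms)

sublocale Sym: assoc_algebra K Sym
  unfolding sym_algebra_def by (rule quot_module_assoc_algebra[OF FP_assoc sym_ideal_ideal])

lemma cl_alg_hom: "(\<lambda>f. cl f) \<in> alg_hom K FP Sym"
  unfolding sym_algebra_def by (rule coset_alg_hom[OF FP_assoc sym_ideal_ideal])

lemma incl_cl: "incl x = cl (basis_elt K [x])"
  by (simp add: sym_incl_def)

lemma incl_closed: "x \<in> carrier P \<Longrightarrow> incl x \<in> carrier Sym"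
  unfolding incl_cl by (rule alg_hom_closed[OF cl_alg_hom basis_closed])

lemma cl_eqI:
  assumes "f \<ominus>\<^bsub>FP\<^esub> g \<in> gens" "f \<in> carrier FP" "g \<in> carrier FP"
  shows "cl f = cl g"
proof -
  have "f \<ominus>\<^bsub>FP\<^esub> g \<in> sym_ideal K P"
    unfolding sym_ideal_eq using FP.U.genideal_self[OF gens_closed] assms(1) by blast
  then show ?thesis
    using coset_eq_iff[OF ideal.axioms(1)[OF sym_ideal_ideal] FP.M.abelian_group_axioms assms(2,3)] by simp
qed

lemma incl_lin: "incl \<in> lin_hom K P Sym"
proof (rule lin_homI[OF incl_closed])
  fix x y assume x: "x \<in> carrier P" and y: "y \<in> carrier P"
  have "basis_elt K [x \<oplus>\<^bsub>P\<^esub> y] \<ominus>\<^bsub>FP\<^esub> (basis_elt K [x] \<oplus>\<^bsub>FP\<^esub> basis_elt K [y]) \<in> gens"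
    unfolding gens_def using x y by blast
  then show "incl (x \<oplus>\<^bsub>P\<^esub> y) = incl x \<oplus>\<^bsub>Sym\<^esub> incl y"
    unfolding incl_cl add_map_add[OF alg_hom_add_map[OF cl_alg_hom] basis_closed[OF x] basis_closed[OF y], symmetric]
    by (rule cl_eqI) (intro basis_closed FP.M.a_closed P.a_closed x y)+
next
  fix k x assume k: "k \<in> carrier K" and x: "x \<in> carrier P"
  have "basis_elt K [k \<odot>\<^bsub>P\<^esub> x] \<ominus>\<^bsub>FP\<^esub> (k \<odot>\<^bsub>FP\<^esub> basis_elt K [x]) \<in> gens"
    unfolding gens_def using x k by blast
  then show "incl (k \<odot>\<^bsub>P\<^esub> x) = k \<odot>\<^bsub>Sym\<^esub> incl x"
    unfolding incl_cl alg_hom_smult[OF cl_alg_hom k basis_closed[OF x], symmetric]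
    by (rule cl_eqI) (intro basis_closed FP.smult_closed P.smult_closed x k)+
qed

lemma incl_commute:
  assumes x: "x \<in> carrier P" and y: "y \<in> carrier P"
  shows "incl x \<otimes>\<^bsub>Sym\<^esub> incl y = incl y \<otimes>\<^bsub>Sym\<^esub> incl x"
proof -
  have "(basis_elt K [x] \<otimes>\<^bsub>FP\<^esub> basis_elt K [y]) \<ominus>\<^bsub>FP\<^esub> (basis_elt K [y] \<otimes>\<^bsub>FP\<^esub> basis_elt K [x]) \<in> gens"
    unfolding gens_def using x y by blast
  then show ?thesis
    unfolding incl_cl alg_hom_mult[OF cl_alg_hom basis_closed[OF x] basis_closed[OF y], symmetric]
      alg_hom_mult[OF cl_alg_hom basis_closed[OF y] basis_closed[OF x], symmetric]
    by (rule cl_eqI) (intro basis_closed FP.U.m_closed x y)+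
qed

abbreviation "iprod w \<equiv> list_prod Sym (map incl w)"

lemma iprod_closed: "w \<in> lists (carrier P) \<Longrightarrow> iprod w \<in> carrier Sym"
  by (rule Sym.U.list_prod_closed) (auto intro: incl_closed)

lemma single_list_prod:
  "single K w \<one>\<^bsub>K\<^esub> = list_prod FP (map (\<lambda>x. basis_elt K [x]) w)"
proof (induction w)
  case Nil
  then show ?case by (simp add: basis_elt_single)
next
  case (Cons x w)
  have "single K (x # w) \<one>\<^bsub>K\<^esub> = single K [x] \<one>\<^bsub>K\<^esub> \<otimes>\<^bsub>FP\<^esub> single K w \<one>\<^bsub>K\<^esub>"
    by (simp add: P.single_mult_single)
  then show ?case using Cons by (simp add: basis_elt_single)
qed

lemma cl_single:
  assumes "w \<in> lists (carrier P)" "a \<in> carrier K"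
  shows "cl (single K w a) = a \<odot>\<^bsub>Sym\<^esub> iprod w"
proof -
  have "single K w a = a \<odot>\<^bsub>FP\<^esub> single K w \<one>\<^bsub>K\<^esub>"
    using assms(2) by (simp add: P.single_smult)
  then have "cl (single K w a) = a \<odot>\<^bsub>Sym\<^esub> cl (list_prod FP (map (\<lambda>x. basis_elt K [x]) w))"
    using alg_hom_smult[OF cl_alg_hom assms(2) single_closed[OF assms(1) P.R.one_closed]]
    by (simp only: single_list_prod)
  also have "cl (list_prod FP (map (\<lambda>x. basis_elt K [x]) w)) = iprod w"
    using alg_hom_list_prod[OF cl_alg_hom FP.U.ring_axioms, of "map (\<lambda>x. basis_elt K [x]) w"] assms(1) basis_closed
    by (auto simp: incl_cl[abs_def] comp_def)
  finally show ?thesis .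
qed

lemma Sym_span: "carrier Sym = add_span Sym {a \<odot>\<^bsub>Sym\<^esub> iprod w |a w. a \<in> carrier K \<and> w \<in> lists (carrier P)}"
  (is "_ = add_span Sym ?G")
proof
  have G: "?G \<subseteq> carrier Sym" by (auto intro!: Sym.smult_closed iprod_closed)
  have J: "additive_subgroup (sym_ideal K P) FP"
    by (rule ideal.axioms(1)[OF sym_ideal_ideal])
  have sub: "{single K w a |w a. w \<in> lists (carrier P) \<and> a \<in> carrier K} \<subseteq> carrier FP"
    using single_closed by blast
  have eq: "(\<lambda>f. cl f) ` {single K w a |w a. w \<in> lists (carrier P) \<and> a \<in> carrier K} \<subseteq> ?G"
    using cl_single by blast
  show "carrier Sym \<subseteq> add_span Sym ?G"
  proof
    fix s assume "s \<in> carrier Sym"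
    then show "s \<in> add_span Sym ?G"
      using quot_module_span[OF J FP.M.abelian_group_axioms sub P.words_span, of s] add_span_mono[OF eq]
      unfolding sym_algebra_def by blast
  qed
  show "add_span Sym ?G \<subseteq> carrier Sym"
    using Sym.M.add_span_closed[OF G] by blast
qed

lemma sym_degree_span:
  "sym_degree K P n = add_span Sym {a \<odot>\<^bsub>Sym\<^esub> iprod w |a w. a \<in> carrier K \<and> w \<in> lists (carrier P) \<and> length w = n}"
  (is "_ = add_span Sym ?G")
proof
  let ?X = "{w \<in> lists (carrier P). length w = n}"
  have G: "?G \<subseteq> carrier Sym" by (auto intro!: Sym.smult_closed iprod_closed)
  have deg: "sym_degree K P n = (\<lambda>f. cl f) ` carrier (free_module K ?X)"
  proof -
    have "carrier (free_module K ?X) = {f \<in> carrier FP. \<forall>w. f w \<noteq> \<zero>\<^bsub>K\<^esub> \<longrightarrow> length w = n}"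
      unfolding free_algebra_simps set_eq_iff mem_Collect_eq free_module_carrier by blast
    then show ?thesis
      unfolding sym_degree_def by blast
  qed
  have sub: "carrier (free_module K ?X) \<subseteq> carrier FP"
    by (auto simp: free_module_carrier)
  have clX: "(\<lambda>f. cl f) \<in> add_map (free_module K ?X) Sym"
    using alg_hom_closed[OF cl_alg_hom] add_map_add[OF alg_hom_add_map[OF cl_alg_hom]] sub
    by (intro add_mapI) (auto simp: free_module_simps subset_iff)
  have FX: "abelian_group (free_module K ?X)" by (rule P.free_module_group)
  show "sym_degree K P n \<subseteq> add_span Sym ?G"
  proof
    fix s assume "s \<in> sym_degree K P n"
    then obtain f where f: "f \<in> carrier (free_module K ?X)" "s = cl f" unfolding deg by blast
    show "s \<in> add_span Sym ?G"
      unfolding f(2)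
    proof (rule add_map_add_span[OF clX FX Sym.M.abelian_group_axioms P.singles_closed G _ P.free_module_span[OF f(1)]])
      fix g assume "g \<in> {single K x a |x a. x \<in> ?X \<and> a \<in> carrier K}"
      then obtain w a where g: "g = single K w a" "w \<in> ?X" "a \<in> carrier K" by blast
      then have "cl g = a \<odot>\<^bsub>Sym\<^esub> iprod w" using cl_single by auto
      then have "cl g \<in> ?G" using g by blast
      then show "cl g \<in> add_span Sym ?G" by (rule Sym.M.add_span_base[OF G])
    qed
  qed
  show "add_span Sym ?G \<subseteq> sym_degree K P n"
  proof
    fix s assume "s \<in> add_span Sym ?G"
    then show "s \<in> sym_degree K P n"
      unfolding deg
    proof (rule Sym.M.add_span_least)
      interpret FX: abelian_group "free_module K ?X" by (rule FX)
      show "\<zero>\<^bsub>Sym\<^esub> \<in> (\<lambda>f. cl f) ` carrier (free_module K ?X)"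
        using add_map_zero[OF clX FX Sym.M.abelian_group_axioms, symmetric] FX.zero_closed by blast
      show "g \<in> (\<lambda>f. cl f) ` carrier (free_module K ?X)" if gG: "g \<in> ?G" for g
      proof -
        obtain a w where g: "g = a \<odot>\<^bsub>Sym\<^esub> iprod w" "a \<in> carrier K" "w \<in> ?X" using gG by blast
        then have "g = cl (single K w a)" using cl_single by auto
        then show ?thesis using P.single_closed[of w ?X a] g by blast
      qed
      show "s \<oplus>\<^bsub>Sym\<^esub> t \<in> (\<lambda>f. cl f) ` carrier (free_module K ?X)"
        if st: "s \<in> (\<lambda>f. cl f) ` carrier (free_module K ?X)" "t \<in> (\<lambda>f. cl f) ` carrier (free_module K ?X)" for s t
      proof -
        obtain f g where "f \<in> carrier (free_module K ?X)" "s = cl f" "g \<in> carrier (free_module K ?X)" "t = cl g"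
          using st by blast
        then show ?thesis using add_map_add[OF clX, of f g] FX.a_closed[of f g] by auto
      qed
    qed
  qed
qed

lemma iprod_commute1:
  assumes "x \<in> carrier P" "w \<in> lists (carrier P)"
  shows "incl x \<otimes>\<^bsub>Sym\<^esub> iprod w = iprod w \<otimes>\<^bsub>Sym\<^esub> incl x"
  using assms(2)
proof (induction w)
  case Nil
  then show ?case using incl_closed assms(1) by simp
next
  case (Cons y w)
  have c: "incl x \<in> carrier Sym" "incl y \<in> carrier Sym" "iprod w \<in> carrier Sym"
    using Cons assms(1) incl_closed iprod_closed by auto
  have "incl x \<otimes>\<^bsub>Sym\<^esub> iprod (y # w) = (incl x \<otimes>\<^bsub>Sym\<^esub> incl y) \<otimes>\<^bsub>Sym\<^esub> iprod w"
    using c by (simp add: Sym.U.m_assoc)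
  also have "\<dots> = incl y \<otimes>\<^bsub>Sym\<^esub> (incl x \<otimes>\<^bsub>Sym\<^esub> iprod w)"
    using c incl_commute[OF assms(1) Cons(1)] by (simp add: Sym.U.m_assoc)
  also have "\<dots> = iprod (y # w) \<otimes>\<^bsub>Sym\<^esub> incl x"
    using c Cons by (simp add: Sym.U.m_assoc)
  finally show ?case .
qed

lemma iprod_commute:
  assumes "v \<in> lists (carrier P)" "w \<in> lists (carrier P)"
  shows "iprod v \<otimes>\<^bsub>Sym\<^esub> iprod w = iprod w \<otimes>\<^bsub>Sym\<^esub> iprod v"
  using assms(1)
proof (induction v)
  case Nil
  then show ?case using iprod_closed[OF assms(2)] by simp
next
  case (Cons x v)
  have c: "incl x \<in> carrier Sym" "iprod v \<in> carrier Sym" "iprod w \<in> carrier Sym"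
    using Cons assms(2) incl_closed iprod_closed by auto
  have "iprod (x # v) \<otimes>\<^bsub>Sym\<^esub> iprod w = incl x \<otimes>\<^bsub>Sym\<^esub> (iprod w \<otimes>\<^bsub>Sym\<^esub> iprod v)"
    using c Cons by (simp add: Sym.U.m_assoc)
  also have "\<dots> = (iprod w \<otimes>\<^bsub>Sym\<^esub> incl x) \<otimes>\<^bsub>Sym\<^esub> iprod v"
    using c iprod_commute1[OF Cons(1) assms(2)] by (simp flip: Sym.U.m_assoc)
  finally show ?case using c by (simp add: Sym.U.m_assoc)
qed

text \<open>The relations make only the letters commute. \<open>iprod_commute\<close> extends this
  to words, and biadditivity to the additive span of their multiples.\<close>

lemma Sym_cring: "cring Sym"
proof -
  let ?G = "{a \<odot>\<^bsub>Sym\<^esub> iprod w |a w. a \<in> carrier K \<and> w \<in> lists (carrier P)}"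
  have G: "?G \<subseteq> carrier Sym" by (auto intro!: Sym.smult_closed iprod_closed)
  have gg: "s \<otimes>\<^bsub>Sym\<^esub> t = t \<otimes>\<^bsub>Sym\<^esub> s" if "s \<in> ?G" "t \<in> ?G" for s t
  proof -
    obtain a v b w where "s = a \<odot>\<^bsub>Sym\<^esub> iprod v" "t = b \<odot>\<^bsub>Sym\<^esub> iprod w" "a \<in> carrier K" "b \<in> carrier K"
      "v \<in> lists (carrier P)" "w \<in> lists (carrier P)" using \<open>s \<in> ?G\<close> \<open>t \<in> ?G\<close> by blast
    then show ?thesis
      using iprod_closed[of v] iprod_closed[of w] iprod_commute[of v w]
      by (simp add: Sym.smult_mult_left Sym.smult_mult_right Sym.smult_left_commute[of a b] del: in_lists_conv_set)
  qed
  note ext = add_map_eq_on_span[OF _ _ Sym.M.abelian_group_axioms Sym.M.abelian_group_axioms G]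
  have ml: "(\<lambda>x. x \<otimes>\<^bsub>Sym\<^esub> y) \<in> add_map Sym Sym" and mr: "(\<lambda>x. y \<otimes>\<^bsub>Sym\<^esub> x) \<in> add_map Sym Sym"
    if "y \<in> carrier Sym" for y
    using that by (auto intro!: add_mapI simp: Sym.U.l_distr Sym.U.r_distr)
  have 1: "s \<otimes>\<^bsub>Sym\<^esub> t = t \<otimes>\<^bsub>Sym\<^esub> s" if s: "s \<in> carrier Sym" and t: "t \<in> ?G" for s t
  proof (rule ext[of "\<lambda>s. s \<otimes>\<^bsub>Sym\<^esub> t" "\<lambda>s. t \<otimes>\<^bsub>Sym\<^esub> s" s])
    have "t \<in> carrier Sym" using t G by blast
    then show "(\<lambda>s. s \<otimes>\<^bsub>Sym\<^esub> t) \<in> add_map Sym Sym" "(\<lambda>s. t \<otimes>\<^bsub>Sym\<^esub> s) \<in> add_map Sym Sym"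
      by (rule ml, rule mr)
    show "s \<in> add_span Sym ?G" using s unfolding Sym_span .
  qed (rule gg[OF _ t])
  have 2: "s \<otimes>\<^bsub>Sym\<^esub> t = t \<otimes>\<^bsub>Sym\<^esub> s" if s: "s \<in> carrier Sym" and t: "t \<in> carrier Sym" for s t
  proof (rule ext[of "\<lambda>t. s \<otimes>\<^bsub>Sym\<^esub> t" "\<lambda>t. t \<otimes>\<^bsub>Sym\<^esub> s" t])
    show "t \<in> add_span Sym ?G" using t unfolding Sym_span .
  qed (rule mr[OF s] ml[OF s] 1[OF s], assumption?)+
  have "ring Sym" by unfold_locales
  then show ?thesis
    using 2 by (intro cring.intro comm_monoid.intro comm_monoid_axioms.intro) (auto simp: ring_def)
qed

text \<open>Evaluation of the free algebra at \<open>f\<close> kills the three kinds of generators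
  of \<open>sym_ideal\<close>, the first two by linearity of \<open>f\<close> and the third by
  \<open>comm\<close>, so it descends to the quotient.\<close>

lemma sym_universal:
  assumes T: "assoc_algebra K T" and f: "f \<in> lin_hom K P T"
    and comm: "\<And>x y. x \<in> carrier P \<Longrightarrow> y \<in> carrier P \<Longrightarrow> f x \<otimes>\<^bsub>T\<^esub> f y = f y \<otimes>\<^bsub>T\<^esub> f x"
  obtains h where "h \<in> alg_hom K Sym T" "\<And>x. x \<in> carrier P \<Longrightarrow> h (incl x) = f x"
proof -
  interpret T: assoc_algebra K T by fact
  have f': "f \<in> carrier P \<rightarrow> carrier T" using lin_hom_closed[OF f] by blast
  let ?e = "free_eval K T f"
  have e: "?e \<in> alg_hom K FP T" by (rule free_eval_alg_hom[OF T f'])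
  have eb: "?e (basis_elt K [x]) = f x" if "x \<in> carrier P" for x
    by (rule free_eval_basis[OF T f' that])
  have ker: "ideal {x \<in> carrier FP. ?e x = \<zero>\<^bsub>T\<^esub>} FP"
    using kernel_ideal[OF FP.U.ring_axioms T.U.ring_axioms alg_homD(2)[OF e]] .
  have "gens \<subseteq> {x \<in> carrier FP. ?e x = \<zero>\<^bsub>T\<^esub>}"
  proof
    fix g assume g: "g \<in> gens"
    note mi = add_map_minus[OF alg_hom_add_map[OF e] FP.M.abelian_group_axioms T.M.abelian_group_axioms]
      and ad = add_map_add[OF alg_hom_add_map[OF e]]
    have tz: "u \<ominus>\<^bsub>T\<^esub> u = \<zero>\<^bsub>T\<^esub>" if "u \<in> carrier T" for u
      using that by (simp add: a_minus_def T.M.r_neg)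
    have fc: "f x \<in> carrier T" if "x \<in> carrier P" for x using f' that by blast
    from g consider x y where "x \<in> carrier P" "y \<in> carrier P" "g = basis_elt K [x \<oplus>\<^bsub>P\<^esub> y] \<ominus>\<^bsub>FP\<^esub> (basis_elt K [x] \<oplus>\<^bsub>FP\<^esub> basis_elt K [y])"
      | k x where "k \<in> carrier K" "x \<in> carrier P" "g = basis_elt K [k \<odot>\<^bsub>P\<^esub> x] \<ominus>\<^bsub>FP\<^esub> (k \<odot>\<^bsub>FP\<^esub> basis_elt K [x])"
      | x y where "x \<in> carrier P" "y \<in> carrier P" "g = (basis_elt K [x] \<otimes>\<^bsub>FP\<^esub> basis_elt K [y]) \<ominus>\<^bsub>FP\<^esub> (basis_elt K [y] \<otimes>\<^bsub>FP\<^esub> basis_elt K [x])"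
      unfolding gens_def by blast
    then have "?e g = \<zero>\<^bsub>T\<^esub>"
    proof cases
      case 1
      have "?e g = f (x \<oplus>\<^bsub>P\<^esub> y) \<ominus>\<^bsub>T\<^esub> (f x \<oplus>\<^bsub>T\<^esub> f y)"
        unfolding 1(3) using 1(1,2)
        by (simp add: mi ad eb basis_closed FP.M.a_closed del: free_algebra_simps)
      then show ?thesis using 1(1,2) fc by (simp add: add_map_add[OF lin_hom_add_map[OF f]] tz)
    next
      case 2
      have "?e g = f (k \<odot>\<^bsub>P\<^esub> x) \<ominus>\<^bsub>T\<^esub> (k \<odot>\<^bsub>T\<^esub> f x)"
        unfolding 2(3) using 2(1,2)
        by (simp add: mi eb basis_closed FP.smult_closed alg_hom_smult[OF e] del: free_algebra_simps)
      then show ?thesis using 2(1,2) fc by (simp add: lin_hom_smult[OF f] tz)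
    next
      case 3
      have "?e g = (f x \<otimes>\<^bsub>T\<^esub> f y) \<ominus>\<^bsub>T\<^esub> (f y \<otimes>\<^bsub>T\<^esub> f x)"
        unfolding 3(3) using 3(1,2)
        by (simp add: mi eb basis_closed FP.U.m_closed alg_hom_mult[OF e] del: free_algebra_simps)
      then show ?thesis using 3(1,2) fc comm[OF 3(1,2)] by (simp add: tz)
    qed
    then show "g \<in> {x \<in> carrier FP. ?e x = \<zero>\<^bsub>T\<^esub>}" using g gens_closed by blast
  qed
  then have van: "?e x = \<zero>\<^bsub>T\<^esub>" if "x \<in> sym_ideal K P" for x
    using FP.U.genideal_minimal[OF ker] that unfolding sym_ideal_eq by blast
  show thesis
  proof (rule that)
    show "quot_lift ?e \<in> alg_hom K Sym T"
      unfolding sym_algebra_def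
      by (rule quot_lift_alg_hom[OF FP_assoc sym_ideal_ideal T e]) (rule van)
    show "quot_lift ?e (incl x) = f x" if "x \<in> carrier P" for x
      unfolding incl_cl eb[OF that, symmetric]
      by (rule quot_lift_eq[OF ideal.axioms(1)[OF sym_ideal_ideal] FP.M.abelian_group_axioms
            T.M.abelian_group_axioms alg_hom_add_map[OF e] _ basis_closed[OF that]]) (rule van)
  qed
qed

end

context comm_algebra
begin

section \<open>The symmetric algebra of the differentials\<close>

sublocale SO: sym_alg A Om
  by unfold_locales

abbreviation "SymO \<equiv> sym_algebra A Om"
abbreviation "sd x \<equiv> sym_incl A Om (d x)"
abbreviation "dprod xs \<equiv> list_prod SymO (map (\<lambda>x. sd x) xs)"

text \<open>The predicate on the number of factors lets the same statements serve a single degree,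
  all degrees below a bound, and the whole algebra.\<close>

definition dterms :: "(nat \<Rightarrow> bool) \<Rightarrow> (('a \<Rightarrow> 'a) set list \<Rightarrow> 'a) set set" where
  "dterms Q = {a \<odot>\<^bsub>SymO\<^esub> dprod xs |a xs. a \<in> carrier A \<and> set xs \<subseteq> carrier A \<and> Q (length xs)}"

lemma sd_closed: "x \<in> carrier A \<Longrightarrow> sd x \<in> carrier SymO"
  by (rule SO.incl_closed) simp

lemma dprod_closed: "set xs \<subseteq> carrier A \<Longrightarrow> dprod xs \<in> carrier SymO"
  by (rule SO.Sym.U.list_prod_closed) (auto intro: sd_closed)

lemma dterms_closed: "dterms Q \<subseteq> carrier SymO"
  by (auto simp: dterms_def dprod_closed)

lemma dterms_smult:
  assumes "a \<in> carrier A" "s \<in> add_span SymO (dterms Q)"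
  shows "a \<odot>\<^bsub>SymO\<^esub> s \<in> add_span SymO (dterms Q)"
proof (rule add_map_add_span[OF _ SO.Sym.M.abelian_group_axioms SO.Sym.M.abelian_group_axioms dterms_closed dterms_closed _ assms(2)])
  show "(\<lambda>s. a \<odot>\<^bsub>SymO\<^esub> s) \<in> add_map SymO SymO"
    using assms(1) by (auto intro!: add_mapI simp: SO.Sym.smult_r_distr)
  fix g assume "g \<in> dterms Q"
  then obtain b xs where g: "g = b \<odot>\<^bsub>SymO\<^esub> dprod xs" "b \<in> carrier A" "set xs \<subseteq> carrier A" "Q (length xs)"
    by (auto simp: dterms_def)
  then have "a \<odot>\<^bsub>SymO\<^esub> g = (a \<otimes> b) \<odot>\<^bsub>SymO\<^esub> dprod xs"
    using assms(1) dprod_closed by (simp add: SO.Sym.smult_assoc1)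
  then have "a \<odot>\<^bsub>SymO\<^esub> g \<in> dterms Q"
    using g assms(1) unfolding dterms_def by blast
  then show "a \<odot>\<^bsub>SymO\<^esub> g \<in> add_span SymO (dterms Q)"
    by (rule SO.Sym.M.add_span_base[OF dterms_closed])
qed

lemma incl_dterms:
  assumes \<omega>: "\<omega> \<in> carrier Om" and s: "s \<in> add_span SymO (dterms (\<lambda>k. k = n))"
  shows "sym_incl A Om \<omega> \<otimes>\<^bsub>SymO\<^esub> s \<in> add_span SymO (dterms (\<lambda>k. k = Suc n))"
proof (rule add_map_add_span[OF _ SO.Sym.M.abelian_group_axioms SO.Sym.M.abelian_group_axioms dterms_closed dterms_closed _ s,
      of "\<lambda>s. sym_incl A Om \<omega> \<otimes>\<^bsub>SymO\<^esub> s"])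
  show "(\<lambda>s. sym_incl A Om \<omega> \<otimes>\<^bsub>SymO\<^esub> s) \<in> add_map SymO SymO"
    using SO.incl_closed[OF \<omega>] by (auto intro!: add_mapI simp: SO.Sym.U.r_distr)
  fix t assume "t \<in> dterms (\<lambda>k. k = n)"
  then obtain b xs where t: "t = b \<odot>\<^bsub>SymO\<^esub> dprod xs" "b \<in> carrier A" "set xs \<subseteq> carrier A" "length xs = n"
    by (auto simp: dterms_def)
  have tc: "t \<in> carrier SymO" using t dprod_closed by simp
  show "sym_incl A Om \<omega> \<otimes>\<^bsub>SymO\<^esub> t \<in> add_span SymO (dterms (\<lambda>k. k = Suc n))"
  proof (rule add_map_add_span[OF _ Om_group SO.Sym.M.abelian_group_axioms differentials_closed dterms_closed _ Om_span[OF \<omega>],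
        of "\<lambda>\<omega>. sym_incl A Om \<omega> \<otimes>\<^bsub>SymO\<^esub> t"])
    show "(\<lambda>\<omega>. sym_incl A Om \<omega> \<otimes>\<^bsub>SymO\<^esub> t) \<in> add_map Om SymO"
      using tc SO.incl_closed add_map_add[OF lin_hom_add_map[OF SO.incl_lin]]
      by (auto intro!: add_mapI simp: SO.Sym.U.l_distr)
    fix g assume "g \<in> differentials"
    then obtain a x where g: "g = a \<odot>\<^bsub>Om\<^esub> d x" "a \<in> carrier A" "x \<in> carrier A" by (auto simp: differentials_def)
    have "sym_incl A Om g \<otimes>\<^bsub>SymO\<^esub> t = (a \<otimes> b) \<odot>\<^bsub>SymO\<^esub> dprod (x # xs)"
      using g t dprod_closed[OF t(3)] sd_closed[OF g(3)]
      by (simp add: lin_hom_smult[OF SO.incl_lin] SO.Sym.smult_mult_left SO.Sym.smult_mult_right SO.Sym.smult_assoc1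
          SO.Sym.smult_left_commute[of b a])
    moreover have "(a \<otimes> b) \<odot>\<^bsub>SymO\<^esub> dprod (x # xs) \<in> dterms (\<lambda>k. k = Suc n)"
      unfolding dterms_def using g t by (intro CollectI exI[of _ "a \<otimes> b"] exI[of _ "x # xs"]) auto
    ultimately show "sym_incl A Om g \<otimes>\<^bsub>SymO\<^esub> t \<in> add_span SymO (dterms (\<lambda>k. k = Suc n))"
      using SO.Sym.M.add_span_base[OF dterms_closed] by simp
  qed
qed

lemma iprod_dterms:
  "w \<in> lists (carrier Om) \<Longrightarrow> SO.iprod w \<in> add_span SymO (dterms (\<lambda>k. k = length w))"
proof (induction w)
  case Nil
  have "\<one>\<^bsub>SymO\<^esub> = \<one> \<odot>\<^bsub>SymO\<^esub> dprod []" by simp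
  then have "\<one>\<^bsub>SymO\<^esub> \<in> dterms (\<lambda>k. k = 0)" unfolding dterms_def by fastforce
  then show ?case using SO.Sym.M.add_span_base[OF dterms_closed] by simp
next
  case (Cons \<omega> w)
  then show ?case using incl_dterms[of \<omega> "SO.iprod w" "length w"] by simp
qed

text \<open>Differentials are sums of terms \<open>a \<odot> d x\<close>; multiplying out turns
  words in arbitrary differentials into words in exact ones without changing their length.\<close>

lemma sym_degree_dterms: "sym_degree A Om n = add_span SymO (dterms (\<lambda>k. k = n))"
proof
  show "sym_degree A Om n \<subseteq> add_span SymO (dterms (\<lambda>k. k = n))"
  proof
    fix s assume "s \<in> sym_degree A Om n"
    then show "s \<in> add_span SymO (dterms (\<lambda>k. k = n))"
      unfolding SO.sym_degree_span
    proof (rule SO.Sym.M.add_span_least[OF _ add_span.zero _ SO.Sym.M.add_span_add[OF dterms_closed]])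
      fix g assume "g \<in> {a \<odot>\<^bsub>SymO\<^esub> SO.iprod w |a w. a \<in> carrier A \<and> w \<in> lists (carrier Om) \<and> length w = n}"
      then show "g \<in> add_span SymO (dterms (\<lambda>k. k = n))"
        using dterms_smult iprod_dterms by blast
    qed
  qed
  have "dterms (\<lambda>k. k = n) \<subseteq> {a \<odot>\<^bsub>SymO\<^esub> SO.iprod w |a w. a \<in> carrier A \<and> w \<in> lists (carrier Om) \<and> length w = n}"
  proof
    fix g assume "g \<in> dterms (\<lambda>k. k = n)"
    then obtain a xs where g: "g = a \<odot>\<^bsub>SymO\<^esub> dprod xs" "a \<in> carrier A" "set xs \<subseteq> carrier A" "length xs = n"
      by (auto simp: dterms_def)
    then have "g = a \<odot>\<^bsub>SymO\<^esub> SO.iprod (map d xs)" "map d xs \<in> lists (carrier Om)" "length (map d xs) = n"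
      by (auto simp: comp_def subset_iff)
    then show "g \<in> {a \<odot>\<^bsub>SymO\<^esub> SO.iprod w |a w. a \<in> carrier A \<and> w \<in> lists (carrier Om) \<and> length w = n}"
      using g(2) by blast
  qed
  then show "add_span SymO (dterms (\<lambda>k. k = n)) \<subseteq> sym_degree A Om n"
    unfolding SO.sym_degree_span by (rule add_span_mono)
qed

lemma SymO_dterms: "carrier SymO = add_span SymO (dterms (\<lambda>_. True))"
proof
  show "carrier SymO \<subseteq> add_span SymO (dterms (\<lambda>_. True))"
  proof
    fix s assume "s \<in> carrier SymO"
    then have "s \<in> add_span SymO {a \<odot>\<^bsub>SymO\<^esub> SO.iprod w |a w. a \<in> carrier A \<and> w \<in> lists (carrier Om)}"
      using SO.Sym_span by simp
    then show "s \<in> add_span SymO (dterms (\<lambda>_. True))"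
    proof (rule SO.Sym.M.add_span_least[OF _ add_span.zero _ SO.Sym.M.add_span_add[OF dterms_closed]])
      fix g assume "g \<in> {a \<odot>\<^bsub>SymO\<^esub> SO.iprod w |a w. a \<in> carrier A \<and> w \<in> lists (carrier Om)}"
      then obtain a w where g: "g = a \<odot>\<^bsub>SymO\<^esub> SO.iprod w" "a \<in> carrier A" "w \<in> lists (carrier Om)" by blast
      have "dterms (\<lambda>k. k = length w) \<subseteq> dterms (\<lambda>_. True)" by (auto simp: dterms_def)
      then show "g \<in> add_span SymO (dterms (\<lambda>_. True))"
        using dterms_smult[OF g(2) iprod_dterms[OF g(3)]] add_span_mono g(1) by blast
    qed
  qed
  show "add_span SymO (dterms (\<lambda>_. True)) \<subseteq> carrier SymO"
    using SO.Sym.M.add_span_closed[OF dterms_closed] by blast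
qed

end

section \<open>The filtration of an enveloping pair and its associated graded algebra\<close>

text \<open>The filtration, its graded algebra and the PBW map are built from the identities of an
  enveloping pair; universality enters later, where the action of \<open>U\<close> on a module is
  produced.\<close>

locale poisson_env = comm_algebra R A
  for R :: "('r, 'c) ring_scheme" and A :: "('r, 'a) poisson" (structure) +
  fixes U :: "('r, 'u) module" and \<alpha> \<beta> :: "'a \<Rightarrow> 'u"
  assumes pair: "enveloping_pair R A U \<alpha> \<beta>"
    and bracket_closed: "x \<in> carrier A \<Longrightarrow> y \<in> carrier A \<Longrightarrow> bracket A x y \<in> carrier A"
begin

sublocale U: assoc_algebra R U
  using pair by (simp add: enveloping_pair_def)

lemma \<alpha>: "\<alpha> \<in> alg_hom R A U" and \<beta>: "\<beta> \<in> lin_hom R A U"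
  using pair by (simp_all add: enveloping_pair_def)

lemma \<beta>_bracket: "x \<in> carrier A \<Longrightarrow> y \<in> carrier A \<Longrightarrow> \<beta> (bracket A x y) = (\<beta> x \<otimes>\<^bsub>U\<^esub> \<beta> y) \<ominus>\<^bsub>U\<^esub> (\<beta> y \<otimes>\<^bsub>U\<^esub> \<beta> x)"
  and \<alpha>_bracket: "x \<in> carrier A \<Longrightarrow> y \<in> carrier A \<Longrightarrow> \<alpha> (bracket A x y) = (\<alpha> x \<otimes>\<^bsub>U\<^esub> \<beta> y) \<ominus>\<^bsub>U\<^esub> (\<beta> y \<otimes>\<^bsub>U\<^esub> \<alpha> x)"
  and \<beta>_mult: "x \<in> carrier A \<Longrightarrow> y \<in> carrier A \<Longrightarrow> \<beta> (x \<otimes> y) = (\<alpha> x \<otimes>\<^bsub>U\<^esub> \<beta> y) \<oplus>\<^bsub>U\<^esub> (\<alpha> y \<otimes>\<^bsub>U\<^esub> \<beta> x)"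
  using pair by (simp_all add: enveloping_pair_def)

lemma \<alpha>_closed [simp]: "a \<in> carrier A \<Longrightarrow> \<alpha> a \<in> carrier U"
  by (rule alg_hom_closed[OF \<alpha>])

lemma \<beta>_closed [simp]: "a \<in> carrier A \<Longrightarrow> \<beta> a \<in> carrier U"
  by (rule lin_hom_closed[OF \<beta>])

lemmas \<alpha>_add = add_map_add[OF alg_hom_add_map[OF \<alpha>]]
  and \<alpha>_mult = alg_hom_mult[OF \<alpha>]
  and \<alpha>_one = alg_hom_one[OF \<alpha>]
  and \<alpha>_neg = add_map_neg[OF alg_hom_add_map[OF \<alpha>] A.is_abelian_group U.M.abelian_group_axioms]
  and \<beta>_add = add_map_add[OF lin_hom_add_map[OF \<beta>]]

lemma (in abelian_group) minus_minus_cancel: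
  "x \<in> carrier G \<Longrightarrow> y \<in> carrier G \<Longrightarrow> x \<ominus> (x \<ominus> y) = y"
  by (simp add: a_minus_def minus_add r_neg1 r_neg2)

lemma (in abelian_group) minus_telescope:
  "x \<in> carrier G \<Longrightarrow> y \<in> carrier G \<Longrightarrow> z \<in> carrier G \<Longrightarrow> x \<ominus> z = (x \<ominus> y) \<oplus> (y \<ominus> z)"
  by (simp add: a_minus_def a_assoc r_neg1)

text \<open>The rule for normal ordering: moving a scalar to the left of \<open>\<beta> x\<close>
  costs a term that contains no \<beta>, hence one of lower filtration degree.\<close>

lemma \<beta>_\<alpha>:
  "x \<in> carrier A \<Longrightarrow> a \<in> carrier A \<Longrightarrow> \<beta> x \<otimes>\<^bsub>U\<^esub> \<alpha> a = (\<alpha> a \<otimes>\<^bsub>U\<^esub> \<beta> x) \<ominus>\<^bsub>U\<^esub> \<alpha> (bracket A a x)"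
  by (simp add: \<alpha>_bracket U.M.minus_minus_cancel)

abbreviation "bprod xs \<equiv> list_prod U (map \<beta> xs)"

lemma bprod_closed: "set xs \<subseteq> carrier A \<Longrightarrow> bprod xs \<in> carrier U"
  by (rule U.U.list_prod_closed) auto

definition ugens :: "nat \<Rightarrow> 'u set" where
  "ugens k = {\<alpha> a \<otimes>\<^bsub>U\<^esub> bprod xs |a xs. a \<in> carrier A \<and> set xs \<subseteq> carrier A \<and> length xs < k}"

text \<open>\<open>FU k\<close> is the step of index \<open>k - 1\<close> of the filtration, so that \<open>FU 0\<close> is \<open>0\<close>.\<close>

definition FU :: "nat \<Rightarrow> 'u set" where
  "FU k = add_span U (ugens k)"

lemma ugens_closed: "ugens k \<subseteq> carrier U"
  by (auto simp: ugens_def bprod_closed)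

lemma FU_closed: "v \<in> FU k \<Longrightarrow> v \<in> carrier U"
  unfolding FU_def by (rule U.M.add_span_closed[OF ugens_closed])

lemma FU_add: "v \<in> FU k \<Longrightarrow> v' \<in> FU k \<Longrightarrow> v \<oplus>\<^bsub>U\<^esub> v' \<in> FU k"
  unfolding FU_def by (rule U.M.add_span_add[OF ugens_closed])

lemma FU_zero: "\<zero>\<^bsub>U\<^esub> \<in> FU k"
  unfolding FU_def by (rule add_span.zero)

lemma FU_gen: "a \<in> carrier A \<Longrightarrow> set xs \<subseteq> carrier A \<Longrightarrow> length xs < k \<Longrightarrow> \<alpha> a \<otimes>\<^bsub>U\<^esub> bprod xs \<in> FU k"
  unfolding FU_def by (rule U.M.add_span_base[OF ugens_closed]) (auto simp: ugens_def)

lemma FU_bprod: "set xs \<subseteq> carrier A \<Longrightarrow> length xs < k \<Longrightarrow> bprod xs \<in> FU k"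
  using FU_gen[of \<one> xs k] bprod_closed by (simp add: \<alpha>_one)

lemma FU_induct:
  assumes "v \<in> FU k" "\<zero>\<^bsub>U\<^esub> \<in> T" "\<And>v v'. v \<in> T \<Longrightarrow> v' \<in> T \<Longrightarrow> v \<oplus>\<^bsub>U\<^esub> v' \<in> T"
    and "\<And>a xs. a \<in> carrier A \<Longrightarrow> set xs \<subseteq> carrier A \<Longrightarrow> length xs < k \<Longrightarrow> \<alpha> a \<otimes>\<^bsub>U\<^esub> bprod xs \<in> T"
  shows "v \<in> T"
  using assms(1) unfolding FU_def
  by (rule U.M.add_span_least) (use assms(2-4) in \<open>auto simp: ugens_def\<close>)

lemma FU_mono: "j \<le> k \<Longrightarrow> FU j \<subseteq> FU k"
  unfolding FU_def by (rule add_span_mono) (unfold ugens_def, blast dest: less_le_trans)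

lemma FU_0: "FU 0 = {\<zero>\<^bsub>U\<^esub>}"
proof -
  have "v = \<zero>\<^bsub>U\<^esub>" if "v \<in> add_span U {}" for v
    using that by induction auto
  then show ?thesis
    by (auto simp: FU_def ugens_def add_span.zero)
qed

lemma FU_left:
  assumes "h \<in> add_map U U" "v \<in> FU k"
    and "\<And>a xs. a \<in> carrier A \<Longrightarrow> set xs \<subseteq> carrier A \<Longrightarrow> length xs < k \<Longrightarrow> h (\<alpha> a \<otimes>\<^bsub>U\<^esub> bprod xs) \<in> FU j"
  shows "h v \<in> FU j"
proof -
  have "v \<in> {v \<in> carrier U. h v \<in> FU j}"
    by (rule FU_induct[OF assms(2)])
       (use assms(3) add_map_zero[OF assms(1) U.M.abelian_group_axioms U.M.abelian_group_axioms]
          add_map_add[OF assms(1)] FU_zero FU_add bprod_closed in auto)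
  then show ?thesis by simp
qed

lemma mult_left_map: "v \<in> carrier U \<Longrightarrow> (\<lambda>z. v \<otimes>\<^bsub>U\<^esub> z) \<in> add_map U U"
  and mult_right_map: "v \<in> carrier U \<Longrightarrow> (\<lambda>z. z \<otimes>\<^bsub>U\<^esub> v) \<in> add_map U U"
  by (auto intro!: add_mapI simp: U.U.r_distr U.U.l_distr)

lemma FU_alpha:
  assumes "a \<in> carrier A" "v \<in> FU k"
  shows "\<alpha> a \<otimes>\<^bsub>U\<^esub> v \<in> FU k"
proof (rule FU_left[OF mult_left_map[OF \<alpha>_closed[OF assms(1)]] assms(2)])
  fix b xs assume b: "b \<in> carrier A" "set xs \<subseteq> carrier A" "length xs < k"
  have "\<alpha> a \<otimes>\<^bsub>U\<^esub> (\<alpha> b \<otimes>\<^bsub>U\<^esub> bprod xs) = \<alpha> (a \<otimes> b) \<otimes>\<^bsub>U\<^esub> bprod xs"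
    using assms(1) b bprod_closed by (simp add: \<alpha>_mult U.U.m_assoc)
  then show "\<alpha> a \<otimes>\<^bsub>U\<^esub> (\<alpha> b \<otimes>\<^bsub>U\<^esub> bprod xs) \<in> FU k"
    using FU_gen[of "a \<otimes> b" xs k] assms(1) b by simp
qed

lemma FU_neg: "v \<in> FU k \<Longrightarrow> \<ominus>\<^bsub>U\<^esub> v \<in> FU k"
  using FU_alpha[of "\<ominus> \<one>" v k] FU_closed[of v k] by (simp add: \<alpha>_neg \<alpha>_one U.U.l_minus)

lemma FU_minus: "v \<in> FU k \<Longrightarrow> v' \<in> FU k \<Longrightarrow> v \<ominus>\<^bsub>U\<^esub> v' \<in> FU k"
  unfolding a_minus_def by (intro FU_add FU_neg)

lemma FU_subgroup: "additive_subgroup (FU k) U"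
  by (intro additive_subgroupI U.M.add.subgroupI)
     (use FU_closed FU_zero[of k] FU_neg FU_add in blast)+

lemma FU_beta:
  assumes "x \<in> carrier A" "v \<in> FU k"
  shows "\<beta> x \<otimes>\<^bsub>U\<^esub> v \<in> FU (Suc k)"
proof (rule FU_left[OF mult_left_map[OF \<beta>_closed[OF assms(1)]] assms(2)])
  fix a xs assume a: "a \<in> carrier A" "set xs \<subseteq> carrier A" "length xs < k"
  have p: "bprod xs \<in> carrier U" using bprod_closed[OF a(2)] .
  have "\<beta> x \<otimes>\<^bsub>U\<^esub> (\<alpha> a \<otimes>\<^bsub>U\<^esub> bprod xs) = (\<beta> x \<otimes>\<^bsub>U\<^esub> \<alpha> a) \<otimes>\<^bsub>U\<^esub> bprod xs"
    using assms(1) a p by (simp add: U.U.m_assoc)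
  also have "\<dots> = (\<alpha> a \<otimes>\<^bsub>U\<^esub> bprod (x # xs)) \<ominus>\<^bsub>U\<^esub> (\<alpha> (bracket A a x) \<otimes>\<^bsub>U\<^esub> bprod xs)"
    using assms(1) a p bracket_closed
    by (simp add: \<beta>_\<alpha> a_minus_def U.U.l_distr U.U.l_minus U.U.m_assoc)
  also have "\<dots> \<in> FU (Suc k)"
    using assms(1) a bracket_closed[OF a(1) assms(1)] FU_gen[of a "x # xs" "Suc k"] FU_gen[of "bracket A a x" xs "Suc k"]
    by (intro FU_minus) auto
  finally show "\<beta> x \<otimes>\<^bsub>U\<^esub> (\<alpha> a \<otimes>\<^bsub>U\<^esub> bprod xs) \<in> FU (Suc k)" .
qed

lemma FU_bprod_mult:
  "set xs \<subseteq> carrier A \<Longrightarrow> v \<in> FU j \<Longrightarrow> bprod xs \<otimes>\<^bsub>U\<^esub> v \<in> FU (length xs + j)"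
proof (induction xs)
  case Nil
  then show ?case using FU_closed by simp
next
  case (Cons x xs)
  then show ?case
    using FU_beta[of x "bprod xs \<otimes>\<^bsub>U\<^esub> v" "length xs + j"] bprod_closed[of xs] FU_closed[of v j]
    by (simp add: U.U.m_assoc)
qed

text \<open>With the index shifted by one, the factors have degrees at most \<open>i - 1\<close> and
  \<open>j - 1\<close>, and the step of degree \<open>i + j - 2\<close> is
  \<open>FU (i + j - 1)\<close>. If an index is \<open>0\<close>, that factor is \<open>0\<close>,
  so the truncated subtraction is harmless.\<close>

lemma FU_mult:
  assumes "v \<in> FU i" "v' \<in> FU j"
  shows "v \<otimes>\<^bsub>U\<^esub> v' \<in> FU (i + j - 1)"
proof (rule FU_left[OF mult_right_map[OF FU_closed[OF assms(2)]] assms(1)])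
  fix a xs assume a: "a \<in> carrier A" "set xs \<subseteq> carrier A" "length xs < i"
  have "\<alpha> a \<otimes>\<^bsub>U\<^esub> (bprod xs \<otimes>\<^bsub>U\<^esub> v') \<in> FU (length xs + j)"
    by (rule FU_alpha[OF a(1) FU_bprod_mult[OF a(2) assms(2)]])
  moreover have "FU (length xs + j) \<subseteq> FU (i + j - 1)"
    using a(3) by (intro FU_mono) arith
  ultimately show "(\<alpha> a \<otimes>\<^bsub>U\<^esub> bprod xs) \<otimes>\<^bsub>U\<^esub> v' \<in> FU (i + j - 1)"
    using a bprod_closed[OF a(2)] FU_closed[OF assms(2)] by (simp add: U.U.m_assoc subset_iff)
qed

lemma bprod_alpha:
  assumes a: "a \<in> carrier A"
  shows "set xs \<subseteq> carrier A \<Longrightarrow> (bprod xs \<otimes>\<^bsub>U\<^esub> \<alpha> a) \<ominus>\<^bsub>U\<^esub> (\<alpha> a \<otimes>\<^bsub>U\<^esub> bprod xs) \<in> FU (length xs)"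
proof (induction xs)
  case Nil
  then show ?case using a FU_zero by (simp add: a_minus_def U.M.r_neg)
next
  case (Cons x xs)
  define l where "l = (bprod xs \<otimes>\<^bsub>U\<^esub> \<alpha> a) \<ominus>\<^bsub>U\<^esub> (\<alpha> a \<otimes>\<^bsub>U\<^esub> bprod xs)"
  have x: "x \<in> carrier A" "set xs \<subseteq> carrier A" using Cons by auto
  have l: "l \<in> FU (length xs)" using Cons by (simp add: l_def)
  have c: "bprod xs \<in> carrier U" "l \<in> carrier U" "\<beta> x \<in> carrier U" "\<alpha> a \<in> carrier U" "\<alpha> (bracket A a x) \<in> carrier U"
    using bprod_closed x FU_closed[OF l] a bracket_closed by auto
  have "bprod xs \<otimes>\<^bsub>U\<^esub> \<alpha> a = l \<oplus>\<^bsub>U\<^esub> (\<alpha> a \<otimes>\<^bsub>U\<^esub> bprod xs)"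
    using c by (simp add: l_def a_minus_def U.M.a_assoc U.M.l_neg)
  then have "bprod (x # xs) \<otimes>\<^bsub>U\<^esub> \<alpha> a = \<beta> x \<otimes>\<^bsub>U\<^esub> l \<oplus>\<^bsub>U\<^esub> (\<beta> x \<otimes>\<^bsub>U\<^esub> \<alpha> a) \<otimes>\<^bsub>U\<^esub> bprod xs"
    using c by (simp add: U.U.m_assoc U.U.r_distr)
  also have "\<dots> = (\<beta> x \<otimes>\<^bsub>U\<^esub> l \<ominus>\<^bsub>U\<^esub> \<alpha> (bracket A a x) \<otimes>\<^bsub>U\<^esub> bprod xs) \<oplus>\<^bsub>U\<^esub> \<alpha> a \<otimes>\<^bsub>U\<^esub> bprod (x # xs)"
    using c x a by (simp add: \<beta>_\<alpha> a_minus_def U.U.l_distr U.U.l_minus U.U.m_assoc U.M.a_ac)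
  finally have "(bprod (x # xs) \<otimes>\<^bsub>U\<^esub> \<alpha> a) \<ominus>\<^bsub>U\<^esub> (\<alpha> a \<otimes>\<^bsub>U\<^esub> bprod (x # xs))
      = \<beta> x \<otimes>\<^bsub>U\<^esub> l \<ominus>\<^bsub>U\<^esub> \<alpha> (bracket A a x) \<otimes>\<^bsub>U\<^esub> bprod xs"
    using c by (simp add: a_minus_def U.M.a_assoc U.M.r_neg)
  moreover have "\<beta> x \<otimes>\<^bsub>U\<^esub> l \<in> FU (length (x # xs))" using FU_beta[OF x(1) l] by simp
  moreover have "\<alpha> (bracket A a x) \<otimes>\<^bsub>U\<^esub> bprod xs \<in> FU (length (x # xs))"
    using FU_gen[OF bracket_closed[OF a x(1)] x(2)] by simp
  ultimately show ?case using FU_minus by simp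
qed

text \<open>Scalars become central in the associated graded algebra; this makes it an algebra over
  \<open>A\<close>, although the values of \<alpha> need not be central in \<open>U\<close>.\<close>

lemma FU_alpha_commute:
  assumes a: "a \<in> carrier A" and v: "v \<in> FU (Suc k)"
  shows "(v \<otimes>\<^bsub>U\<^esub> \<alpha> a) \<ominus>\<^bsub>U\<^esub> (\<alpha> a \<otimes>\<^bsub>U\<^esub> v) \<in> FU k"
proof (rule FU_left[OF _ v])
  show "(\<lambda>v. (v \<otimes>\<^bsub>U\<^esub> \<alpha> a) \<ominus>\<^bsub>U\<^esub> (\<alpha> a \<otimes>\<^bsub>U\<^esub> v)) \<in> add_map U U"
    using a by (intro add_mapI) (auto simp: U.U.l_distr U.U.r_distr a_minus_def U.M.minus_add U.M.a_ac)
  fix b xs assume b: "b \<in> carrier A" "set xs \<subseteq> carrier A" "length xs < Suc k"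
  have c: "\<alpha> a \<in> carrier U" "\<alpha> b \<in> carrier U" "bprod xs \<in> carrier U" using a b bprod_closed by auto
  have ab: "\<alpha> a \<otimes>\<^bsub>U\<^esub> \<alpha> b = \<alpha> b \<otimes>\<^bsub>U\<^esub> \<alpha> a"
    using a b by (simp add: A.m_comm flip: \<alpha>_mult)
  have "\<alpha> a \<otimes>\<^bsub>U\<^esub> (\<alpha> b \<otimes>\<^bsub>U\<^esub> bprod xs) = (\<alpha> a \<otimes>\<^bsub>U\<^esub> \<alpha> b) \<otimes>\<^bsub>U\<^esub> bprod xs"
    using c by (simp add: U.U.m_assoc)
  also have "\<dots> = \<alpha> b \<otimes>\<^bsub>U\<^esub> (\<alpha> a \<otimes>\<^bsub>U\<^esub> bprod xs)"
    unfolding ab using c by (simp add: U.U.m_assoc)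
  finally have "((\<alpha> b \<otimes>\<^bsub>U\<^esub> bprod xs) \<otimes>\<^bsub>U\<^esub> \<alpha> a) \<ominus>\<^bsub>U\<^esub> (\<alpha> a \<otimes>\<^bsub>U\<^esub> (\<alpha> b \<otimes>\<^bsub>U\<^esub> bprod xs))
      = \<alpha> b \<otimes>\<^bsub>U\<^esub> ((bprod xs \<otimes>\<^bsub>U\<^esub> \<alpha> a) \<ominus>\<^bsub>U\<^esub> (\<alpha> a \<otimes>\<^bsub>U\<^esub> bprod xs))"
    using c by (simp add: a_minus_def U.U.m_assoc U.U.r_distr U.U.r_minus)
  then show "((\<alpha> b \<otimes>\<^bsub>U\<^esub> bprod xs) \<otimes>\<^bsub>U\<^esub> \<alpha> a) \<ominus>\<^bsub>U\<^esub> (\<alpha> a \<otimes>\<^bsub>U\<^esub> (\<alpha> b \<otimes>\<^bsub>U\<^esub> bprod xs)) \<in> FU k"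
    using FU_alpha[OF b(1) bprod_alpha[OF a b(2)]] FU_mono[of "length xs" k] b(3) by auto
qed

section \<open>The graded pieces and their direct sum\<close>

abbreviation "LM \<equiv> left_module U \<alpha>"

lemma LM_simps [simp]:
  "carrier LM = carrier U" "zero LM = zero U" "add LM = add U" "a \<odot>\<^bsub>LM\<^esub> v = \<alpha> a \<otimes>\<^bsub>U\<^esub> v"
  by (simp_all add: left_module_def)

sublocale LM: module A LM
proof (rule moduleI[OF A.is_cring])
  show "abelian_group LM"
    by (rule abelian_groupI) (use abelian_groupE(6)[OF U.M.abelian_group_axioms] in \<open>auto simp: U.M.a_ac\<close>)
qed (auto simp: \<alpha>_add \<alpha>_mult \<alpha>_one U.U.l_distr U.U.r_distr U.U.m_assoc)

lemma FU_submodule: "submodule (FU k) A LM"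
proof -
  have "subgroup (FU k) (add_monoid LM)"
    using additive_subgroup.a_subgroup[OF FU_subgroup[of k]] by (simp add: subgroup_def a_inv_def m_inv_def)
  then show ?thesis
    using FU_alpha by (intro submodule.intro submodule_axioms.intro) auto
qed

text \<open>Scalars are collected on the left, so the submodule generated by the products is already
  the additive span of scalars times products. The successor is the shift of index in
  \<open>FU\<close>.\<close>

lemma env_filt_FU: "env_filt A U \<alpha> \<beta> k = FU (Suc k)"
proof
  let ?S = "{bprod xs |xs. set xs \<subseteq> carrier A \<and> length xs \<le> k}"
  have S: "?S \<subseteq> carrier LM" using bprod_closed by auto
  show "env_filt A U \<alpha> \<beta> k \<subseteq> FU (Suc k)"
    unfolding env_filt_def using FU_bprod by (intro LM.submodule_gen_minimal FU_submodule) auto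
  have sub: "submodule (submodule_gen A LM ?S) A LM" by (rule LM.submodule_gen_submodule[OF S])
  note sg = additive_subgroup_mem[OF submodule_additive_subgroup[OF sub] LM.M.abelian_group_axioms]
  show "FU (Suc k) \<subseteq> env_filt A U \<alpha> \<beta> k"
    unfolding env_filt_def
  proof
    fix v assume "v \<in> FU (Suc k)"
    then show "v \<in> submodule_gen A LM ?S"
    proof (rule FU_induct)
      show "\<zero>\<^bsub>U\<^esub> \<in> submodule_gen A LM ?S" using sg(1) by simp
      show "v \<oplus>\<^bsub>U\<^esub> v' \<in> submodule_gen A LM ?S"
        if "v \<in> submodule_gen A LM ?S" "v' \<in> submodule_gen A LM ?S" for v v'
        using sg(2)[OF that] by simp
      fix a xs assume a: "a \<in> carrier A" "set xs \<subseteq> carrier A" "length xs < Suc k"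
      then have "bprod xs \<in> ?S" by (intro CollectI exI[of _ xs]) auto
      then have "bprod xs \<in> submodule_gen A LM ?S"
        using LM.submodule_gen_self[of ?S] by blast
      then show "\<alpha> a \<otimes>\<^bsub>U\<^esub> bprod xs \<in> submodule_gen A LM ?S"
        using submodule.smult_closed[OF sub a(1)] by simp
    qed
  qed
qed

lemma env_filt_pred_FU: "env_filt_pred A U \<alpha> \<beta> k = FU k"
  by (cases k) (simp_all add: env_filt_pred_def env_filt_FU FU_0)

abbreviation "G n \<equiv> gr_piece A U \<alpha> \<beta> n"
abbreviation "GA \<equiv> gr_algebra A U \<alpha> \<beta>"
abbreviation "gc n v \<equiv> gr_class A U \<alpha> \<beta> n v"
abbreviation "gin n v \<equiv> gr_in A U \<alpha> \<beta> n (gc n v)"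
abbreviation "LMn n \<equiv> LM\<lparr>carrier := FU (Suc n)\<rparr>"

lemma gc_coset: "gc n v = FU n +>\<^bsub>U\<^esub> v"
  by (simp add: gr_class_def env_filt_pred_FU)

text \<open>Forming a coset does not involve the carrier, so classes in the step of degree
  \<open>n\<close>, taken as a module of its own, can be handled as cosets in
  \<open>U\<close>.\<close>

lemma LMn_coset: "FU n +>\<^bsub>LMn n\<^esub> v = gc n v"
  by (simp add: gc_coset a_r_coset_def r_coset_def)

lemma G_quot: "G n = quot_module (LMn n) (FU n)"
  by (simp add: gr_piece_def env_filt_FU env_filt_pred_FU)

lemma LMn_module: "module A (LMn n)"
  by (rule submodule.submodule_is_module[OF FU_submodule LM.module_axioms])

lemma FU_LMn: "submodule (FU n) A (LMn n)"
proof -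
  interpret M: module A "LMn n" by (rule LMn_module)
  have "module A (LM\<lparr>carrier := FU n\<rparr>)"
    by (rule submodule.submodule_is_module[OF FU_submodule LM.module_axioms])
  then show ?thesis
    using FU_mono[of n "Suc n"] by (intro M.module_incl_imp_submodule) auto
qed

lemma LMn_group: "abelian_group (LMn n)" and FU_LMn_group: "additive_subgroup (FU n) (LMn n)"
  using LMn_module[of n] submodule_additive_subgroup[OF FU_LMn] by (auto simp: module_def)

sublocale G: module A "G n" for n
  unfolding G_quot by (rule quot_module_module[OF FU_LMn LMn_module])

lemma G_carrier: "carrier (G n) = gc n ` FU (Suc n)"
  by (simp add: G_quot quot_module_carrier LMn_coset)

lemma gc_closed: "v \<in> FU (Suc n) \<Longrightarrow> gc n v \<in> carrier (G n)"
  by (auto simp: G_carrier)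

lemma G_add: "v \<in> FU (Suc n) \<Longrightarrow> v' \<in> FU (Suc n) \<Longrightarrow> gc n v \<oplus>\<^bsub>G n\<^esub> gc n v' = gc n (v \<oplus>\<^bsub>U\<^esub> v')"
  using quot_module_add[OF FU_LMn_group LMn_group, of v n v'] by (simp add: G_quot LMn_coset)

lemma G_smult: "a \<in> carrier A \<Longrightarrow> v \<in> FU (Suc n) \<Longrightarrow> a \<odot>\<^bsub>G n\<^esub> gc n v = gc n (\<alpha> a \<otimes>\<^bsub>U\<^esub> v)"
  using quot_module_smult[OF FU_LMn LMn_module, of a v n] by (simp add: G_quot LMn_coset del: LM_simps(1))

lemma gc_eq_iff: "v \<in> carrier U \<Longrightarrow> v' \<in> carrier U \<Longrightarrow> gc n v = gc n v' \<longleftrightarrow> v \<ominus>\<^bsub>U\<^esub> v' \<in> FU n"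
  unfolding gc_coset by (rule coset_eq_iff[OF FU_subgroup U.M.abelian_group_axioms])

lemma G_zero: "\<zero>\<^bsub>G n\<^esub> = FU n"
  by (simp add: G_quot)

lemma gc_zero_iff: "v \<in> carrier U \<Longrightarrow> gc n v = \<zero>\<^bsub>G n\<^esub> \<longleftrightarrow> v \<in> FU n"
  unfolding gc_coset G_zero by (rule coset_eq_self_iff[OF FU_subgroup U.M.abelian_group_axioms])

lemma gc_zero: "gc n \<zero>\<^bsub>U\<^esub> = \<zero>\<^bsub>G n\<^esub>"
  by (simp add: gc_zero_iff FU_zero)

lemma GA_simps:
  "s \<in> carrier GA \<longleftrightarrow> (\<forall>n. s n \<in> carrier (G n)) \<and> finite {n. s n \<noteq> \<zero>\<^bsub>G n\<^esub>}"
  "zero GA = (\<lambda>n. \<zero>\<^bsub>G n\<^esub>)"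
  "(s \<oplus>\<^bsub>GA\<^esub> t) n = s n \<oplus>\<^bsub>G n\<^esub> t n"
  "(a \<odot>\<^bsub>GA\<^esub> s) n = a \<odot>\<^bsub>G n\<^esub> s n"
  "one GA = gin 0 \<one>\<^bsub>U\<^esub>"
  "(s \<otimes>\<^bsub>GA\<^esub> t) n = (\<Oplus>\<^bsub>G n\<^esub>i\<in>{..n}. gr_piece_mult A U \<alpha> \<beta> i (n - i) (s i) (t (n - i)))"
  by (simp_all add: gr_algebra_def Let_def)

lemma GA_carrierI:
  assumes "\<And>n. s n \<in> carrier (G n)" "finite F" "\<And>n. n \<notin> F \<Longrightarrow> s n = \<zero>\<^bsub>G n\<^esub>"
  shows "s \<in> carrier GA"
  unfolding GA_simps using assms by (auto intro: finite_subset[of _ F])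

lemma GA_add_closed:
  assumes "s \<in> carrier GA" "t \<in> carrier GA"
  shows "s \<oplus>\<^bsub>GA\<^esub> t \<in> carrier GA"
  using assms
  by (intro GA_carrierI[where F="{n. s n \<noteq> \<zero>\<^bsub>G n\<^esub>} \<union> {n. t n \<noteq> \<zero>\<^bsub>G n\<^esub>}"]) (auto simp: GA_simps)

sublocale GA: module A GA
proof (rule moduleI[OF A.is_cring])
  show "abelian_group GA"
  proof (rule abelian_groupI[OF GA_add_closed])
    fix s assume s: "s \<in> carrier GA"
    have "(\<lambda>n. \<ominus>\<^bsub>G n\<^esub> s n) \<in> carrier GA"
      using s by (intro GA_carrierI[where F="{n. s n \<noteq> \<zero>\<^bsub>G n\<^esub>}"]) (auto simp: GA_simps(1) G.M.neg_zero)
    then show "\<exists>t\<in>carrier GA. t \<oplus>\<^bsub>GA\<^esub> s = \<zero>\<^bsub>GA\<^esub>"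
      using s by (intro bexI[of _ "\<lambda>n. \<ominus>\<^bsub>G n\<^esub> s n"]) (auto simp: fun_eq_iff GA_simps G.M.l_neg)
  qed (auto simp: fun_eq_iff GA_simps G.M.a_ac)
  fix a s assume "a \<in> carrier A" "s \<in> carrier GA"
  then show "a \<odot>\<^bsub>GA\<^esub> s \<in> carrier GA"
    by (intro GA_carrierI[where F="{n. s n \<noteq> \<zero>\<^bsub>G n\<^esub>}"]) (auto simp: GA_simps)
qed (auto simp: fun_eq_iff GA_simps G.smult_l_distr G.smult_r_distr G.smult_assoc1)

lemma GA_group: "abelian_group GA" ..

lemma gin_apply: "gin n v k = (if k = n then gc n v else \<zero>\<^bsub>G k\<^esub>)"
  by (simp add: gr_in_def)

lemma gin_closed: "v \<in> FU (Suc n) \<Longrightarrow> gin n v \<in> carrier GA"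
  by (rule GA_carrierI[where F="{n}"]) (auto simp: gin_apply gc_closed)

lemma gin_add: "v \<in> FU (Suc n) \<Longrightarrow> v' \<in> FU (Suc n) \<Longrightarrow> gin n (v \<oplus>\<^bsub>U\<^esub> v') = gin n v \<oplus>\<^bsub>GA\<^esub> gin n v'"
  by (auto simp: fun_eq_iff GA_simps gin_apply G_add)

lemma gin_smult: "a \<in> carrier A \<Longrightarrow> v \<in> FU (Suc n) \<Longrightarrow> a \<odot>\<^bsub>GA\<^esub> gin n v = gin n (\<alpha> a \<otimes>\<^bsub>U\<^esub> v)"
  by (auto simp: fun_eq_iff GA_simps gin_apply G_smult)

lemma gin_eq_iff: "v \<in> carrier U \<Longrightarrow> v' \<in> carrier U \<Longrightarrow> gin n v = gin n v' \<longleftrightarrow> v \<ominus>\<^bsub>U\<^esub> v' \<in> FU n"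
  unfolding gc_eq_iff[symmetric] by (metis gin_apply)

lemma gin_zero_iff: "v \<in> carrier U \<Longrightarrow> gin n v = \<zero>\<^bsub>GA\<^esub> \<longleftrightarrow> v \<in> FU n"
  unfolding gc_zero_iff[symmetric] by (auto simp: fun_eq_iff GA_simps gin_apply)

definition ghom :: "(nat \<Rightarrow> 'u set) set" where
  "ghom = {gin n v |n v. v \<in> FU (Suc n)}"

lemma ghom_closed: "ghom \<subseteq> carrier GA"
  by (auto simp: ghom_def gin_closed)

lemma GA_span: "carrier GA = add_span GA ghom"
proof
  show "carrier GA \<subseteq> add_span GA ghom"
  proof
    fix s assume "s \<in> carrier GA"
    then show "s \<in> add_span GA ghom"
    proof (induction "card {n. s n \<noteq> \<zero>\<^bsub>G n\<^esub>}" arbitrary: s)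
      case 0
      have "finite {n. s n \<noteq> \<zero>\<^bsub>G n\<^esub>}" using 0(2) unfolding GA_simps(1) by blast
      then have "{n. s n \<noteq> \<zero>\<^bsub>G n\<^esub>} = {}" using 0(1) by (metis card_0_eq)
      then have "s = \<zero>\<^bsub>GA\<^esub>" unfolding GA_simps(2) by blast
      then show ?case by (simp only: add_span.zero)
    next
      case (Suc k)
      then have fin: "finite {n. s n \<noteq> \<zero>\<^bsub>G n\<^esub>}" unfolding GA_simps(1) by blast
      obtain n where n: "s n \<noteq> \<zero>\<^bsub>G n\<^esub>"
        using Suc(2) by (metis (mono_tags, lifting) Collect_empty_eq card.empty nat.distinct(1))
      let ?t = "s(n := \<zero>\<^bsub>G n\<^esub>)"
      have t: "?t \<in> carrier GA"
        using Suc(3) fin by (intro GA_carrierI[OF _ fin]) (auto simp: GA_simps(1))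
      have "{i. ?t i \<noteq> \<zero>\<^bsub>G i\<^esub>} = {i. s i \<noteq> \<zero>\<^bsub>G i\<^esub>} - {n}" by auto
      then have "card {i. ?t i \<noteq> \<zero>\<^bsub>G i\<^esub>} = k"
        using Suc(2) n fin by (simp add: card_Diff_singleton)
      then have "?t \<in> add_span GA ghom" using Suc(1) t by blast
      moreover obtain v where v: "v \<in> FU (Suc n)" "s n = gc n v"
        using Suc(3) unfolding GA_simps(1) G_carrier by blast
      moreover have "s = gin n v \<oplus>\<^bsub>GA\<^esub> ?t"
        using Suc(3) v gc_closed[OF v(1)] by (auto simp: fun_eq_iff GA_simps(1,3) gin_apply)
      moreover have "gin n v \<in> ghom" using v by (auto simp: ghom_def)
      ultimately show ?case using add_span.add by metis
    qed
  qed
  show "add_span GA ghom \<subseteq> carrier GA"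
    using GA.M.add_span_closed[OF ghom_closed] by blast
qed

section \<open>The multiplication of the associated graded algebra\<close>

abbreviation "pm \<equiv> gr_piece_mult A U \<alpha> \<beta>"

lemma pm_gc:
  assumes v: "v \<in> FU (Suc i)" and v': "v' \<in> FU (Suc j)"
  shows "pm i j (gc i v) (gc j v') = gc (i + j) (v \<otimes>\<^bsub>U\<^esub> v')"
proof -
  note vc = FU_closed[OF v] and vc' = FU_closed[OF v']
  have eq: "gc (i + j) (x \<otimes>\<^bsub>U\<^esub> y) = gc (i + j) (v \<otimes>\<^bsub>U\<^esub> v')" if x: "x \<in> gc i v" and y: "y \<in> gc j v'" for x y
  proof -
    have x': "x \<in> carrier U" "x \<ominus>\<^bsub>U\<^esub> v \<in> FU i"
      using x mem_coset_iff[OF FU_subgroup U.M.abelian_group_axioms vc] by (auto simp: gc_coset)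
    have y': "y \<in> carrier U" "y \<ominus>\<^bsub>U\<^esub> v' \<in> FU j"
      using y mem_coset_iff[OF FU_subgroup U.M.abelian_group_axioms vc'] by (auto simp: gc_coset)
    have "y = (y \<ominus>\<^bsub>U\<^esub> v') \<oplus>\<^bsub>U\<^esub> v'"
      using y' vc' by (simp add: a_minus_def U.M.a_assoc U.M.l_neg)
    moreover have "(y \<ominus>\<^bsub>U\<^esub> v') \<oplus>\<^bsub>U\<^esub> v' \<in> FU (Suc j)"
      using y'(2) FU_mono[of j "Suc j"] v' by (intro FU_add) auto
    ultimately have yF: "y \<in> FU (Suc j)" by simp
    have "(x \<ominus>\<^bsub>U\<^esub> v) \<otimes>\<^bsub>U\<^esub> y \<in> FU (i + j)" using FU_mult[OF x'(2) yF] by simp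
    moreover have "v \<otimes>\<^bsub>U\<^esub> (y \<ominus>\<^bsub>U\<^esub> v') \<in> FU (i + j)" using FU_mult[OF v y'(2)] by simp
    \<comment> \<open>Representatives are exchanged one factor at a time, each time at the cost of a
      product of lower filtration degree.\<close>
    moreover have "x \<otimes>\<^bsub>U\<^esub> y \<ominus>\<^bsub>U\<^esub> v \<otimes>\<^bsub>U\<^esub> v' = (x \<ominus>\<^bsub>U\<^esub> v) \<otimes>\<^bsub>U\<^esub> y \<oplus>\<^bsub>U\<^esub> v \<otimes>\<^bsub>U\<^esub> (y \<ominus>\<^bsub>U\<^esub> v')"
      using x'(1) y'(1) vc vc' U.M.minus_telescope[of "x \<otimes>\<^bsub>U\<^esub> y" "v \<otimes>\<^bsub>U\<^esub> y" "v \<otimes>\<^bsub>U\<^esub> v'"]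
      by (simp add: a_minus_def U.U.l_distr U.U.r_distr U.U.l_minus U.U.r_minus)
    ultimately show ?thesis
      using x'(1) y'(1) vc vc' FU_add by (simp add: gc_eq_iff)
  qed
  have "v \<in> gc i v" "v' \<in> gc j v'"
    using mem_coset_iff[OF FU_subgroup U.M.abelian_group_axioms] vc vc' FU_zero
    by (simp_all add: gc_coset a_minus_def U.M.r_neg)
  then show ?thesis
    unfolding gr_piece_mult_def using eq by blast
qed

lemma FU_mult_Suc: "v \<in> FU (Suc i) \<Longrightarrow> v' \<in> FU (Suc j) \<Longrightarrow> v \<otimes>\<^bsub>U\<^esub> v' \<in> FU (Suc (i + j))"
  using FU_mult[of v "Suc i" v' "Suc j"] by simp

lemma pm_closed: "X \<in> carrier (G i) \<Longrightarrow> Y \<in> carrier (G j) \<Longrightarrow> pm i j X Y \<in> carrier (G (i + j))"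
  by (auto simp: G_carrier pm_gc FU_mult_Suc)

lemma pm_add_left:
  assumes "X \<in> carrier (G i)" "X' \<in> carrier (G i)" "Y \<in> carrier (G j)"
  shows "pm i j (X \<oplus>\<^bsub>G i\<^esub> X') Y = pm i j X Y \<oplus>\<^bsub>G (i + j)\<^esub> pm i j X' Y"
proof -
  obtain v v' z where "v \<in> FU (Suc i)" "X = gc i v" "v' \<in> FU (Suc i)" "X' = gc i v'" "z \<in> FU (Suc j)" "Y = gc j z"
    using assms by (auto simp: G_carrier)
  then show ?thesis
    by (simp add: G_add pm_gc FU_add FU_mult_Suc FU_closed U.U.l_distr)
qed

lemma pm_add_right:
  assumes "X \<in> carrier (G i)" "Y \<in> carrier (G j)" "Y' \<in> carrier (G j)"
  shows "pm i j X (Y \<oplus>\<^bsub>G j\<^esub> Y') = pm i j X Y \<oplus>\<^bsub>G (i + j)\<^esub> pm i j X Y'"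
proof -
  obtain v v' z where "v \<in> FU (Suc j)" "Y = gc j v" "v' \<in> FU (Suc j)" "Y' = gc j v'" "z \<in> FU (Suc i)" "X = gc i z"
    using assms by (auto simp: G_carrier)
  then show ?thesis
    by (simp add: G_add pm_gc FU_add FU_mult_Suc FU_closed U.U.r_distr)
qed

lemma pm_zero_left: "Y \<in> carrier (G j) \<Longrightarrow> pm i j \<zero>\<^bsub>G i\<^esub> Y = \<zero>\<^bsub>G (i + j)\<^esub>"
  unfolding G_carrier gc_zero[symmetric] by (auto simp: pm_gc FU_zero FU_closed)

lemma pm_zero_right: "X \<in> carrier (G i) \<Longrightarrow> pm i j X \<zero>\<^bsub>G j\<^esub> = \<zero>\<^bsub>G (i + j)\<^esub>"
  unfolding G_carrier gc_zero[symmetric] by (auto simp: pm_gc FU_zero FU_closed)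

lemma pm_summand_closed:
  assumes "s \<in> carrier GA" "t \<in> carrier GA" "i \<le> n"
  shows "pm i (n - i) (s i) (t (n - i)) \<in> carrier (G n)"
  using pm_closed[of "s i" i "t (n - i)" "n - i"] assms by (simp add: GA_simps(1))

lemma GA_mult_closed:
  assumes s: "s \<in> carrier GA" and t: "t \<in> carrier GA"
  shows "s \<otimes>\<^bsub>GA\<^esub> t \<in> carrier GA"
proof -
  \<comment> \<open>\<open>N\<close> bounds both supports. Beyond degree \<open>2 * N\<close> one
    factor of every summand has degree above \<open>N\<close> and vanishes.\<close>
  obtain N where N: "\<forall>n\<in>{n. s n \<noteq> \<zero>\<^bsub>G n\<^esub>} \<union> {n. t n \<noteq> \<zero>\<^bsub>G n\<^esub>}. n \<le> N"
    using s t finite_nat_set_iff_bounded_le[of "{n. s n \<noteq> \<zero>\<^bsub>G n\<^esub>} \<union> {n. t n \<noteq> \<zero>\<^bsub>G n\<^esub>}"]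
    unfolding GA_simps(1) by blast
  show ?thesis
  proof (rule GA_carrierI[where F="{..2 * N}"])
    show "(s \<otimes>\<^bsub>GA\<^esub> t) n \<in> carrier (G n)" for n
      unfolding GA_simps(6) using pm_summand_closed[OF s t] by (intro G.M.finsum_closed) auto
    fix n assume n: "n \<notin> {..2 * N}"
    have "pm i (n - i) (s i) (t (n - i)) = \<zero>\<^bsub>G n\<^esub>" if i: "i \<in> {..n}" for i
    proof (cases "i \<le> N")
      case True
      then have "\<not> n - i \<le> N" using n by auto
      then have "t (n - i) = \<zero>\<^bsub>G (n - i)\<^esub>" using N by blast
      then show ?thesis using pm_zero_right[of "s i" i "n - i"] s i by (simp add: GA_simps(1))
    next
      case False
      then have "s i = \<zero>\<^bsub>G i\<^esub>" using N by blast
      then show ?thesis using pm_zero_left[of "t (n - i)" "n - i" i] t i by (simp add: GA_simps(1))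
    qed
    then show "(s \<otimes>\<^bsub>GA\<^esub> t) n = \<zero>\<^bsub>G n\<^esub>"
      unfolding GA_simps(6) by (rule G.M.add.finprod_one_eqI)
  qed simp
qed

lemma gin_mult:
  assumes v: "v \<in> FU (Suc i)" and v': "v' \<in> FU (Suc j)"
  shows "gin i v \<otimes>\<^bsub>GA\<^esub> gin j v' = gin (i + j) (v \<otimes>\<^bsub>U\<^esub> v')"
proof
  fix n
  have cl: "gin i v k \<in> carrier (G k)" "gin j v' k \<in> carrier (G k)" for k
    using v v' by (auto simp: gin_apply gc_closed)
  have z: "pm k (n - k) (gin i v k) (gin j v' (n - k)) = \<zero>\<^bsub>G n\<^esub>" if "k \<le> n" "k \<noteq> i \<or> n - k \<noteq> j" for k
  proof (cases "k = i")
    case True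
    then have "gin j v' (n - k) = \<zero>\<^bsub>G (n - k)\<^esub>" using that by (simp add: gin_apply)
    then show ?thesis using pm_zero_right[OF cl(1)[of k], of "n - k"] that by simp
  next
    case False
    then have "gin i v k = \<zero>\<^bsub>G k\<^esub>" by (simp add: gin_apply)
    then show ?thesis using pm_zero_left[OF cl(2)[of "n - k"], of k] that by simp
  qed
  show "(gin i v \<otimes>\<^bsub>GA\<^esub> gin j v') n = gin (i + j) (v \<otimes>\<^bsub>U\<^esub> v') n"
  proof (cases "n = i + j")
    case True
    have "(gin i v \<otimes>\<^bsub>GA\<^esub> gin j v') n = (\<Oplus>\<^bsub>G n\<^esub>k\<in>{i}. pm k (n - k) (gin i v k) (gin j v' (n - k)))"
      unfolding GA_simps(6)
    proof (rule G.M.add.finprod_mono_neutral_cong_right)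
      show "pm k (n - k) (gin i v k) (gin j v' (n - k)) = \<zero>\<^bsub>G n\<^esub>" if "k \<in> {..n} - {i}" for k
        using that by (intro z) auto
      show "(\<lambda>k. pm k (n - k) (gin i v k) (gin j v' (n - k))) \<in> {..n} \<rightarrow> carrier (G n)"
        using pm_summand_closed[OF gin_closed[OF v] gin_closed[OF v']] by auto
    qed (use True in auto)
    also have "\<dots> = gc n (v \<otimes>\<^bsub>U\<^esub> v')"
      using True v v' pm_gc[OF v v'] gc_closed[OF FU_mult_Suc[OF v v']] by (simp add: gin_apply)
    finally show ?thesis using True by (simp add: gin_apply)
  next
    case False
    have "(gin i v \<otimes>\<^bsub>GA\<^esub> gin j v') n = \<zero>\<^bsub>G n\<^esub>"
      unfolding GA_simps(6) using False by (intro G.M.add.finprod_one_eqI z) auto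
    then show ?thesis using False by (simp add: gin_apply)
  qed
qed

lemma one_FU: "\<one>\<^bsub>U\<^esub> \<in> FU (Suc 0)"
  using FU_bprod[of "[]" "Suc 0"] by simp

text \<open>Homogeneous elements generate additively, and for them \<open>gin_mult\<close> reduces
  the monoid laws to those of \<open>U\<close>. Only the rule for a scalar in the second factor
  needs more, namely \<open>FU_alpha_commute\<close>.\<close>

lemma GA_assoc_algebra: "assoc_algebra A GA"
proof (rule assoc_algebra_by_span[OF GA.module_axioms ghom_closed GA_span GA_mult_closed])
  show "\<one>\<^bsub>GA\<^esub> \<in> carrier GA"
    unfolding GA_simps(5) by (rule gin_closed[OF one_FU])
next
  fix s t r assume s: "s \<in> carrier GA" and t: "t \<in> carrier GA" and r: "r \<in> carrier GA"
  have c: "s n \<in> carrier (G n)" "t n \<in> carrier (G n)" "r n \<in> carrier (G n)" for n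
    using s t r by (auto simp: GA_simps(1))
  show "(s \<oplus>\<^bsub>GA\<^esub> t) \<otimes>\<^bsub>GA\<^esub> r = s \<otimes>\<^bsub>GA\<^esub> r \<oplus>\<^bsub>GA\<^esub> t \<otimes>\<^bsub>GA\<^esub> r"
  proof
    fix n
    have "((s \<oplus>\<^bsub>GA\<^esub> t) \<otimes>\<^bsub>GA\<^esub> r) n =
        (\<Oplus>\<^bsub>G n\<^esub>i\<in>{..n}. pm i (n - i) (s i) (r (n - i)) \<oplus>\<^bsub>G n\<^esub> pm i (n - i) (t i) (r (n - i)))"
      unfolding GA_simps(6)
    proof (rule G.M.finsum_cong')
      show "(\<lambda>i. pm i (n - i) (s i) (r (n - i)) \<oplus>\<^bsub>G n\<^esub> pm i (n - i) (t i) (r (n - i))) \<in> {..n} \<rightarrow> carrier (G n)"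
        using pm_summand_closed[OF s r] pm_summand_closed[OF t r] by auto
      show "pm i (n - i) ((s \<oplus>\<^bsub>GA\<^esub> t) i) (r (n - i)) =
          pm i (n - i) (s i) (r (n - i)) \<oplus>\<^bsub>G n\<^esub> pm i (n - i) (t i) (r (n - i))" if "i \<in> {..n}" for i
        using pm_add_left[OF c(1)[of i] c(2)[of i] c(3)[of "n - i"]] that by (simp add: GA_simps(3))
    qed simp
    also have "\<dots> = (s \<otimes>\<^bsub>GA\<^esub> r \<oplus>\<^bsub>GA\<^esub> t \<otimes>\<^bsub>GA\<^esub> r) n"
      unfolding GA_simps(3,6) using pm_summand_closed[OF s r] pm_summand_closed[OF t r]
      by (intro G.M.finsum_addf) auto
    finally show "((s \<oplus>\<^bsub>GA\<^esub> t) \<otimes>\<^bsub>GA\<^esub> r) n = (s \<otimes>\<^bsub>GA\<^esub> r \<oplus>\<^bsub>GA\<^esub> t \<otimes>\<^bsub>GA\<^esub> r) n" .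
  qed
  show "r \<otimes>\<^bsub>GA\<^esub> (s \<oplus>\<^bsub>GA\<^esub> t) = r \<otimes>\<^bsub>GA\<^esub> s \<oplus>\<^bsub>GA\<^esub> r \<otimes>\<^bsub>GA\<^esub> t"
  proof
    fix n
    have "(r \<otimes>\<^bsub>GA\<^esub> (s \<oplus>\<^bsub>GA\<^esub> t)) n =
        (\<Oplus>\<^bsub>G n\<^esub>i\<in>{..n}. pm i (n - i) (r i) (s (n - i)) \<oplus>\<^bsub>G n\<^esub> pm i (n - i) (r i) (t (n - i)))"
      unfolding GA_simps(6)
    proof (rule G.M.finsum_cong')
      show "(\<lambda>i. pm i (n - i) (r i) (s (n - i)) \<oplus>\<^bsub>G n\<^esub> pm i (n - i) (r i) (t (n - i))) \<in> {..n} \<rightarrow> carrier (G n)"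
        using pm_summand_closed[OF r s] pm_summand_closed[OF r t] by auto
      show "pm i (n - i) (r i) ((s \<oplus>\<^bsub>GA\<^esub> t) (n - i)) =
          pm i (n - i) (r i) (s (n - i)) \<oplus>\<^bsub>G n\<^esub> pm i (n - i) (r i) (t (n - i))" if "i \<in> {..n}" for i
        using pm_add_right[OF c(3)[of i] c(1)[of "n - i"] c(2)[of "n - i"]] that by (simp add: GA_simps(3))
    qed simp
    also have "\<dots> = (r \<otimes>\<^bsub>GA\<^esub> s \<oplus>\<^bsub>GA\<^esub> r \<otimes>\<^bsub>GA\<^esub> t) n"
      unfolding GA_simps(3,6) using pm_summand_closed[OF r s] pm_summand_closed[OF r t]
      by (intro G.M.finsum_addf) auto
    finally show "(r \<otimes>\<^bsub>GA\<^esub> (s \<oplus>\<^bsub>GA\<^esub> t)) n = (r \<otimes>\<^bsub>GA\<^esub> s \<oplus>\<^bsub>GA\<^esub> r \<otimes>\<^bsub>GA\<^esub> t) n" .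
  qed
next
  fix s t r assume "s \<in> ghom" "t \<in> ghom" "r \<in> ghom"
  then obtain i j k v w z where s: "s = gin i v" "v \<in> FU (Suc i)" and t: "t = gin j w" "w \<in> FU (Suc j)"
    and r: "r = gin k z" "z \<in> FU (Suc k)" by (auto simp: ghom_def)
  show "(s \<otimes>\<^bsub>GA\<^esub> t) \<otimes>\<^bsub>GA\<^esub> r = s \<otimes>\<^bsub>GA\<^esub> (t \<otimes>\<^bsub>GA\<^esub> r)"
    using s(2) t(2) r(2) unfolding s(1) t(1) r(1)
    by (simp add: gin_mult FU_mult_Suc FU_closed U.U.m_assoc add.assoc)
next
  fix s assume "s \<in> ghom"
  then obtain i v where s: "s = gin i v" "v \<in> FU (Suc i)" by (auto simp: ghom_def)
  show "\<one>\<^bsub>GA\<^esub> \<otimes>\<^bsub>GA\<^esub> s = s" "s \<otimes>\<^bsub>GA\<^esub> \<one>\<^bsub>GA\<^esub> = s"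
    using gin_mult[OF one_FU s(2)] gin_mult[OF s(2) one_FU] FU_closed[OF s(2)]
    unfolding s(1) GA_simps(5) by simp_all
next
  fix a s t assume a: "a \<in> carrier A" and "s \<in> ghom" "t \<in> ghom"
  then obtain i v j w where s: "s = gin i v" "v \<in> FU (Suc i)" and t: "t = gin j w" "w \<in> FU (Suc j)"
    by (auto simp: ghom_def)
  note c = FU_closed[OF s(2)] FU_closed[OF t(2)]
  show "(a \<odot>\<^bsub>GA\<^esub> s) \<otimes>\<^bsub>GA\<^esub> t = a \<odot>\<^bsub>GA\<^esub> (s \<otimes>\<^bsub>GA\<^esub> t)"
    using a s(2) t(2) c unfolding s(1) t(1) by (simp add: gin_smult gin_mult FU_alpha FU_mult_Suc U.U.m_assoc)
  \<comment> \<open>The error made by moving the scalar from the second factor to the front; it lies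
    one filtration step lower and so vanishes in degree \<open>i + j\<close>.\<close>
  have "(v \<otimes>\<^bsub>U\<^esub> \<alpha> a \<ominus>\<^bsub>U\<^esub> \<alpha> a \<otimes>\<^bsub>U\<^esub> v) \<otimes>\<^bsub>U\<^esub> w \<in> FU (i + j)"
    using FU_mult[OF FU_alpha_commute[OF a s(2)] t(2)] by simp
  moreover have "(v \<otimes>\<^bsub>U\<^esub> \<alpha> a \<ominus>\<^bsub>U\<^esub> \<alpha> a \<otimes>\<^bsub>U\<^esub> v) \<otimes>\<^bsub>U\<^esub> w = v \<otimes>\<^bsub>U\<^esub> (\<alpha> a \<otimes>\<^bsub>U\<^esub> w) \<ominus>\<^bsub>U\<^esub> \<alpha> a \<otimes>\<^bsub>U\<^esub> (v \<otimes>\<^bsub>U\<^esub> w)"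
    using a c by (simp add: a_minus_def U.U.l_distr U.U.l_minus U.U.m_assoc)
  ultimately show "s \<otimes>\<^bsub>GA\<^esub> (a \<odot>\<^bsub>GA\<^esub> t) = a \<odot>\<^bsub>GA\<^esub> (s \<otimes>\<^bsub>GA\<^esub> t)"
    using a s(2) t(2) c unfolding s(1) t(1)
    by (simp add: gin_smult gin_mult FU_alpha FU_mult_Suc gin_eq_iff)
qed

sublocale GA: assoc_algebra A GA
  by (rule GA_assoc_algebra)

section \<open>The PBW map\<close>

text \<open>\<open>\<beta>_mult\<close> is the Leibniz rule for the class of \<beta> in degree
  \<open>1\<close>, so the universal property of the differentials applies; compatibility with
  scalars from \<open>R\<close> comes from the linearity of \<alpha> and \<beta>.\<close>

lemma gin_beta_lin:
  obtains \<Psi> where "\<Psi> \<in> lin_hom A Om GA" "\<And>x. x \<in> carrier A \<Longrightarrow> \<Psi> (d x) = gin 1 (\<beta> x)"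
proof (rule kaehler_linear_extension[OF GA.module_axioms, of "\<lambda>x. gin 1 (\<beta> x)"])
  have bF: "\<beta> x \<in> FU (Suc 1)" if "x \<in> carrier A" for x
    using FU_bprod[of "[x]" "Suc 1"] that by simp
  show "(\<lambda>x. gin 1 (\<beta> x)) \<in> add_map A GA"
    using bF by (intro add_mapI gin_closed) (auto simp: \<beta>_add gin_add)
  show "gin 1 (\<beta> (x \<otimes> y)) = x \<odot>\<^bsub>GA\<^esub> gin 1 (\<beta> y) \<oplus>\<^bsub>GA\<^esub> y \<odot>\<^bsub>GA\<^esub> gin 1 (\<beta> x)"
    if "x \<in> carrier A" "y \<in> carrier A" for x y
    using that bF by (simp add: \<beta>_mult gin_smult gin_add FU_alpha)
  show "gin 1 (\<beta> (r \<odot> x)) = ofR r \<odot>\<^bsub>GA\<^esub> gin 1 (\<beta> x)" if r: "r \<in> carrier R" and x: "x \<in> carrier A" for r x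
  proof -
    have "\<alpha> (ofR r) \<otimes>\<^bsub>U\<^esub> \<beta> x = \<beta> (r \<odot> x)"
      using r x by (simp add: alg_hom_smult[OF \<alpha>] \<alpha>_one lin_hom_smult[OF \<beta>] U.smult_mult_left)
    then show ?thesis using gin_smult[of "ofR r" "\<beta> x" 1] r x bF by simp
  qed
qed (use that in blast)

lemma pbw_hom:
  shows "\<exists>h. h \<in> alg_hom A SymO GA \<and> (\<forall>x\<in>carrier A. h (sd x) = gin 1 (\<beta> x))"
proof -
  obtain \<Psi> where \<Psi>: "\<Psi> \<in> lin_hom A Om GA" "\<And>x. x \<in> carrier A \<Longrightarrow> \<Psi> (d x) = gin 1 (\<beta> x)"
    using gin_beta_lin by blast
  have bF: "\<beta> x \<in> FU (Suc 1)" if "x \<in> carrier A" for x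
    using FU_bprod[of "[x]" "Suc 1"] that by simp
  \<comment> \<open>The commutator is \<open>\<beta> (bracket A x y)\<close>, of degree at most
    \<open>1\<close>, hence \<open>0\<close> in degree \<open>2\<close> of the graded algebra. By
    the shift of index, \<open>FU 2\<close> is the step of degree \<open>1\<close>.\<close>
  have dd: "gin 1 (\<beta> x) \<otimes>\<^bsub>GA\<^esub> gin 1 (\<beta> y) = gin 1 (\<beta> y) \<otimes>\<^bsub>GA\<^esub> gin 1 (\<beta> x)"
    if x: "x \<in> carrier A" and y: "y \<in> carrier A" for x y
  proof -
    have "\<beta> x \<otimes>\<^bsub>U\<^esub> \<beta> y \<ominus>\<^bsub>U\<^esub> \<beta> y \<otimes>\<^bsub>U\<^esub> \<beta> x \<in> FU 2"
      using bF[OF bracket_closed[OF x y]] \<beta>_bracket[OF x y] by (simp add: numeral_2_eq_2)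
    then show ?thesis
      using x y bF by (simp add: gin_mult gin_eq_iff numeral_2_eq_2)
  qed
  have \<Psi>c: "\<Psi> \<omega> \<in> carrier GA" if "\<omega> \<in> carrier Om" for \<omega>
    using lin_hom_closed[OF \<Psi>(1) that] .
  have ml: "(\<lambda>\<omega>. \<Psi> \<omega> \<otimes>\<^bsub>GA\<^esub> t) \<in> lin_hom A Om GA" and mr: "(\<lambda>\<omega>. t \<otimes>\<^bsub>GA\<^esub> \<Psi> \<omega>) \<in> lin_hom A Om GA"
    if "t \<in> carrier GA" for t
    using that \<Psi>c add_map_add[OF lin_hom_add_map[OF \<Psi>(1)]] lin_hom_smult[OF \<Psi>(1)]
    by (auto intro!: lin_homI simp: GA.U.l_distr GA.U.r_distr GA.smult_mult_left GA.smult_mult_right)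
  have 1: "\<Psi> \<omega> \<otimes>\<^bsub>GA\<^esub> \<Psi> (d y) = \<Psi> (d y) \<otimes>\<^bsub>GA\<^esub> \<Psi> \<omega>" if "\<omega> \<in> carrier Om" "y \<in> carrier A" for \<omega> y
    by (rule Om_lin_eqI[OF ml mr GA_group that(1)]) (use that \<Psi>c \<Psi>c[OF d_closed[OF that(2)]] dd \<Psi>(2) in auto)
  have 2: "\<Psi> \<omega> \<otimes>\<^bsub>GA\<^esub> \<Psi> \<eta> = \<Psi> \<eta> \<otimes>\<^bsub>GA\<^esub> \<Psi> \<omega>" if "\<omega> \<in> carrier Om" "\<eta> \<in> carrier Om" for \<omega> \<eta>
    by (rule Om_lin_eqI[OF mr ml GA_group that(2)]) (use that \<Psi>c 1 in auto)
  obtain h where "h \<in> alg_hom A SymO GA" "\<And>\<omega>. \<omega> \<in> carrier Om \<Longrightarrow> h (sym_incl A Om \<omega>) = \<Psi> \<omega>"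
    using SO.sym_universal[OF GA_assoc_algebra \<Psi>(1) 2] by blast
  then show ?thesis using \<Psi>(2) by (intro exI[of _ h]) simp
qed

lemma pbw_hom_dprod:
  assumes h: "h \<in> alg_hom A SymO GA" "\<And>x. x \<in> carrier A \<Longrightarrow> h (sd x) = gin 1 (\<beta> x)"
    and a: "a \<in> carrier A" and xs: "set xs \<subseteq> carrier A"
  shows "h (a \<odot>\<^bsub>SymO\<^esub> dprod xs) = gin (length xs) (\<alpha> a \<otimes>\<^bsub>U\<^esub> bprod xs)"
proof -
  have "h (dprod xs) = gin (length xs) (bprod xs)"
    using xs
  proof (induction xs)
    case Nil
    then show ?case using alg_hom_one[OF h(1)] by (simp add: GA_simps(5))
  next
    case (Cons x xs)
    have "h (dprod (x # xs)) = gin 1 (\<beta> x) \<otimes>\<^bsub>GA\<^esub> gin (length xs) (bprod xs)"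
      using Cons h(2) alg_hom_mult[OF h(1), of "sd x" "dprod xs"] sd_closed dprod_closed by simp
    also have "\<dots> = gin (length (x # xs)) (bprod (x # xs))"
      using gin_mult[of "\<beta> x" 1 "bprod xs" "length xs"] FU_bprod[of "[x]" "Suc 1"] FU_bprod[of xs "Suc (length xs)"] Cons
      by simp
    finally show ?case .
  qed
  then show ?thesis
    using alg_hom_smult[OF h(1) a dprod_closed[OF xs]] gin_smult[OF a FU_bprod[OF xs], of "length xs"] by simp
qed

lemma gr_degree_gin: "gr_degree A U \<alpha> \<beta> n = {gin n v |v. v \<in> FU (Suc n)}"
proof
  show "gr_degree A U \<alpha> \<beta> n \<subseteq> {gin n v |v. v \<in> FU (Suc n)}"
  proof
    fix s assume s: "s \<in> gr_degree A U \<alpha> \<beta> n"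
    then obtain v where v: "v \<in> FU (Suc n)" "s n = gc n v"
      unfolding gr_degree_def GA_simps(1) G_carrier by blast
    have "s = gin n v"
      using s v by (auto simp: gr_degree_def fun_eq_iff gin_apply)
    then show "s \<in> {gin n v |v. v \<in> FU (Suc n)}" using v(1) by blast
  qed
qed (auto simp: gr_degree_def gin_closed gin_apply)

text \<open>Surjectivity onto degree \<open>n\<close>: the step is spanned by scalars times words of
  at most \<open>n\<close> letters. Words of length \<open>n\<close> are images by
  \<open>pbw_hom_dprod\<close>, and shorter ones vanish in the graded piece.\<close>

lemma pbw_hom_degree:
  assumes h: "h \<in> alg_hom A SymO GA" "\<And>x. x \<in> carrier A \<Longrightarrow> h (sd x) = gin 1 (\<beta> x)"
  shows "h ` sym_degree A Om n = gr_degree A U \<alpha> \<beta> n"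
proof
  note ha = alg_hom_add_map[OF h(1)]
  let ?T = "{s \<in> carrier SymO. h s \<in> gr_degree A U \<alpha> \<beta> n}"
  show "h ` sym_degree A Om n \<subseteq> gr_degree A U \<alpha> \<beta> n"
  proof
    fix t assume "t \<in> h ` sym_degree A Om n"
    then obtain s where s: "s \<in> add_span SymO (dterms (\<lambda>k. k = n))" "t = h s"
      unfolding sym_degree_dterms by blast
    have "s \<in> ?T"
    proof (rule SO.Sym.M.add_span_least[OF s(1)])
      have "h \<zero>\<^bsub>SymO\<^esub> = gin n \<zero>\<^bsub>U\<^esub>"
        using add_map_zero[OF ha SO.Sym.M.abelian_group_axioms GA_group] gin_zero_iff[of "\<zero>\<^bsub>U\<^esub>" n] FU_zero by simp
      then show "\<zero>\<^bsub>SymO\<^esub> \<in> ?T" unfolding gr_degree_gin using FU_zero by auto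
      show "g \<in> ?T" if "g \<in> dterms (\<lambda>k. k = n)" for g
        using that unfolding dterms_def gr_degree_gin
        by (auto simp: pbw_hom_dprod[OF h] dprod_closed intro!: FU_gen)
      show "s \<oplus>\<^bsub>SymO\<^esub> s' \<in> ?T" if "s \<in> ?T" "s' \<in> ?T" for s s'
      proof -
        obtain v v' where "v \<in> FU (Suc n)" "h s = gin n v" "v' \<in> FU (Suc n)" "h s' = gin n v'"
          using \<open>s \<in> ?T\<close> \<open>s' \<in> ?T\<close> unfolding gr_degree_gin by blast
        then have "h (s \<oplus>\<^bsub>SymO\<^esub> s') = gin n (v \<oplus>\<^bsub>U\<^esub> v')" "v \<oplus>\<^bsub>U\<^esub> v' \<in> FU (Suc n)"
          using add_map_add[OF ha, of s s'] \<open>s \<in> ?T\<close> \<open>s' \<in> ?T\<close> by (auto simp: gin_add FU_add)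
        then show ?thesis
          unfolding gr_degree_gin using \<open>s \<in> ?T\<close> \<open>s' \<in> ?T\<close> by blast
      qed
    qed
    then show "t \<in> gr_degree A U \<alpha> \<beta> n" using s(2) by simp
  qed
  show "gr_degree A U \<alpha> \<beta> n \<subseteq> h ` sym_degree A Om n"
  proof
    fix t assume "t \<in> gr_degree A U \<alpha> \<beta> n"
    then obtain v where v: "v \<in> FU (Suc n)" "t = gin n v" unfolding gr_degree_gin by blast
    let ?V = "{v \<in> FU (Suc n). gin n v \<in> h ` add_span SymO (dterms (\<lambda>k. k = n))}"
    have "v \<in> ?V"
    proof (rule FU_induct[OF v(1)])
      have "gin n \<zero>\<^bsub>U\<^esub> = h \<zero>\<^bsub>SymO\<^esub>"
        using add_map_zero[OF ha SO.Sym.M.abelian_group_axioms GA_group] gin_zero_iff[of "\<zero>\<^bsub>U\<^esub>" n] FU_zero by simp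
      then show "\<zero>\<^bsub>U\<^esub> \<in> ?V" using FU_zero add_span.zero by blast
      show "v \<oplus>\<^bsub>U\<^esub> v' \<in> ?V" if vv: "v \<in> ?V" "v' \<in> ?V" for v v'
      proof -
        obtain s s' where ss: "s \<in> add_span SymO (dterms (\<lambda>k. k = n))" "gin n v = h s"
          "s' \<in> add_span SymO (dterms (\<lambda>k. k = n))" "gin n v' = h s'" using vv by blast
        have "gin n (v \<oplus>\<^bsub>U\<^esub> v') = h (s \<oplus>\<^bsub>SymO\<^esub> s')"
          using ss vv add_map_add[OF ha, of s s'] SO.Sym.M.add_span_closed[OF dterms_closed] by (auto simp: gin_add)
        moreover have "s \<oplus>\<^bsub>SymO\<^esub> s' \<in> add_span SymO (dterms (\<lambda>k. k = n))"
          using ss SO.Sym.M.add_span_add[OF dterms_closed] by blast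
        ultimately show ?thesis using vv FU_add by blast
      qed
      fix a xs assume a: "a \<in> carrier A" and xs: "set xs \<subseteq> carrier A" and len: "length xs < Suc n"
      have aF: "\<alpha> a \<otimes>\<^bsub>U\<^esub> bprod xs \<in> FU (Suc n)" by (rule FU_gen[OF a xs len])
      have "gin n (\<alpha> a \<otimes>\<^bsub>U\<^esub> bprod xs) \<in> h ` add_span SymO (dterms (\<lambda>k. k = n))"
      proof (cases "length xs = n")
        case True
        have "a \<odot>\<^bsub>SymO\<^esub> dprod xs \<in> dterms (\<lambda>k. k = n)" using a xs True by (auto simp: dterms_def)
        then show ?thesis
          using imageI[OF SO.Sym.M.add_span_base[OF dterms_closed], of _ _ h] pbw_hom_dprod[OF h a xs]
          unfolding True by force
      next
        case False
        then have "\<alpha> a \<otimes>\<^bsub>U\<^esub> bprod xs \<in> FU n" using FU_gen[OF a xs, of n] len by simp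
        then have "gin n (\<alpha> a \<otimes>\<^bsub>U\<^esub> bprod xs) = h \<zero>\<^bsub>SymO\<^esub>"
          using add_map_zero[OF ha SO.Sym.M.abelian_group_axioms GA_group] gin_zero_iff[of "\<alpha> a \<otimes>\<^bsub>U\<^esub> bprod xs" n]
            FU_closed[OF aF] by simp
        then show ?thesis using add_span.zero by blast
      qed
      then show "\<alpha> a \<otimes>\<^bsub>U\<^esub> bprod xs \<in> ?V" using aF by blast
    qed
    then show "t \<in> h ` sym_degree A Om n" unfolding sym_degree_dterms v(2) by blast
  qed
qed

lemma pbw_map_unique:
  assumes "is_pbw_map R A U \<alpha> \<beta> \<phi>" "is_pbw_map R A U \<alpha> \<beta> \<phi>'"
  shows "\<phi> = \<phi>'"
proof (rule extensionalityI[of _ "carrier SymO"])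
  show "\<phi> \<in> extensional (carrier SymO)" "\<phi>' \<in> extensional (carrier SymO)"
    using assms by (simp_all add: is_pbw_map_def)
  fix s assume "s \<in> carrier SymO"
  then have s: "s \<in> add_span SymO (dterms (\<lambda>_. True))" using SymO_dterms by simp
  have add: "\<phi> \<in> add_map SymO GA" "\<phi>' \<in> add_map SymO GA"
    using assms by (auto simp: is_pbw_map_def graded_alg_hom_def intro: alg_hom_add_map)
  show "\<phi> s = \<phi>' s"
  proof (rule add_map_eq_on_span[OF add SO.Sym.M.abelian_group_axioms GA_group dterms_closed _ s])
    fix g assume "g \<in> dterms (\<lambda>_. True)"
    then obtain a xs where g: "g = a \<odot>\<^bsub>SymO\<^esub> dprod xs" "a \<in> carrier A" "xs \<in> lists (carrier A)"
      by (auto simp: dterms_def)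
    then show "\<phi> g = \<phi>' g"
      using assms unfolding is_pbw_map_def by metis
  qed
qed

lemma pbw_map_exists:
  obtains \<phi> where "is_pbw_map R A U \<alpha> \<beta> \<phi>" "\<phi> \<in> alg_hom A SymO GA"
    "\<And>x. x \<in> carrier A \<Longrightarrow> \<phi> (sd x) = gin 1 (\<beta> x)"
proof -
  obtain h where h: "h \<in> alg_hom A SymO GA" "\<And>x. x \<in> carrier A \<Longrightarrow> h (sd x) = gin 1 (\<beta> x)"
    using pbw_hom by blast
  \<comment> \<open>Restriction makes the map extensional, so that it is unique as a function and
    \<open>pbw_map\<close> can select it by a definite description.\<close>
  define \<phi> where "\<phi> = restrict h (carrier SymO)"
  have \<phi>: "\<phi> s = h s" if "s \<in> carrier SymO" for s using that by (simp add: \<phi>_def)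
  have \<phi>h: "\<phi> \<in> alg_hom A SymO GA"
    by (intro alg_homI lin_homI)
       (simp_all add: \<phi> alg_hom_closed[OF h(1)] add_map_add[OF alg_hom_add_map[OF h(1)]]
          alg_hom_smult[OF h(1)] alg_hom_mult[OF h(1)] alg_hom_one[OF h(1)])
  have \<phi>s: "\<phi> (sd x) = gin 1 (\<beta> x)" if "x \<in> carrier A" for x
    using \<phi>[OF sd_closed[OF that]] h(2)[OF that] by simp
  have "\<phi> \<in> graded_alg_hom A SymO (sym_degree A Om) GA (gr_degree A U \<alpha> \<beta>)"
    unfolding graded_alg_hom_def using \<phi>h pbw_hom_degree[OF \<phi>h \<phi>s] by blast
  moreover have "\<phi> \<in> extensional (carrier SymO)" by (simp add: \<phi>_def)
  ultimately have "is_pbw_map R A U \<alpha> \<beta> \<phi>"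
    unfolding is_pbw_map_def using pbw_hom_dprod[OF \<phi>h \<phi>s] by auto
  then show thesis using that \<phi>h \<phi>s by blast
qed

text \<open>Injectivity in each single degree suffices. An element of the kernel is peeled from the
  top: its part of highest degree alone contributes to that degree of the image, so it is in the
  kernel too and vanishes. Working with spans of bounded degree avoids a direct sum decomposition of
  the symmetric algebra.\<close>

lemma pbw_iso:
  assumes \<phi>: "\<phi> \<in> alg_hom A SymO GA" "\<And>x. x \<in> carrier A \<Longrightarrow> \<phi> (sd x) = gin 1 (\<beta> x)"
    and inj: "\<And>n s. s \<in> sym_degree A Om n \<Longrightarrow> \<phi> s = \<zero>\<^bsub>GA\<^esub> \<Longrightarrow> s = \<zero>\<^bsub>SymO\<^esub>"
  shows "inj_on \<phi> (carrier SymO)"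
    and "\<phi> \<in> graded_alg_iso A SymO (sym_degree A Om) GA (gr_degree A U \<alpha> \<beta>)"
proof -
  note \<phi>a = alg_hom_add_map[OF \<phi>(1)]
  note dcl = SO.Sym.M.add_span_closed[OF dterms_closed]
  have deg0: "\<phi> s k = \<zero>\<^bsub>G k\<^esub>" if "s \<in> add_span SymO (dterms (\<lambda>j. j < n))" "n \<le> k" for s n k
  proof -
    have "s \<in> {s \<in> carrier SymO. \<phi> s k = \<zero>\<^bsub>G k\<^esub>}"
    proof (rule SO.Sym.M.add_span_least[OF that(1)])
      show "\<zero>\<^bsub>SymO\<^esub> \<in> {s \<in> carrier SymO. \<phi> s k = \<zero>\<^bsub>G k\<^esub>}"
        using add_map_zero[OF \<phi>a SO.Sym.M.abelian_group_axioms GA_group] by (simp add: GA_simps(2))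
      show "g \<in> {s \<in> carrier SymO. \<phi> s k = \<zero>\<^bsub>G k\<^esub>}" if "g \<in> dterms (\<lambda>j. j < n)" for g
        using that \<open>n \<le> k\<close> by (auto simp: dterms_def pbw_hom_dprod[OF \<phi>] dprod_closed gin_apply)
      show "s \<oplus>\<^bsub>SymO\<^esub> t \<in> {s \<in> carrier SymO. \<phi> s k = \<zero>\<^bsub>G k\<^esub>}"
        if "s \<in> {s \<in> carrier SymO. \<phi> s k = \<zero>\<^bsub>G k\<^esub>}" "t \<in> {s \<in> carrier SymO. \<phi> s k = \<zero>\<^bsub>G k\<^esub>}" for s t
        using that by (simp add: add_map_add[OF \<phi>a] GA_simps(3))
    qed
    then show ?thesis by simp
  qed
  have split: "\<exists>s1\<in>add_span SymO (dterms (\<lambda>j. j < n)). \<exists>s2\<in>add_span SymO (dterms (\<lambda>j. j = n)). s = s1 \<oplus>\<^bsub>SymO\<^esub> s2"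
    if "s \<in> add_span SymO (dterms (\<lambda>j. j < Suc n))" for s n
  proof -
    let ?P = "{s. \<exists>s1\<in>add_span SymO (dterms (\<lambda>j. j < n)). \<exists>s2\<in>add_span SymO (dterms (\<lambda>j. j = n)). s = s1 \<oplus>\<^bsub>SymO\<^esub> s2}"
    have "s \<in> ?P"
    proof (rule SO.Sym.M.add_span_least[OF that])
      have "\<zero>\<^bsub>SymO\<^esub> = \<zero>\<^bsub>SymO\<^esub> \<oplus>\<^bsub>SymO\<^esub> \<zero>\<^bsub>SymO\<^esub>" by simp
      then show "\<zero>\<^bsub>SymO\<^esub> \<in> ?P" using add_span.zero by blast
      fix g assume "g \<in> dterms (\<lambda>j. j < Suc n)"
      then have g: "g \<in> dterms (\<lambda>j. j < n) \<or> g \<in> dterms (\<lambda>j. j = n)" and gc: "g \<in> carrier SymO"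
        using dterms_closed by (auto simp: dterms_def less_Suc_eq)
      have "g = g \<oplus>\<^bsub>SymO\<^esub> \<zero>\<^bsub>SymO\<^esub>" "g = \<zero>\<^bsub>SymO\<^esub> \<oplus>\<^bsub>SymO\<^esub> g" using gc by simp_all
      then show "g \<in> ?P"
        using g SO.Sym.M.add_span_base[OF dterms_closed] add_span.zero by blast
    next
      fix s t assume "s \<in> ?P" "t \<in> ?P"
      then obtain s1 s2 t1 t2 where st: "s1 \<in> add_span SymO (dterms (\<lambda>j. j < n))" "s2 \<in> add_span SymO (dterms (\<lambda>j. j = n))"
        "s = s1 \<oplus>\<^bsub>SymO\<^esub> s2" "t1 \<in> add_span SymO (dterms (\<lambda>j. j < n))" "t2 \<in> add_span SymO (dterms (\<lambda>j. j = n))"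
        "t = t1 \<oplus>\<^bsub>SymO\<^esub> t2" by blast
      then have "s \<oplus>\<^bsub>SymO\<^esub> t = (s1 \<oplus>\<^bsub>SymO\<^esub> t1) \<oplus>\<^bsub>SymO\<^esub> (s2 \<oplus>\<^bsub>SymO\<^esub> t2)"
        using dcl by (simp add: SO.Sym.M.a_ac)
      then show "s \<oplus>\<^bsub>SymO\<^esub> t \<in> ?P"
        using st SO.Sym.M.add_span_add[OF dterms_closed] by blast
    qed
    then show ?thesis by blast
  qed
  have zero: "s = \<zero>\<^bsub>SymO\<^esub>" if "s \<in> add_span SymO (dterms (\<lambda>j. j < n))" "\<phi> s = \<zero>\<^bsub>GA\<^esub>" for s n
    using that
  proof (induction n arbitrary: s)
    case 0
    have e: "dterms (\<lambda>j. j < 0) = {}" by (auto simp: dterms_def)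
    show ?case using 0(1) unfolding e by induction auto
  next
    case (Suc n)
    obtain s1 s2 where s: "s1 \<in> add_span SymO (dterms (\<lambda>j. j < n))" "s2 \<in> add_span SymO (dterms (\<lambda>j. j = n))"
      "s = s1 \<oplus>\<^bsub>SymO\<^esub> s2" using split[OF Suc.prems(1)] by blast
    have c: "s1 \<in> carrier SymO" "s2 \<in> carrier SymO" using s dcl by auto
    have sum: "\<phi> s1 k \<oplus>\<^bsub>G k\<^esub> \<phi> s2 k = \<zero>\<^bsub>G k\<^esub>" for k
      using Suc.prems(2) add_map_add[OF \<phi>a c] s(3) GA_simps(2,3) by metis
    have s2d: "s2 \<in> sym_degree A Om n" using s(2) sym_degree_dterms by simp
    then obtain v where v: "v \<in> FU (Suc n)" "\<phi> s2 = gin n v"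
      using pbw_hom_degree[OF \<phi>] gr_degree_gin by blast
    \<comment> \<open>By \<open>deg0\<close> the lower part \<open>s1\<close> contributes nothing in
      degree \<open>n\<close>.\<close>
    have "\<phi> s2 n = \<zero>\<^bsub>G n\<^esub>"
      using sum[of n] deg0[OF s(1), of n] alg_hom_closed[OF \<phi>(1) c(2)] by (simp add: GA_simps(1))
    then have "gc n v = \<zero>\<^bsub>G n\<^esub>" unfolding v(2) gin_apply by simp
    then have "v \<in> FU n" using gc_zero_iff[OF FU_closed[OF v(1)]] by simp
    then have "\<phi> s2 = \<zero>\<^bsub>GA\<^esub>" unfolding v(2) using gin_zero_iff[OF FU_closed[OF v(1)]] by simp
    then have "s2 = \<zero>\<^bsub>SymO\<^esub>" using inj[OF s2d] by simp
    then have "s = s1" using s(3) c by simp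
    then show ?case using Suc.IH[OF s(1)] Suc.prems(2) by simp
  qed
  have ker: "s = \<zero>\<^bsub>SymO\<^esub>" if "s \<in> carrier SymO" "\<phi> s = \<zero>\<^bsub>GA\<^esub>" for s
  proof -
    have "\<exists>n. s \<in> add_span SymO (dterms (\<lambda>j. j < n))"
      using that(1) unfolding SymO_dterms
    proof induction
      case zero
      show ?case using add_span.zero by blast
    next
      case (add g s)
      then obtain n where n: "s \<in> add_span SymO (dterms (\<lambda>j. j < n))" by blast
      obtain a xs where g: "g = a \<odot>\<^bsub>SymO\<^esub> dprod xs" "a \<in> carrier A" "set xs \<subseteq> carrier A"
        using add(1) by (auto simp: dterms_def)
      let ?m = "max n (Suc (length xs))"
      have "g \<in> dterms (\<lambda>j. j < ?m)" unfolding dterms_def using g less_max_iff_disj[of "length xs" n "Suc (length xs)"] lessI by blast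
      moreover have "dterms (\<lambda>j. j < n) \<subseteq> dterms (\<lambda>j. j < ?m)"
        unfolding dterms_def less_max_iff_disj by blast
      ultimately have "g \<oplus>\<^bsub>SymO\<^esub> s \<in> add_span SymO (dterms (\<lambda>j. j < ?m))"
        using n add_span_mono[of "dterms (\<lambda>j. j < n)"] by (intro add_span.add) auto
      then show ?case by blast
    qed
    then show ?thesis using zero that(2) by blast
  qed
  show injO: "inj_on \<phi> (carrier SymO)"
  proof (rule inj_onI)
    fix s t assume s: "s \<in> carrier SymO" and t: "t \<in> carrier SymO" and eq: "\<phi> s = \<phi> t"
    have "\<phi> (s \<ominus>\<^bsub>SymO\<^esub> t) = \<zero>\<^bsub>GA\<^esub>"
      using add_map_minus[OF \<phi>a SO.Sym.M.abelian_group_axioms GA_group s t] eq alg_hom_closed[OF \<phi>(1) t]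
      by (simp add: a_minus_def GA.M.r_neg)
    then have "s \<ominus>\<^bsub>SymO\<^esub> t = \<zero>\<^bsub>SymO\<^esub>" using ker[of "s \<ominus>\<^bsub>SymO\<^esub> t"] s t by simp
    then show "s = t" using SO.Sym.M.minus_eq_zero_iff s t by simp
  qed
  have surj: "\<phi> ` carrier SymO = carrier GA"
  proof
    show "\<phi> ` carrier SymO \<subseteq> carrier GA" using alg_hom_closed[OF \<phi>(1)] by blast
    show "carrier GA \<subseteq> \<phi> ` carrier SymO"
    proof
      fix t assume "t \<in> carrier GA"
      then have "t \<in> add_span GA ghom" using GA_span by simp
      then show "t \<in> \<phi> ` carrier SymO"
      proof (rule GA.M.add_span_least)
        show "\<zero>\<^bsub>GA\<^esub> \<in> \<phi> ` carrier SymO"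
          using add_map_zero[OF \<phi>a SO.Sym.M.abelian_group_axioms GA_group, symmetric] SO.Sym.M.zero_closed by blast
        fix g assume "g \<in> ghom"
        then obtain n where "g \<in> gr_degree A U \<alpha> \<beta> n" unfolding gr_degree_gin ghom_def by blast
        then obtain s where "s \<in> sym_degree A Om n" "g = \<phi> s" using pbw_hom_degree[OF \<phi>] by blast
        then show "g \<in> \<phi> ` carrier SymO" using sym_degree_dterms dcl by blast
      next
        fix x y assume "x \<in> \<phi> ` carrier SymO" "y \<in> \<phi> ` carrier SymO"
        then obtain s t where st: "s \<in> carrier SymO" "x = \<phi> s" "t \<in> carrier SymO" "y = \<phi> t" by blast
        then have "x \<oplus>\<^bsub>GA\<^esub> y = \<phi> (s \<oplus>\<^bsub>SymO\<^esub> t)" using add_map_add[OF \<phi>a, of s t] by simp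
        then show "x \<oplus>\<^bsub>GA\<^esub> y \<in> \<phi> ` carrier SymO" using st by blast
      qed
    qed
  qed
  show "\<phi> \<in> graded_alg_iso A SymO (sym_degree A Om) GA (gr_degree A U \<alpha> \<beta>)"
    unfolding graded_alg_iso_def bij_betw_def using \<phi>(1) injO surj pbw_hom_degree[OF \<phi>] by blast
qed

end

section \<open>Quotients of Poisson algebras and universality\<close>

lemma poisson_quotient_simps [simp]:
  "carrier (poisson_quotient A I) = carrier (quot_module A I)"
  "monoid.mult (poisson_quotient A I) = monoid.mult (quot_module A I)"
  "one (poisson_quotient A I) = one (quot_module A I)"
  "zero (poisson_quotient A I) = zero (quot_module A I)"
  "add (poisson_quotient A I) = add (quot_module A I)"
  "smult (poisson_quotient A I) = smult (quot_module A I)"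
  by (simp_all add: poisson_quotient_def module.extend_def)

lemma poisson_quotient_bracket:
  "bracket (poisson_quotient A I) X Y = (\<Union>x\<in>X. \<Union>y\<in>Y. I +>\<^bsub>A\<^esub> bracket A x y)"
  by (simp add: poisson_quotient_def module.extend_def poisson.fields_def)

locale poisson_quot = poisson_kaehler R A
  for R :: "('r, 'c) ring_scheme" and A :: "('r, 'a) poisson" (structure) +
  fixes I :: "'a set"
  assumes I: "poisson_ideal R A I"
begin

abbreviation "B \<equiv> poisson_quotient A I"
abbreviation "pr x \<equiv> I +> x"

lemma I_ideal: "ideal I A" and I_submodule: "submodule I R A" and pb_I: "a \<in> carrier A \<Longrightarrow> x \<in> I \<Longrightarrow> pb a x \<in> I"
  using I by (auto simp: poisson_ideal_def)

lemma I_subgroup: "additive_subgroup I A"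
  using I_ideal by (rule ideal.axioms)

lemma A_assoc: "assoc_algebra R A"
  by (rule algebra_assoc_algebra[OF algebra])

lemma A_add_group: "abelian_group A" ..

lemmas I_mem = additive_subgroup_mem[OF I_subgroup A_add_group]

lemma B_carrier: "carrier B = pr ` carrier A"
  by (simp add: quot_module_carrier)

lemma pr_closed: "x \<in> carrier A \<Longrightarrow> pr x \<in> carrier B"
  by (simp add: quot_module_carrier)

lemma pr_add: "x \<in> carrier A \<Longrightarrow> y \<in> carrier A \<Longrightarrow> pr x \<oplus>\<^bsub>B\<^esub> pr y = pr (x \<oplus> y)"
  by (simp add: quot_module_add[OF I_subgroup A_add_group])

lemma pr_mult: "x \<in> carrier A \<Longrightarrow> y \<in> carrier A \<Longrightarrow> pr x \<otimes>\<^bsub>B\<^esub> pr y = pr (x \<otimes> y)"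
  by (simp add: quot_module_mult[OF I_ideal])

lemma pr_smult: "r \<in> carrier R \<Longrightarrow> x \<in> carrier A \<Longrightarrow> r \<odot>\<^bsub>B\<^esub> pr x = pr (r \<odot> x)"
  by (simp add: quot_module_smult[OF I_submodule RA.module_axioms])

lemma pr_eq_iff: "x \<in> carrier A \<Longrightarrow> y \<in> carrier A \<Longrightarrow> pr x = pr y \<longleftrightarrow> x \<ominus> y \<in> I"
  by (rule coset_eq_iff[OF I_subgroup A_add_group])

lemma pr_zero_iff: "x \<in> carrier A \<Longrightarrow> pr x = \<zero>\<^bsub>B\<^esub> \<longleftrightarrow> x \<in> I"
  by (simp add: coset_eq_self_iff[OF I_subgroup A_add_group])

lemma pb_left_map: "y \<in> carrier A \<Longrightarrow> (\<lambda>x. pb x y) \<in> add_map A A"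
  and pb_right_map: "x \<in> carrier A \<Longrightarrow> pb x \<in> add_map A A"
  by (auto intro!: add_mapI simp: pb_closed pb_add pb_add_left)

text \<open>Independence of representatives: changing one argument at a time by an element of
  \<open>I\<close> changes the bracket by an element of \<open>I\<close>. For the left argument this
  goes through \<open>pb_anti\<close>, since stability of \<open>I\<close> is given for brackets
  from the left.\<close>

lemma pr_bracket:
  assumes "x \<in> carrier A" "y \<in> carrier A"
  shows "bracket B (pr x) (pr y) = pr (pb x y)"
proof -
  have eq: "pr (pb x' y') = pr (pb x y)" if "x' \<in> pr x" "y' \<in> pr y" for x' y'
  proof -
    have x': "x' \<in> carrier A" "x' \<ominus> x \<in> I" and y': "y' \<in> carrier A" "y' \<ominus> y \<in> I"
      using that mem_coset_iff[OF I_subgroup A_add_group] assms by auto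
    have "pb x' y' \<ominus> pb x' y \<in> I"
      using add_map_minus[OF pb_right_map[OF x'(1)] A_add_group A_add_group y'(1) assms(2)] pb_I[OF x'(1) y'(2)] by simp
    moreover have "pb x' y \<ominus> pb x y \<in> I"
      using add_map_minus[OF pb_left_map[OF assms(2)] A_add_group A_add_group x'(1) assms(1)]
        pb_anti[of y "x' \<ominus> x"] I_mem(3)[OF pb_I[OF assms(2) x'(2)]] x' assms by simp
    ultimately have "pb x' y' \<ominus> pb x y \<in> I"
      using A.minus_telescope[of "pb x' y'" "pb x' y" "pb x y"] I_mem(2) x' y' assms pb_closed by simp
    then show ?thesis using pr_eq_iff x' y' assms pb_closed by simp
  qed
  have "x \<in> pr x" "y \<in> pr y"
    using mem_coset_iff[OF I_subgroup A_add_group] assms I_mem(1) by (simp_all add: a_minus_def A.r_neg)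
  then show ?thesis
    unfolding poisson_quotient_bracket using eq by blast
qed

lemma B_assoc: "assoc_algebra R (quot_module A I)"
  by (rule quot_module_assoc_algebra[OF A_assoc I_ideal])

lemma B_algebra: "algebra R B"
proof -
  interpret Q: assoc_algebra R "quot_module A I" by (rule B_assoc)
  have comm: "X \<otimes>\<^bsub>quot_module A I\<^esub> Y = Y \<otimes>\<^bsub>quot_module A I\<^esub> X"
    if "X \<in> carrier (quot_module A I)" "Y \<in> carrier (quot_module A I)" for X Y
    using that unfolding quot_module_carrier by (auto simp: quot_module_mult[OF I_ideal] A.m_comm)
  have "cring B"
  proof (rule cringI)
    show "abelian_group B"
      by (rule abelian_groupI)
         (use abelian_groupE(6)[OF Q.M.abelian_group_axioms] in \<open>auto simp: Q.M.a_ac simp del: quot_module_zero\<close>)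
    show "comm_monoid B"
      by (rule comm_monoidI) (simp_all add: Q.U.m_assoc del: quot_module_one, rule comm)
  qed (auto simp: Q.U.l_distr)
  moreover have "module R B"
    by (rule module_cong[OF Q.module_axioms]) simp_all
  ultimately show ?thesis
    by (simp add: algebra_def algebra_axioms_def Q.smult_mult_left)
qed

lemma B_bracket_closed: "X \<in> carrier B \<Longrightarrow> Y \<in> carrier B \<Longrightarrow> bracket B X Y \<in> carrier B"
  unfolding B_carrier by (auto simp: pr_bracket pb_closed)

lemma pr_alg_hom: "(\<lambda>x. pr x) \<in> alg_hom R A B"
  by (intro alg_homI lin_homI) (auto simp: pr_closed pr_add pr_mult pr_smult simp del: poisson_quotient_simps(1,2,4-6))

lemma enveloping_pair_quotient:
  assumes env: "enveloping_pair R A U \<alpha> \<beta>"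
    and van: "\<And>x. x \<in> I \<Longrightarrow> \<alpha> x = \<zero>\<^bsub>U\<^esub>" "\<And>x. x \<in> I \<Longrightarrow> \<beta> x = \<zero>\<^bsub>U\<^esub>"
  obtains \<alpha>' \<beta>' where "enveloping_pair R B U \<alpha>' \<beta>'"
    "\<And>x. x \<in> carrier A \<Longrightarrow> \<alpha>' (pr x) = \<alpha> x" "\<And>x. x \<in> carrier A \<Longrightarrow> \<beta>' (pr x) = \<beta> x"
proof -
  have U: "assoc_algebra R U" and \<alpha>: "\<alpha> \<in> alg_hom R A U" and \<beta>: "\<beta> \<in> lin_hom R A U"
    using env by (simp_all add: enveloping_pair_def)
  interpret U: assoc_algebra R U by (rule U)
  have ql: "quot_lift \<alpha> (pr x) = \<alpha> x" "quot_lift \<beta> (pr x) = \<beta> x" if "x \<in> carrier A" for x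
    by (rule quot_lift_eq[OF I_subgroup A_add_group U.M.abelian_group_axioms alg_hom_add_map[OF \<alpha>] van(1) that], assumption)
       (rule quot_lift_eq[OF I_subgroup A_add_group U.M.abelian_group_axioms lin_hom_add_map[OF \<beta>] van(2) that])
  have cl: "\<alpha> x \<in> carrier U" "\<beta> x \<in> carrier U" if "x \<in> carrier A" for x
    using alg_hom_closed[OF \<alpha> that] lin_hom_closed[OF \<beta> that] by auto
  note simps = pr_add pr_mult pr_smult pr_bracket pb_closed ql cl
  have "enveloping_pair R B U (quot_lift \<alpha>) (quot_lift \<beta>)"
    unfolding enveloping_pair_def
  proof (intro conjI ballI U)
    have "one B = pr \<one>" by simp
    then show "quot_lift \<alpha> \<in> alg_hom R B U"
      using add_map_add[OF alg_hom_add_map[OF \<alpha>]] alg_hom_smult[OF \<alpha>] alg_hom_mult[OF \<alpha>] alg_hom_one[OF \<alpha>]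
      by (intro alg_homI lin_homI) (auto simp: B_carrier simps simp del: poisson_quotient_simps)
    show "quot_lift \<beta> \<in> lin_hom R B U"
      using add_map_add[OF lin_hom_add_map[OF \<beta>]] lin_hom_smult[OF \<beta>]
      by (intro lin_homI) (auto simp: B_carrier simps simp del: poisson_quotient_simps)
    fix X Y assume "X \<in> carrier B" "Y \<in> carrier B"
    then obtain x y where xy: "x \<in> carrier A" "y \<in> carrier A" "X = pr x" "Y = pr y" unfolding B_carrier by blast
    note E = env[unfolded enveloping_pair_def, THEN conjunct2, THEN conjunct2, THEN conjunct2, THEN bspec, OF xy(1), THEN bspec, OF xy(2)]
    show "quot_lift \<beta> (bracket B X Y) = quot_lift \<beta> X \<otimes>\<^bsub>U\<^esub> quot_lift \<beta> Y \<ominus>\<^bsub>U\<^esub> quot_lift \<beta> Y \<otimes>\<^bsub>U\<^esub> quot_lift \<beta> X"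
      "quot_lift \<alpha> (bracket B X Y) = quot_lift \<alpha> X \<otimes>\<^bsub>U\<^esub> quot_lift \<beta> Y \<ominus>\<^bsub>U\<^esub> quot_lift \<beta> Y \<otimes>\<^bsub>U\<^esub> quot_lift \<alpha> X"
      "quot_lift \<beta> (X \<otimes>\<^bsub>B\<^esub> Y) = quot_lift \<alpha> X \<otimes>\<^bsub>U\<^esub> quot_lift \<beta> Y \<oplus>\<^bsub>U\<^esub> quot_lift \<alpha> Y \<otimes>\<^bsub>U\<^esub> quot_lift \<beta> X"
      using E xy by (simp_all add: simps del: poisson_quotient_simps)
  qed
  then show thesis using that ql by blast
qed

end

text \<open>All conditions on an enveloping pair are equations in the target algebra, so they can be
  tested after an injective algebra morphism.\<close>

lemma enveloping_pair_reflect: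
  assumes env: "enveloping_pair R B U \<alpha> \<beta>" and B: "algebra R B"
    and br: "\<And>x y. x \<in> carrier B \<Longrightarrow> y \<in> carrier B \<Longrightarrow> bracket B x y \<in> carrier B"
    and W: "assoc_algebra R W" and \<iota>: "\<iota> \<in> alg_hom R W U" "inj_on \<iota> (carrier W)"
    and \<alpha>': "\<And>x. x \<in> carrier B \<Longrightarrow> \<alpha>' x \<in> carrier W" "\<And>x. x \<in> carrier B \<Longrightarrow> \<iota> (\<alpha>' x) = \<alpha> x"
    and \<beta>': "\<And>x. x \<in> carrier B \<Longrightarrow> \<beta>' x \<in> carrier W" "\<And>x. x \<in> carrier B \<Longrightarrow> \<iota> (\<beta>' x) = \<beta> x"
  shows "enveloping_pair R B W \<alpha>' \<beta>'"
proof -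
  have U: "assoc_algebra R U" and \<alpha>: "\<alpha> \<in> alg_hom R B U" and \<beta>: "\<beta> \<in> lin_hom R B U"
    using env by (simp_all add: enveloping_pair_def)
  interpret B: algebra R B by (rule B)
  interpret W: assoc_algebra R W by (rule W)
  interpret U: assoc_algebra R U by (rule U)
  have inj: "x = y" if "\<iota> x = \<iota> y" "x \<in> carrier W" "y \<in> carrier W" for x y
    using that \<iota>(2) by (auto dest: inj_onD)
  have \<iota>add: "\<iota> (x \<oplus>\<^bsub>W\<^esub> y) = \<iota> x \<oplus>\<^bsub>U\<^esub> \<iota> y" "\<iota> (x \<ominus>\<^bsub>W\<^esub> y) = \<iota> x \<ominus>\<^bsub>U\<^esub> \<iota> y" "\<iota> (x \<otimes>\<^bsub>W\<^esub> y) = \<iota> x \<otimes>\<^bsub>U\<^esub> \<iota> y"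
    if "x \<in> carrier W" "y \<in> carrier W" for x y
    using that add_map_add[OF alg_hom_add_map[OF \<iota>(1)]] alg_hom_mult[OF \<iota>(1)]
      add_map_minus[OF alg_hom_add_map[OF \<iota>(1)] W.M.abelian_group_axioms U.M.abelian_group_axioms] by auto
  note simps = \<iota>add alg_hom_smult[OF \<iota>(1)] alg_hom_one[OF \<iota>(1)] \<alpha>' \<beta>'
  show ?thesis
    unfolding enveloping_pair_def
  proof (intro conjI ballI W)
    show "\<alpha>' \<in> alg_hom R B W"
      using add_map_add[OF alg_hom_add_map[OF \<alpha>]] alg_hom_smult[OF \<alpha>] alg_hom_mult[OF \<alpha>] alg_hom_one[OF \<alpha>]
      by (intro alg_homI lin_homI inj) (auto simp: simps)
    show "\<beta>' \<in> lin_hom R B W"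
      using add_map_add[OF lin_hom_add_map[OF \<beta>]] lin_hom_smult[OF \<beta>]
      by (intro lin_homI inj) (auto simp: simps)
    fix x y assume xy: "x \<in> carrier B" "y \<in> carrier B"
    note E = env[unfolded enveloping_pair_def, THEN conjunct2, THEN conjunct2, THEN conjunct2, THEN bspec, OF xy(1), THEN bspec, OF xy(2)]
    show "\<beta>' (bracket B x y) = \<beta>' x \<otimes>\<^bsub>W\<^esub> \<beta>' y \<ominus>\<^bsub>W\<^esub> \<beta>' y \<otimes>\<^bsub>W\<^esub> \<beta>' x"
      "\<alpha>' (bracket B x y) = \<alpha>' x \<otimes>\<^bsub>W\<^esub> \<beta>' y \<ominus>\<^bsub>W\<^esub> \<beta>' y \<otimes>\<^bsub>W\<^esub> \<alpha>' x"
      "\<beta>' (x \<otimes>\<^bsub>B\<^esub> y) = \<alpha>' x \<otimes>\<^bsub>W\<^esub> \<beta>' y \<oplus>\<^bsub>W\<^esub> \<alpha>' y \<otimes>\<^bsub>W\<^esub> \<beta>' x"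
      using xy br E by (intro inj; simp add: simps)+
  qed
qed

text \<open>The image of the free algebra on two copies of \<^term>\<open>B\<close> in a given target replaces that target
  by a test algebra of the type admitted in \<^const>\<open>poisson_enveloping_algebra\<close>.\<close>

lemma enveloping_morphism_exists:
  assumes U: "poisson_enveloping_algebra R B U \<alpha> \<beta>" and env: "enveloping_pair R B U' \<alpha>' \<beta>'" and B: "algebra R B"
    and br: "\<And>x y. x \<in> carrier B \<Longrightarrow> y \<in> carrier B \<Longrightarrow> bracket B x y \<in> carrier B"
  obtains \<gamma> where "enveloping_morphism R B U \<alpha> \<beta> U' \<alpha>' \<beta>' \<gamma>"
proof -
  define F where "F = free_algebra R (carrier B <+> carrier B)"
  define ev where "ev = free_eval R U' (case_sum \<alpha>' \<beta>')"
  define J where "J = {f \<in> carrier F. ev f = \<zero>\<^bsub>U'\<^esub>}"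
  have U': "assoc_algebra R U'" and \<alpha>': "\<alpha>' \<in> alg_hom R B U'" and \<beta>': "\<beta>' \<in> lin_hom R B U'"
    using env by (simp_all add: enveloping_pair_def)
  interpret B: algebra R B by (rule B)
  interpret U': assoc_algebra R U' by (rule U')
  have g: "case_sum \<alpha>' \<beta>' \<in> carrier B <+> carrier B \<rightarrow> carrier U'"
    using alg_hom_closed[OF \<alpha>'] lin_hom_closed[OF \<beta>'] by auto
  have F: "assoc_algebra R F" unfolding F_def by (rule B.R.free_algebra_assoc_algebra)
  interpret F: assoc_algebra R F by (rule F)
  have ev: "ev \<in> alg_hom R F U'" unfolding ev_def F_def by (rule free_eval_alg_hom[OF U' g])
  have J: "ideal J F" unfolding J_def
    by (rule kernel_ideal[OF F.U.ring_axioms U'.U.ring_axioms alg_homD(2)[OF ev]])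
  define W where "W = quot_module F J"
  have W: "assoc_algebra R W" unfolding W_def by (rule quot_module_assoc_algebra[OF F J])
  have J0: "\<And>x. x \<in> J \<Longrightarrow> ev x = \<zero>\<^bsub>U'\<^esub>" by (simp add: J_def)
  define \<iota> where "\<iota> = quot_lift ev"
  note Jg = ideal.axioms(1)[OF J]
  have \<iota>: "\<iota> \<in> alg_hom R W U'" unfolding \<iota>_def W_def by (rule quot_lift_alg_hom[OF F J U' ev]) (rule J0)
  have \<iota>_coset: "\<iota> (J +>\<^bsub>F\<^esub> f) = ev f" if "f \<in> carrier F" for f
    unfolding \<iota>_def
    by (rule quot_lift_eq[OF Jg F.M.abelian_group_axioms U'.M.abelian_group_axioms alg_hom_add_map[OF ev] _ that]) (rule J0)
  have inj: "inj_on \<iota> (carrier W)"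
  proof (rule inj_onI)
    fix X Y assume "X \<in> carrier W" "Y \<in> carrier W" and eq: "\<iota> X = \<iota> Y"
    then obtain f f' where f: "f \<in> carrier F" "X = J +>\<^bsub>F\<^esub> f" "f' \<in> carrier F" "Y = J +>\<^bsub>F\<^esub> f'"
      unfolding W_def quot_module_carrier by blast
    have "ev (f \<ominus>\<^bsub>F\<^esub> f') = ev f \<ominus>\<^bsub>U'\<^esub> ev f'"
      by (rule add_map_minus[OF alg_hom_add_map[OF ev] F.M.abelian_group_axioms U'.M.abelian_group_axioms f(1,3)])
    also have "\<dots> = \<zero>\<^bsub>U'\<^esub>"
      using eq f \<iota>_coset alg_hom_closed[OF ev f(3)] by (simp add: a_minus_def U'.M.r_neg)
    finally have "f \<ominus>\<^bsub>F\<^esub> f' \<in> J" using f by (simp add: J_def)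
    then show "X = Y" using f coset_eq_iff[OF Jg F.M.abelian_group_axioms] by simp
  qed
  define \<alpha>W \<beta>W where "\<alpha>W x = J +>\<^bsub>F\<^esub> basis_elt R [Inl x]" and "\<beta>W x = J +>\<^bsub>F\<^esub> basis_elt R [Inr x]" for x
  have bF: "basis_elt R [Inl x] \<in> carrier F" "basis_elt R [Inr x] \<in> carrier F" if "x \<in> carrier B" for x
    using that by (auto simp: F_def basis_elt_single intro!: B.R.single_closed)
  have w: "\<alpha>W x \<in> carrier W" "\<iota> (\<alpha>W x) = \<alpha>' x" "\<beta>W x \<in> carrier W" "\<iota> (\<beta>W x) = \<beta>' x" if "x \<in> carrier B" for x
    using that bF[OF that] \<iota>_coset free_eval_basis[OF U' g InlI[OF that]] free_eval_basis[OF U' g InrI[OF that]]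
    by (auto simp: \<alpha>W_def \<beta>W_def W_def quot_module_carrier ev_def)
  have "enveloping_pair R B W \<alpha>W \<beta>W"
    by (rule enveloping_pair_reflect[OF env B br W \<iota> inj]) (use w in auto)
  then obtain \<gamma> where \<gamma>: "enveloping_morphism R B U \<alpha> \<beta> W \<alpha>W \<beta>W \<gamma>"
    using U unfolding poisson_enveloping_algebra_def by blast
  then have "enveloping_morphism R B U \<alpha> \<beta> U' \<alpha>' \<beta>' (\<lambda>v. \<iota> (\<gamma> v))"
    using w alg_hom_comp[OF _ \<iota>] by (auto simp: enveloping_morphism_def)
  then show thesis by (rule that)
qed

section \<open>Endomorphism algebras\<close>

text \<open>Extensional maps are taken so that pointwise equality on the carrier is equality of
  elements.\<close>

definition end_algebra :: "('r, 'c) ring_scheme \<Rightarrow> ('r, 'q, 'm) module_scheme \<Rightarrow> ('r, 'q \<Rightarrow> 'q) module" where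
  "end_algebra R M =
    \<lparr>carrier = lin_hom R M M \<inter> extensional (carrier M),
     monoid.mult = (\<lambda>f g. \<lambda>x\<in>carrier M. f (g x)), one = (\<lambda>x\<in>carrier M. x),
     zero = (\<lambda>x\<in>carrier M. \<zero>\<^bsub>M\<^esub>), add = (\<lambda>f g. \<lambda>x\<in>carrier M. f x \<oplus>\<^bsub>M\<^esub> g x),
     smult = (\<lambda>r f. \<lambda>x\<in>carrier M. r \<odot>\<^bsub>M\<^esub> f x)\<rparr>"

lemma end_algebra_simps:
  "f \<in> carrier (end_algebra R M) \<longleftrightarrow> f \<in> lin_hom R M M \<and> f \<in> extensional (carrier M)"
  "x \<in> carrier M \<Longrightarrow> (f \<otimes>\<^bsub>end_algebra R M\<^esub> g) x = f (g x)"
  "x \<in> carrier M \<Longrightarrow> \<one>\<^bsub>end_algebra R M\<^esub> x = x"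
  "x \<in> carrier M \<Longrightarrow> \<zero>\<^bsub>end_algebra R M\<^esub> x = \<zero>\<^bsub>M\<^esub>"
  "x \<in> carrier M \<Longrightarrow> (f \<oplus>\<^bsub>end_algebra R M\<^esub> g) x = f x \<oplus>\<^bsub>M\<^esub> g x"
  "x \<in> carrier M \<Longrightarrow> (r \<odot>\<^bsub>end_algebra R M\<^esub> f) x = r \<odot>\<^bsub>M\<^esub> f x"
  by (simp_all add: end_algebra_def)

lemma end_algebra_eqI:
  assumes "f \<in> carrier (end_algebra R M)" "g \<in> carrier (end_algebra R M)" "\<And>x. x \<in> carrier M \<Longrightarrow> f x = g x"
  shows "f = g"
  using assms by (auto simp: end_algebra_simps(1) intro: extensionalityI)

context module
begin

lemma end_algebra_assoc_algebra: "assoc_algebra R (end_algebra R M)"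
proof -
  let ?E = "end_algebra R M"
  have lin: "f \<in> lin_hom R M M" if "f \<in> carrier ?E" for f
    using that by (simp add: end_algebra_simps(1))
  have cl: "f x \<in> carrier M" if "f \<in> carrier ?E" "x \<in> carrier M" for f x
    using lin_hom_closed[OF lin] that by blast
  have add: "f (x \<oplus>\<^bsub>M\<^esub> y) = f x \<oplus>\<^bsub>M\<^esub> f y" if "f \<in> carrier ?E" "x \<in> carrier M" "y \<in> carrier M" for f x y
    using add_map_add[OF lin_hom_add_map[OF lin]] that by blast
  have smult: "f (r \<odot>\<^bsub>M\<^esub> x) = r \<odot>\<^bsub>M\<^esub> f x" if "f \<in> carrier ?E" "r \<in> carrier R" "x \<in> carrier M" for f r x
    using lin_hom_smult[OF lin] that by blast
  note props = cl add smult
  have I: "restrict h (carrier M) \<in> carrier ?E"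
    if "\<And>x. x \<in> carrier M \<Longrightarrow> h x \<in> carrier M"
      "\<And>x y. x \<in> carrier M \<Longrightarrow> y \<in> carrier M \<Longrightarrow> h (x \<oplus>\<^bsub>M\<^esub> y) = h x \<oplus>\<^bsub>M\<^esub> h y"
      "\<And>r x. r \<in> carrier R \<Longrightarrow> x \<in> carrier M \<Longrightarrow> h (r \<odot>\<^bsub>M\<^esub> x) = r \<odot>\<^bsub>M\<^esub> h x" for h
    unfolding end_algebra_simps(1) using that by (intro conjI lin_homI) simp_all
  have eqs: "f \<oplus>\<^bsub>?E\<^esub> g = (\<lambda>x\<in>carrier M. f x \<oplus>\<^bsub>M\<^esub> g x)" "f \<otimes>\<^bsub>?E\<^esub> g = (\<lambda>x\<in>carrier M. f (g x))"
    "r \<odot>\<^bsub>?E\<^esub> f = (\<lambda>x\<in>carrier M. r \<odot>\<^bsub>M\<^esub> f x)" "\<one>\<^bsub>?E\<^esub> = (\<lambda>x\<in>carrier M. x)" "\<zero>\<^bsub>?E\<^esub> = (\<lambda>x\<in>carrier M. \<zero>\<^bsub>M\<^esub>)" for f g r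
    by (simp_all add: end_algebra_def)
  have closed: "f \<oplus>\<^bsub>?E\<^esub> g \<in> carrier ?E" "f \<otimes>\<^bsub>?E\<^esub> g \<in> carrier ?E" "r \<odot>\<^bsub>?E\<^esub> f \<in> carrier ?E"
    if "f \<in> carrier ?E" "g \<in> carrier ?E" "r \<in> carrier R" for f g r
    unfolding eqs by (rule I; use that in \<open>simp add: props M.a_ac smult_r_distr smult_left_commute\<close>)+
  have closed': "f \<oplus>\<^bsub>?E\<^esub> g \<in> carrier ?E" "f \<otimes>\<^bsub>?E\<^esub> g \<in> carrier ?E"
    if "f \<in> carrier ?E" "g \<in> carrier ?E" for f g
    using closed[OF that R.zero_closed] by auto
  have sclosed: "r \<odot>\<^bsub>?E\<^esub> f \<in> carrier ?E" if "r \<in> carrier R" "f \<in> carrier ?E" for r f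
    using closed(3)[OF that(2) that(2) that(1)] .
  have one: "\<one>\<^bsub>?E\<^esub> \<in> carrier ?E" and zero: "\<zero>\<^bsub>?E\<^esub> \<in> carrier ?E"
    unfolding eqs by (rule I; simp)+
  have neg: "\<exists>g\<in>carrier ?E. g \<oplus>\<^bsub>?E\<^esub> f = \<zero>\<^bsub>?E\<^esub>" if f: "f \<in> carrier ?E" for f
  proof
    show n: "(\<ominus> \<one>) \<odot>\<^bsub>?E\<^esub> f \<in> carrier ?E" by (rule sclosed[OF _ f]) simp
    show "(\<ominus> \<one>) \<odot>\<^bsub>?E\<^esub> f \<oplus>\<^bsub>?E\<^esub> f = \<zero>\<^bsub>?E\<^esub>"
      by (rule end_algebra_eqI[OF closed'(1)[OF n f] zero]) (simp add: end_algebra_simps(2-) cl f smult_l_minus M.l_neg)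
  qed
  note eqI = end_algebra_eqI[of _ R M]
  note all = closed' sclosed one zero
  note ps = end_algebra_simps(2-) props
  have mod: "module R ?E"
  proof (rule moduleI[OF is_cring])
    show "abelian_group ?E"
      by (rule abelian_groupI) (simp_all add: all neg, (rule eqI; simp add: all ps M.a_ac)+)
  qed (simp_all add: all, (rule eqI; simp add: all ps smult_l_distr smult_r_distr smult_assoc1)+)
  then have ag: "abelian_group ?E" by (simp add: module_def)
  have "Group.monoid ?E"
    by (rule monoidI) (simp_all add: all, (rule eqI; simp add: all ps)+)
  then have "ring ?E"
    by (rule ringI[OF ag]) (rule eqI; simp add: all ps)+
  with mod show ?thesis
    by (rule assoc_algebraI) (rule eqI; simp add: all ps)+
qed

end

section \<open>The action of the enveloping algebra of the quotient\<close>

text \<open>Restriction of scalars along \<open>h\<close>. It turns \<open>S\<close> into a module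
  over \<open>R\<close>, over which the operators \<open>E (u x)\<close> are linear, and the
  differentials of a quotient into a module over the original algebra.\<close>

definition scalars :: "('r \<Rightarrow> 'a) \<Rightarrow> ('a, 'b, 'n) module_scheme \<Rightarrow> ('r, 'b) module" where
  "scalars h M =
    \<lparr>carrier = carrier M, monoid.mult = monoid.mult M, one = one M, zero = zero M, add = add M,
     smult = (\<lambda>r x. h r \<odot>\<^bsub>M\<^esub> x)\<rparr>"

lemma scalars_simps [simp]:
  "carrier (scalars h M) = carrier M" "zero (scalars h M) = zero M" "add (scalars h M) = add M"
  "r \<odot>\<^bsub>scalars h M\<^esub> x = h r \<odot>\<^bsub>M\<^esub> x"
  by (simp_all add: scalars_def)

lemma scalars_module:
  assumes "cring K" "h \<in> ring_hom K A" "module A M"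
  shows "module K (scalars h M)"
proof -
  interpret M: module A M by (rule assms)
  note h = ring_hom_closed[OF assms(2)] ring_hom_mult[OF assms(2)] ring_hom_add[OF assms(2)] ring_hom_one[OF assms(2)]
  show ?thesis
  proof (rule moduleI[OF assms(1)])
    show "abelian_group (scalars h M)"
      by (rule abelian_groupI) (use abelian_groupE(6)[OF M.M.abelian_group_axioms] in \<open>auto simp: M.M.a_ac\<close>)
  qed (auto simp: h M.smult_l_distr M.smult_r_distr M.smult_assoc1)
qed

lemma scalars_submodule:
  assumes "h \<in> ring_hom K A" "submodule N A M"
  shows "submodule N K (scalars h M)"
proof -
  have "subgroup N (add_monoid (scalars h M))"
    using additive_subgroup.a_subgroup[OF submodule_additive_subgroup[OF assms(2)]]
    by (simp add: subgroup_def a_inv_def m_inv_def)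
  then show ?thesis
    using submodule.smult_closed[OF assms(2)] ring_hom_closed[OF assms(1)]
    by (intro submodule.intro submodule_axioms.intro) auto
qed

lemma (in comm_algebra) ofR_ring_hom: "(\<lambda>r. ofR r) \<in> ring_hom R A"
  by (rule ring_hom_memI) (auto simp: RA.smult_l_distr RA.smult_assoc1 ofR_mult)

definition quot_end :: "('r, 'q) module \<Rightarrow> 'q set \<Rightarrow> ('q \<Rightarrow> 'q) \<Rightarrow> 'q set \<Rightarrow> 'q set" where
  "quot_end M N T = (\<lambda>X\<in>carrier (quot_module M N). quot_lift (\<lambda>x. N +>\<^bsub>M\<^esub> T x) X)"

lemma quot_end:
  assumes N: "submodule N R M" and M: "module R M" and T: "T \<in> lin_hom R M M" "\<And>x. x \<in> N \<Longrightarrow> T x \<in> N"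
  shows "quot_end M N T \<in> carrier (end_algebra R (quot_module M N))"
    and "x \<in> carrier M \<Longrightarrow> quot_end M N T (N +>\<^bsub>M\<^esub> x) = N +>\<^bsub>M\<^esub> T x"
proof -
  let ?h = "\<lambda>x. N +>\<^bsub>M\<^esub> T x" and ?Q = "quot_module M N"
  have sg: "additive_subgroup N M" by (rule submodule_additive_subgroup[OF N])
  have ag: "abelian_group M" using M by (simp add: module_def)
  have QM: "module R ?Q" by (rule quot_module_module[OF N M])
  then have Qg: "abelian_group ?Q" by (simp add: module_def)
  have h: "?h \<in> lin_hom R M ?Q" by (rule lin_hom_comp[OF T(1) coset_lin_hom[OF N M]])
  have van: "?h x = \<zero>\<^bsub>?Q\<^esub>" if "x \<in> N" for x
    using T(2)[OF that] coset_eq_self_iff[OF sg ag] additive_subgroup_mem(5)[OF sg ag] by simp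
  have l: "quot_lift ?h \<in> lin_hom R ?Q ?Q" by (rule quot_lift_lin_hom[OF N M QM h]) (rule van)
  interpret Q: module R ?Q by (rule QM)
  have "restrict (quot_lift ?h) (carrier ?Q) \<in> lin_hom R ?Q ?Q"
    using l by (auto simp: lin_hom_def)
  then show "quot_end M N T \<in> carrier (end_algebra R ?Q)"
    by (simp add: end_algebra_simps(1) quot_end_def)
  show "quot_end M N T (N +>\<^bsub>M\<^esub> x) = N +>\<^bsub>M\<^esub> T x" if x: "x \<in> carrier M"
    using quot_lift_eq[OF sg ag Qg lin_hom_add_map[OF h] van x] x by (simp add: quot_end_def quot_module_carrier)
qed

lemma end_eval_add_map:
  assumes "X \<in> carrier M"
  shows "(\<lambda>f. f X) \<in> add_map (end_algebra R M) M"
  using assms by (auto intro!: add_mapI simp: end_algebra_simps lin_hom_closed)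

context poisson_pbw
begin

abbreviation "SR \<equiv> scalars (\<lambda>r. ofR r) S"
abbreviation "qc f \<equiv> N +>\<^bsub>SR\<^esub> f"
abbreviation "Q \<equiv> quot_module SR N"
abbreviation "EQ \<equiv> end_algebra R Q"

lemma SR_module: "module R SR" and N_SR: "submodule N R SR"
  by (rule scalars_module[OF RA.is_cring ofR_ring_hom S_module], rule scalars_submodule[OF ofR_ring_hom N_submodule])

sublocale SR: module R SR by (rule SR_module)

lemma SR_group: "abelian_group SR" and N_group: "additive_subgroup N SR"
  using submodule_additive_subgroup[OF N_SR] SR_module by (auto simp: module_def)

lemma Q_module: "module R Q"
  by (rule quot_module_module[OF N_SR SR_module])

sublocale Q: module R Q by (rule Q_module)

lemma EQ_assoc: "assoc_algebra R EQ"
  by (rule Q.end_algebra_assoc_algebra)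

sublocale EQ: assoc_algebra R EQ by (rule EQ_assoc)

lemma qc_closed: "f \<in> carrier S \<Longrightarrow> qc f \<in> carrier Q"
  by (simp add: quot_module_carrier)

lemma qc_add: "f \<in> carrier S \<Longrightarrow> g \<in> carrier S \<Longrightarrow> qc f \<oplus>\<^bsub>Q\<^esub> qc g = qc (f \<oplus>\<^bsub>S\<^esub> g)"
  using quot_module_add[OF N_group SR_group] by simp

lemma SR_minus: "g \<in> carrier S \<Longrightarrow> f \<ominus>\<^bsub>SR\<^esub> g = f \<ominus>\<^bsub>S\<^esub> g"
  by (simp add: a_minus_def a_inv_def m_inv_def)

lemma qc_minus: "f \<in> carrier S \<Longrightarrow> g \<in> carrier S \<Longrightarrow> qc f \<ominus>\<^bsub>Q\<^esub> qc g = qc (f \<ominus>\<^bsub>S\<^esub> g)"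
  using quot_module_minus[OF N_group SR_group, of f g] SR_minus[of g f] by simp

lemma qc_eq_iff: "f \<in> carrier S \<Longrightarrow> g \<in> carrier S \<Longrightarrow> qc f = qc g \<longleftrightarrow> f \<ominus>\<^bsub>S\<^esub> g \<in> N"
  using coset_eq_iff[OF N_group SR_group, of f g] SR_minus[of g f] by simp

lemma EQ_eqI:
  assumes "h \<in> carrier EQ" "k \<in> carrier EQ" "\<And>f. f \<in> carrier S \<Longrightarrow> h (qc f) = k (qc f)"
  shows "h = k"
  by (rule end_algebra_eqI[OF assms(1,2)]) (use assms(3) in \<open>auto simp: quot_module_carrier\<close>)

lemma EQ_apply:
  assumes "f \<in> carrier S"
  shows "(h \<otimes>\<^bsub>EQ\<^esub> k) (qc f) = h (k (qc f))" "(h \<oplus>\<^bsub>EQ\<^esub> k) (qc f) = h (qc f) \<oplus>\<^bsub>Q\<^esub> k (qc f)"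
    "(r \<odot>\<^bsub>EQ\<^esub> h) (qc f) = r \<odot>\<^bsub>Q\<^esub> h (qc f)" "\<one>\<^bsub>EQ\<^esub> (qc f) = qc f" "\<zero>\<^bsub>EQ\<^esub> (qc f) = \<zero>\<^bsub>Q\<^esub>"
    "h \<in> carrier EQ \<Longrightarrow> k \<in> carrier EQ \<Longrightarrow> (h \<ominus>\<^bsub>EQ\<^esub> k) (qc f) = h (qc f) \<ominus>\<^bsub>Q\<^esub> k (qc f)"
  using qc_closed[OF assms] end_algebra_simps(2-)[of "qc f" Q]
    add_map_minus[OF end_eval_add_map[OF qc_closed[OF assms]] EQ.M.abelian_group_axioms Q.M.abelian_group_axioms]
  by (simp_all del: quot_module_zero)

definition \<alpha>E :: "'a \<Rightarrow> ('y multiset \<Rightarrow> 'a) set \<Rightarrow> ('y multiset \<Rightarrow> 'a) set" where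
  "\<alpha>E a = quot_end SR N (\<lambda>f. a \<odot>\<^bsub>S\<^esub> f)"

definition \<beta>E :: "'a \<Rightarrow> ('y multiset \<Rightarrow> 'a) set \<Rightarrow> ('y multiset \<Rightarrow> 'a) set" where
  "\<beta>E x = quot_end SR N (E (u x))"

text \<open>Hamiltonian derivations kill the image of \<open>R\<close>; this is what makes the
  operators \<open>E (u x)\<close> linear over \<open>R\<close>.\<close>

lemma ofR_u: "x \<in> carrier A \<Longrightarrow> r \<in> carrier R \<Longrightarrow> anc (u x) (ofR r) = \<zero>"
  using pb_smult[of r x \<one>] pb_one[of x] by (simp add: anc_u)

lemma \<alpha>E:
  assumes "a \<in> carrier A"
  shows "\<alpha>E a \<in> carrier EQ" "f \<in> carrier S \<Longrightarrow> \<alpha>E a (qc f) = qc (a \<odot>\<^bsub>S\<^esub> f)"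
proof -
  have "(\<lambda>f. a \<odot>\<^bsub>S\<^esub> f) \<in> lin_hom R SR SR"
    using assms by (intro lin_homI) (auto simp: S.smult_r_distr intro: S.smult_left_commute)
  note * = quot_end[OF N_SR SR_module this N_smult[OF assms]]
  show "\<alpha>E a \<in> carrier EQ" "f \<in> carrier S \<Longrightarrow> \<alpha>E a (qc f) = qc (a \<odot>\<^bsub>S\<^esub> f)"
    unfolding \<alpha>E_def by (rule *(1), assumption) (rule *(2); simp)
qed

lemma \<beta>E:
  assumes "x \<in> carrier A"
  shows "\<beta>E x \<in> carrier EQ" "f \<in> carrier S \<Longrightarrow> \<beta>E x (qc f) = qc (E (u x) f)"
proof -
  have "E (u x) \<in> lin_hom R SR SR"
    using assms u_closed[OF assms] ofR_u[OF assms]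
    by (intro lin_homI) (auto simp: E_closed E_add E_smult)
  note * = quot_end[OF N_SR SR_module this E_N[OF assms]]
  show "\<beta>E x \<in> carrier EQ" "f \<in> carrier S \<Longrightarrow> \<beta>E x (qc f) = qc (E (u x) f)"
    unfolding \<beta>E_def by (rule *(1), assumption) (rule *(2); simp)
qed

lemma E_commute_smult:
  assumes "x \<in> carrier A" "a \<in> carrier A" "f \<in> carrier S"
  shows "a \<odot>\<^bsub>S\<^esub> E (u x) f \<ominus>\<^bsub>S\<^esub> E (u x) (a \<odot>\<^bsub>S\<^esub> f) = pb a x \<odot>\<^bsub>S\<^esub> f"
  using assms u_closed[of x] pb_anti[of x a] pb_closed[of x a]
  by (simp add: E_smult anc_u a_minus_def S.M.minus_add S.M.r_neg2 E_closed S.smult_l_minus)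

text \<open>The bracket identity for \<open>\<beta>E\<close> is \<open>E_commutator\<close>, the
  mixed identity is the Leibniz rule of \<open>E (u x)\<close> in its coefficients, and the product
  rule is that of \<open>u\<close>.\<close>

lemma enveloping_pair_EQ: "enveloping_pair R A EQ \<alpha>E \<beta>E"
  unfolding enveloping_pair_def
proof (intro conjI ballI EQ_assoc)
  have qs: "r \<odot>\<^bsub>Q\<^esub> qc f = qc (ofR r \<odot>\<^bsub>S\<^esub> f)" if "r \<in> carrier R" "f \<in> carrier S" for r f
    using quot_module_smult[OF N_SR SR_module that(1), of f] that by simp
  note simps = \<alpha>E \<beta>E EQ_apply qc_add qc_minus qs E_closed u_closed pb_closed
  have ev: "h = k" if "h \<in> carrier EQ" "k \<in> carrier EQ" "\<And>f. f \<in> carrier S \<Longrightarrow> h (qc f) = k (qc f)" for h k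
    using EQ_eqI that by blast
  show "\<alpha>E \<in> alg_hom R A EQ"
    by (intro alg_homI lin_homI ev) (simp_all add: simps S.smult_l_distr ofR_mult flip: S.smult_assoc1)
  show "\<beta>E \<in> lin_hom R A EQ"
    by (intro lin_homI ev) (simp_all add: simps u_smult E_add_left E_smult_left add_map_add[OF u_add_map])
  fix x y assume xy: "x \<in> carrier A" "y \<in> carrier A"
  show "\<beta>E (pb x y) = \<beta>E x \<otimes>\<^bsub>EQ\<^esub> \<beta>E y \<ominus>\<^bsub>EQ\<^esub> \<beta>E y \<otimes>\<^bsub>EQ\<^esub> \<beta>E x"
  proof (rule ev)
    fix f assume f: "f \<in> carrier S"
    have "E (u x) (E (u y) f) \<ominus>\<^bsub>S\<^esub> E (u y) (E (u x) f) = E (u (pb x y)) f"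
      using E_commutator[of "u x" "u y" f] xy f br_u[of x y]
      by (simp add: u_closed pb_closed E_closed a_minus_def S.M.a_ac S.M.l_neg S.M.r_neg S.M.r_neg1 S.M.r_neg2)
    then show "\<beta>E (pb x y) (qc f) = (\<beta>E x \<otimes>\<^bsub>EQ\<^esub> \<beta>E y \<ominus>\<^bsub>EQ\<^esub> \<beta>E y \<otimes>\<^bsub>EQ\<^esub> \<beta>E x) (qc f)"
      using xy f by (simp add: simps)
  qed (use xy in \<open>simp_all add: simps\<close>)
  show "\<alpha>E (pb x y) = \<alpha>E x \<otimes>\<^bsub>EQ\<^esub> \<beta>E y \<ominus>\<^bsub>EQ\<^esub> \<beta>E y \<otimes>\<^bsub>EQ\<^esub> \<alpha>E x"
    by (rule ev) (use xy in \<open>simp_all add: simps E_commute_smult\<close>)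
  show "\<beta>E (x \<otimes> y) = \<alpha>E x \<otimes>\<^bsub>EQ\<^esub> \<beta>E y \<oplus>\<^bsub>EQ\<^esub> \<alpha>E y \<otimes>\<^bsub>EQ\<^esub> \<beta>E x"
    by (rule ev) (use xy in \<open>simp_all add: simps u_mult E_add_left E_smult_left\<close>)
qed

text \<open>Together these make the action factor through \<open>A / I\<close>: \<open>I S\<close>
  lies in \<open>N\<close> by construction, and \<open>E (u a)\<close> maps into \<open>N\<close> by
  \<open>E_I_N\<close>.\<close>

lemma \<alpha>E_I: "a \<in> I \<Longrightarrow> \<alpha>E a = \<zero>\<^bsub>EQ\<^esub>" and \<beta>E_I: "a \<in> I \<Longrightarrow> \<beta>E a = \<zero>\<^bsub>EQ\<^esub>"
proof -
  assume a: "a \<in> I"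
  have z: "qc g = \<zero>\<^bsub>Q\<^esub>" if "g \<in> N" for g
    using coset_eq_self_iff[OF N_group SR_group] N_closed that by simp
  show "\<alpha>E a = \<zero>\<^bsub>EQ\<^esub>"
    by (rule EQ_eqI) (use a I_closed[OF a] z[OF IS_N[OF I_smult[OF a]]] in \<open>simp_all add: \<alpha>E EQ_apply del: quot_module_zero\<close>)
  show "\<beta>E a = \<zero>\<^bsub>EQ\<^esub>"
    by (rule EQ_eqI) (use a I_closed[OF a] z[OF E_I_N[OF a]] in \<open>simp_all add: \<beta>E EQ_apply del: quot_module_zero\<close>)
qed

section \<open>Degrees under the action\<close>

definition Sdeg :: "(nat \<Rightarrow> bool) \<Rightarrow> ('y multiset \<Rightarrow> 'a) set" where
  "Sdeg P = {f \<in> carrier S. \<forall>m. f m \<noteq> \<zero> \<longrightarrow> P (size m)}"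

lemma Sdeg_closed: "f \<in> Sdeg P \<Longrightarrow> f \<in> carrier S"
  by (simp add: Sdeg_def)

lemma Sdeg_iff: "f \<in> Sdeg P \<longleftrightarrow> f \<in> carrier S \<and> (\<forall>m. \<not> P (size m) \<longrightarrow> f m = \<zero>)"
  by (auto simp: Sdeg_def)

lemma Sdeg_zero: "\<zero>\<^bsub>S\<^esub> \<in> Sdeg P"
  using S.M.zero_closed by (simp add: Sdeg_iff free_module_simps)

lemma Sdeg_add: "f \<in> Sdeg P \<Longrightarrow> g \<in> Sdeg P \<Longrightarrow> f \<oplus>\<^bsub>S\<^esub> g \<in> Sdeg P"
  by (auto simp: Sdeg_iff A.free_module_add_apply)

lemma Sdeg_minus: "f \<in> Sdeg P \<Longrightarrow> g \<in> Sdeg P \<Longrightarrow> f \<ominus>\<^bsub>S\<^esub> g \<in> Sdeg P"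
  unfolding Sdeg_iff by (simp add: S_minus_apply A.minus_eq A.r_neg)

lemma Sdeg_smult: "a \<in> carrier A \<Longrightarrow> f \<in> Sdeg P \<Longrightarrow> a \<odot>\<^bsub>S\<^esub> f \<in> Sdeg P"
  by (auto simp: Sdeg_iff A.free_module_smult_apply)

lemma Sdeg_mono: "f \<in> Sdeg P \<Longrightarrow> (\<And>k. P k \<Longrightarrow> P' k) \<Longrightarrow> f \<in> Sdeg P'"
  by (auto simp: Sdeg_def)

lemma Sdeg_mu:
  assumes v: "v \<in> carrier L" and f: "f \<in> Sdeg P" and P: "\<And>k. P k \<Longrightarrow> P' (Suc k)"
  shows "mu v f \<in> Sdeg P'"
proof -
  have "mu v f m = \<zero>" if m: "\<not> P' (size m)" for m
    unfolding mu_coeff[OF v Sdeg_closed[OF f]]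
  proof (rule A.add.finprod_one_eqI)
    fix k assume "k \<in> set_mset m"
    then have "\<not> P (size (m - {#k#}))" using P m by (metis size_Suc_Diff1)
    then show "co v k \<otimes> f (m - {#k#}) = \<zero>" using f co_coeff[OF v] by (simp add: Sdeg_iff)
  qed
  then show ?thesis using mu_closed[OF v Sdeg_closed[OF f]] by (simp add: Sdeg_iff)
qed

lemma Sdeg_E_lead:
  assumes v: "v \<in> carrier L" and f: "f \<in> Sdeg (\<lambda>k. k \<le> n)"
  shows "E v f \<ominus>\<^bsub>S\<^esub> mu v f \<in> Sdeg (\<lambda>k. k < Suc n)"
  using E_lead[OF v, of f n] f by (simp add: Sle_iff Sdeg_def less_Suc_eq_le)

end

section \<open>Injectivity of the PBW map of the quotient\<close>

lemma (in poisson_quot) prime_if_domain: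
  assumes "domain B"
  shows "primeideal I A"
proof -
  interpret B: domain B by (rule assms)
  show ?thesis
  proof (rule primeidealI[OF I_ideal A.is_cring])
    have "pr \<one> \<noteq> \<zero>\<^bsub>B\<^esub>" using B.one_not_zero by simp
    then show "carrier A \<noteq> I" using pr_zero_iff[OF A.one_closed] by auto
    fix a b assume ab: "a \<in> carrier A" "b \<in> carrier A" "a \<otimes> b \<in> I"
    then have "pr a \<otimes>\<^bsub>B\<^esub> pr b = \<zero>\<^bsub>B\<^esub>" using pr_mult pr_zero_iff[of "a \<otimes> b"] by simp
    then show "a \<in> I \<or> b \<in> I" using B.integral[OF _ pr_closed pr_closed] pr_zero_iff ab by metis
  qed
qed

text \<open>\<open>g\<close> stands for a map from \<open>L\<close> to the differentials of
  \<open>A / I\<close> that agrees with the canonical one on the \<open>d x\<close> and is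
  semilinear along the projection. Followed by the inclusion into the symmetric algebra it serves as
  the \<open>\<tau>\<close> of the evaluation.\<close>

locale poisson_pbw_quotient = poisson_pbw R A L br anc co le u I f0
  for R :: "('r, 'c) ring_scheme" and A :: "('r, 'a) poisson" (structure)
    and L :: "('a, 'l, 'n) module_scheme" and br :: "'l \<Rightarrow> 'l \<Rightarrow> 'l" and anc :: "'l \<Rightarrow> 'a \<Rightarrow> 'a"
    and co :: "'l \<Rightarrow> 'y \<Rightarrow> 'a" and le :: "'y \<Rightarrow> 'y \<Rightarrow> bool"
    and u :: "'a \<Rightarrow> 'l" and I :: "'a set" and f0 :: 'a +
  fixes U :: "('r, 'u) module" and \<alpha> \<beta> :: "'a set \<Rightarrow> 'u" and g :: "'l \<Rightarrow> ('a set \<Rightarrow> 'a set) set"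
  assumes U: "poisson_enveloping_algebra R (poisson_quotient A I) U \<alpha> \<beta>"
    and g: "g \<in> add_map L (kaehler R (poisson_quotient A I))"
    and g_smult: "a \<in> carrier A \<Longrightarrow> v \<in> carrier L \<Longrightarrow> g (a \<odot>\<^bsub>L\<^esub> v) = (I +> a) \<odot>\<^bsub>kaehler R (poisson_quotient A I)\<^esub> g v"
    and g_u: "x \<in> carrier A \<Longrightarrow> g (u x) = kaehler_d R (poisson_quotient A I) (I +> x)"
begin

sublocale PQ: poisson_quot R A I
  by (intro poisson_quot.intro poisson_kaehler_axioms poisson_quot_axioms.intro poisson_ideal)

abbreviation "B \<equiv> poisson_quotient A I"
abbreviation "pr x \<equiv> I +> x"

sublocale B: poisson_env R B U \<alpha> \<beta>
  using U PQ.B_bracket_closed PQ.B_algebra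
  by (intro poisson_env.intro comm_algebra.intro poisson_env_axioms.intro) (auto simp: poisson_enveloping_algebra_def)

abbreviation "SB \<equiv> sym_algebra B (kaehler R B)"

text \<open>The condition \<open>\<tau>_w\<close> of the evaluation originates here:
  \<open>f0\<close> becomes \<open>0\<close> in the quotient, and so does its differential.\<close>

lemma g_f0: "g (u f0) = \<zero>\<^bsub>kaehler R B\<^esub>"
proof -
  have "pr f0 = \<zero>\<^bsub>B\<^esub>" using f0 f0_closed PQ.pr_zero_iff by simp
  then show ?thesis
    using g_u[OF f0_closed] add_map_zero[OF B.d_add_map B.A.is_abelian_group B.Om_group] by simp
qed

sublocale poisson_pbw_eval R A L br anc co le u I f0 SB "\<lambda>a. pr a \<odot>\<^bsub>SB\<^esub> \<one>\<^bsub>SB\<^esub>" "\<lambda>v. sym_incl B (kaehler R B) (g v)"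
proof unfold_locales
  note SB = B.SO.Sym.module_axioms
  have m: "(pr a \<odot>\<^bsub>SB\<^esub> \<one>\<^bsub>SB\<^esub>) \<otimes>\<^bsub>SB\<^esub> s = pr a \<odot>\<^bsub>SB\<^esub> s" if "a \<in> carrier A" "s \<in> carrier SB" for a s
    using that PQ.pr_closed by (simp add: B.SO.Sym.smult_mult_left)
  show "(\<lambda>a. pr a \<odot>\<^bsub>SB\<^esub> \<one>\<^bsub>SB\<^esub>) \<in> ring_hom A SB"
  proof (rule ring_hom_memI)
    fix a b assume ab: "a \<in> carrier A" "b \<in> carrier A"
    show "pr a \<odot>\<^bsub>SB\<^esub> \<one>\<^bsub>SB\<^esub> \<in> carrier SB" using ab PQ.pr_closed by simp
    show "pr (a \<otimes> b) \<odot>\<^bsub>SB\<^esub> \<one>\<^bsub>SB\<^esub> = (pr a \<odot>\<^bsub>SB\<^esub> \<one>\<^bsub>SB\<^esub>) \<otimes>\<^bsub>SB\<^esub> (pr b \<odot>\<^bsub>SB\<^esub> \<one>\<^bsub>SB\<^esub>)"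
      using ab PQ.pr_closed by (simp add: m PQ.pr_mult[symmetric] B.SO.Sym.smult_assoc1 del: poisson_quotient_simps)
    show "pr (a \<oplus> b) \<odot>\<^bsub>SB\<^esub> \<one>\<^bsub>SB\<^esub> = pr a \<odot>\<^bsub>SB\<^esub> \<one>\<^bsub>SB\<^esub> \<oplus>\<^bsub>SB\<^esub> pr b \<odot>\<^bsub>SB\<^esub> \<one>\<^bsub>SB\<^esub>"
      using ab PQ.pr_closed by (simp add: PQ.pr_add[symmetric] B.SO.Sym.smult_l_distr del: poisson_quotient_simps)
  next
    have "pr \<one> = \<one>\<^bsub>B\<^esub>" by simp
    then show "pr \<one> \<odot>\<^bsub>SB\<^esub> \<one>\<^bsub>SB\<^esub> = \<one>\<^bsub>SB\<^esub>" using B.SO.Sym.smult_one by simp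
  qed
  show "pr x \<odot>\<^bsub>SB\<^esub> \<one>\<^bsub>SB\<^esub> = \<zero>\<^bsub>SB\<^esub>" if "x \<in> I" for x
  proof -
    have z: "pr x = \<zero>\<^bsub>B\<^esub>" using that PQ.pr_zero_iff[OF I_closed[OF that]] by blast
    show ?thesis unfolding z by (rule B.SO.Sym.smult_l_null) simp
  qed
  show "(\<lambda>v. sym_incl B (kaehler R B) (g v)) \<in> add_map L SB"
    by (rule add_map_comp[OF g lin_hom_add_map[OF B.SO.incl_lin]])
  show "sym_incl B (kaehler R B) (g (a \<odot>\<^bsub>L\<^esub> v)) = (pr a \<odot>\<^bsub>SB\<^esub> \<one>\<^bsub>SB\<^esub>) \<otimes>\<^bsub>SB\<^esub> sym_incl B (kaehler R B) (g v)"
    if "a \<in> carrier A" "v \<in> carrier L" for a v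
    using that PQ.pr_closed m B.SO.incl_closed[OF add_map_closed[OF g that(2)]]
      lin_hom_smult[OF B.SO.incl_lin _ add_map_closed[OF g that(2)], of "pr a"] by (simp add: g_smult)
  show "sym_incl B (kaehler R B) (g (u f0)) = \<zero>\<^bsub>SB\<^esub>"
    unfolding g_f0 by (rule add_map_zero[OF lin_hom_add_map[OF B.SO.incl_lin] B.Om_group B.SO.Sym.M.abelian_group_axioms])
qed (rule comm_monoid.m_comm[OF cring.axioms(2)[OF B.SO.Sym_cring]])

lemma rho_pr: "a \<in> carrier A \<Longrightarrow> f \<in> carrier S \<Longrightarrow> rho (a \<odot>\<^bsub>S\<^esub> f) = pr a \<odot>\<^bsub>SB\<^esub> rho f"
  using PQ.pr_closed[of a] rho_closed[of f] by (simp add: rho_smult B.SO.Sym.smult_mult_left)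

text \<open>Here universality of \<open>U\<close> enters: the pair on \<open>Q\<close> kills
  \<open>I\<close>, so it descends to the quotient algebra and induces a representation of
  \<open>U\<close> on \<open>Q\<close>.\<close>

lemma action_exists:
  obtains \<gamma> where "\<gamma> \<in> alg_hom R U EQ" "\<And>a. a \<in> carrier A \<Longrightarrow> \<gamma> (\<alpha> (pr a)) = \<alpha>E a" "\<And>x. x \<in> carrier A \<Longrightarrow> \<gamma> (\<beta> (pr x)) = \<beta>E x"
proof -
  obtain \<alpha>' \<beta>' where p: "enveloping_pair R B EQ \<alpha>' \<beta>'"
    "\<And>x. x \<in> carrier A \<Longrightarrow> \<alpha>' (pr x) = \<alpha>E x" "\<And>x. x \<in> carrier A \<Longrightarrow> \<beta>' (pr x) = \<beta>E x"
    using PQ.enveloping_pair_quotient[OF enveloping_pair_EQ \<alpha>E_I \<beta>E_I] by metis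
  obtain \<gamma> where "enveloping_morphism R B U \<alpha> \<beta> EQ \<alpha>' \<beta>' \<gamma>"
    using enveloping_morphism_exists[OF U p(1) PQ.B_algebra PQ.B_bracket_closed] by metis
  then have "\<gamma> \<in> alg_hom R U EQ" "\<gamma> (\<alpha> (pr x)) = \<alpha>E x" "\<gamma> (\<beta> (pr x)) = \<beta>E x" if "x \<in> carrier A" for x
    using that p(2,3) PQ.pr_closed[of x] by (auto simp: enveloping_morphism_def)
  then show thesis using that[of \<gamma>] A.zero_closed by blast
qed

text \<open>The action on the class of \<open>1\<close> lifts an element of filtration degree \<open>n\<close> to a polynomial,
  whose part of degree \<open>n\<close> evaluates to the given element of the symmetric algebra.\<close>

definition lifts :: "('u \<Rightarrow> ('y multiset \<Rightarrow> 'a) set \<Rightarrow> ('y multiset \<Rightarrow> 'a) set) \<Rightarrow> nat \<Rightarrow> 'u \<Rightarrow> (('a set \<Rightarrow> 'a set) set list \<Rightarrow> 'a set) set \<Rightarrow> bool" where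
  "lifts \<gamma> n v s \<longleftrightarrow> (\<exists>f\<in>Sdeg (\<lambda>k. k = n). \<exists>l\<in>Sdeg (\<lambda>k. k < n). \<gamma> v (qc (mon {#})) = qc (f \<oplus>\<^bsub>S\<^esub> l) \<and> rho f = s)"

context
  fixes \<gamma>
  assumes \<gamma>: "\<gamma> \<in> alg_hom R U EQ" and \<gamma>\<alpha>: "\<And>a. a \<in> carrier A \<Longrightarrow> \<gamma> (\<alpha> (pr a)) = \<alpha>E a"
    and \<gamma>\<beta>: "\<And>x. x \<in> carrier A \<Longrightarrow> \<gamma> (\<beta> (pr x)) = \<beta>E x"
begin

lemma \<gamma>_mult: "v \<in> carrier U \<Longrightarrow> v' \<in> carrier U \<Longrightarrow> f \<in> carrier S \<Longrightarrow> \<gamma> (v \<otimes>\<^bsub>U\<^esub> v') (qc f) = \<gamma> v (\<gamma> v' (qc f))"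
  by (simp add: alg_hom_mult[OF \<gamma>] EQ_apply)

lemma \<gamma>_add: "v \<in> carrier U \<Longrightarrow> v' \<in> carrier U \<Longrightarrow> f \<in> carrier S \<Longrightarrow> \<gamma> (v \<oplus>\<^bsub>U\<^esub> v') (qc f) = \<gamma> v (qc f) \<oplus>\<^bsub>Q\<^esub> \<gamma> v' (qc f)"
  by (simp add: add_map_add[OF alg_hom_add_map[OF \<gamma>]] EQ_apply)

lemma \<gamma>_zero: "f \<in> carrier S \<Longrightarrow> \<gamma> \<zero>\<^bsub>U\<^esub> (qc f) = qc \<zero>\<^bsub>S\<^esub>"
  using add_map_zero[OF alg_hom_add_map[OF \<gamma>] B.U.M.abelian_group_axioms EQ.M.abelian_group_axioms]
    coset_eq_self_iff[OF N_group SR_group, of "\<zero>\<^bsub>S\<^esub>"] additive_subgroup_mem(1)[OF N_group SR_group]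
  by (simp add: EQ_apply)

lemma lifts_zero: "lifts \<gamma> n \<zero>\<^bsub>U\<^esub> \<zero>\<^bsub>SB\<^esub>"
  unfolding lifts_def using add_map_zero[OF rho_add_map S_group C_group]
  by (intro bexI[of _ "\<zero>\<^bsub>S\<^esub>"]) (simp_all add: Sdeg_zero \<gamma>_zero)

lemma lifts_add:
  assumes "lifts \<gamma> n v s" "lifts \<gamma> n v' s'" "v \<in> carrier U" "v' \<in> carrier U"
  shows "lifts \<gamma> n (v \<oplus>\<^bsub>U\<^esub> v') (s \<oplus>\<^bsub>SB\<^esub> s')"
proof -
  obtain f l where f: "f \<in> Sdeg (\<lambda>k. k = n)" "l \<in> Sdeg (\<lambda>k. k < n)" "\<gamma> v (qc (mon {#})) = qc (f \<oplus>\<^bsub>S\<^esub> l)" "rho f = s"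
    using assms(1) unfolding lifts_def by blast
  obtain f' l' where f': "f' \<in> Sdeg (\<lambda>k. k = n)" "l' \<in> Sdeg (\<lambda>k. k < n)" "\<gamma> v' (qc (mon {#})) = qc (f' \<oplus>\<^bsub>S\<^esub> l')" "rho f' = s'"
    using assms(2) unfolding lifts_def by blast
  note c = Sdeg_closed[OF f(1)] Sdeg_closed[OF f(2)] Sdeg_closed[OF f'(1)] Sdeg_closed[OF f'(2)]
  have "\<gamma> (v \<oplus>\<^bsub>U\<^esub> v') (qc (mon {#})) = qc ((f \<oplus>\<^bsub>S\<^esub> f') \<oplus>\<^bsub>S\<^esub> (l \<oplus>\<^bsub>S\<^esub> l'))"
    using c f(3) f'(3) assms(3,4) by (simp add: \<gamma>_add qc_add S.M.a_ac)
  moreover have "rho (f \<oplus>\<^bsub>S\<^esub> f') = s \<oplus>\<^bsub>SB\<^esub> s'"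
    using add_map_add[OF rho_add_map c(1,3)] f(4) f'(4) by simp
  ultimately show ?thesis
    unfolding lifts_def using Sdeg_add[OF f(1) f'(1)] Sdeg_add[OF f(2) f'(2)] by blast
qed

lemma lifts_smult:
  assumes "lifts \<gamma> n v s" "v \<in> carrier U" "X \<in> carrier B"
  shows "lifts \<gamma> n (\<alpha> X \<otimes>\<^bsub>U\<^esub> v) (X \<odot>\<^bsub>SB\<^esub> s)"
proof -
  obtain a where a: "a \<in> carrier A" "X = pr a" using assms(3) unfolding PQ.B_carrier by blast
  obtain f l where f: "f \<in> Sdeg (\<lambda>k. k = n)" "l \<in> Sdeg (\<lambda>k. k < n)" "\<gamma> v (qc (mon {#})) = qc (f \<oplus>\<^bsub>S\<^esub> l)" "rho f = s"
    using assms(1) unfolding lifts_def by blast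
  note c = Sdeg_closed[OF f(1)] Sdeg_closed[OF f(2)]
  have "\<gamma> (\<alpha> X \<otimes>\<^bsub>U\<^esub> v) (qc (mon {#})) = qc (a \<odot>\<^bsub>S\<^esub> f \<oplus>\<^bsub>S\<^esub> a \<odot>\<^bsub>S\<^esub> l)"
    using c f(3) assms(2,3) a by (simp add: \<gamma>_mult \<gamma>\<alpha> \<alpha>E S.smult_r_distr)
  moreover have "rho (a \<odot>\<^bsub>S\<^esub> f) = X \<odot>\<^bsub>SB\<^esub> s"
    using rho_pr[OF a(1) c(1)] f(4) a(2) by simp
  ultimately show ?thesis
    unfolding lifts_def using Sdeg_smult[OF a(1) f(1)] Sdeg_smult[OF a(1) f(2)] by blast
qed

text \<open>\<open>\<beta> X\<close> acts by \<open>E (u x)\<close>, whose leading part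
  \<open>mu (u x)\<close> becomes multiplication by \<open>B.sd X\<close> under \<open>rho\<close>;
  all other terms have degree at most \<open>n\<close>.\<close>

lemma lifts_beta:
  assumes "lifts \<gamma> n v s" "v \<in> carrier U" "X \<in> carrier B"
  shows "lifts \<gamma> (Suc n) (\<beta> X \<otimes>\<^bsub>U\<^esub> v) (B.sd X \<otimes>\<^bsub>SB\<^esub> s)"
proof -
  obtain x where x: "x \<in> carrier A" "X = pr x" using assms(3) unfolding PQ.B_carrier by blast
  obtain f l where f: "f \<in> Sdeg (\<lambda>k. k = n)" "l \<in> Sdeg (\<lambda>k. k < n)" "\<gamma> v (qc (mon {#})) = qc (f \<oplus>\<^bsub>S\<^esub> l)" "rho f = s"
    using assms(1) unfolding lifts_def by blast
  note c = Sdeg_closed[OF f(1)] Sdeg_closed[OF f(2)] and ux = u_closed[OF x(1)]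
  \<comment> \<open>Everything except the leading product \<open>mu (u x) f\<close>: the error of
    \<open>E (u x)\<close> on \<open>f\<close>, and all of \<open>E (u x) l\<close>, split into
    error and product so that the degrees can be read off.\<close>
  let ?l = "(E (u x) f \<ominus>\<^bsub>S\<^esub> mu (u x) f) \<oplus>\<^bsub>S\<^esub> ((E (u x) l \<ominus>\<^bsub>S\<^esub> mu (u x) l) \<oplus>\<^bsub>S\<^esub> mu (u x) l)"
  have cancel: "mu (u x) h \<oplus>\<^bsub>S\<^esub> (E (u x) h \<ominus>\<^bsub>S\<^esub> mu (u x) h) = E (u x) h" "(E (u x) h \<ominus>\<^bsub>S\<^esub> mu (u x) h) \<oplus>\<^bsub>S\<^esub> mu (u x) h = E (u x) h"
    if "h \<in> carrier S" for h
    using that mu_closed[OF ux] E_closed[OF ux] by (simp_all add: a_minus_def S.M.a_assoc S.M.a_lcomm[of "mu (u x) h" "E (u x) h"] S.M.r_neg S.M.l_neg)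
  have lo: "(E (u x) f \<ominus>\<^bsub>S\<^esub> mu (u x) f) \<in> carrier S"
    using c mu_closed[OF ux] E_closed[OF ux] by simp
  have "E (u x) (f \<oplus>\<^bsub>S\<^esub> l) = E (u x) f \<oplus>\<^bsub>S\<^esub> E (u x) l" by (rule E_add[OF ux c])
  also have "\<dots> = mu (u x) f \<oplus>\<^bsub>S\<^esub> ?l"
    unfolding cancel(2)[OF c(2)] using cancel(1)[OF c(1)] S.M.a_assoc[OF mu_closed[OF ux c(1)] lo E_closed[OF ux c(2)]] by simp
  finally have E: "E (u x) (f \<oplus>\<^bsub>S\<^esub> l) = mu (u x) f \<oplus>\<^bsub>S\<^esub> ?l" .
  have "\<gamma> (\<beta> X \<otimes>\<^bsub>U\<^esub> v) (qc (mon {#})) = qc (mu (u x) f \<oplus>\<^bsub>S\<^esub> ?l)"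
    unfolding E[symmetric] using c f(3) assms(2,3) x by (simp add: \<gamma>_mult \<gamma>\<beta> \<beta>E)
  moreover have "rho (mu (u x) f) = B.sd X \<otimes>\<^bsub>SB\<^esub> s"
    using rho_mu[OF ux c(1)] g_u[OF x(1)] f(4) x(2) by simp
  moreover have "mu (u x) f \<in> Sdeg (\<lambda>k. k = Suc n)"
    by (rule Sdeg_mu[OF ux f(1)]) simp
  moreover have "?l \<in> Sdeg (\<lambda>k. k < Suc n)"
    by (intro Sdeg_add Sdeg_E_lead[OF ux] Sdeg_mu[OF ux f(2)] Sdeg_mono[OF f(1)] Sdeg_mono[OF f(2)]) auto
  ultimately show ?thesis unfolding lifts_def by blast
qed

lemma lifts_word: "set xs \<subseteq> carrier B \<Longrightarrow> lifts \<gamma> (length xs) (B.bprod xs) (B.dprod xs)"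
proof (induction xs)
  case Nil
  have "mon {#} \<in> Sdeg (\<lambda>k. k = 0)" using mon_closed by (auto simp: Sdeg_def basis_elt_def)
  moreover have "\<gamma> \<one>\<^bsub>U\<^esub> (qc (mon {#})) = qc (mon {#} \<oplus>\<^bsub>S\<^esub> \<zero>\<^bsub>S\<^esub>)"
    using alg_hom_one[OF \<gamma>] EQ_apply(4)[OF mon_closed] by simp
  ultimately show ?case
    unfolding lifts_def using Sdeg_zero rho_one by fastforce
next
  case (Cons x xs)
  then show ?case using lifts_beta[of "length xs" "B.bprod xs" "B.dprod xs" x] B.bprod_closed by simp
qed

text \<open>The step is spanned by scalars times words of fewer than \<open>n\<close> letters, and
  each of these lifts to a polynomial whose degree is at most the length of the word.\<close>

lemma FU_lower:
  assumes "v \<in> B.FU n"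
  shows "\<exists>l\<in>Sdeg (\<lambda>k. k < n). \<gamma> v (qc (mon {#})) = qc l"
proof -
  have "v \<in> {v \<in> carrier U. \<exists>l\<in>Sdeg (\<lambda>k. k < n). \<gamma> v (qc (mon {#})) = qc l}"
  proof (rule B.FU_induct[OF assms])
    show "\<zero>\<^bsub>U\<^esub> \<in> {v \<in> carrier U. \<exists>l\<in>Sdeg (\<lambda>k. k < n). \<gamma> v (qc (mon {#})) = qc l}"
      using Sdeg_zero \<gamma>_zero[OF mon_closed] by blast
    show "v \<oplus>\<^bsub>U\<^esub> v' \<in> {v \<in> carrier U. \<exists>l\<in>Sdeg (\<lambda>k. k < n). \<gamma> v (qc (mon {#})) = qc l}"
      if v: "v \<in> {v \<in> carrier U. \<exists>l\<in>Sdeg (\<lambda>k. k < n). \<gamma> v (qc (mon {#})) = qc l}"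
        "v' \<in> {v \<in> carrier U. \<exists>l\<in>Sdeg (\<lambda>k. k < n). \<gamma> v (qc (mon {#})) = qc l}" for v v'
    proof -
      obtain l l' where "l \<in> Sdeg (\<lambda>k. k < n)" "\<gamma> v (qc (mon {#})) = qc l" "l' \<in> Sdeg (\<lambda>k. k < n)" "\<gamma> v' (qc (mon {#})) = qc l'"
        using v by blast
      then show ?thesis
        using v Sdeg_add[of l "\<lambda>k. k < n" l'] by (auto simp: \<gamma>_add qc_add Sdeg_closed intro!: bexI[of _ "l \<oplus>\<^bsub>S\<^esub> l'"])
    qed
    fix X xs assume X: "X \<in> carrier B" "set xs \<subseteq> carrier B" "length xs < n"
    have "lifts \<gamma> (length xs) (\<alpha> X \<otimes>\<^bsub>U\<^esub> B.bprod xs) (X \<odot>\<^bsub>SB\<^esub> B.dprod xs)"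
      by (rule lifts_smult[OF lifts_word[OF X(2)] B.bprod_closed[OF X(2)] X(1)])
    then obtain f l where f: "f \<in> Sdeg (\<lambda>k. k = length xs)" "l \<in> Sdeg (\<lambda>k. k < length xs)"
      "\<gamma> (\<alpha> X \<otimes>\<^bsub>U\<^esub> B.bprod xs) (qc (mon {#})) = qc (f \<oplus>\<^bsub>S\<^esub> l)"
      unfolding lifts_def by blast
    have "f \<oplus>\<^bsub>S\<^esub> l \<in> Sdeg (\<lambda>k. k < n)"
      by (rule Sdeg_add; rule Sdeg_mono[OF f(1)] Sdeg_mono[OF f(2)]) (use X(3) in auto)
    then show "\<alpha> X \<otimes>\<^bsub>U\<^esub> B.bprod xs \<in> {v \<in> carrier U. \<exists>l\<in>Sdeg (\<lambda>k. k < n). \<gamma> v (qc (mon {#})) = qc l}"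
      using f(3) B.bprod_closed[OF X(2)] X(1) B.\<alpha>_closed by blast
  qed
  then show ?thesis by blast
qed

text \<open>The image of \<open>s\<close> is the class of some \<open>v\<close> whose lift has a
  leading form \<open>f\<close> with \<open>rho f = s\<close>. If this image is \<open>0\<close>,
  then \<open>v\<close> lies in the lower step and also lifts to a polynomial of degree below
  \<open>n\<close>. The two lifts differ by an element of \<open>N\<close>, so
  \<open>symbol_detection\<close> gives \<open>rho f = 0\<close>.\<close>

lemma pbw_hom_injective:
  assumes \<phi>: "\<phi> \<in> alg_hom B SB B.GA" "\<And>X. X \<in> carrier B \<Longrightarrow> \<phi> (B.sd X) = B.gin 1 (\<beta> X)"
    and s: "s \<in> sym_degree B (kaehler R B) n" and z: "\<phi> s = \<zero>\<^bsub>B.GA\<^esub>"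
  shows "s = \<zero>\<^bsub>SB\<^esub>"
proof -
  \<comment> \<open>\<open>lifts\<close> is a relation, the polynomial being determined only modulo
    \<open>N\<close>. Hence the elements \<open>s\<close> that admit a suitable \<open>v\<close> are
    shown to include the generators and to be closed under sums.\<close>
  let ?T = "{s \<in> carrier SB. \<exists>v\<in>B.FU (Suc n). \<phi> s = B.gin n v \<and> lifts \<gamma> n v s}"
  note \<phi>a = alg_hom_add_map[OF \<phi>(1)]
  have "s \<in> ?T"
  proof (rule B.SO.Sym.M.add_span_least[OF s[unfolded B.sym_degree_dterms]])
    have "\<phi> \<zero>\<^bsub>SB\<^esub> = B.gin n \<zero>\<^bsub>U\<^esub>"
      using add_map_zero[OF \<phi>a B.SO.Sym.M.abelian_group_axioms B.GA_group] B.gin_zero_iff[of "\<zero>\<^bsub>U\<^esub>" n] B.FU_zero by simp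
    then show "\<zero>\<^bsub>SB\<^esub> \<in> ?T" using B.FU_zero lifts_zero by auto
  next
    fix t assume "t \<in> B.dterms (\<lambda>k. k = n)"
    then obtain X xs where t: "t = X \<odot>\<^bsub>SB\<^esub> B.dprod xs" "X \<in> carrier B" "set xs \<subseteq> carrier B" "length xs = n"
      unfolding B.dterms_def by blast
    have "lifts \<gamma> n (\<alpha> X \<otimes>\<^bsub>U\<^esub> B.bprod xs) t"
      using lifts_smult[OF lifts_word[OF t(3)] B.bprod_closed[OF t(3)] t(2)] t(1,4) by simp
    moreover have "\<phi> t = B.gin n (\<alpha> X \<otimes>\<^bsub>U\<^esub> B.bprod xs)"
      using B.pbw_hom_dprod[OF \<phi> t(2,3)] t(1,4) by simp
    moreover have "t \<in> carrier SB" using t B.dprod_closed by simp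
    moreover have "\<alpha> X \<otimes>\<^bsub>U\<^esub> B.bprod xs \<in> B.FU (Suc n)" using B.FU_gen[OF t(2,3)] t(4) by simp
    ultimately show "t \<in> ?T" by blast
  next
    fix t t' assume tt: "t \<in> ?T" "t' \<in> ?T"
    then obtain v v' where v: "v \<in> B.FU (Suc n)" "\<phi> t = B.gin n v" "lifts \<gamma> n v t"
      "v' \<in> B.FU (Suc n)" "\<phi> t' = B.gin n v'" "lifts \<gamma> n v' t'" by blast
    have "\<phi> (t \<oplus>\<^bsub>SB\<^esub> t') = B.gin n (v \<oplus>\<^bsub>U\<^esub> v')"
      using add_map_add[OF \<phi>a, of t t'] tt v B.gin_add by simp
    then show "t \<oplus>\<^bsub>SB\<^esub> t' \<in> ?T"
      using lifts_add[OF v(3,6) B.FU_closed[OF v(1)] B.FU_closed[OF v(4)]] B.FU_add[OF v(1,4)] tt by auto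
  qed
  then obtain v f l where v: "v \<in> B.FU (Suc n)" "\<phi> s = B.gin n v"
    and f: "f \<in> Sdeg (\<lambda>k. k = n)" "l \<in> Sdeg (\<lambda>k. k < n)" "\<gamma> v (qc (mon {#})) = qc (f \<oplus>\<^bsub>S\<^esub> l)" "rho f = s"
    unfolding lifts_def by blast
  have "v \<in> B.FU n" using z v(2) B.gin_zero_iff[OF B.FU_closed[OF v(1)]] by simp
  then obtain l' where l': "l' \<in> Sdeg (\<lambda>k. k < n)" "\<gamma> v (qc (mon {#})) = qc l'" using FU_lower by blast
  note c = Sdeg_closed[OF f(1)] Sdeg_closed[OF f(2)] Sdeg_closed[OF l'(1)]
  have "(f \<oplus>\<^bsub>S\<^esub> l) \<ominus>\<^bsub>S\<^esub> l' \<in> N" using qc_eq_iff[of "f \<oplus>\<^bsub>S\<^esub> l" l'] f(3) l'(2) c by simp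
  moreover have "(f \<oplus>\<^bsub>S\<^esub> l) \<ominus>\<^bsub>S\<^esub> l' = f \<ominus>\<^bsub>S\<^esub> (l' \<ominus>\<^bsub>S\<^esub> l)"
    using c by (simp add: a_minus_def S.M.minus_add S.M.a_ac)
  ultimately have "f \<ominus>\<^bsub>S\<^esub> (l' \<ominus>\<^bsub>S\<^esub> l) \<in> N" by simp
  moreover have "l' \<ominus>\<^bsub>S\<^esub> l \<in> Sdeg (\<lambda>k. k < n)" by (rule Sdeg_minus[OF l'(1) f(2)])
  ultimately have "rho f = \<zero>\<^bsub>SB\<^esub>"
    using f(1) by (intro symbol_detection[of f n "l' \<ominus>\<^bsub>S\<^esub> l"]) (auto simp: Sdeg_def)
  then show ?thesis using f(4) by simp
qed

end

lemma pbw_theorem: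
  shows "(\<exists>!\<phi>. is_pbw_map R B U \<alpha> \<beta> \<phi>) \<and> inj_on (pbw_map R B U \<alpha> \<beta>) (carrier SB) \<and>
    pbw_map R B U \<alpha> \<beta> \<in> graded_alg_iso B SB (sym_degree B (kaehler R B)) B.GA (gr_degree B U \<alpha> \<beta>)"
proof -
  obtain \<gamma> where \<gamma>: "\<gamma> \<in> alg_hom R U EQ" "\<And>a. a \<in> carrier A \<Longrightarrow> \<gamma> (\<alpha> (pr a)) = \<alpha>E a" "\<And>x. x \<in> carrier A \<Longrightarrow> \<gamma> (\<beta> (pr x)) = \<beta>E x"
    by (rule action_exists) blast
  obtain \<phi> where \<phi>: "is_pbw_map R B U \<alpha> \<beta> \<phi>" "\<phi> \<in> alg_hom B SB B.GA" "\<And>X. X \<in> carrier B \<Longrightarrow> \<phi> (B.sd X) = B.gin 1 (\<beta> X)"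
    by (rule B.pbw_map_exists) blast
  have ex1: "\<exists>!\<phi>. is_pbw_map R B U \<alpha> \<beta> \<phi>"
    using \<phi>(1) B.pbw_map_unique by blast
  have "pbw_map R B U \<alpha> \<beta> = \<phi>"
    using the1_equality[where P="is_pbw_map R B U \<alpha> \<beta>", OF ex1 \<phi>(1)] by (simp add: pbw_map_def)
  then show ?thesis
    using ex1 B.pbw_iso[OF \<phi>(2,3) pbw_hom_injective[OF \<gamma> \<phi>(2,3)]] by simp
qed

end

text \<open>The differentials of the quotient become an \<open>A\<close>-module by restriction of
  scalars, and the universal derivation after the projection is a derivation of \<open>A\<close>
  with values in it.\<close>

lemma (in poisson_quot) kaehler_quotient_map:
  obtains h where "h \<in> add_map Om (kaehler R B)"
    "\<And>a \<omega>. a \<in> carrier A \<Longrightarrow> \<omega> \<in> carrier Om \<Longrightarrow> h (a \<odot>\<^bsub>Om\<^esub> \<omega>) = pr a \<odot>\<^bsub>kaehler R B\<^esub> h \<omega>"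
    "\<And>x. x \<in> carrier A \<Longrightarrow> h (d x) = kaehler_d R B (pr x)"
proof -
  interpret B: comm_algebra R B by (rule comm_algebra.intro[OF B_algebra])
  let ?P = "scalars (\<lambda>x. pr x) (kaehler R B)"
  have hom: "(\<lambda>x. pr x) \<in> ring_hom A B" using alg_homD(2)[OF pr_alg_hom] .
  have P: "module A ?P" by (rule scalars_module[OF A.is_cring hom B.Om_module])
  obtain \<Psi> where \<Psi>: "\<Psi> \<in> lin_hom A Om ?P" "\<And>x. x \<in> carrier A \<Longrightarrow> \<Psi> (d x) = kaehler_d R B (pr x)"
  proof (rule kaehler_linear_extension[OF P, of "\<lambda>x. kaehler_d R B (pr x)"])
    show "(\<lambda>x. kaehler_d R B (pr x)) \<in> add_map A ?P"
      by (rule add_mapI) (simp_all add: pr_closed B.d_add pr_add[symmetric] del: poisson_quotient_simps)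
    fix x y assume xy: "x \<in> carrier A" "y \<in> carrier A"
    show "kaehler_d R B (pr (x \<otimes> y)) = x \<odot>\<^bsub>?P\<^esub> kaehler_d R B (pr y) \<oplus>\<^bsub>?P\<^esub> y \<odot>\<^bsub>?P\<^esub> kaehler_d R B (pr x)"
      using xy by (simp add: pr_closed B.d_mult pr_mult[symmetric] del: poisson_quotient_simps)
  next
    fix r x assume r: "r \<in> carrier R" and x: "x \<in> carrier A"
    have "pr (ofR r) = r \<odot>\<^bsub>B\<^esub> \<one>\<^bsub>B\<^esub>"
      unfolding alg_hom_one[OF pr_alg_hom, symmetric] by (rule alg_hom_smult[OF pr_alg_hom r A.one_closed])
    moreover have "kaehler_d R B (pr (r \<odot> x)) = (r \<odot>\<^bsub>B\<^esub> \<one>\<^bsub>B\<^esub>) \<odot>\<^bsub>kaehler R B\<^esub> kaehler_d R B (pr x)"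
      unfolding alg_hom_smult[OF pr_alg_hom r x] by (rule B.d_smult[OF r pr_closed[OF x]])
    ultimately show "kaehler_d R B (pr (r \<odot> x)) = ofR r \<odot>\<^bsub>?P\<^esub> kaehler_d R B (pr x)"
      by simp
  qed (use that in blast)
  show thesis
    using that[of \<Psi>] \<Psi>(2) lin_hom_smult[OF \<Psi>(1)] lin_hom_add_map[OF \<Psi>(1)] by (simp add: add_map_def)
qed

theorem theorem1p1:
  fixes R :: "('r, 'c) ring_scheme"
    and A :: "('r, 'a) poisson"
    and I :: "'a set"
    and U :: "('r, 'u) module"
    and \<alpha> \<beta> :: "'a set \<Rightarrow> 'u"
  assumes "cring R"
    and "poisson_algebra R A"
    and "smooth_poisson R A"
    and "poisson_ideal R A I"
    and "principalideal I A"
    and "domain (poisson_quotient A I)"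
    and "poisson_enveloping_algebra R (poisson_quotient A I) U \<alpha> \<beta>"
  shows "(\<exists>!\<phi>. is_pbw_map R (poisson_quotient A I) U \<alpha> \<beta> \<phi>)
    \<and> inj_on (pbw_map R (poisson_quotient A I) U \<alpha> \<beta>)
        (carrier (sym_kaehler R (poisson_quotient A I)))
    \<and> pbw_map R (poisson_quotient A I) U \<alpha> \<beta> \<in>
        graded_alg_iso (poisson_quotient A I)
          (sym_kaehler R (poisson_quotient A I))
          (sym_degree (poisson_quotient A I) (kaehler R (poisson_quotient A I)))
          (gr_algebra (poisson_quotient A I) U \<alpha> \<beta>)
          (gr_degree (poisson_quotient A I) U \<alpha> \<beta>)"
proof -
  interpret PQ: poisson_quot R A I
    using assms(2,4)
    by (intro poisson_quot.intro poisson_kaehler.intro comm_algebra.intro poisson_kaehler_axioms.intro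
      poisson_quot_axioms.intro) (simp_all add: poisson_algebra_def)
  \<comment> \<open>The splitting uses the free module over the type of the differentials; the
    swindle takes countably many copies of it, so the final coordinates are indexed by pairs with a
    natural number.\<close>
  obtain s t where st: "s \<in> lin_hom A PQ.Om (free_module A (UNIV :: ('a \<Rightarrow> 'a) set set))"
    "t \<in> lin_hom A (free_module A UNIV) PQ.Om"
    "\<And>x. x \<in> carrier PQ.Om \<Longrightarrow> t (s x) = x"
    by (rule projective_splitting[OF conjunct2[OF assms(3)[unfolded smooth_poisson_def]]]) blast
  interpret PS: projective_split A PQ.Om s t
    using st PQ.Om_module by unfold_locales auto
  interpret LR: lie_rinehart A PQ.Om PQ.kbr PQ.anch by (rule PQ.kaehler_lie_rinehart)
  let ?F = "free_module A (UNIV :: (('a \<Rightarrow> 'a) set \<times> nat) set)"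
  \<comment> \<open>\<open>d x\<close> in the original summand, with coordinates \<open>0\<close> in
    the free one; brackets of such elements keep this form because derivations kill
    \<open>0\<close>.\<close>
  define u where "u x = (PQ.d x, \<zero>\<^bsub>?F\<^esub>)" for x
  obtain le :: "('a \<Rightarrow> 'a) set \<times> nat \<Rightarrow> ('a \<Rightarrow> 'a) set \<times> nat \<Rightarrow> bool" where le: "\<And>x y. le x y \<or> le y x"
    "\<And>x y z. le x y \<Longrightarrow> le y z \<Longrightarrow> le x z" "\<And>x y. le x y \<Longrightarrow> le y x \<Longrightarrow> x = y"
    by (rule total_order_exists) (rule that)
  obtain i where i: "i \<in> carrier A" "I = Idl\<^bsub>A\<^esub> {i}"
    using principalideal.generate[OF assms(5)] by blast
  then have I: "I = PIdl\<^bsub>A\<^esub> i" using PQ.A.cgenideal_eq_genideal by simp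
  obtain h where h: "h \<in> add_map PQ.Om (kaehler R PQ.B)"
    "\<And>a \<omega>. a \<in> carrier A \<Longrightarrow> \<omega> \<in> carrier PQ.Om \<Longrightarrow> h (a \<odot>\<^bsub>PQ.Om\<^esub> \<omega>) = PQ.pr a \<odot>\<^bsub>kaehler R PQ.B\<^esub> h \<omega>"
    "\<And>x. x \<in> carrier A \<Longrightarrow> h (PQ.d x) = kaehler_d R PQ.B (PQ.pr x)"
    by (rule PQ.kaehler_quotient_map) blast
  interpret W: lie_rinehart A PS.W LR.sd_br LR.sd_anc by (rule LR.semidirect_lie_rinehart)
  interpret I: primeideal I A by (rule PQ.prime_if_domain[OF assms(6)])
  have F0: "\<zero>\<^bsub>?F\<^esub> \<in> carrier ?F" by simp
  \<comment> \<open>\<open>fst\<close> discards the added free summand before the canonical map to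
    the differentials of the quotient is applied.\<close>
  interpret poisson_pbw_quotient R A PS.W LR.sd_br LR.sd_anc PS.Theta le u I i U \<alpha> \<beta> "\<lambda>v. h (fst v)"
  proof unfold_locales
    show "PS.Theta \<in> lin_hom A PS.W ?F" by (rule PS.Theta_lin)
    show "bij_betw PS.Theta (carrier PS.W) (carrier ?F)" by (rule PS.Theta_bij)
    show "le x y \<or> le y x" "le x y \<Longrightarrow> le y z \<Longrightarrow> le x z" "le x y \<Longrightarrow> le y x \<Longrightarrow> x = y" for x y z
      using le by blast+
    show "u \<in> add_map A PS.W"
      using F0 by (intro add_mapI) (simp_all add: u_def PQ.d_add)
    show "u (r \<odot>\<^bsub>A\<^esub> x) = PQ.ofR r \<odot>\<^bsub>PS.W\<^esub> u x" if "r \<in> carrier R" "x \<in> carrier A" for r x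
      using that by (simp add: u_def PQ.d_smult)
    show "u (x \<otimes>\<^bsub>A\<^esub> y) = x \<odot>\<^bsub>PS.W\<^esub> u y \<oplus>\<^bsub>PS.W\<^esub> y \<odot>\<^bsub>PS.W\<^esub> u x" if "x \<in> carrier A" "y \<in> carrier A" for x y
      using that by (simp add: u_def PQ.d_mult)
    show "LR.sd_br (u x) (u y) = u (PQ.pb x y)" if "x \<in> carrier A" "y \<in> carrier A" for x y
      using that by (simp add: u_def LR.sd_br_def PQ.kbr_d free_module_simps LR.anc_zero PQ.A.minus_eq)
    show "LR.sd_anc (u x) a = PQ.pb x a" if "x \<in> carrier A" "a \<in> carrier A" for x a
      using that by (simp add: u_def LR.sd_anc_def PQ.anch_props)
    show "poisson_ideal R A I" by (rule assms(4))
    show "\<exists>c\<in>carrier A. x = c \<otimes>\<^bsub>A\<^esub> i" if "x \<in> I" for x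
      using that unfolding I cgenideal_def by blast
    show "i \<in> I" unfolding I by (rule PQ.A.cgenideal_self[OF i(1)])
    show "poisson_enveloping_algebra R (poisson_quotient A I) U \<alpha> \<beta>" by (rule assms(7))
    show "(\<lambda>v. h (fst v)) \<in> add_map PS.W (kaehler R (poisson_quotient A I))"
      using h(1) by (intro add_mapI) (auto simp: add_map_add[OF h(1)] add_map_closed[OF h(1)])
    show "h (fst (a \<odot>\<^bsub>PS.W\<^esub> v)) = (I +>\<^bsub>A\<^esub> a) \<odot>\<^bsub>kaehler R (poisson_quotient A I)\<^esub> h (fst v)"
      if "a \<in> carrier A" "v \<in> carrier PS.W" for a v
      using that h(2) by (cases v) simp
    show "h (fst (u x)) = kaehler_d R (poisson_quotient A I) (I +>\<^bsub>A\<^esub> x)" if "x \<in> carrier A" for x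
      using that h(3) by (simp add: u_def)
  qed
  show ?thesis by (rule pbw_theorem)
qed

end
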